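(* Let $G=\mathrm{SL}(2,\mathbb R)$ and let $\Gamma$ be a cocompact lattice of $G$. Let $V$ be a Harish-Chandra module of a $K$-spherical unitary principal series representation of $G$ and assume that $V$ is $\Gamma$-automorphic, i.e. there is $\eta\in(V^{-\infty})^\Gamma\setminus\{0\}$; fix such an $\eta$. Then $$d([p_{\rm aut}],[p_{\max}])\ge\tfrac16 .$$
   Context: $G=\mathrm{SL}(2,\mathbb R)$, $K=\mathrm{SO}(2)$, with Lie algebras $\mathfrak g,\mathfrak k$. A $K$-spherical unitary principal series module is the module of $K$-finite vectors in the space of smooth functions $f$ on $\mathbb R^2\setminus\{0\}$ with $f(tx)=|t|^{-1-\lambda}f(x)$ ($t\in\mathbb R^\times$), for some $\lambda\in i\mathbb R$, with $G$ acting by $(g f)(x)=f(g^{-1}x)$. A norm $p$ on $V$ is $G$-continuous if there is a continuous representation of $G$ on the Banach completion $V_p$ whose $(\mathfrak g,K)$-module of $K$-finite vectors is $V$. $V^\infty$ is the Casselman-Wallach globalization (space of smooth vectors of $V_p$ for any $G$-continuous norm $p$) and $V^{-\infty}$ the space of continuous linear functionals on it. $\mathrm{Norm}(V)$ is the set of $G$-continuous norms $p$ on $V$ for which there is $C>0$ with $p(g\cdot v)\le Cp(v)$ for all $g\in G,v\in V$. Write $p\lesssim q$ if $p\le Cq$ for some $C>0$, and $p\sim q$ if $p\lesssim q\lesssim p$. $\mathfrak{Norm}(V)=\mathrm{Norm}(V)/\!\sim$ is partially ordered by $\lesssim$ and has a unique maximal element $[p_{\max}]$. Sobolev norms: let $\Delta_K=-Y^2$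 for a fixed unit vector $Y\in\mathfrak k$ (with respect to minus a multiple of the Killing form); for $s\in\mathbb R$ let $D_s=(1+\Delta_K)^{s/2}$ (acting diagonally on $K$-types) and $p_s(v):=p(D_sv)$. Put $d_\to([p],[q])=\inf\{s\ge0\mid p\lesssim q_s\}$ and $d([p],[q])=\max\{d_\to([p],[q]),d_\to([q],[p])\}$. The automorphic norm is $p_{\rm aut}(v):=\sup_{g\in G}|\eta(g\cdot v)|$; it belongs to $\mathrm{Norm}(V)$. *)

theory Defs
  imports
    "HOL-Analysis.Analysis"
    "HOL-Algebra.Coset"
    "HOL-Library.Function_Algebras"
begin

section \<open>The group\<close>

type_synonym mat2 = "real^2^2"

definition SL2 :: "mat2 set" where
  "SL2 = {g. det g = 1}"

definition SL2_group :: "mat2 monoid" where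
  "SL2_group = \<lparr>carrier = SL2, mult = (**), one = mat 1\<rparr>"

definition SO2 :: "mat2 set" where
  "SO2 = {k \<in> SL2. orthogonal_matrix k}"

definition sl2 :: "mat2 set" where
  "sl2 = {X. trace X = 0}"

definition so2 :: "mat2 set" where
  "so2 = {X. transpose X = - X}"

text \<open>On \<open>sl2\<close> the form \<open>tr (ad X \<circ> ad Z)\<close> equals \<open>4 tr (X Z)\<close>.\<close>

definition killing_form :: "mat2 \<Rightarrow> mat2 \<Rightarrow> real" where
  "killing_form X Z = 4 * trace (X ** Z)"

definition mexp :: "mat2 \<Rightarrow> mat2" where
  "mexp X = (\<Sum>n. (((**) X ^^ n) (mat 1)) /\<^sub>R fact n)"

text \<open>A discrete subgroup with compact quotient automatically has finite covolume.  The
  topology \<open>T\<close> below is the quotient topology on the coset space; being a quotient map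
  determines it.\<close>

definition cocompact_lattice :: "mat2 set \<Rightarrow> bool" where
  "cocompact_lattice \<Gamma> \<longleftrightarrow>
     subgroup \<Gamma> SL2_group \<and> discrete \<Gamma> \<and>
     (\<exists>T. quotient_map (top_of_set SL2) T (\<lambda>g. \<Gamma> #>\<^bsub>SL2_group\<^esub> g) \<and> compact_space T)"


section \<open>Spherical unitary principal series\<close>

text \<open>A function on the punctured plane is extended by the value 0 at the origin.\<close>

type_synonym fn = "real^2 \<Rightarrow> complex"

definition scaleF :: "complex \<Rightarrow> fn \<Rightarrow> fn" where
  "scaleF c f = (\<lambda>x. c * f x)"

primrec Ck_on :: "nat \<Rightarrow> (real^2) set \<Rightarrow> fn \<Rightarrow> bool" where
  "Ck_on 0 S f \<longleftrightarrow> continuous_on S f"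
| "Ck_on (Suc k) S f \<longleftrightarrow>
     (\<forall>x\<in>S. f differentiable (at x)) \<and> (\<forall>v. Ck_on k S (\<lambda>x. frechet_derivative f (at x) v))"

definition principal_series_smooth :: "complex \<Rightarrow> fn set" where
  "principal_series_smooth lam = {f. f 0 = 0 \<and> (\<forall>k. Ck_on k (- {0}) f) \<and>
     (\<forall>t x. t \<noteq> 0 \<longrightarrow> x \<noteq> 0 \<longrightarrow>
        f (t *\<^sub>R x) = complex_of_real \<bar>t\<bar> powr (- 1 - lam) * f x)}"

definition act :: "mat2 \<Rightarrow> fn \<Rightarrow> fn" where
  "act g f = (\<lambda>x. f (matrix_inv g *v x))"

definition lie_act :: "mat2 \<Rightarrow> fn \<Rightarrow> fn" where
  "lie_act X f = (\<lambda>x. vector_derivative (\<lambda>t. act (mexp (t *\<^sub>R X)) f x) (at 0))"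

definition principal_series :: "complex \<Rightarrow> fn set" where
  "principal_series lam = {f \<in> principal_series_smooth lam.
     \<exists>B. finite B \<and> (\<forall>k\<in>SO2. \<exists>c. act k f = (\<Sum>b\<in>B. scaleF (c b) b))}"


section \<open>Norms and Banach completions\<close>

text \<open>Norms on \<open>V\<close> are functions on the ambient type \<open>fn\<close>; their values outside \<open>V\<close> are
  irrelevant.\<close>

definition is_norm :: "fn set \<Rightarrow> (fn \<Rightarrow> real) \<Rightarrow> bool" where
  "is_norm V p \<longleftrightarrow>
     (\<forall>v\<in>V. 0 \<le> p v \<and> (p v = 0 \<longleftrightarrow> v = 0)) \<and>
     (\<forall>v\<in>V. \<forall>c. p (scaleF c v) = cmod c * p v) \<and>
     (\<forall>u\<in>V. \<forall>v\<in>V. p (u + v) \<le> p u + p v)"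

definition cauchy_seqs :: "fn set \<Rightarrow> (fn \<Rightarrow> real) \<Rightarrow> (nat \<Rightarrow> fn) set" where
  "cauchy_seqs V p = {x. range x \<subseteq> V \<and>
     (\<forall>e>0. \<exists>N. \<forall>m\<ge>N. \<forall>n\<ge>N. p (x m - x n) < e)}"

definition null_rel :: "fn set \<Rightarrow> (fn \<Rightarrow> real) \<Rightarrow> ((nat \<Rightarrow> fn) \<times> (nat \<Rightarrow> fn)) set" where
  "null_rel V p = {(x, y). x \<in> cauchy_seqs V p \<and> y \<in> cauchy_seqs V p \<and>
     (\<lambda>n. p (x n - y n)) \<longlonglongrightarrow> 0}"

text \<open>The completion consists of the classes of Cauchy sequences modulo null sequences.\<close>

type_synonym cvec = "(nat \<Rightarrow> fn) set"

definition completion :: "fn set \<Rightarrow> (fn \<Rightarrow> real) \<Rightarrow> cvec set" where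
  "completion V p = cauchy_seqs V p // null_rel V p"

definition cls :: "fn set \<Rightarrow> (fn \<Rightarrow> real) \<Rightarrow> (nat \<Rightarrow> fn) \<Rightarrow> cvec" where
  "cls V p x = null_rel V p `` {x}"

definition rep :: "cvec \<Rightarrow> nat \<Rightarrow> fn" where
  "rep a = (SOME x. x \<in> a)"

definition emb :: "fn set \<Rightarrow> (fn \<Rightarrow> real) \<Rightarrow> fn \<Rightarrow> cvec" where
  "emb V p v = cls V p (\<lambda>_. v)"

definition cnorm :: "(fn \<Rightarrow> real) \<Rightarrow> cvec \<Rightarrow> real" where
  "cnorm p a = lim (\<lambda>n. p (rep a n))"

definition clincomb :: "fn set \<Rightarrow> (fn \<Rightarrow> real) \<Rightarrow> cvec set \<Rightarrow> (cvec \<Rightarrow> complex) \<Rightarrow> cvec" where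
  "clincomb V p B c = cls V p (\<lambda>n. \<Sum>b\<in>B. scaleF (c b) (rep b n))"

definition cadd :: "fn set \<Rightarrow> (fn \<Rightarrow> real) \<Rightarrow> cvec \<Rightarrow> cvec \<Rightarrow> cvec" where
  "cadd V p a b = cls V p (\<lambda>n. rep a n + rep b n)"

definition cscale :: "fn set \<Rightarrow> (fn \<Rightarrow> real) \<Rightarrow> complex \<Rightarrow> cvec \<Rightarrow> cvec" where
  "cscale V p c a = cls V p (\<lambda>n. scaleF c (rep a n))"

definition cdiff :: "fn set \<Rightarrow> (fn \<Rightarrow> real) \<Rightarrow> cvec \<Rightarrow> cvec \<Rightarrow> cvec" where
  "cdiff V p a b = cls V p (\<lambda>n. rep a n - rep b n)"

definition has_cderiv_at0 ::
    "fn set \<Rightarrow> (fn \<Rightarrow> real) \<Rightarrow> (real \<Rightarrow> cvec) \<Rightarrow> cvec \<Rightarrow> bool" where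
  "has_cderiv_at0 V p \<gamma> z \<longleftrightarrow> z \<in> completion V p \<and>
     ((\<lambda>t. cnorm p (cdiff V p
         (cscale V p (complex_of_real (1 / t)) (cdiff V p (\<gamma> t) (\<gamma> 0))) z)) \<longlongrightarrow> 0) (at 0)"


section \<open>Globalizations\<close>

definition continuous_rep ::
    "fn set \<Rightarrow> (fn \<Rightarrow> real) \<Rightarrow> (mat2 \<Rightarrow> cvec \<Rightarrow> cvec) \<Rightarrow> bool" where
  "continuous_rep V p \<rho> \<longleftrightarrow>
     (\<forall>g\<in>SL2. \<forall>a\<in>completion V p. \<rho> g a \<in> completion V p) \<and>
     (\<forall>g\<in>SL2. \<forall>a\<in>completion V p. \<forall>b\<in>completion V p.
        \<rho> g (cadd V p a b) = cadd V p (\<rho> g a) (\<rho> g b)) \<and>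
     (\<forall>g\<in>SL2. \<forall>a\<in>completion V p. \<forall>c. \<rho> g (cscale V p c a) = cscale V p c (\<rho> g a)) \<and>
     (\<forall>a\<in>completion V p. \<rho> (mat 1) a = a) \<and>
     (\<forall>g\<in>SL2. \<forall>h\<in>SL2. \<forall>a\<in>completion V p. \<rho> (g ** h) a = \<rho> g (\<rho> h a)) \<and>
     (\<forall>g\<in>SL2. \<forall>a\<in>completion V p. \<forall>e>0. \<exists>d>0. \<forall>h\<in>SL2. \<forall>b\<in>completion V p.
        dist h g < d \<and> cnorm p (cdiff V p b a) < d \<longrightarrow>
        cnorm p (cdiff V p (\<rho> h b) (\<rho> g a)) < e)"

definition K_finite_vectors ::
    "fn set \<Rightarrow> (fn \<Rightarrow> real) \<Rightarrow> (mat2 \<Rightarrow> cvec \<Rightarrow> cvec) \<Rightarrow> cvec set" where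
  "K_finite_vectors V p \<rho> = {a \<in> completion V p.
     \<exists>B. finite B \<and> B \<subseteq> completion V p \<and> (\<forall>k\<in>SO2. \<exists>c. \<rho> k a = clincomb V p B c)}"

text \<open>\<open>globalization V p \<rho>\<close>: \<open>\<rho>\<close> is a continuous representation on the completion of \<open>(V, p)\<close>
  whose module of \<open>K\<close>-finite vectors, with its actions of \<open>K\<close> and of the Lie algebra, is \<open>V\<close>.
  Given \<open>p\<close>, there is at most one such \<open>\<rho>\<close> (as far as its values on the completion go).\<close>

definition globalization ::
    "fn set \<Rightarrow> (fn \<Rightarrow> real) \<Rightarrow> (mat2 \<Rightarrow> cvec \<Rightarrow> cvec) \<Rightarrow> bool" where
  "globalization V p \<rho> \<longleftrightarrow> is_norm V p \<and> continuous_rep V p \<rho> \<and>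
     K_finite_vectors V p \<rho> = emb V p ` V \<and>
     (\<forall>k\<in>SO2. \<forall>v\<in>V. \<rho> k (emb V p v) = emb V p (act k v)) \<and>
     (\<forall>X\<in>sl2. \<forall>v\<in>V. lie_act X v \<in> V \<and>
        has_cderiv_at0 V p (\<lambda>t. \<rho> (mexp (t *\<^sub>R X)) (emb V p v)) (emb V p (lie_act X v)))"

text \<open>A norm \<open>p\<close> is \<open>G\<close>-continuous if \<open>globalization V p \<rho>\<close> holds for some \<open>\<rho>\<close>.  \<open>G\<close> need not
  preserve \<open>V\<close>, so \<open>p (g \<cdot> v)\<close> is the norm of \<open>\<rho> g v\<close> in the completion.\<close>

definition bounded_norms :: "fn set \<Rightarrow> (fn \<Rightarrow> real) set" where
  "bounded_norms V = {p. \<exists>\<rho>. globalization V p \<rho> \<and>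
     (\<exists>C>0. \<forall>g\<in>SL2. \<forall>v\<in>V. cnorm p (\<rho> g (emb V p v)) \<le> C * p v)}"

definition norm_le :: "fn set \<Rightarrow> (fn \<Rightarrow> real) \<Rightarrow> (fn \<Rightarrow> real) \<Rightarrow> bool" where
  "norm_le V p q \<longleftrightarrow> (\<exists>C>0. \<forall>v\<in>V. p v \<le> C * q v)"

text \<open>Representatives of the maximal element of \<open>bounded_norms V\<close> modulo equivalence.\<close>

definition is_max_norm :: "fn set \<Rightarrow> (fn \<Rightarrow> real) \<Rightarrow> bool" where
  "is_max_norm V p \<longleftrightarrow> p \<in> bounded_norms V \<and>
     (\<forall>q\<in>bounded_norms V. norm_le V p q \<longrightarrow> norm_le V q p)"


section \<open>Smooth vectors and distribution vectors\<close>

text \<open>Differentiability classes of maps from the group to the completion, in terms of the frame of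
  left-invariant vector fields.\<close>

definition C0_group :: "fn set \<Rightarrow> (fn \<Rightarrow> real) \<Rightarrow> (mat2 \<Rightarrow> cvec) \<Rightarrow> bool" where
  "C0_group V p F \<longleftrightarrow> (\<forall>g\<in>SL2. F g \<in> completion V p) \<and>
     (\<forall>g\<in>SL2. \<forall>e>0. \<exists>d>0. \<forall>h\<in>SL2. dist h g < d \<longrightarrow> cnorm p (cdiff V p (F h) (F g)) < e)"

primrec Ck_group ::
    "nat \<Rightarrow> fn set \<Rightarrow> (fn \<Rightarrow> real) \<Rightarrow> (mat2 \<Rightarrow> cvec) \<Rightarrow> bool" where
  "Ck_group 0 V p F \<longleftrightarrow> C0_group V p F"
| "Ck_group (Suc k) V p F \<longleftrightarrow> C0_group V p F \<and>
     (\<forall>X\<in>sl2. \<exists>F'. Ck_group k V p F' \<and>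
        (\<forall>g\<in>SL2. has_cderiv_at0 V p (\<lambda>t. F (g ** mexp (t *\<^sub>R X))) (F' g)))"

definition smooth_vectors ::
    "fn set \<Rightarrow> (fn \<Rightarrow> real) \<Rightarrow> (mat2 \<Rightarrow> cvec \<Rightarrow> cvec) \<Rightarrow> cvec set" where
  "smooth_vectors V p \<rho> =
     {a \<in> completion V p. \<forall>k. Ck_group k V p (\<lambda>g. \<rho> g a)}"

definition lie_deriv ::
    "fn set \<Rightarrow> (fn \<Rightarrow> real) \<Rightarrow> (mat2 \<Rightarrow> cvec \<Rightarrow> cvec) \<Rightarrow> mat2 \<Rightarrow> cvec \<Rightarrow> cvec" where
  "lie_deriv V p \<rho> X a = (THE z. has_cderiv_at0 V p (\<lambda>t. \<rho> (mexp (t *\<^sub>R X)) a) z)"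

text \<open>The Frechet topology on the space of smooth vectors is given by the seminorms
  \<open>a \<mapsto> cnorm p (X\<^sub>1 \<dots> X\<^sub>m a)\<close>, for finite words \<open>X\<^sub>1 \<dots> X\<^sub>m\<close> in the Lie algebra.\<close>

definition distribution_vectors ::
    "fn set \<Rightarrow> (fn \<Rightarrow> real) \<Rightarrow> (mat2 \<Rightarrow> cvec \<Rightarrow> cvec) \<Rightarrow> (cvec \<Rightarrow> complex) set" where
  "distribution_vectors V p \<rho> = {\<eta>.
     (\<forall>a\<in>smooth_vectors V p \<rho>. \<forall>b\<in>smooth_vectors V p \<rho>. \<eta> (cadd V p a b) = \<eta> a + \<eta> b) \<and>
     (\<forall>a\<in>smooth_vectors V p \<rho>. \<forall>c. \<eta> (cscale V p c a) = c * \<eta> a) \<and>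
     (\<exists>W C. finite W \<and> W \<subseteq> lists sl2 \<and>
       (\<forall>a\<in>smooth_vectors V p \<rho>.
          cmod (\<eta> a) \<le> C * (\<Sum>Xs\<in>W. cnorm p (foldr (lie_deriv V p \<rho>) Xs a))))}"

definition invariant_under ::
    "mat2 set \<Rightarrow> fn set \<Rightarrow> (fn \<Rightarrow> real) \<Rightarrow> (mat2 \<Rightarrow> cvec \<Rightarrow> cvec) \<Rightarrow> (cvec \<Rightarrow> complex) \<Rightarrow> bool" where
  "invariant_under \<Gamma> V p \<rho> \<eta> \<longleftrightarrow>
     (\<forall>g\<in>\<Gamma>. \<forall>a\<in>smooth_vectors V p \<rho>. \<eta> (\<rho> g a) = \<eta> a)"

text \<open>Here \<open>(q, \<rho>)\<close> is the Banach globalization used to realize the smooth vectors.\<close>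

definition automorphic_norm ::
    "fn set \<Rightarrow> (fn \<Rightarrow> real) \<Rightarrow> (mat2 \<Rightarrow> cvec \<Rightarrow> cvec) \<Rightarrow> (cvec \<Rightarrow> complex) \<Rightarrow> fn \<Rightarrow> real" where
  "automorphic_norm V q \<rho> \<eta> v = (SUP g\<in>SL2. cmod (\<eta> (\<rho> g (emb V q v))))"


section \<open>Sobolev distance\<close>

definition laplace_K :: "mat2 \<Rightarrow> fn \<Rightarrow> fn" where
  "laplace_K Y f = - lie_act Y (lie_act Y f)"

text \<open>\<open>(1 + \<Delta>\<^sub>K)\<^bsup>s/2\<^esup>\<close>: decompose \<open>v\<close> into eigenvectors \<open>u \<mu>\<close> of \<open>\<Delta>\<^sub>K\<close>.  Each \<open>K\<close>-type lies in
  an eigenspace, so this is the diagonal action on \<open>K\<close>-types.\<close>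

definition sobolev_op :: "fn set \<Rightarrow> mat2 \<Rightarrow> real \<Rightarrow> fn \<Rightarrow> fn" where
  "sobolev_op V Y s v = (THE w. \<exists>S u. finite S \<and>
     (\<forall>\<mu>\<in>S. u \<mu> \<in> V \<and> laplace_K Y (u \<mu>) = scaleF (complex_of_real \<mu>) (u \<mu>)) \<and>
     v = (\<Sum>\<mu>\<in>S. u \<mu>) \<and>
     w = (\<Sum>\<mu>\<in>S. scaleF (complex_of_real ((1 + \<mu>) powr (s / 2))) (u \<mu>)))"

definition sobolev_norm :: "fn set \<Rightarrow> mat2 \<Rightarrow> real \<Rightarrow> (fn \<Rightarrow> real) \<Rightarrow> fn \<Rightarrow> real" where
  "sobolev_norm V Y s p v = p (sobolev_op V Y s v)"

text \<open>Extended reals, so that the infimum of the empty set is \<open>\<infinity>\<close>.  Both quantities depend only on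
  the equivalence classes of the norms.\<close>

definition dist_to :: "fn set \<Rightarrow> mat2 \<Rightarrow> (fn \<Rightarrow> real) \<Rightarrow> (fn \<Rightarrow> real) \<Rightarrow> ereal" where
  "dist_to V Y p q = Inf (ereal ` {s. 0 \<le> s \<and> norm_le V p (sobolev_norm V Y s q)})"

definition sobolev_dist :: "fn set \<Rightarrow> mat2 \<Rightarrow> (fn \<Rightarrow> real) \<Rightarrow> (fn \<Rightarrow> real) \<Rightarrow> ereal" where
  "sobolev_dist V Y p q = max (dist_to V Y p q) (dist_to V Y q p)"

end

theory Submission
 imports Defs "HOL-Real_Asymp.Real_Asymp"
begin

text \<open>Suppose that the maximal norm is bounded by the automorphic norm twisted by \<open>D\<^sub>s\<close> with \<open>s < 1/6\<close>.
 Put \<open>t = (log L)/2 + O(1)\<close>. The spherical matrix coefficients \<open>\<langle>a\<^sub>t e\<^sub>0, e\<^sub>m\<rangle>\<close>, \<open>\<bar>m\<bar> \<le> L\<close>, carry a fixed part of the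
 \<open>L\<^sup>2\<close> mass but are all at most \<open>(1 + t) exp (- t)\<close>, so about \<open>L\<close> weights \<open>m\<close> have a coefficient of size at least
 about \<open>L\<^bsup>-1/2\<^esup>\<close>. Let \<open>v\<close> be the sum of the \<open>e\<^sub>m\<close> over these weights with random signs. By spherical
 averaging and Bessel's inequality, \<open>\<Sum> \<bar>\<eta>(g e\<^sub>m)\<bar>\<^sup>2\<close> is \<open>O(L)\<close>, so the automorphic norm of \<open>D\<^sub>s v\<close> is almost surely
 \<open>O(L\<^bsup>s + 1/2 + o(1)\<^esup>)\<close>, while \<open>\<langle>g e\<^sub>0, v\<rangle>\<close> is bounded by \<open>L\<^bsup>o(1)\<^esup>\<close> for all \<open>g\<close>. Functionals of the latter kind can be
 added to any norm in \<open>Norm(V)\<close> without leaving it; pairing \<open>v\<close> with itself, the maximal norm of \<open>v\<close> is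
 therefore at least \<open>L\<^bsup>1 - o(1)\<^esup>\<close>, a contradiction.\<close>

text \<open>\<open>V\<close> is not stable under the group, and each norm has its own completion.
  The analysis therefore runs on scalar families \<open>Ph g v\<close>, standing for a functional
  evaluated at g v, with only linearity in \<open>v\<close> and a derivative rule along g exp(tX)
  (\<open>coeff_family\<close>). Uniqueness for the radial differential equation shows that the
  K-averages of all locally bounded families are governed by the same spherical coefficients
  \<open>Mco\<close>. Adding functionals to a norm is delicate because the new norm must again be
  G-continuous with the same K-finite vectors: the new completion is realized inside the old one,
  and an orbit vector g v stays in it because its K-Fourier series converges like the sum of 1/m^2
  in the new norm. Random signs control only finitely many points, so suprema over the group go
  through nets of size polynomial in \<open>L\<close>; cocompactness makes one net finite, the decay
  of \<open>Mco\<close> for large t the other. For s <= 1/6 the twist costs at most a constant times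
  L^(1/6); the exponents compared are 1/6 + 1/2 and 1, and the gap absorbs logarithms and powers of
  L^(1/50).\<close>

abbreviation cor :: "real => complex" where "cor \<equiv> complex_of_real"

section \<open>Two by two matrices\<close>

definition mk :: "real => real => real => real => mat2" where
 "mk a b c d = vector [vector [a, b], vector [c, d]]"

lemma mk_entries [simp]:
 "mk a b c d $ 1 $ 1 = a" "mk a b c d $ 1 $ 2 = b"
 "mk a b c d $ 2 $ 1 = c" "mk a b c d $ 2 $ 2 = d"
 by (simp_all add: mk_def)

lemma mat2_eq_iff:
 "(A::mat2) = B \<longleftrightarrow> A$1$1 = B$1$1 & A$1$2 = B$1$2 & A$2$1 = B$2$1 & A$2$2 = B$2$2"
 by (auto simp: vec_eq_iff forall_2)

lemma mat2_mult_entry [simp]: "((A::mat2) ** B) $ i $ j = A$i$1 * B$1$j + A$i$2 * B$2$j"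
 by (simp add: matrix_matrix_mult_def sum_2)

lemma mat2_vec_entry [simp]: "((A::mat2) *v x) $ i = A$i$1 * x$1 + A$i$2 * x$2"
 by (simp add: matrix_vector_mult_def sum_2)

lemma mat_1_entries [simp]:
 "(mat 1 :: mat2)$1$1 = 1" "(mat 1 :: mat2)$1$2 = 0"
 "(mat 1 :: mat2)$2$1 = 0" "(mat 1 :: mat2)$2$2 = 1"
 by (simp_all add: mat_def)

text \<open>The adjugate agrees with the inverse on \<open>SL2\<close>, but it is linear in the
  entries and meaningful for every matrix, so identities between entries carry no side
  condition.\<close>

definition adj2 :: "mat2 => mat2" where
 "adj2 A = mk (A$2$2) (- A$1$2) (- A$2$1) (A$1$1)"

definition rot :: "real => mat2" where "rot tta = mk (cos tta) (- sin tta) (sin tta) (cos tta)"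
definition diagm :: "real => mat2" where "diagm t = mk (exp t) 0 0 (exp (- t))"
definition Hm :: mat2 where "Hm = mk 1 0 0 (- 1)"
definition Em :: mat2 where "Em = mk 0 1 0 0"
definition Fm :: mat2 where "Fm = mk 0 0 1 0"
definition Jm :: mat2 where "Jm = mk 0 (- 1) 1 0"

lemma SL2_iff: "A : SL2 \<longleftrightarrow> A$1$1 * A$2$2 - A$1$2 * A$2$1 = 1"
 by (simp add: SL2_def det_2)

lemma sl2_iff: "X : sl2 \<longleftrightarrow> X$2$2 = - X$1$1"
 by (auto simp: sl2_def trace_def sum_2)

lemma SL2_mult [intro]: "A : SL2 ==> B : SL2 ==> A ** B : SL2"
 by (simp add: SL2_def det_mul)

lemma SL2_one [simp, intro]: "mat 1 : SL2"
 by (simp add: SL2_iff)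

lemma adj2_SL2 [intro]: "A : SL2 ==> adj2 A : SL2"
 by (simp add: SL2_iff adj2_def algebra_simps)

lemma adj2_mult: "A : SL2 ==> adj2 A ** A = mat 1" "A : SL2 ==> A ** adj2 A = mat 1"
 by (simp_all add: SL2_iff adj2_def mat2_eq_iff algebra_simps)

lemma matrix_inv_unique2: "A ** B = mat 1 ==> B ** A = mat 1 ==> matrix_inv A = (B::mat2)"
proof -
 assume AB: "A ** B = mat 1" "B ** A = mat 1"
 then have "A ** matrix_inv A = mat 1"
  unfolding matrix_inv_def by (rule someI2[of _ B, OF conjI]) simp
 then have "B ** (A ** matrix_inv A) = B" by simp
 then show ?thesis using AB by (simp add: matrix_mul_assoc)
qed

lemma matrix_inv_SL2: "A : SL2 ==> matrix_inv A = adj2 A"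
 by (rule matrix_inv_unique2) (simp_all add: adj2_mult)

lemma adj2_mult_distrib: "adj2 (A ** B) = adj2 B ** adj2 A"
 by (simp add: adj2_def mat2_eq_iff algebra_simps)

lemma adj2_adj2 [simp]: "adj2 (adj2 A) = A"
 by (simp add: adj2_def mat2_eq_iff)

lemma rot_SL2 [simp, intro]: "rot tta : SL2"
 by (simp add: SL2_iff rot_def sin_cos_squared_add3)

lemma diagm_SL2 [simp, intro]: "diagm t : SL2"
 by (simp add: SL2_iff diagm_def flip: exp_add)

lemma basis_sl2 [simp, intro]: "Hm : sl2" "Em : sl2" "Fm : sl2" "Jm : sl2"
 by (simp_all add: sl2_iff Hm_def Em_def Fm_def Jm_def)

lemma sl2_closed [intro]:
 "X : sl2 ==> c *\<^sub>R X : sl2" "X : sl2 ==> Z : sl2 ==> X + Z : sl2"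
 by (simp_all add: sl2_iff)

lemma sl2_decomp: "X : sl2 ==> X = X$1$1 *\<^sub>R Hm + X$1$2 *\<^sub>R Em + X$2$1 *\<^sub>R Fm"
 by (simp add: sl2_iff mat2_eq_iff Hm_def Em_def Fm_def)

lemma rot_add: "rot (a + b) = rot a ** rot b"
 by (simp add: rot_def mat2_eq_iff cos_add sin_add)

lemma rot_0 [simp]: "rot 0 = mat 1"
 by (simp add: rot_def mat2_eq_iff)

lemma rot_pi [simp]: "rot pi = - mat 1"
 by (simp add: rot_def mat2_eq_iff)

lemma diagm_0 [simp]: "diagm 0 = mat 1"
 by (simp add: diagm_def mat2_eq_iff)

lemma adj2_rot: "adj2 (rot tta) = rot (- tta)"
 by (simp add: adj2_def rot_def mat2_eq_iff)

lemma rot_SO2 [simp, intro]: "rot tta : SO2"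
 using rot_SL2[of tta] sin_cos_squared_add3[of tta]
 unfolding SO2_def orthogonal_matrix_def
 by (simp add: mat2_eq_iff transpose_def) (simp add: rot_def add.commute)

lemma SO2_SL2: "k : SO2 ==> k : SL2"
 by (simp add: SO2_def)

lemma SO2_eq_rot: "k : SO2 ==> \<exists>tta. k = rot tta"
proof -
 assume k: "k : SO2"
 then have d: "k$1$1 * k$2$2 - k$1$2 * k$2$1 = 1" and o: "transpose k ** k = mat 1"
  by (auto simp: SO2_def SL2_iff orthogonal_matrix_def)
 from o have e: "(k$1$1)\<^sup>2 + (k$2$1)\<^sup>2 = 1" "k$1$1 * k$1$2 + k$2$1 * k$2$2 = 0"
  by (simp_all add: mat2_eq_iff transpose_def power2_eq_square)
 obtain tta where t: "k$1$1 = cos tta" "k$2$1 = sin tta"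
  using sincos_total_2pi[OF e(1)] by metis
 \<comment> \<open>Cramer's rule for the second column as polynomial identities; a^2 + c^2 = 1 is
   substituted afterwards.\<close>
 have gen: "a * (a * d - b * c) + c * (a * b + c * d) = d * (a\<^sup>2 + c\<^sup>2)"
  "- c * (a * d - b * c) + a * (a * b + c * d) = b * (a\<^sup>2 + c\<^sup>2)" for a b c d :: real
  by (simp_all add: power2_eq_square algebra_simps)
 have "k$2$2 = k$1$1 * (k$1$1 * k$2$2 - k$1$2 * k$2$1) + k$2$1 * (k$1$1 * k$1$2 + k$2$1 * k$2$2)"
  unfolding gen e(1) by simp
 moreover have "k$1$2 = - k$2$1 * (k$1$1 * k$2$2 - k$1$2 * k$2$1) + k$1$1 * (k$1$1 * k$1$2 + k$2$1 * k$2$2)"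
  unfolding gen e(1) by simp
 ultimately have "k$2$2 = k$1$1" "k$1$2 = - k$2$1" using d e(2) by simp_all
 then show ?thesis using t by (auto simp: rot_def mat2_eq_iff)
qed

lemma mat2_norm_entry: "\<bar>(A::mat2)$i$j\<bar> <= norm A"
 by (metis Finite_Cartesian_Product.norm_nth_le order_trans real_norm_def)

section \<open>The exponential on traceless matrices\<close>

text \<open>A traceless X satisfies X^2 = d with d = -det X, so exp(tX) = \<open>ccf d t\<close> +
  \<open>ssf d t\<close> X (\<open>mexp_sl2\<close>). The pair is the fundamental system of f'' = d
  f; its derivative rules are uniform in the sign of d, and so is the group law derived from
  them.\<close>

definition ccf :: "real => real => real" where
 "ccf d t = (if d > 0 then cosh (sqrt d * t) else if d = 0 then 1 else cos (sqrt (- d) * t))"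

definition ssf :: "real => real => real" where
 "ssf d t = (if d > 0 then sinh (sqrt d * t) / sqrt d else if d = 0 then t
  else sin (sqrt (- d) * t) / sqrt (- d))"

lemma ccf_0 [simp]: "ccf d 0 = 1" and ssf_0 [simp]: "ssf d 0 = 0"
 by (simp_all add: ccf_def ssf_def)

lemma ccf_deriv: "(ccf d has_real_derivative d * ssf d t) (at t)"
proof -
 consider "d > 0" | "d = 0" | "d < 0" by linarith
 then show ?thesis
 proof cases
  case 1
  have "((%t. cosh (sqrt d * t)) has_real_derivative sinh (sqrt d * t) * sqrt d) (at t)"
   by (auto intro!: derivative_eq_intros)
  moreover have "sinh (sqrt d * t) * sqrt d = d * ssf d t"
   using 1 real_div_sqrt[of d] by (simp add: ssf_def field_simps)
  ultimately show ?thesis using 1 by (simp add: ccf_def [abs_def])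
 next
  case 3
  have "((%t. cos (sqrt (- d) * t)) has_real_derivative - sin (sqrt (- d) * t) * sqrt (- d)) (at t)"
   by (auto intro!: derivative_eq_intros)
  moreover have "- sin (sqrt (- d) * t) * sqrt (- d) = d * ssf d t"
   using 3 real_sqrt_mult_self[of "- d"] by (simp add: ssf_def divide_simps mult.assoc del: real_sqrt_mult_self)
  ultimately show ?thesis using 3 by (simp add: ccf_def [abs_def])
 qed (simp add: ccf_def [abs_def])
qed

lemma ssf_deriv: "(ssf d has_real_derivative ccf d t) (at t)"
proof -
 consider "d > 0" | "d = 0" | "d < 0" by linarith
 then show ?thesis
 proof cases
  case 1
  have "((%t. sinh (sqrt d * t) / sqrt d) has_real_derivative cosh (sqrt d * t) * sqrt d / sqrt d) (at t)"
   by (rule DERIV_cdivide) (auto intro!: derivative_eq_intros)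
  then show ?thesis using 1 by (simp add: ssf_def [abs_def] ccf_def)
 next
  case 3
  have "((%t. sin (sqrt (- d) * t) / sqrt (- d)) has_real_derivative
    cos (sqrt (- d) * t) * sqrt (- d) / sqrt (- d)) (at t)"
   by (rule DERIV_cdivide) (auto intro!: derivative_eq_intros)
  then show ?thesis using 3 by (simp add: ssf_def [abs_def] ccf_def)
 qed (simp add: ssf_def [abs_def] ccf_def)
qed

text \<open>Both left sides have derivative 0 in \<open>t\<close> and reduce to the right side at t
  = 0.\<close>

lemma ccf_ssf_add:
 "ccf d (s + t) * ccf d t - d * ssf d (s + t) * ssf d t = ccf d s" (is ?A)
 "ssf d (s + t) * ccf d t - ccf d (s + t) * ssf d t = ssf d s" (is ?B)
proof -
 have sh: "((%t. ccf d (s + t)) has_real_derivative d * ssf d (s + t)) (at t)"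
  "((%t. ssf d (s + t)) has_real_derivative ccf d (s + t)) (at t)" for t
  using DERIV_shift[of "ccf d" "d * ssf d (s+t)" t s] DERIV_shift[of "ssf d" "ccf d (s+t)" t s]
   ccf_deriv ssf_deriv by (simp_all add: add.commute)
 have "((%t. ccf d (s + t) * ccf d t - d * ssf d (s + t) * ssf d t) has_real_derivative 0) (at t)" for t
  by (rule derivative_eq_intros sh ccf_deriv ssf_deriv refl | simp add: algebra_simps)+
 then show ?A
  using DERIV_isconst_all[of "%t. ccf d (s + t) * ccf d t - d * ssf d (s + t) * ssf d t" t 0] by simp
 have "((%t. ssf d (s + t) * ccf d t - ccf d (s + t) * ssf d t) has_real_derivative 0) (at t)" for t
  by (rule derivative_eq_intros sh ccf_deriv ssf_deriv refl | simp add: algebra_simps)+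
 then show ?B
  using DERIV_isconst_all[of "%t. ssf d (s + t) * ccf d t - ccf d (s + t) * ssf d t" t 0] by simp
qed

lemma ccf_ssf_pyth: "(ccf d t)\<^sup>2 - d * (ssf d t)\<^sup>2 = 1"
 using ccf_ssf_add(1)[of d 0 t] by (simp add: power2_eq_square algebra_simps)

lemma ccf_minus [simp]: "ccf d (- t) = ccf d t" and ssf_minus [simp]: "ssf d (- t) = - ssf d t"
 using ccf_ssf_add(1)[of d t "- t"] ccf_ssf_add(2)[of d t "- t"] by simp_all

lemma sl2_square:
 assumes "X : sl2" shows "X ** X = (- det X) *\<^sub>R mat 1"
 using assms by (simp add: sl2_iff mat2_eq_iff det_2 algebra_simps)

lemma sl2_powers:
 assumes "X : sl2"
 shows "((**) (t *\<^sub>R X) ^^ n) (mat 1) =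
  (if even n then (t ^ n * (- det X) ^ (n div 2)) *\<^sub>R mat 1
   else (t ^ n * (- det X) ^ (n div 2)) *\<^sub>R X)"
proof (induction n)
 case (Suc n)
 have "X ** mat 1 = X" by simp
 moreover have "(t *\<^sub>R X) ** (c *\<^sub>R A) = (t * c) *\<^sub>R (X ** A)" for c and A :: mat2
  by (simp add: mat2_eq_iff algebra_simps)
 ultimately show ?case
  using Suc sl2_square[OF assms] by (auto simp: mult_ac elim!: evenE oddE)
qed simp

lemma sqrt_even_power: "d >= 0 ==> sqrt d ^ (b * 2) = d ^ b" "d >= 0 ==> sqrt d ^ (2 * b) = d ^ b"
 by (simp_all add: power_mult mult.commute[of b])

lemma ccf_sums: "(%n. if even n then (t ^ n * d ^ (n div 2)) / fact n else 0) sums ccf d t"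
proof -
 consider "d > 0" | "d = 0" | "d < 0" by linarith
 then show ?thesis
 proof cases
  case 1
  have "(if even n then (t ^ n * d ^ (n div 2)) / fact n else 0) =
   (if even n then (sqrt d * t) ^ n /\<^sub>R fact n else 0)" for n
   using 1 by (auto simp: power_mult_distrib sqrt_even_power elim!: evenE simp: field_simps)
  then show ?thesis using cosh_converges[of "sqrt d * t"] 1 by (simp add: ccf_def)
 next
  case 2
  have "(%n. if even n then (t ^ n * d ^ (n div 2)) / fact n else 0) =
   (%n. if n = 0 then 1 else 0)"
   using 2 by (auto simp: fun_eq_iff elim!: evenE)
  then show ?thesis using sums_single[of 0 "%_. 1::real"] 2 by (simp add: ccf_def)
 next
  case 3
  have "(if even n then (t ^ n * d ^ (n div 2)) / fact n else 0) =
   cos_coeff n *\<^sub>R (sqrt (- d) * t) ^ n" for n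
   using 3 sqrt_even_power[of "- d"] power_mult_distrib[of "-1" d]
   by (auto simp: cos_coeff_def power_mult_distrib field_simps elim!: evenE)
  then show ?thesis using cos_converges[of "sqrt (- d) * t"] 3 by (simp add: ccf_def)
 qed
qed

lemma ssf_sums: "(%n. if even n then 0 else (t ^ n * d ^ (n div 2)) / fact n) sums ssf d t"
proof -
 consider "d > 0" | "d = 0" | "d < 0" by linarith
 then show ?thesis
 proof cases
  case 1
  have "(if even n then 0 else (t ^ n * d ^ (n div 2)) / fact n) =
   (if even n then 0 else (sqrt d * t) ^ n /\<^sub>R fact n) / sqrt d" for n
   using 1 by (auto simp: power_mult_distrib sqrt_even_power elim!: oddE simp: field_simps)
  then show ?thesis using sums_divide[OF sinh_converges[of "sqrt d * t"], of "sqrt d"] 1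
   by (simp add: ssf_def)
 next
  case 2
  have "(%n. if even n then 0 else (t ^ n * d ^ (n div 2)) / fact n) =
   (%n. if n = 1 then t else 0)"
   using 2 by (auto simp: fun_eq_iff elim!: oddE)
  then show ?thesis using sums_single[of 1 "%_. t"] 2 by (simp add: ssf_def)
 next
  case 3
  have "(if even n then 0 else (t ^ n * d ^ (n div 2)) / fact n) =
   (sin_coeff n *\<^sub>R (sqrt (- d) * t) ^ n) / sqrt (- d)" for n
   using 3 sqrt_even_power[of "- d"] power_mult_distrib[of "-1" d]
   by (auto simp: sin_coeff_def power_mult_distrib field_simps elim!: oddE)
  then show ?thesis using sums_divide[OF sin_converges[of "sqrt (- d) * t"], of "sqrt (- d)"] 3
   by (simp add: ssf_def)
 qed
qed

lemma mexp_sl2: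
 assumes "X : sl2"
 shows "mexp (t *\<^sub>R X) = ccf (- det X) t *\<^sub>R mat 1 + ssf (- det X) t *\<^sub>R X"
proof -
 let ?d = "- det X"
 have "(%n. (if even n then (t ^ n * ?d ^ (n div 2)) / fact n else 0) *\<^sub>R mat 1
     + (if even n then 0 else (t ^ n * ?d ^ (n div 2)) / fact n) *\<^sub>R X)
    sums (ccf ?d t *\<^sub>R mat 1 + ssf ?d t *\<^sub>R X)"
  by (intro sums_add bounded_linear.sums[OF bounded_linear_scaleR_left] ccf_sums ssf_sums)
 moreover have "(if even n then (t ^ n * ?d ^ (n div 2)) / fact n else 0) *\<^sub>R mat 1
     + (if even n then 0 else (t ^ n * ?d ^ (n div 2)) / fact n) *\<^sub>R X
   = (((**) (t *\<^sub>R X) ^^ n) (mat 1)) /\<^sub>R fact n" for n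
  by (simp add: sl2_powers[OF assms] field_simps)
 ultimately show ?thesis
  unfolding mexp_def by (simp add: sums_iff)
qed

abbreviation mxp :: "real => mat2 => mat2" where "mxp t X \<equiv> mexp (t *\<^sub>R X)"

lemma mexp_0 [simp]: "mexp 0 = mat 1"
 using mexp_sl2[of Hm 0] by simp

lemma mexp_scale_SL2 [intro]:
 assumes "X : sl2" shows "mxp t X : SL2"
 using ccf_ssf_pyth[of "- det X" t] assms
 by (simp add: mexp_sl2 SL2_iff sl2_iff det_2 power2_eq_square algebra_simps)

lemma mexp_add:
 assumes "X : sl2"
 shows "mxp (s + t) X = mxp s X ** mxp t X"
proof -
 have "(a *\<^sub>R mat 1 + b *\<^sub>R X) ** (c *\<^sub>R mat 1 + e *\<^sub>R X) =
   (a * c + (- det X) * b * e) *\<^sub>R mat 1 + (a * e + b * c) *\<^sub>R X" for a b c e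
  using assms by (simp add: sl2_iff mat2_eq_iff det_2 algebra_simps)
 moreover have "ccf d (s + t) = ccf d s * ccf d t + d * ssf d s * ssf d t"
  "ssf d (s + t) = ccf d s * ssf d t + ssf d s * ccf d t" for d
  using ccf_ssf_add[of d "s + t" "- t"] by (simp_all add: algebra_simps)
 ultimately show ?thesis
  by (simp add: mexp_sl2[OF assms])
qed

lemma mexp_inverse:
 assumes "X : sl2" shows "adj2 (mxp t X) = mxp (- t) X"
 using assms unfolding mexp_sl2[OF assms] by (simp add: sl2_iff adj2_def mat2_eq_iff)

definition Ad :: "mat2 => mat2 => mat2" where "Ad g X = g ** X ** adj2 g"

lemma Ad_sl2 [intro]: "g : SL2 ==> X : sl2 ==> Ad g X : sl2"
 unfolding Ad_def by (simp add: sl2_iff SL2_iff adj2_def algebra_simps)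

lemma det_Ad: "g : SL2 ==> det (Ad g X) = det X"
 unfolding Ad_def using adj2_SL2[of g] by (simp add: SL2_def det_mul)

lemma mexp_Ad:
 assumes "g : SL2" "X : sl2"
 shows "mexp (t *\<^sub>R Ad g X) = g ** mxp t X ** adj2 g"
proof -
 have "g ** (a *\<^sub>R mat 1 + b *\<^sub>R X) ** adj2 g = a *\<^sub>R mat 1 + b *\<^sub>R Ad g X" for a b
 proof -
  have "g ** (a *\<^sub>R mat 1 + b *\<^sub>R X) ** adj2 g = a *\<^sub>R (g ** adj2 g) + b *\<^sub>R Ad g X"
   by (simp add: Ad_def mat2_eq_iff algebra_simps)
  then show ?thesis by (simp add: adj2_mult assms)
 qed
 then show ?thesis
  using assms by (simp add: mexp_sl2 Ad_sl2 det_Ad)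
qed

text \<open>Moves a one-parameter group from the left of g to its right, the only side on which the
  families studied below have a derivative rule.\<close>

lemma mexp_right_Ad:
 assumes "g : SL2" "X : sl2"
 shows "mxp t X ** g = g ** mexp (t *\<^sub>R Ad (adj2 g) X)"
proof -
 have "g ** mexp (t *\<^sub>R Ad (adj2 g) X) = (g ** adj2 g) ** mxp t X ** g"
  using assms by (simp add: mexp_Ad adj2_SL2 matrix_mul_assoc)
 then show ?thesis by (simp add: adj2_mult assms)
qed

lemma mexp_Hm: "mxp t Hm = diagm t"
 unfolding mexp_sl2[OF basis_sl2(1)]
 by (simp add: mat2_eq_iff Hm_def diagm_def ccf_def ssf_def det_2 cosh_plus_sinh cosh_minus_sinh)

lemma mexp_Em: "mxp t Em = mk 1 t 0 1"
 unfolding mexp_sl2[OF basis_sl2(2)] by (simp add: mat2_eq_iff Em_def ccf_def ssf_def det_2)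

lemma mexp_Fm: "mxp t Fm = mk 1 0 t 1"
 unfolding mexp_sl2[OF basis_sl2(3)] by (simp add: mat2_eq_iff Fm_def ccf_def ssf_def det_2)

lemma mexp_Jm: "mxp t Jm = rot t"
 unfolding mexp_sl2[OF basis_sl2(4)] by (simp add: mat2_eq_iff Jm_def rot_def ccf_def ssf_def det_2)

lemma mexp_entry_deriv:
 assumes "X : sl2"
 shows "((%t. mxp t X $ i $ j) has_real_derivative (X ** mxp t X) $ i $ j) (at t)"
proof -
 have sq: "X ** (a *\<^sub>R mat 1 + b *\<^sub>R X) = a *\<^sub>R X + (- det X * b) *\<^sub>R mat 1" for a b
  using assms by (simp add: sl2_iff mat2_eq_iff det_2 algebra_simps)
 have "((%t. ccf (- det X) t * (mat 1::mat2) $ i $ j + ssf (- det X) t * X $ i $ j) has_real_derivative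
   ccf (- det X) t * X $ i $ j + (- det X * ssf (- det X) t) * (mat 1::mat2) $ i $ j) (at t)"
  by (rule derivative_eq_intros ccf_deriv ssf_deriv refl | simp)+
 then show ?thesis
  unfolding mexp_sl2[OF assms] sq by simp
qed

lemma mexp_entry_cont: "X : sl2 ==> continuous_on S (%t. mxp t X $ i $ j)"
 using DERIV_isCont[OF mexp_entry_deriv] by (intro continuous_at_imp_continuous_on) blast

lemma continuous_mat2I:
 assumes "continuous_on S (%x. f x $ 1 $ 1)" "continuous_on S (%x. f x $ 1 $ 2)"
  "continuous_on S (%x. f x $ 2 $ 1)" "continuous_on S (%x. f x $ 2 $ 2)"
 shows "continuous_on S (f :: _ => mat2)"
proof -
 have "continuous_on S (%x. f x $ i $ j)" for i j
  using exhaust_2[of i] exhaust_2[of j] assms by auto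
 then have "continuous_on S (%x. \<chi> i j. f x $ i $ j)"
  by (intro continuous_on_vec_lambda)
 then show ?thesis by simp
qed

lemma mexp_cont: "X : sl2 ==> continuous_on S (%t. mxp t X)"
 by (intro continuous_mat2I mexp_entry_cont)

lemma mat2_mult_cont [continuous_intros]:
 "continuous_on S f ==> continuous_on S g ==> continuous_on S (%x. (f x :: mat2) ** (g x :: mat2))"
 by (rule continuous_mat2I; simp only: mat2_mult_entry; intro continuous_intros)

lemma rot_cont [continuous_intros]:
 fixes f :: "'a::t2_space => real"
 shows "continuous_on S f ==> continuous_on S (%x. rot (f x))"
 by (rule continuous_mat2I; simp only: rot_def mk_entries; intro continuous_intros)

lemma adj2_cont [continuous_intros]:
 "continuous_on S f ==> continuous_on S (%x. adj2 (f x))"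
 by (rule continuous_mat2I; simp add: adj2_def; intro continuous_intros)

section \<open>Decompositions\<close>

text \<open>Reduces Lipschitz estimates near the identity to three one-parameter moves of length
  linear in the distance. The bound on b comes from ln u <= u - 1 for both u = \<open>?x\<close> and
  u = 1/\<open>?x\<close>, where \<open>?x\<close> >= 1/2.\<close>

lemma LDU:
 assumes "w : SL2" "!!i j. \<bar>w$i$j - (mat 1::mat2)$i$j\<bar> <= dlt" "dlt <= 1/2"
 obtains a b c where "w = mxp a Fm ** mxp b Hm ** mxp c Em"
  "\<bar>a\<bar> <= 2 * dlt" "\<bar>b\<bar> <= 2 * dlt" "\<bar>c\<bar> <= 2 * dlt"
proof -
 let ?x = "w$1$1"
 have d: "w$1$1 * w$2$2 - w$1$2 * w$2$1 = 1" using assms(1) by (simp add: SL2_iff)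
 have e: "\<bar>?x - 1\<bar> <= dlt" "\<bar>w$1$2\<bar> <= dlt" "\<bar>w$2$1\<bar> <= dlt"
  using assms(2)[of 1 1] assms(2)[of 1 2] assms(2)[of 2 1] by simp_all
 have x: "?x >= 1/2" using e(1) assms(3) by linarith
 have dd: "0 <= dlt" using e(1) by linarith
 have r: "\<bar>y / ?x\<bar> <= 2 * dlt" if "\<bar>y\<bar> <= dlt" for y
 proof -
  have "\<bar>y / ?x\<bar> = \<bar>y\<bar> / ?x" using x by (simp add: abs_divide)
  also have "\<dots> <= dlt / (1/2)" using that x by (intro frac_le) auto
  finally show ?thesis by simp
 qed
 have "ln ?x <= ?x - 1" using x by (intro ln_le_minus_one) simp
 moreover have "ln (1 / ?x) <= 1 / ?x - 1" using x by (intro ln_le_minus_one) simp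
 moreover have "1 / ?x - 1 <= 2 * dlt"
  using r[of "1 - ?x"] e(1) x by (simp add: abs_minus_commute diff_divide_distrib)
 ultimately have l: "\<bar>ln ?x\<bar> <= 2 * dlt" using e(1) x dd by (simp add: ln_div)
 have "w = mxp (w$2$1 / ?x) Fm ** mexp (ln ?x *\<^sub>R Hm) ** mxp (w$1$2 / ?x) Em"
  using x d by (simp add: mexp_Fm mexp_Hm mexp_Em diagm_def mat2_eq_iff exp_minus field_simps)
 then show thesis using that r[OF e(2)] r[OF e(3)] l by blast
qed

text \<open>A right rotation by pi/2 exchanges the columns up to sign and so reverses the sign of
  their inner product \<open>P\<close>; the intermediate value theorem yields orthogonal columns. By
  Lagrange's identity their lengths then multiply to 1, and one more quarter turn, if necessary,
  makes the first column the longer one, whence t >= 0.\<close>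

lemma KAK:
 assumes "g : SL2"
 obtains tta t phh where "t >= 0" "g = rot tta ** diagm t ** rot phh"
proof -
 define P where "P phh = (g ** rot phh)$1$1 * (g ** rot phh)$1$2 + (g ** rot phh)$2$1 * (g ** rot phh)$2$2" for phh
 have cP: "continuous_on S P" for S
  unfolding P_def by (simp add: rot_def) (intro continuous_intros)
 have shift: "g ** rot (phh + pi/2) = mk ((g ** rot phh)$1$2) (- (g ** rot phh)$1$1)
   ((g ** rot phh)$2$2) (- (g ** rot phh)$2$1)" for phh
  by (simp add: mat2_eq_iff rot_def cos_add sin_add)
 have "P (pi/2) = - P 0"
  using shift[of 0] by (simp add: P_def)
 then have "\<exists>phh. P phh = 0"
  using IVT'[of P 0 0 "pi/2"] IVT2'[of P "pi/2" 0 0] cP by (cases "P 0 <= 0") force+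
 then obtain phh0 where p0: "P phh0 = 0" by blast
 define n where "n phh = ((g ** rot phh)$1$1)\<^sup>2 + ((g ** rot phh)$2$1)\<^sup>2" for phh
 have det1: "(g ** rot phh)$1$1 * (g ** rot phh)$2$2 - (g ** rot phh)$1$2 * (g ** rot phh)$2$1 = 1" for phh
  using SL2_mult[OF assms rot_SL2, of phh] unfolding SL2_iff .
 have prod: "n phh * n (phh + pi/2) = 1" if "P phh = 0" for phh
 proof -
  let ?u = "(g ** rot phh)"
  have gen: "(a\<^sup>2 + c\<^sup>2) * (b\<^sup>2 + d\<^sup>2) = (a * d - b * c)\<^sup>2 + (a * b + c * d)\<^sup>2" for a b c d :: real
   by (simp add: power2_eq_square algebra_simps)
  have "n phh * n (phh + pi/2) = (?u$1$1 * ?u$2$2 - ?u$1$2 * ?u$2$1)\<^sup>2 + (P phh)\<^sup>2"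
   unfolding n_def shift P_def mk_entries by (rule gen)
  then show ?thesis by (simp only: det1 that) simp
 qed
 have "\<exists>phh. P phh = 0 & n phh >= 1"
 proof (cases "n phh0 >= 1")
  case False
  have "n phh0 >= 0" by (simp add: n_def)
  have "P (phh0 + pi/2) = - P phh0" unfolding P_def shift mk_entries by (simp only: mult_minus_right mult.commute add.commute minus_add_distrib)
  moreover have "n (phh0 + pi/2) >= 1"
   using prod[OF p0] False \<open>n phh0 >= 0\<close>
   by (metis linear mult_left_le not_le)
  ultimately show ?thesis using p0 by (metis neg_equal_0_iff_equal)
 qed (use p0 in blast)
 then obtain phh where ph: "P phh = 0" "n phh >= 1" by blast
 define u where "u = g ** rot phh"
 define r where "r = sqrt (n phh)"
 have r: "r >= 1" "r\<^sup>2 = n phh" using ph by (simp_all add: r_def)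
 have "(u$1$1 / r)\<^sup>2 + (u$2$1 / r)\<^sup>2 = 1"
 proof -
  have "(u$1$1)\<^sup>2 + (u$2$1)\<^sup>2 = r\<^sup>2" using r unfolding n_def u_def by (simp only:)
  then show ?thesis using r(1) by (simp only: power_divide add_divide_distrib[symmetric]) simp
 qed
 then obtain tta where th: "u$1$1 / r = cos tta" "u$2$1 / r = sin tta"
  using sincos_total_2pi by metis
 then have th': "u$1$1 = r * cos tta" "u$2$1 = r * sin tta" using r by (auto simp: field_simps)
 have o: "u$1$1 * u$1$2 + u$2$1 * u$2$2 = 0" using ph(1) by (simp only: P_def u_def)
 have dt: "u$1$1 * u$2$2 - u$1$2 * u$2$1 = 1" using det1[of phh] by (simp only: u_def)
 have "r * (cos tta * u$1$2 + sin tta * u$2$2) = 0" using o unfolding th' by (simp only: algebra_simps)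
 then have o': "cos tta * u$1$2 + sin tta * u$2$2 = 0" using r by simp
 have "r * (cos tta * u$2$2 - sin tta * u$1$2) = 1" using dt unfolding th' by (simp only: algebra_simps)
 then have dt': "cos tta * u$2$2 - sin tta * u$1$2 = 1 / r" using r by (simp add: eq_divide_eq mult.commute)
 have gen2: "(c * x - s * y) * c + (c * y + s * x) * s = x * (c * c + s * s)"
  "- (c * x - s * y) * s + (c * y + s * x) * c = y * (c * c + s * s)" for c s x y :: real
  by (simp_all add: algebra_simps)
 have u22: "u$2$2 = cos tta / r"
  using gen2(1)[of "cos tta" "u$2$2" "sin tta" "u$1$2"] by (simp add: o' dt')
 have u12: "u$1$2 = - sin tta / r"
  using gen2(2)[of "cos tta" "u$2$2" "sin tta" "u$1$2"] by (simp add: o' dt')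
 have "u = rot tta ** diagm (ln r)"
  using r by (simp add: mat2_eq_iff rot_def diagm_def th' u22 u12 exp_minus field_simps)
 moreover have "g = u ** rot (- phh)"
  by (simp add: u_def flip: matrix_mul_assoc rot_add)
 ultimately show thesis using that[of "ln r" tta "- phh"] r by simp
qed

text \<open>The images of the balls of radius n are open in the quotient, since their preimages are
  unions of translates of balls, and they exhaust it; compactness leaves finitely many, and the
  largest radius is R.\<close>

lemma cocompact_bounded_representatives:
 assumes "cocompact_lattice \<Gamma>"
 obtains R where "!!g. g : SL2 ==> \<exists>ga\<in>\<Gamma>. \<exists>w\<in>SL2. norm w <= R & g = ga ** w"
proof -
 let ?q = "%g. \<Gamma> #>\<^bsub>SL2_group\<^esub> g"
 from assms obtain T where sub: "subgroup \<Gamma> SL2_group" and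
  q: "quotient_map (top_of_set SL2) T ?q" and c: "compact_space T"
  by (auto simp: cocompact_lattice_def)
 have GS: "\<Gamma> \<subseteq> SL2" using subgroup.subset[OF sub] by (simp add: SL2_group_def)
 have coset: "?q g = {h ** g |h. h : \<Gamma>}" for g
  by (auto simp: r_coset_def SL2_group_def)
 have one: "mat 1 : \<Gamma>" using subgroup.one_closed[OF sub] by (simp add: SL2_group_def)
 have mult: "!!a b. a : \<Gamma> ==> b : \<Gamma> ==> a ** b : \<Gamma>"
  using subgroup.m_closed[OF sub] by (simp add: SL2_group_def)
 have adjG: "adj2 a : \<Gamma>" if "a : \<Gamma>" for a
 proof -
  have aS: "a : SL2" using GS that by blast
  have "inv\<^bsub>SL2_group\<^esub> a = adj2 a"
   unfolding m_inv_def
  proof (rule the_equality)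
   show "adj2 a : carrier SL2_group & a \<otimes>\<^bsub>SL2_group\<^esub> adj2 a = \<one>\<^bsub>SL2_group\<^esub> &
    adj2 a \<otimes>\<^bsub>SL2_group\<^esub> a = \<one>\<^bsub>SL2_group\<^esub>"
    using aS by (simp add: SL2_group_def adj2_mult adj2_SL2)
   fix y assume "y : carrier SL2_group & a \<otimes>\<^bsub>SL2_group\<^esub> y = \<one>\<^bsub>SL2_group\<^esub> &
    y \<otimes>\<^bsub>SL2_group\<^esub> a = \<one>\<^bsub>SL2_group\<^esub>"
   then have "y ** a = mat 1" by (simp add: SL2_group_def)
   then have "y ** (a ** adj2 a) = adj2 a" by (simp add: matrix_mul_assoc)
   then show "y = adj2 a" by (simp add: adj2_mult aS)
  qed
  then show ?thesis using subgroup.m_inv_closed[OF sub that] by simp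
 qed
 have eq: "?q (ga ** w) = ?q w" if "ga : \<Gamma>" for ga w
 proof -
  have 1: "h ** w = (h ** adj2 ga) ** (ga ** w)" for h
  proof -
   have "(h ** adj2 ga) ** (ga ** w) = h ** (adj2 ga ** ga) ** w"
    by (simp only: matrix_mul_assoc)
   then show ?thesis using that GS by (simp add: adj2_mult subset_iff)
  qed
  have 2: "h ** (ga ** w) = (h ** ga) ** w" for h by (simp only: matrix_mul_assoc)
  show ?thesis
   unfolding coset
  proof (rule subset_antisym; rule subsetI)
   fix x assume "x : {h ** (ga ** w) |h. h : \<Gamma>}"
   then show "x : {h ** w |h. h : \<Gamma>}" using 2 mult that by blast
  next
   fix x assume "x : {h ** w |h. h : \<Gamma>}"
   then show "x : {h ** (ga ** w) |h. h : \<Gamma>}" using 1 mult adjG that by blast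
  qed
 qed
 have eqD: "\<exists>ga\<in>\<Gamma>. g = ga ** w" if "?q g = ?q w" for g w
 proof -
  have "g : ?q g" unfolding coset using one by (auto intro!: exI[of _ "mat 1"])
  then have "g : ?q w" using that by (simp only:)
  then show ?thesis unfolding coset by blast
 qed
 define U where "U n = ?q ` (SL2 \<inter> ball 0 (real n))" for n
 have qs: "?q ` SL2 = topspace T" using q by (auto simp: quotient_map_def)
 have Uo: "openin T (U n)" for n
 proof -
  have top: "U n \<subseteq> topspace T" using qs by (auto simp: U_def)
  have "{g : SL2. ?q g : U n} = SL2 \<inter> (\<Union>ga\<in>\<Gamma>. {g. adj2 ga ** g : ball 0 (real n)})"
   (is "?L = ?R")
  proof
   show "?L \<subseteq> ?R"
   proof
    fix g assume "g : ?L"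
    then obtain w where w: "g : SL2" "w : SL2" "w : ball 0 (real n)" "?q g = ?q w"
     by (auto simp: U_def)
    then obtain ga where g: "ga : \<Gamma>" "g = ga ** w" using eqD by blast
    then have "adj2 ga ** g = w" using GS by (auto simp: matrix_mul_assoc adj2_mult)
    then show "g : ?R" using w g by blast
   qed
   show "?R \<subseteq> ?L"
   proof
    fix g assume "g : ?R"
    then obtain ga where g: "g : SL2" "ga : \<Gamma>" "adj2 ga ** g : ball 0 (real n)" by auto
    then have "?q g = ?q (adj2 ga ** g)" using eq adjG by simp
    moreover have "adj2 ga ** g : SL2" using g GS by blast
    ultimately show "g : ?L" using g by (auto simp: U_def)
   qed
  qed
  moreover have "openin (top_of_set SL2) ?R"
  proof (rule openin_open_Int, rule open_UN, rule ballI)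
   fix ga
   have "continuous_on UNIV (%g::mat2. adj2 ga ** g)"
    using mat2_mult_cont[of UNIV "%_. adj2 ga" "%g. g"] by simp
   then show "open {g::mat2. adj2 ga ** g : ball 0 (real n)}"
    using open_vimage[of "ball 0 (real n)" "%g. adj2 ga ** g"] by (simp add: vimage_def)
  qed
  moreover have "\<forall>W\<subseteq>topspace T. openin (top_of_set SL2) {x : SL2. ?q x : W} = openin T W"
   using q unfolding quotient_map_def by simp
  then have "openin (top_of_set SL2) {x : SL2. ?q x : U n} = openin T (U n)" using top by simp
  ultimately show ?thesis by (simp only:)
 qed
 have "topspace T \<subseteq> \<Union>(range U)"
 proof
  fix a assume "a : topspace T"
  then obtain g where g: "g : SL2" "a = ?q g" using qs by blast
  obtain n where "norm g < real n" using reals_Archimedean2 by blast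
  then have "a : U n" unfolding U_def using g by (intro image_eqI[of _ _ g]) auto
  then show "a : \<Union>(range U)" by blast
 qed
 then obtain \<F> where F: "finite \<F>" "\<F> \<subseteq> range U" "topspace T \<subseteq> \<Union>\<F>"
  using c Uo unfolding compact_space_alt by (metis (no_types, lifting) imageE)
 then obtain N where N: "finite N" "\<F> = U ` N" by (metis finite_subset_image)
 define R where "R = real (Max (insert 0 N))"
 have "\<exists>ga\<in>\<Gamma>. \<exists>w\<in>SL2. norm w <= R & g = ga ** w" if "g : SL2" for g
 proof -
  have "?q g : topspace T" using qs that by blast
  then obtain n where n: "n : N" "?q g : U n" using F N by auto
  then obtain w where w: "w : SL2" "norm w < real n" "?q g = ?q w" by (auto simp: U_def)
  have "real n <= R" using N n by (simp add: R_def)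
  then show ?thesis using eqD[OF w(3)] w by (metis less_le_not_le order_less_le_trans)
 qed
 then show thesis using that by blast
qed

section \<open>Fourier coefficients of functions of period \<open>\<pi>\<close>\<close>

text \<open>One period of an even function on the circle, centred at 0 because the matrix
  coefficients estimated later concentrate there.\<close>

definition I0 :: "real set" where "I0 = {- (pi / 2)..pi / 2}"

definition circ :: "real => real^2" where "circ tta = vector [cos tta, sin tta]"

text \<open>Index m belongs to cis(-2 m tta). With this sign the coefficient of index m of tta |->
  Ph (g rot tta) picks out the weight vector of the same index (\<open>Ph_rot\<close>).\<close>

definition fhat :: "int => (real => complex) => complex" where
 "fhat m h = cor (1 / pi) * integral I0 (%tta. h tta * cis (2 * real_of_int m * tta))"

definition msq :: "(real => complex) => real" where
 "msq h = (1 / pi) * integral I0 (%tta. (cmod (h tta))\<^sup>2)"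

definition tpoly :: "int set => (int => complex) => real => complex" where
 "tpoly F a tta = (\<Sum>m\<in>F. a m * cis (- 2 * real_of_int m * tta))"

lemma I0_iff: "tta : I0 \<longleftrightarrow> \<bar>tta\<bar> <= pi / 2"
 by (auto simp: I0_def)

lemma compact_I0 [simp]: "compact I0"
 by (simp add: I0_def)

lemma integral_const_I0 [simp]: "integral I0 (%_. c :: 'a::euclidean_space) = pi *\<^sub>R c"
 by (simp add: I0_def)

lemma circ_entries [simp]: "circ tta $ 1 = cos tta" "circ tta $ 2 = sin tta"
 by (simp_all add: circ_def)

lemma norm_circ [simp]: "norm (circ tta) = 1"
 by (simp add: norm_vec_def L2_set_def sum_2)

lemma circ_shift: "circ (tta + pi) = - circ tta"
 by (simp add: vec_eq_iff forall_2)

lemma cis_cont [continuous_intros]: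
 fixes f :: "'a::t2_space => real"
 shows "continuous_on S f ==> continuous_on S (%x. cis (f x))"
 unfolding cis_conv_exp by (intro continuous_intros)

lemma integrable_I0 [intro]: "continuous_on I0 h ==> (h :: real => 'a::banach) integrable_on I0"
 unfolding I0_def by (rule integrable_continuous_real)

lemma integral_cis_I0:
 "integral I0 (%tta. cis (2 * real_of_int k * tta)) = (if k = 0 then cor pi else 0)"
proof (cases "k = 0")
 case True
 then show ?thesis by (simp add: scaleR_conv_of_real)
next
 case False
 let ?c = "\<i> * cor (2 * real_of_int k)"
 have "((%tta. cis (2 * real_of_int k * tta) / ?c) has_vector_derivative cis (2 * real_of_int k * tta)) (at tta within I0)" for tta
  using False unfolding has_vector_derivative_def
  by (auto intro!: derivative_eq_intros simp: scaleR_conv_of_real field_simps)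
 then have "((%tta. cis (2 * real_of_int k * tta)) has_integral
   (cis (2 * real_of_int k * (pi/2)) / ?c - cis (2 * real_of_int k * (- (pi/2))) / ?c)) I0"
  unfolding I0_def by (intro fundamental_theorem_of_calculus) auto
 moreover have "cis (2 * real_of_int k * (pi/2)) = cis (2 * real_of_int k * (- (pi/2)))"
  using sin_npi_int[of k] by (simp add: complex_eq_iff mult.commute)
 ultimately show ?thesis using False by (simp add: integral_unique)
qed

lemma fhat_add:
 "continuous_on I0 h ==> continuous_on I0 h' ==> fhat m (%tta. h tta + h' tta) = fhat m h + fhat m h'"
 unfolding fhat_def distrib_right
 by (subst integral_add) (auto intro!: integrable_I0 continuous_intros simp: distrib_left add_divide_distrib)

lemma fhat_cmult: "fhat m (%tta. c * h tta) = c * fhat m h"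
 unfolding fhat_def by (simp add: mult.assoc mult.left_commute)

lemma fhat_bound:
 assumes "continuous_on I0 h" "!!tta. tta : I0 ==> cmod (h tta) <= B"
 shows "cmod (fhat m h) <= B"
proof -
 have "norm (integral I0 (%tta. h tta * cis (2 * real_of_int m * tta))) <= integral I0 (%_. B)"
  by (rule integral_norm_bound_integral) (use assms in \<open>auto intro!: integrable_I0 continuous_intros simp: norm_mult\<close>)
 then show ?thesis by (simp add: fhat_def norm_mult norm_divide field_simps)
qed

lemma fhat_bound_integral:
 assumes "continuous_on I0 h" "continuous_on I0 b" "!!tta. tta : I0 ==> cmod (h tta) <= b tta"
 shows "cmod (fhat m h) <= (1 / pi) * integral I0 b"
proof -
 have "norm (integral I0 (%tta. h tta * cis (2 * real_of_int m * tta))) <= integral I0 b"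
  by (rule integral_norm_bound_integral) (use assms in \<open>auto intro!: integrable_I0 continuous_intros simp: norm_mult\<close>)
 then show ?thesis by (simp add: fhat_def norm_mult norm_divide field_simps)
qed

lemma tpoly_cont [continuous_intros]: "continuous_on S (tpoly F a)"
 unfolding tpoly_def by (cases "finite F") (auto intro!: continuous_intros)

lemma fhat_tpoly:
 assumes "finite F"
 shows "fhat m (tpoly F a) = (if m : F then a m else 0)"
proof -
 have e: "tpoly F a tta * cis (2 * real_of_int m * tta)
   = (\<Sum>k\<in>F. a k * cis (2 * real_of_int (m - k) * tta))" for tta
  unfolding tpoly_def sum_distrib_right mult.assoc cis_mult by (simp add: algebra_simps)
 have "integral I0 (%tta. tpoly F a tta * cis (2 * real_of_int m * tta))
   = (\<Sum>k\<in>F. a k * integral I0 (%tta. cis (2 * real_of_int (m - k) * tta)))"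
  unfolding e using assms
  by (subst integral_sum) (auto intro!: integrable_I0 continuous_intros)
 also have "\<dots> = (\<Sum>k\<in>F. if k = m then a k * cor pi else 0)"
  by (intro sum.cong refl) (subst integral_cis_I0, auto)
 also have "\<dots> = (if m : F then a m * cor pi else 0)"
  using assms by (simp add: sum.delta)
 finally show ?thesis by (simp add: fhat_def)
qed

lemma cmod_diff_square: "(cmod (z - w))\<^sup>2 = (cmod z)\<^sup>2 - 2 * Re (z * cnj w) + (cmod w)\<^sup>2"
 by (simp add: cmod_power2) (simp add: power2_eq_square algebra_simps)

text \<open>Stated for arbitrary coefficients \<open>a\<close>: taking a = \<open>fhat\<close> gives
  Bessel's inequality, and comparing with the coefficients of a uniform approximation gives
  Parseval.\<close>

lemma msq_diff_tpoly:
 assumes F: "finite F" and h: "continuous_on I0 h"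
 shows "msq (%tta. h tta - tpoly F a tta) = msq h - (\<Sum>m\<in>F. (cmod (fhat m h))\<^sup>2)
  + (\<Sum>m\<in>F. (cmod (a m - fhat m h))\<^sup>2)"
proof -
 have inner: "integral I0 (%tta. u tta * cnj (tpoly F a tta)) = cor pi * (\<Sum>m\<in>F. cnj (a m) * fhat m u)"
  if u: "continuous_on I0 u" for u
 proof -
  have "u tta * cnj (tpoly F a tta) = (\<Sum>m\<in>F. cnj (a m) * (u tta * cis (2 * real_of_int m * tta)))" for tta
   by (simp add: tpoly_def sum_distrib_left cis_cnj mult_ac)
  then have "integral I0 (%tta. u tta * cnj (tpoly F a tta))
   = (\<Sum>m\<in>F. cnj (a m) * integral I0 (%tta. u tta * cis (2 * real_of_int m * tta)))"
   using F u by (simp, subst integral_sum) (auto intro!: integrable_I0 continuous_intros)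
  then show ?thesis by (simp add: fhat_def sum_distrib_left mult_ac)
 qed
 have tt: "integral I0 (%tta. (cmod (tpoly F a tta))\<^sup>2) = pi * (\<Sum>m\<in>F. (cmod (a m))\<^sup>2)"
 proof -
  have "cor (integral I0 (%tta. (cmod (tpoly F a tta))\<^sup>2))
   = integral I0 (%tta. cor ((cmod (tpoly F a tta))\<^sup>2))"
   by (subst integral_linear[OF _ bounded_linear_of_real, unfolded o_def])
    (auto intro!: integrable_I0 continuous_intros)
  also have "\<dots> = integral I0 (%tta. tpoly F a tta * cnj (tpoly F a tta))"
   by (simp only: complex_norm_square)
  also have "\<dots> = cor pi * (\<Sum>m\<in>F. cnj (a m) * a m)"
   by (subst inner) (auto intro!: continuous_intros simp: fhat_tpoly F)
  also have "\<dots> = cor (pi * (\<Sum>m\<in>F. (cmod (a m))\<^sup>2))"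
   by (simp only: of_real_mult of_real_sum complex_norm_square mult.commute)
  finally show ?thesis by (simp only: of_real_eq_iff)
 qed
 have "integral I0 (%tta. (cmod (h tta - tpoly F a tta))\<^sup>2)
  = integral I0 (%tta. ((cmod (h tta))\<^sup>2 - 2 * Re (h tta * cnj (tpoly F a tta))) + (cmod (tpoly F a tta))\<^sup>2)"
  by (simp only: cmod_diff_square)
 also have "\<dots> = integral I0 (%tta. (cmod (h tta))\<^sup>2) - 2 * Re (integral I0 (%tta. h tta * cnj (tpoly F a tta)))
   + integral I0 (%tta. (cmod (tpoly F a tta))\<^sup>2)"
 proof -
  have c: "continuous_on I0 (%tta. h tta * cnj (tpoly F a tta))" by (intro continuous_intros h)
  have r: "integral I0 (%tta. Re (h tta * cnj (tpoly F a tta))) = Re (integral I0 (%tta. h tta * cnj (tpoly F a tta)))"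
   using integral_linear[OF integrable_I0[OF c] bounded_linear_Re] by (simp add: o_def)
  have i: "(%tta. (cmod (h tta))\<^sup>2) integrable_on I0" "(%tta. Re (h tta * cnj (tpoly F a tta))) integrable_on I0"
   "(%tta. (cmod (tpoly F a tta))\<^sup>2) integrable_on I0"
   by (rule integrable_I0, intro continuous_intros h)+
  show ?thesis
   unfolding r[symmetric] using i
   by (intro integral_unique has_integral_add has_integral_diff has_integral_mult_right integrable_integral)
 qed
 also have "\<dots> = integral I0 (%tta. (cmod (h tta))\<^sup>2) + pi * (\<Sum>m\<in>F. (cmod (a m))\<^sup>2 - 2 * Re (a m * cnj (fhat m h)))"
 proof -
  have "Re (integral I0 (%tta. h tta * cnj (tpoly F a tta))) = pi * (\<Sum>m\<in>F. Re (a m * cnj (fhat m h)))"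
   by (simp add: inner[OF h] Re_sum algebra_simps)
  then show ?thesis by (simp add: tt sum_subtractf sum_distrib_left algebra_simps)
 qed
 also have "\<dots> = integral I0 (%tta. (cmod (h tta))\<^sup>2) + pi * (\<Sum>m\<in>F. (cmod (a m - fhat m h))\<^sup>2 - (cmod (fhat m h))\<^sup>2)"
  by (simp add: cmod_diff_square)
 finally show ?thesis
  by (simp add: msq_def sum_subtractf field_simps)
qed

lemma msq_nonneg: "continuous_on I0 h ==> 0 <= msq h"
 unfolding msq_def by (intro mult_nonneg_nonneg integral_nonneg) (auto intro!: integrable_I0 continuous_intros)

lemma Bessel:
 assumes "finite F" "continuous_on I0 h"
 shows "(\<Sum>m\<in>F. (cmod (fhat m h))\<^sup>2) <= msq h"
proof -
 have "0 <= msq (%tta. h tta - tpoly F (%m. fhat m h) tta)"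
  by (intro msq_nonneg continuous_intros assms)
 then show ?thesis using msq_diff_tpoly[OF assms, of "%m. fhat m h"] by simp
qed

lemma msq_le:
 assumes "continuous_on I0 h" "!!tta. tta : I0 ==> cmod (h tta) <= B"
 shows "msq h <= B\<^sup>2"
proof -
 have "integral I0 (%tta. (cmod (h tta))\<^sup>2) <= integral I0 (%tta. B\<^sup>2)"
  by (intro integral_le) (auto intro!: integrable_I0 continuous_intros assms power_mono)
 then show ?thesis by (simp add: msq_def field_simps)
qed

section \<open>Parseval's inequality from uniform trigonometric approximation\<close>

definition trig_approx :: "(real => complex) => bool" where
 "trig_approx h \<longleftrightarrow> (\<forall>ep>0. \<exists>F a. finite F & (\<forall>tta\<in>I0. cmod (h tta - tpoly F a tta) <= ep))"

lemma trig_approx_Parseval: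
 assumes "trig_approx h" "continuous_on I0 h" "ep > 0"
 shows "\<exists>F. finite F & (\<forall>F'. finite F' & F \<subseteq> F' --> msq h <= (\<Sum>m\<in>F'. (cmod (fhat m h))\<^sup>2) + ep)"
proof -
 have "sqrt ep > 0" using assms(3) by simp
 from assms(1)[unfolded trig_approx_def, rule_format, OF this]
 obtain F a where F: "finite F" "!!tta. tta : I0 ==> cmod (h tta - tpoly F a tta) <= sqrt ep"
  by auto
 have "msq (%tta. h tta - tpoly F a tta) <= (sqrt ep)\<^sup>2"
  by (rule msq_le) (auto intro!: continuous_intros assms F)
 then have le: "msq h <= (\<Sum>m\<in>F. (cmod (fhat m h))\<^sup>2) + ep"
  using msq_diff_tpoly[OF F(1) assms(2), of a] assms(3) sum_nonneg[of F "%m. (cmod (a m - fhat m h))\<^sup>2"]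
  by simp
 have "msq h <= (\<Sum>m\<in>F'. (cmod (fhat m h))\<^sup>2) + ep" if "finite F'" "F \<subseteq> F'" for F'
  using le sum_mono2[OF that, of "%m. (cmod (fhat m h))\<^sup>2"] by force
 then show ?thesis using F(1) by blast
qed

lemma fhat_zero_imp_zero:
 assumes "trig_approx h" "continuous_on I0 h" "!!m. fhat m h = 0" "tta : I0"
 shows "h tta = 0"
proof -
 have "msq h <= ep" if "ep > 0" for ep
  using trig_approx_Parseval[OF assms(1,2) that] assms(3) by auto
 then have "msq h <= 0" using field_le_epsilon[of "msq h" 0] by simp
 then have "integral I0 (%tta. (cmod (h tta))\<^sup>2) = 0"
  using msq_nonneg[OF assms(2)] by (simp add: msq_def zero_le_mult_iff mult_le_0_iff)
 moreover have c: "continuous_on {- (pi / 2)..pi / 2} (%tta. (cmod (h tta))\<^sup>2)"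
  using assms(2) unfolding I0_def by (intro continuous_on_power continuous_on_norm)
 ultimately have "\<forall>tta\<in>{- (pi / 2)..pi / 2}. (cmod (h tta))\<^sup>2 = 0"
  using integral_eq_0_iff[OF c] unfolding I0_def by simp
 then have "(cmod (h tta))\<^sup>2 = 0" using assms(4) unfolding I0_def by blast
 then show ?thesis by simp
qed

inductive trig :: "(real => complex) => bool" where
 "trig (%tta. c * cis (real_of_int k * tta))"
| "trig f ==> trig g ==> trig (%tta. f tta + g tta)"

lemma trig_mult: "trig f ==> trig g ==> trig (%tta. f tta * g tta)"
proof (induction f rule: trig.induct)
 case (1 c k)
 from 1 show ?case
 proof (induction g rule: trig.induct)
  case (1 d l)
  have "(%tta. c * cis (real_of_int k * tta) * (d * cis (real_of_int l * tta)))
   = (%tta. (c * d) * cis (real_of_int (k + l) * tta))"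
   by (simp add: fun_eq_iff distrib_right flip: cis_mult)
  then show ?case by (simp only: trig.intros)
 next
  case (2 f g)
  then show ?case using trig.intros(2) by (simp add: distrib_left)
 qed
next
 case (2 f1 f2)
 then show ?case using trig.intros(2) by (simp add: distrib_right)
qed

lemma trig_cmult: "trig f ==> trig (%tta. c * f tta)"
 using trig_mult[OF trig.intros(1)[of c 0]] by simp

lemma tpoly_add:
 assumes "finite F" "finite G"
 shows "\<exists>b. \<forall>tta. tpoly F a tta + tpoly G a' tta = tpoly (F \<union> G) b tta"
proof -
 let ?b = "%m. (if m : F then a m else 0) + (if m : G then a' m else 0)"
 have eq: "(F \<union> G) \<inter> {m. m : F} = F" "(F \<union> G) \<inter> {m. m : G} = G" by auto
 have "tpoly (F \<union> G) ?b tta = tpoly F a tta + tpoly G a' tta" for tta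
 proof -
  have "tpoly (F \<union> G) ?b tta = (\<Sum>m\<in>F \<union> G. (if m : F then a m * cis (- 2 * real_of_int m * tta) else 0))
  + (\<Sum>m\<in>F \<union> G. (if m : G then a' m * cis (- 2 * real_of_int m * tta) else 0))"
   unfolding tpoly_def sum.distrib[symmetric] by (intro sum.cong) (auto simp: distrib_right)
  then show ?thesis using assms by (simp add: tpoly_def sum.If_cases eq)
 qed
 then show ?thesis by (intro exI[of _ ?b]) simp
qed

lemma trig_even_part:
 "trig f ==> \<exists>F a. finite F & (\<forall>tta. (f tta + f (tta + pi)) / 2 = tpoly F a tta)"
proof (induction f rule: trig.induct)
 case (1 c k)
 have p: "cis (real_of_int k * pi) = (if even k then 1 else -1)"
  using cos_npi_int[of k] sin_npi_int[of k] by (auto simp: complex_eq_iff mult.commute)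
 have s: "cis (real_of_int k * (tta + pi)) = cis (real_of_int k * tta) * cis (real_of_int k * pi)" for tta
  by (simp add: cis_mult distrib_left)
 show ?case
 proof (cases "even k")
  case True
  then obtain j where j: "k = 2 * j" by blast
  have "cis (real_of_int k * (tta + pi)) = cis (real_of_int k * tta)" for tta
   using True by (simp add: s p)
  then have "(c * cis (real_of_int k * tta) + c * cis (real_of_int k * (tta + pi))) / 2 = tpoly {- j} (%_. c) tta" for tta
   by (simp only: tpoly_def) (simp add: j)
  then show ?thesis by blast
 next
  case False
  then show ?thesis by (intro exI[of _ "{}"]) (simp add: s p tpoly_def)
 qed
next
 case (2 f g)
 then obtain F a G b where *: "finite F" "finite G"
  "!!tta. (f tta + f (tta + pi)) / 2 = tpoly F a tta" "!!tta. (g tta + g (tta + pi)) / 2 = tpoly G b tta" by metis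
 obtain c where "!!tta. tpoly F a tta + tpoly G b tta = tpoly (F \<union> G) c tta"
  using tpoly_add[OF *(1,2)] by metis
 then have "(f tta + g tta + (f (tta + pi) + g (tta + pi))) / 2 = tpoly (F \<union> G) c tta" for tta
 proof -
  have "(f tta + g tta + (f (tta + pi) + g (tta + pi))) / 2 = (f tta + f (tta + pi)) / 2 + (g tta + g (tta + pi)) / 2"
   by (simp add: field_simps)
  then show ?thesis using \<open>!!tta. tpoly F a tta + tpoly G b tta = tpoly (F \<union> G) c tta\<close>
   by (simp only: *(3,4))
 qed
 then show ?case using * by (intro exI[of _ "F \<union> G"] exI[of _ c]) simp
qed

lemma real_polynomial_trig:
 fixes p :: "real^2 => real"
 shows "real_polynomial_function p ==> trig (%tta. cor (p (circ tta)))"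
proof (induction p rule: real_polynomial_function.induct)
 case (linear f)
 then interpret bounded_linear f .
 have e: "circ tta = cos tta *\<^sub>R axis 1 1 + sin tta *\<^sub>R axis 2 1" for tta
  by (simp add: vec_eq_iff forall_2 axis_def)
 let ?a = "cor (f (axis 1 1))" and ?b = "cor (f (axis 2 1))"
 have "cor (f (circ tta)) =
   (?a / 2 + ?b / (2 * \<i>)) * cis (real_of_int 1 * tta) + (?a / 2 - ?b / (2 * \<i>)) * cis (real_of_int (-1) * tta)" for tta
 proof -
  have 1: "cis (real_of_int 1 * tta) = cor (cos tta) + \<i> * cor (sin tta)"
   "cis (real_of_int (-1) * tta) = cor (cos tta) - \<i> * cor (sin tta)"
   by (simp_all add: complex_eq_iff)
  have "f (circ tta) = cos tta * f (axis 1 1) + sin tta * f (axis 2 1)"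
   by (simp add: e add scaleR)
  then show ?thesis unfolding 1 by (simp add: field_simps)
 qed
 then show ?case by (simp only: trig.intros)
next
 case (const c)
 then show ?case using trig.intros(1)[of "cor c" 0] by simp
qed (simp_all add: trig.intros trig_mult)

text \<open>Stone-Weierstrass approximates f on the circle by a polynomial. As f is even, averaging
  the polynomial over antipodal points does not increase the error and removes the odd
  frequencies.\<close>

lemma even_function_trig_approx:
 fixes f :: "real^2 => complex"
 assumes c: "continuous_on (sphere 0 1) f" and ev: "!!x. f (- x) = f x"
 shows "trig_approx (%tta. f (circ tta))" "trig_approx (%tta. f (circ (- tta)))"
proof -
 have main: "\<exists>F a. finite F & (\<forall>tta. cmod (f (circ tta) - tpoly F a tta) <= ep)" if "ep > 0" for ep
 proof -
  obtain g where g: "polynomial_function g" "!!x. x : sphere 0 1 ==> norm (f x - g x) < ep"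
   using Stone_Weierstrass_polynomial_function[OF _ c \<open>ep > 0\<close>] by auto
  have "real_polynomial_function (%x. Re (g x))" "real_polynomial_function (%x. Im (g x))"
   using g(1) unfolding polynomial_function_def by (force simp: o_def intro: bounded_linear_Re bounded_linear_Im)+
  then have "trig (%tta. cor (Re (g (circ tta))) + \<i> * cor (Im (g (circ tta))))"
   by (intro trig.intros trig_cmult real_polynomial_trig)
  then have "trig (%tta. g (circ tta))" by (simp flip: complex_eq)
  from trig_even_part[OF this] obtain F a where F: "finite F"
   "!!tta. (g (circ tta) + g (circ (tta + pi))) / 2 = tpoly F a tta" by blast
  have "cmod (f (circ tta) - tpoly F a tta) <= ep" for tta
  proof -
   have "f (circ tta) - tpoly F a tta = ((f (circ tta) - g (circ tta)) + (f (circ (tta + pi)) - g (circ (tta + pi)))) / 2"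
   proof -
    have f2: "f (circ (tta + pi)) = f (circ tta)" by (simp add: circ_shift ev)
    show ?thesis unfolding f2 F(2)[symmetric] by (simp add: field_simps)
   qed
   also have "cmod \<dots> <= (cmod (f (circ tta) - g (circ tta)) + cmod (f (circ (tta + pi)) - g (circ (tta + pi)))) / 2"
    by (simp add: norm_divide norm_triangle_ineq divide_right_mono)
   also have "\<dots> <= (ep + ep) / 2"
    by (intro divide_right_mono add_mono less_imp_le g) auto
   finally show ?thesis by simp
  qed
  then show ?thesis using F by blast
 qed
 show "trig_approx (%tta. f (circ tta))"
  unfolding trig_approx_def
 proof (intro allI impI)
  fix ep :: real assume "ep > 0"
  from main[OF this] obtain F a where F: "finite F & (\<forall>tta. cmod (f (circ tta) - tpoly F a tta) <= ep)"
   by (elim exE)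
  show "\<exists>F a. finite F & (\<forall>tta\<in>I0. cmod (f (circ tta) - tpoly F a tta) <= ep)"
   by (rule exI[of _ F], rule exI[of _ a]) (simp add: F)
 qed
 show "trig_approx (%tta. f (circ (- tta)))"
  unfolding trig_approx_def
 proof (intro allI impI)
  fix ep :: real assume "ep > 0"
  from main[OF this] obtain F a where F: "finite F & (\<forall>tta. cmod (f (circ tta) - tpoly F a tta) <= ep)"
   by (elim exE)
  have eq: "tpoly F a (- tta) = tpoly (uminus ` F) (%m. a (- m)) tta" for tta
   by (simp add: tpoly_def sum.reindex)
  show "\<exists>F a. finite F & (\<forall>tta\<in>I0. cmod (f (circ (- tta)) - tpoly F a tta) <= ep)"
  proof (rule exI[of _ "uminus ` F"], rule exI[of _ "%m. a (- m)"], intro conjI ballI)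
   fix tta
   show "cmod (f (circ (- tta)) - tpoly (uminus ` F) (%m. a (- m)) tta) <= ep"
    unfolding eq[symmetric] using F by (simp only:)
  qed (use F in simp)
 qed
qed

section \<open>The weight vectors\<close>

lemma fn_sum_apply: "(\<Sum>i\<in>F. (f i :: fn)) x = (\<Sum>i\<in>F. f i x)"
 by (induction F rule: infinite_finite_induct) auto

lemma scaleF_apply [simp]: "scaleF c f x = c * f x"
 by (simp add: scaleF_def)

lemma scaleF_simps:
 "scaleF c (f + g) = scaleF c f + scaleF c g" "scaleF (a + b) f = scaleF a f + scaleF b f"
 "scaleF a (scaleF b f) = scaleF (a * b) f" "scaleF 1 f = f" "scaleF 0 f = 0" "scaleF a 0 = 0"
 "scaleF c (f - g) = scaleF c f - scaleF c g" "scaleF (- a) f = - scaleF a f"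
 by (simp_all add: fun_eq_iff algebra_simps)

lemma scaleF_minus_one: "- f = scaleF (- 1) f"
 by (simp add: fun_eq_iff)

lemma scaleF_sum: "scaleF c (\<Sum>i\<in>F. f i) = (\<Sum>i\<in>F. scaleF c (f i))"
 by (simp add: fun_eq_iff fn_sum_apply sum_distrib_left)

definition zz :: "real^2 => complex" where "zz x = Complex (x$1) (x$2)"
definition rsq :: "real^2 => real" where "rsq x = (x$1)\<^sup>2 + (x$2)\<^sup>2"

text \<open>In polar coordinates this is the function \<open>r\<^sup>s e\<^bsup>iktta\<^esup>\<close>.\<close>

definition uu :: "int => complex => fn" where
 "uu k s x = (if x = 0 then 0
  else zz x powi k * exp ((s - of_int k) * cor (ln (rsq x) / 2)))"

text \<open>In polar coordinates r^(-1-lam) e^(2 i m theta). Only even frequencies occur because the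
  functions of the principal series are even.\<close>

definition ee :: "complex => int => fn" where
 "ee lam m = uu (2 * m) (- 1 - lam)"

lemma vec2_zero_iff: "(x::real^2) = 0 \<longleftrightarrow> x$1 = 0 & x$2 = 0"
 by (simp add: vec_eq_iff forall_2)

lemma rsq_pos: "x ~= 0 ==> rsq x > 0"
 by (simp add: rsq_def vec2_zero_iff sum_power2_gt_zero_iff)

lemma zz_nonzero: "x ~= 0 ==> zz x ~= 0"
 by (simp add: zz_def vec2_zero_iff complex_eq_iff)

lemma zz_cnj: "zz x * cnj (zz x) = cor (rsq x)"
 by (simp add: zz_def rsq_def complex_eq_iff power2_eq_square)

lemma cmod_zz: "cmod (zz x) = sqrt (rsq x)"
 by (simp add: zz_def rsq_def cmod_def)

lemma circ_nonzero [simp]: "circ tta ~= 0"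
 using norm_circ[of tta] by (metis norm_zero zero_neq_one)

lemma rsq_circ [simp]: "rsq (circ tta) = 1"
 by (simp add: rsq_def)

lemma uu_0 [simp]: "uu k s 0 = 0"
 by (simp add: uu_def)

lemma uu_circ: "uu k s (circ tta) = cis (of_int k * tta)"
proof -
 have "zz (circ tta) = cis tta" by (simp add: zz_def cis.ctr)
 then show ?thesis by (simp add: uu_def cis_power_int mult.commute)
qed

lemma ee_circ: "ee lam m (circ tta) = cis (2 * of_int m * tta)"
 by (simp add: ee_def uu_circ)

lemma ee_0 [simp]: "ee lam m 0 = 0"
 by (simp add: ee_def)

lemma rsq_scale: "rsq (t *\<^sub>R x) = t\<^sup>2 * rsq x"
 by (simp add: rsq_def power_mult_distrib algebra_simps)

lemma ee_scale:
 assumes "t ~= 0" "x ~= 0"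
 shows "ee lam m (t *\<^sub>R x) = cor \<bar>t\<bar> powr (- 1 - lam) * ee lam m x"
proof -
 let ?l = "cor (ln \<bar>t\<bar>)" and ?s = "- 1 - lam - of_int (2 * m)"
 have l: "ln (rsq (t *\<^sub>R x)) / 2 = ln \<bar>t\<bar> + ln (rsq x) / 2"
 proof -
  have "rsq (t *\<^sub>R x) = \<bar>t\<bar> ^ 2 * rsq x" by (simp add: rsq_scale)
  moreover have "ln (\<bar>t\<bar> ^ 2 * rsq x) = ln (\<bar>t\<bar> ^ 2) + ln (rsq x)"
   using assms rsq_pos[OF assms(2)] by (intro ln_mult_pos) auto
  moreover have "ln (\<bar>t\<bar> ^ 2) = 2 * ln \<bar>t\<bar>" using assms by (subst ln_realpow) auto
  ultimately show ?thesis by (simp only:) (simp add: add_divide_distrib)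
 qed
 have z: "zz (t *\<^sub>R x) = cor t * zz x" by (simp add: zz_def complex_eq_iff)
 have tp: "cor t powi (2 * m) = exp (of_int (2 * m) * ?l)"
 proof -
  have "cor t powi (2 * m) = (cor \<bar>t\<bar>) powi (2 * m)"
   by (simp add: power_int_mult flip: of_real_power of_real_power_int)
  also have "cor \<bar>t\<bar> = exp ?l" using assms by (simp add: exp_of_real)
  finally show ?thesis by (simp add: exp_power_int mult.commute)
 qed
 have "cor \<bar>t\<bar> powr (- 1 - lam) = exp (of_int (2 * m) * ?l) * exp (?s * ?l)"
  using assms by (simp add: powr_def Ln_of_real algebra_simps flip: exp_add)
 moreover have "exp (?s * cor (ln (rsq (t *\<^sub>R x)) / 2))
   = exp (?s * ?l) * exp (?s * cor (ln (rsq x) / 2))"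
  unfolding l of_real_add distrib_left exp_add ..
 ultimately show ?thesis
  using assms by (simp add: ee_def uu_def z power_int_mult_distrib tp)
qed

lemma ee_uminus: "ee lam m (- x) = ee lam m x"
 using ee_scale[of "-1" x lam m] by (cases "x = 0") auto

lemma ee_norm: "cmod (ee lam m x) = rsq x powr (- (1 + Re lam) / 2)"
proof (cases "x = 0")
 case False
 have "cmod (zz x) = exp (ln (rsq x) / 2)"
  using rsq_pos[OF False] by (simp add: cmod_zz ln_sqrt[symmetric])
 then have "cmod (zz x powi (2 * m)) = exp (of_int (2 * m) * (ln (rsq x) / 2))"
  by (simp add: norm_power_int exp_power_int mult.commute)
 then show ?thesis using False rsq_pos[OF False]
  by (simp add: ee_def uu_def norm_mult powr_def) (simp add: field_simps flip: exp_add)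
qed (simp add: rsq_def)

lemma has_derivative_uu:
 assumes x: "x ~= 0"
 shows "(uu k s has_derivative (%h. uu k s x * (of_int k * (zz h / zz x)
  + (s - of_int k) * cor ((x$1 * h$1 + x$2 * h$2) / rsq x)))) (at x)"
proof -
 have zd: "(zz has_derivative zz) (at x)"
 proof -
  have "zz = (%x. cor (x$1) + \<i> * cor (x$2))"
   by (simp add: fun_eq_iff zz_def complex_eq_iff)
  moreover have "((%x::real^2. cor (x$1) + \<i> * cor (x$2)) has_derivative
   (%x. cor (x$1) + \<i> * cor (x$2))) (at x)"
   by (auto intro!: derivative_eq_intros bounded_linear.has_derivative[OF bounded_linear_vec_nth])
  ultimately show ?thesis by simp
 qed
 have rd: "(rsq has_derivative (%h. 2 * (x$1 * h$1 + x$2 * h$2))) (at x)"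
  unfolding rsq_def [abs_def]
  by (auto intro!: derivative_eq_intros bounded_linear.has_derivative[OF bounded_linear_vec_nth])
 have ld: "((%x. ln (rsq x) / 2) has_derivative (%h. (x$1 * h$1 + x$2 * h$2) / rsq x)) (at x)"
  using rsq_pos[OF x] by (auto intro!: derivative_eq_intros rd simp: field_simps)
 have pd: "((%x. zz x powi k) has_derivative (%h. zz h * (of_int k * zz x powi (k - 1)))) (at x)"
  by (rule has_derivative_power_int[OF zz_nonzero[OF x] zd])
 have ed: "((%x. exp ((s - of_int k) * cor (ln (rsq x) / 2))) has_derivative
  (%h. exp ((s - of_int k) * cor (ln (rsq x) / 2)) * ((s - of_int k) * cor ((x$1 * h$1 + x$2 * h$2) / rsq x)))) (at x)"
  by (rule has_derivative_compose[OF has_derivative_mult_right[OF has_derivative_of_real[OF ld]]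
     DERIV_exp[unfolded has_field_derivative_def]])
 have "((%x. zz x powi k * exp ((s - of_int k) * cor (ln (rsq x) / 2))) has_derivative
  (%h. uu k s x * (of_int k * (zz h / zz x)
  + (s - of_int k) * cor ((x$1 * h$1 + x$2 * h$2) / rsq x)))) (at x)"
  using has_derivative_mult[OF pd ed] x zz_nonzero[OF x]
  by (simp add: uu_def power_int_diff algebra_simps)
 then show ?thesis
  by (rule has_derivative_transform_within_open[where s="- {0}"]) (use x in \<open>auto simp: uu_def\<close>)
qed

text \<open>In the complex coordinate z a traceless X acts by z |-> a conj(z) + i b z with a =
  \<open>alX X\<close>, b = \<open>beX X\<close> (\<open>zz_sl2\<close>). Here a encodes the
  symmetric part, which shifts weights, and b the infinitesimal rotation, which does not.\<close>

definition alX :: "mat2 => complex" where "alX X = Complex (X$1$1) ((X$1$2 + X$2$1) / 2)"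
definition beX :: "mat2 => complex" where "beX X = cor ((X$2$1 - X$1$2) / 2)"

lemma act_SL2: "g : SL2 ==> act g f = (%x. f (adj2 g *v x))"
 by (simp add: act_def matrix_inv_SL2)

lemma mexp_vec_deriv:
 assumes "X : sl2"
 shows "((%t. mxp t X *v x) has_vector_derivative (X *v x)) (at 0)"
proof -
 let ?d = "- det X"
 have "((%t. ccf ?d t *\<^sub>R x + ssf ?d t *\<^sub>R (X *v x)) has_vector_derivative
   (ccf ?d 0 *\<^sub>R 0 + (?d * ssf ?d 0) *\<^sub>R x) + (ssf ?d 0 *\<^sub>R 0 + ccf ?d 0 *\<^sub>R (X *v x))) (at 0)"
  by (intro has_vector_derivative_add has_vector_derivative_scaleR ccf_deriv ssf_deriv has_vector_derivative_const)
 moreover have "mxp t X *v x = ccf ?d t *\<^sub>R x + ssf ?d t *\<^sub>R (X *v x)" for t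
  unfolding mexp_sl2[OF assms] by (simp add: vec_eq_iff forall_2 algebra_simps)
 ultimately show ?thesis by simp
qed

text \<open>The quotients conj(z)/z and z/conj(z) shift the index by -1 and +1
  (\<open>ee_shift\<close>); rewritten with them, the derivative of \<open>ee lam m\<close> at x in
  direction -X x is this three-term combination.\<close>

definition lie_ee :: "complex => mat2 => int => fn" where
 "lie_ee lam X m = scaleF (- 2 * \<i> * of_int m * beX X) (ee lam m)
  + scaleF (- (of_int m - (1 + lam) / 2) * alX X) (ee lam (m - 1))
  + scaleF ((of_int m + (1 + lam) / 2) * cnj (alX X)) (ee lam (m + 1))"

lemma ee_shift:
 assumes "x ~= 0"
 shows "ee lam (m - 1) x = ee lam m x * (cnj (zz x) / zz x)"
  "ee lam (m + 1) x = ee lam m x * (zz x / cnj (zz x))"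
proof -
 let ?L = "cor (ln (rsq x) / 2)"
 have R: "exp (2 * ?L) = zz x * cnj (zz x)"
  using rsq_pos[OF assms] unfolding zz_cnj by (simp add: exp_of_real)
 have z: "zz x ~= 0" "cnj (zz x) ~= 0" using zz_nonzero[OF assms] by auto
 have *: "ee lam (j - 1) x = ee lam j x * (cnj (zz x) / zz x)" for j
 proof -
  have "exp ((- 1 - lam - of_int (2 * (j - 1))) * ?L) = exp ((- 1 - lam - of_int (2 * j)) * ?L) * (zz x * cnj (zz x))"
   unfolding R[symmetric] by (simp add: algebra_simps flip: exp_add)
  moreover have "zz x powi (2 * (j - 1)) = zz x powi (2 * j) / (zz x * zz x)"
   using z by (simp add: power_int_diff right_diff_distrib power_int_numeral power2_eq_square)
  ultimately show ?thesis using z assms by (simp add: ee_def uu_def)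
 qed
 show "ee lam (m - 1) x = ee lam m x * (cnj (zz x) / zz x)" by (rule *)
 show "ee lam (m + 1) x = ee lam m x * (zz x / cnj (zz x))"
  using *[of "m + 1"] z by (simp add: field_simps)
qed

lemma zz_sl2: "X : sl2 ==> zz (X *v x) = alX X * cnj (zz x) + \<i> * beX X * zz x"
 by (simp add: zz_def alX_def beX_def sl2_iff complex_eq_iff field_simps)

lemma ee_lie_deriv:
 assumes X: "X : sl2"
 shows "((%t. act (mxp t X) (ee lam m) x) has_vector_derivative lie_ee lam X m x) (at 0)"
proof -
 have ax: "act (mxp t X) (ee lam m) x = ee lam m (mxp (- t) X *v x)" for t
  using X by (simp add: act_SL2 mexp_scale_SL2 mexp_inverse)
 show ?thesis
 proof (cases "x = 0")
  case True
  then show ?thesis by (simp add: act_def lie_ee_def)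
 next
  case False
  let ?D = "%h. ee lam m x * (of_int (2 * m) * (zz h / zz x)
   + (- 1 - lam - of_int (2 * m)) * cor ((x$1 * h$1 + x$2 * h$2) / rsq x))"
  have g: "((%t. mxp (- t) X *v x) has_vector_derivative (- (X *v x))) (at 0)"
  proof -
   have "((%t. mexp (t *\<^sub>R (- X)) *v x) has_vector_derivative (- X) *v x) (at 0)"
    using X by (intro mexp_vec_deriv) (simp add: sl2_iff)
   moreover have "(- X) *v x = - (X *v x)" by (simp add: vec_eq_iff)
   ultimately show ?thesis by simp
  qed
  have g1: "((%t. mxp (- t) X *v x) has_derivative (%t. t *\<^sub>R (- (X *v x)))) (at 0)"
   using g unfolding has_vector_derivative_def .
  have "(ee lam m has_derivative ?D) (at x)"
   using has_derivative_uu[OF False, of "2 * m" "- 1 - lam"] unfolding ee_def .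
  then have g2: "(ee lam m has_derivative ?D) (at (mxp (- 0) X *v x))" by simp
  have "((%t. ee lam m (mxp (- t) X *v x)) has_derivative (%t. ?D (t *\<^sub>R (- (X *v x))))) (at 0)"
   by (rule has_derivative_compose[OF g1 g2])
  moreover have "?D (t *\<^sub>R (- (X *v x))) = t *\<^sub>R lie_ee lam X m x" for t
  proof -
   let ?z = "zz x" and ?a = "alX X" and ?b = "beX X"
   have z: "?z ~= 0" "cnj ?z ~= 0" using zz_nonzero[OF False] by auto
   have zl: "zz (t *\<^sub>R (- (X *v x))) = - (cor t * zz (X *v x))"
    by (simp add: zz_def complex_eq_iff)
   have dot: "cor ((x$1 * (t *\<^sub>R (- (X *v x)))$1 + x$2 * (t *\<^sub>R (- (X *v x)))$2) / rsq x)
    = - cor t * ((?a * cnj ?z * cnj ?z + cnj ?a * ?z * ?z) / 2) / (?z * cnj ?z)"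
   proof -
    have "cor (x$1 * (X *v x)$1 + x$2 * (X *v x)$2) = (?a * cnj ?z * cnj ?z + cnj ?a * ?z * ?z) / 2"
     using X by (simp add: zz_def alX_def sl2_iff complex_eq_iff field_simps)
    moreover have "x$1 * (t *\<^sub>R (- (X *v x)))$1 + x$2 * (t *\<^sub>R (- (X *v x)))$2 = - t * (x$1 * (X *v x)$1 + x$2 * (X *v x)$2)"
     by (simp add: algebra_simps)
    ultimately show ?thesis unfolding zz_cnj by (simp only: of_real_divide of_real_mult of_real_minus)
   qed
   \<comment> \<open>Opaque names for the two quotients, the value and (1 + lam)/2 turn the
     remaining goal into a polynomial identity.\<close>
   obtain p r A muu where d: "p = cnj ?z / ?z" "r = ?z / cnj ?z" "A = ee lam m x" "muu = (1 + lam) / 2" by blast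
   have 1: "zz (t *\<^sub>R (- (X *v x))) / ?z = - (cor t * (?a * p + \<i> * ?b))"
    unfolding zl zz_sl2[OF X] d using z by (simp add: field_simps)
   have 2: "- cor t * ((?a * cnj ?z * cnj ?z + cnj ?a * ?z * ?z) / 2) / (?z * cnj ?z)
     = - cor t * (?a * p + cnj ?a * r) / 2"
    unfolding d using z by (simp add: field_simps)
   have l: "- 1 - lam = - 2 * muu" unfolding d by (simp add: field_simps)
   have sc: "t *\<^sub>R c = cor t * c" for c :: complex by (rule scaleR_conv_of_real)
   show ?thesis
    unfolding dot 1 2 lie_ee_def plus_fun_apply scaleF_apply ee_shift[OF False] sc
     d(1,2,3,4)[symmetric] l
    by (simp add: algebra_simps)
  qed
  ultimately show ?thesis by (simp add: ax has_vector_derivative_def)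
 qed
qed

section \<open>The span of the weight vectors\<close>

definition Vs :: "complex => fn set" where
 "Vs lam = {v. \<exists>F c. finite F & v = (\<Sum>m\<in>F. scaleF (c m) (ee lam m))}"

text \<open>The sign compensates for that of \<open>fhat\<close>: on the circle
  \<open>ee lam m\<close> is cis(2 m tta).\<close>

definition cf :: "int => fn => complex" where
 "cf m v = fhat (- m) (%tta. v (circ tta))"

lemma ee_in_Vs [simp, intro]: "ee lam m : Vs lam"
 unfolding Vs_def by (rule CollectI, rule exI[of _ "{m}"], rule exI[of _ "%_. 1"]) (simp add: scaleF_simps)

lemma Vs_0 [simp, intro]: "0 : Vs lam"
 unfolding Vs_def by (rule CollectI, rule exI[of _ "{}"]) simp

lemma Vs_scale [intro]: "v : Vs lam ==> scaleF c v : Vs lam"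
proof -
 assume "v : Vs lam"
 then obtain F d where "finite F" "v = (\<Sum>m\<in>F. scaleF (d m) (ee lam m))" unfolding Vs_def by auto
 then have "finite F & scaleF c v = (\<Sum>m\<in>F. scaleF (c * d m) (ee lam m))"
  by (simp add: scaleF_sum scaleF_simps)
 then show ?thesis unfolding Vs_def by (intro CollectI exI)
qed

lemma Vs_add [intro]:
 assumes "v : Vs lam" "w : Vs lam" shows "v + w : Vs lam"
proof -
 obtain F c G d where *: "finite F" "v = (\<Sum>m\<in>F. scaleF (c m) (ee lam m))"
  "finite G" "w = (\<Sum>m\<in>G. scaleF (d m) (ee lam m))" using assms unfolding Vs_def by auto
 let ?c = "%m. (if m : F then c m else 0)" and ?d = "%m. (if m : G then d m else 0)"
 have "v = (\<Sum>m\<in>F \<union> G. scaleF (?c m) (ee lam m))" "w = (\<Sum>m\<in>F \<union> G. scaleF (?d m) (ee lam m))"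
  unfolding * by (rule sum.mono_neutral_cong_left; use * in \<open>auto simp: scaleF_simps\<close>)+
 then have "v + w = (\<Sum>m\<in>F \<union> G. scaleF (?c m + ?d m) (ee lam m))"
  by (simp add: scaleF_simps sum.distrib)
 moreover have "finite (F \<union> G)" using * by simp
 ultimately show ?thesis unfolding Vs_def by (intro CollectI exI conjI)
qed

lemma Vs_uminus [intro]: "v : Vs lam ==> - v : Vs lam"
 unfolding scaleF_minus_one by (rule Vs_scale)

lemma Vs_diff [intro]: "v : Vs lam ==> w : Vs lam ==> v - w : Vs lam"
 using Vs_add[OF _ Vs_uminus, of v lam w] by simp

lemma Vs_sum [intro]: "(!!i. i : F ==> f i : Vs lam) ==> (\<Sum>i\<in>F. f i) : Vs lam"
 by (induction F rule: infinite_finite_induct) auto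

lemma Vs_induct [consumes 1, case_names zero ee add scale]:
 assumes "v : Vs lam" "P 0" "!!m. P (ee lam m)"
  "!!v w. v : Vs lam ==> w : Vs lam ==> P v ==> P w ==> P (v + w)"
  "!!v c. v : Vs lam ==> P v ==> P (scaleF c v)"
 shows "P v"
proof -
 obtain F c where "finite F" "v = (\<Sum>m\<in>F. scaleF (c m) (ee lam m))" using assms(1) unfolding Vs_def by auto
 moreover have "P (\<Sum>m\<in>F. scaleF (c m) (ee lam m))" if "finite F" for F
  using that
 proof (induction F)
  case (insert m F)
  then have "(\<Sum>m\<in>insert m F. scaleF (c m) (ee lam m)) = scaleF (c m) (ee lam m) + (\<Sum>m\<in>F. scaleF (c m) (ee lam m))"
   by simp
  moreover have "P (scaleF (c m) (ee lam m) + (\<Sum>m\<in>F. scaleF (c m) (ee lam m)))"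
   using insert.IH by (intro assms(4)[OF _ _ assms(5)[OF _ assms(3)]] Vs_scale Vs_sum ee_in_Vs)
  ultimately show ?case by (simp only:)
 qed (use assms(2) in \<open>simp only: sum.empty\<close>)
 ultimately show ?thesis by (simp only:)
qed

lemma Vs_circ_tpoly:
 assumes "finite F" "v = (\<Sum>m\<in>F. scaleF (c m) (ee lam m))"
 shows "(%tta. v (circ tta)) = tpoly (uminus ` F) (%m. c (- m))"
 by (simp add: fun_eq_iff assms(2) fn_sum_apply ee_circ tpoly_def sum.reindex)

lemma Vs_circ_cont [continuous_intros]: "v : Vs lam ==> continuous_on S (%tta. v (circ tta))"
 unfolding Vs_def by clarify (simp only: Vs_circ_tpoly[OF _ refl] tpoly_cont)

lemma cf_sum:
 assumes "finite F"
 shows "cf k (\<Sum>m\<in>F. scaleF (c m) (ee lam m)) = (if k : F then c k else 0)"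
 unfolding cf_def Vs_circ_tpoly[OF assms refl] using assms
 by (subst fhat_tpoly) (auto simp: image_iff)

lemma cf_ee: "cf k (ee lam m) = (if k = m then 1 else 0)"
 using cf_sum[of "{m}" k "%_. 1" lam] by (auto simp: scaleF_simps)

lemma cf_0 [simp]: "cf k 0 = 0"
 using cf_sum[of "{}"] by simp

lemma cf_add: "v : Vs lam ==> w : Vs lam ==> cf k (v + w) = cf k v + cf k w"
 unfolding cf_def plus_fun_apply by (rule fhat_add) (auto intro: Vs_circ_cont)

lemma cf_scale: "cf k (scaleF c v) = c * cf k v"
 by (simp add: cf_def fhat_cmult)

lemma cf_diff: "v : Vs lam ==> w : Vs lam ==> cf k (v - w) = cf k v - cf k w"
 using cf_add[of v lam "scaleF (-1) w" k] cf_scale[of k "-1" w] by (auto simp flip: scaleF_minus_one)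

lemma Vs_expand:
 assumes "v : Vs lam"
 shows "finite {m. cf m v ~= 0}" "v = (\<Sum>m | cf m v ~= 0. scaleF (cf m v) (ee lam m))"
proof -
 obtain F c where F: "finite F" "v = (\<Sum>m\<in>F. scaleF (c m) (ee lam m))"
  using assms unfolding Vs_def by auto
 then have c: "cf m v = (if m : F then c m else 0)" for m by (simp add: cf_sum)
 then have sub: "{m. cf m v ~= 0} \<subseteq> F" by (auto split: if_splits)
 then show fin: "finite {m. cf m v ~= 0}" using F(1) finite_subset by blast
 show "v = (\<Sum>m | cf m v ~= 0. scaleF (cf m v) (ee lam m))"
 proof -
  have "v = (\<Sum>m\<in>F. scaleF (cf m v) (ee lam m))" using F c by (simp cong: sum.cong)
  also have "\<dots> = (\<Sum>m | cf m v ~= 0. scaleF (cf m v) (ee lam m))"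
   by (rule sum.mono_neutral_right) (use F sub in \<open>auto simp: scaleF_simps\<close>)
  finally show ?thesis .
 qed
qed

lemma Vs_expand_finite:
 assumes "v : Vs lam" "finite F" "{m. cf m v ~= 0} \<subseteq> F"
 shows "v = (\<Sum>m\<in>F. scaleF (cf m v) (ee lam m))"
proof -
 have "(\<Sum>m | cf m v ~= 0. scaleF (cf m v) (ee lam m)) = (\<Sum>m\<in>F. scaleF (cf m v) (ee lam m))"
  by (rule sum.mono_neutral_left) (use assms in \<open>auto simp: scaleF_simps\<close>)
 then show ?thesis using Vs_expand(2)[OF assms(1)] by simp
qed

lemma Vs_eqI:
 assumes "v : Vs lam" "w : Vs lam" "!!m. cf m v = cf m w" shows "v = w"
 using Vs_expand(2)[OF assms(1)] Vs_expand(2)[OF assms(2)] assms(3) by simp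

lemma lie_deriv_Vs:
 assumes "v : Vs lam" "X : sl2"
 shows "lie_act X v : Vs lam &
  (\<forall>x. ((%t. act (mxp t X) v x) has_vector_derivative lie_act X v x) (at 0))"
proof -
 have "\<exists>w\<in>Vs lam. \<forall>x. ((%t. act (mxp t X) v x) has_vector_derivative w x) (at 0)"
  using assms(1)
 proof (induction rule: Vs_induct)
  case zero
  show ?case by (rule bexI[of _ 0]) (simp_all add: act_def)
 next
  case (ee m)
  show ?case
  proof
   show "lie_ee lam X m : Vs lam" unfolding lie_ee_def by (intro Vs_add Vs_scale ee_in_Vs)
  qed (use ee_lie_deriv[OF assms(2)] in blast)
 next
  case (add v w)
  then obtain v' w' where *: "v' : Vs lam" "w' : Vs lam"
   "!!x. ((%t. act (mxp t X) v x) has_vector_derivative v' x) (at 0)"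
   "!!x. ((%t. act (mxp t X) w x) has_vector_derivative w' x) (at 0)" by blast
  show ?case
  proof (rule bexI[of _ "v' + w'"], rule allI)
   fix x show "((%t. act (mxp t X) (v + w) x) has_vector_derivative (v' + w') x) (at 0)"
    using has_vector_derivative_add[OF *(3,4)[of x]] by (simp add: act_def)
  qed (use * in blast)
 next
  case (scale v c)
  then obtain v' where *: "v' : Vs lam"
   "!!x. ((%t. act (mxp t X) v x) has_vector_derivative v' x) (at 0)" by blast
  show ?case
  proof (rule bexI[of _ "scaleF c v'"], rule allI)
   fix x show "((%t. act (mxp t X) (scaleF c v) x) has_vector_derivative (scaleF c v') x) (at 0)"
    using has_vector_derivative_mult_right[OF *(2)[of x], of c] by (simp add: act_def)
  qed (use * in blast)
 qed
 then obtain w where w: "w : Vs lam" "!!x. ((%t. act (mxp t X) v x) has_vector_derivative w x) (at 0)"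
  by blast
 then have "lie_act X v = w" by (simp add: lie_act_def fun_eq_iff vector_derivative_at)
 then show ?thesis using w by simp
qed

lemma lie_act_Vs [intro]: "v : Vs lam ==> X : sl2 ==> lie_act X v : Vs lam"
 using lie_deriv_Vs by blast

lemma lie_act_ee: "X : sl2 ==> lie_act X (ee lam m) = lie_ee lam X m"
 by (simp add: lie_act_def fun_eq_iff vector_derivative_at[OF ee_lie_deriv])

lemma lie_act_add:
 assumes "v : Vs lam" "w : Vs lam" "X : sl2"
 shows "lie_act X (v + w) = lie_act X v + lie_act X w"
proof
 fix x
 have "((%t. act (mxp t X) v x + act (mxp t X) w x) has_vector_derivative (lie_act X v x + lie_act X w x)) (at 0)"
  using lie_deriv_Vs assms by (intro has_vector_derivative_add) blast+
 then show "lie_act X (v + w) x = (lie_act X v + lie_act X w) x"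
  unfolding lie_act_def[of X "v + w"] by (simp add: act_def vector_derivative_at)
qed

lemma lie_act_scale:
 assumes "v : Vs lam" "X : sl2"
 shows "lie_act X (scaleF c v) = scaleF c (lie_act X v)"
proof
 fix x
 have "((%t. c * act (mxp t X) v x) has_vector_derivative (c * lie_act X v x)) (at 0)"
  using lie_deriv_Vs assms by (intro has_vector_derivative_mult_right) blast+
 then show "lie_act X (scaleF c v) x = (scaleF c (lie_act X v)) x"
  unfolding lie_act_def[of X "scaleF c v"] by (simp add: act_def vector_derivative_at)
qed

lemma lie_act_0: "X : sl2 ==> lie_act X 0 = 0"
 using lie_act_scale[of 0 0 X 0] by (simp add: scaleF_simps)

text \<open>Each direction has its own one-parameter group, so additivity in X is not built into the
  definition of \<open>lie_act\<close>; on weight vectors it is visible from the formula, as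
  \<open>alX\<close> and \<open>beX\<close> are real linear.\<close>

lemma lie_act_linear_left:
 assumes "v : Vs lam" "X : sl2" "Z : sl2"
 shows "lie_act (a *\<^sub>R X + b *\<^sub>R Z) v
  = scaleF (cor a) (lie_act X v) + scaleF (cor b) (lie_act Z v)"
 using assms(1)
proof (induction rule: Vs_induct)
 case zero
 show ?case unfolding lie_act_0[OF assms(2)] lie_act_0[OF assms(3)]
   lie_act_0[OF sl2_closed(2)[OF sl2_closed(1)[OF assms(2)] sl2_closed(1)[OF assms(3)]]]
  by (simp only: scaleF_simps add_0)
next
 case (ee m)
 have "alX (a *\<^sub>R X + b *\<^sub>R Z) = cor a * alX X + cor b * alX Z"
  "beX (a *\<^sub>R X + b *\<^sub>R Z) = cor a * beX X + cor b * beX Z"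
  by (simp_all add: alX_def beX_def complex_eq_iff field_simps)
 moreover have "a *\<^sub>R X + b *\<^sub>R Z : sl2" using assms by blast
 ultimately show ?case using assms
  by (simp add: lie_act_ee lie_ee_def fun_eq_iff algebra_simps)
next
 case (add v w)
 have C: "a *\<^sub>R X + b *\<^sub>R Z : sl2" using assms by blast
 show ?case
  unfolding lie_act_add[OF add(1,2) C] lie_act_add[OF add(1,2) assms(2)] lie_act_add[OF add(1,2) assms(3)]
   add(3,4) by (simp add: fun_eq_iff algebra_simps)
next
 case (scale v c)
 have C: "a *\<^sub>R X + b *\<^sub>R Z : sl2" using assms by blast
 show ?case
  unfolding lie_act_scale[OF scale(1) C] lie_act_scale[OF scale(1) assms(2)] lie_act_scale[OF scale(1) assms(3)]
   scale(2) by (simp add: fun_eq_iff algebra_simps)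
qed

text \<open>By linearity it suffices to treat weight vectors, where the brackets of
  \<open>alX\<close> and \<open>beX\<close> reduce the claim to a polynomial identity in the values
  of five neighbouring weights. It is what makes the product rule close up in
  \<open>LX_deriv\<close>.\<close>

lemma lie_act_commutator:
 assumes "v : Vs lam" "X : sl2" "Z : sl2"
 shows "lie_act X (lie_act Z v) - lie_act Z (lie_act X v) = lie_act (X ** Z - Z ** X) v"
proof -
 have C: "X ** Z - Z ** X : sl2" using assms by (simp add: sl2_iff algebra_simps)
 show ?thesis using assms(1)
 proof (induction rule: Vs_induct)
  case zero
  show ?case unfolding lie_act_0[OF assms(2)] lie_act_0[OF assms(3)] lie_act_0[OF C] by (simp only: diff_self)
 next
  case (ee m)
  have ab: "beX (X ** Z - Z ** X) = \<i> * (alX X * cnj (alX Z) - cnj (alX X) * alX Z) * (-1)"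
   "alX (X ** Z - Z ** X) = 2 * \<i> * (beX X * alX Z - alX X * beX Z)"
   "cnj (alX (X ** Z - Z ** X)) = - 2 * \<i> * (beX X * cnj (alX Z) - cnj (alX X) * beX Z)"
   using assms by (simp_all add: alX_def beX_def sl2_iff complex_eq_iff field_simps)
  have L: "lie_act A (lie_act B (ee lam m)) = scaleF (- 2 * \<i> * of_int m * beX B) (lie_ee lam A m)
  + scaleF (- (of_int m - (1 + lam) / 2) * alX B) (lie_ee lam A (m - 1))
  + scaleF ((of_int m + (1 + lam) / 2) * cnj (alX B)) (lie_ee lam A (m + 1))"
   if "A : sl2" "B : sl2" for A B
   unfolding lie_act_ee[OF that(2)] lie_ee_def[of lam B m]
   using that by (simp add: lie_act_add[of _ lam] lie_act_scale[of _ lam] lie_act_ee Vs_add Vs_scale)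
  obtain muu where mu: "muu = (1 + lam) / 2" by blast
  obtain a b c d e f where abc: "a = alX X" "b = alX Z" "c = beX X" "d = beX Z"
   "e = cnj (alX X)" "f = cnj (alX Z)" by blast
  have sh: "m - 1 + 1 = m" "m + 1 - 1 = m" by simp_all
  have re: "cnj c = c" "cnj d = d" by (simp_all add: abc beX_def)
  show ?case
  proof
   fix x
   obtain E0 E1 E2 E3 E4 where E: "E0 = ee lam m x" "E1 = ee lam (m - 1) x" "E2 = ee lam (m + 1) x"
    "E3 = ee lam (m - 1 - 1) x" "E4 = ee lam (m + 1 + 1) x" by blast
   show "(lie_act X (lie_act Z (ee lam m)) - lie_act Z (lie_act X (ee lam m))) x
    = lie_act (X ** Z - Z ** X) (ee lam m) x"
    unfolding L[OF assms(2,3)] L[OF assms(3,2)] lie_act_ee[OF C] lie_ee_def ab mu[symmetric]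
     minus_apply plus_fun_apply scaleF_apply sh abc[symmetric] E[symmetric] of_int_diff of_int_add of_int_1
    by (simp add: re algebra_simps)
  qed
 next
  case (add v w)
  note V = lie_act_Vs[OF add(1) assms(2)] lie_act_Vs[OF add(2) assms(2)]
   lie_act_Vs[OF add(1) assms(3)] lie_act_Vs[OF add(2) assms(3)]
  show ?case
   unfolding lie_act_add[OF add(1,2) assms(2)] lie_act_add[OF add(1,2) assms(3)] lie_act_add[OF add(1,2) C]
    lie_act_add[OF V(1,2) assms(3)] lie_act_add[OF V(3,4) assms(2)] add(3,4)[symmetric]
   by (simp add: fun_eq_iff)
 next
  case (scale v c)
  note V = lie_act_Vs[OF scale(1) assms(2)] lie_act_Vs[OF scale(1) assms(3)]
  show ?case
   unfolding lie_act_scale[OF scale(1) assms(2)] lie_act_scale[OF scale(1) assms(3)] lie_act_scale[OF scale(1) C]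
    lie_act_scale[OF V(1) assms(3)] lie_act_scale[OF V(2) assms(2)] scale(2)[symmetric] scaleF_simps ..
 qed
qed

lemma act_rot_ee: "act (rot phh) (ee lam m) = scaleF (cis (- 2 * of_int m * phh)) (ee lam m)"
proof
 fix x :: "real^2"
 show "act (rot phh) (ee lam m) x = scaleF (cis (- 2 * of_int m * phh)) (ee lam m) x"
 proof (cases "x = 0")
  case True
  then show ?thesis by (simp add: act_SL2)
 next
  case False
  have z: "zz (rot (- phh) *v x) = cis (- phh) * zz x"
   by (simp add: zz_def rot_def complex_eq_iff)
  have r: "rsq (rot (- phh) *v x) = rsq x"
  proof -
   have "cor (rsq (rot (- phh) *v x)) = cor (rsq x)"
    unfolding zz_cnj[symmetric] z by (simp add: cis_cnj mult_ac) (simp add: cis_mult flip: mult.assoc)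
   then show ?thesis by simp
  qed
  have n: "rot (- phh) *v x ~= 0" using r rsq_pos[OF False] by (metis rsq_def less_irrefl power_zero_numeral zero_index add_0)
  show ?thesis
   using False n by (simp add: act_SL2 adj2_rot ee_def uu_def z r power_int_mult_distrib cis_power_int mult_ac)
 qed
qed

section \<open>Identification of the Harish-Chandra module\<close>

text \<open>A class that contains every \<open>uu k s\<close> and is closed under directional
  derivatives, so smoothness of all orders follows by induction; two-parameter indices are required
  because a derivative lowers s by 1 and moves k by +1 or -1.\<close>

inductive UC :: "fn => bool" where
 UC_uu: "UC (uu k s)"
| UC_add: "UC f ==> UC g ==> UC (%x. f x + g x)"
| UC_mult: "UC f ==> UC (%x. c * f x)"

lemma uu_shift:
 assumes "x ~= 0"
 shows "uu (k + 1) (s - 1) x = uu k s x / cnj (zz x)" "uu (k - 1) (s - 1) x = uu k s x / zz x"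
proof -
 let ?L = "cor (ln (rsq x) / 2)"
 have R: "exp (2 * ?L) = zz x * cnj (zz x)"
  using rsq_pos[OF assms] unfolding zz_cnj by (simp add: exp_of_real)
 have z: "zz x ~= 0" "cnj (zz x) ~= 0" using zz_nonzero[OF assms] by auto
 have e1: "exp ((s - 1 - of_int (k + 1)) * ?L) = exp ((s - of_int k) * ?L) / (zz x * cnj (zz x))"
  unfolding R[symmetric] exp_diff[symmetric] by (rule arg_cong[where f=exp]) (simp add: field_simps)
 have e2: "(s - 1 - of_int (k - 1)) * ?L = (s - of_int k) * ?L" by simp
 show "uu (k + 1) (s - 1) x = uu k s x / cnj (zz x)"
  using assms z unfolding uu_def e1 by (simp add: power_int_add)
 show "uu (k - 1) (s - 1) x = uu k s x / zz x"
  using assms z unfolding uu_def e2 by (simp add: power_int_diff)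
qed

lemma UC_deriv:
 assumes "UC f"
 shows "(\<forall>x. x ~= 0 --> f differentiable (at x)) &
  (\<forall>v. \<exists>g. UC g & (\<forall>x. x ~= 0 --> frechet_derivative f (at x) v = g x))"
 using assms
proof (induction rule: UC.induct)
 case (UC_uu k s)
 show ?case
 proof (intro conjI allI impI)
  fix x :: "real^2" assume "x ~= 0"
  then show "uu k s differentiable at x" using has_derivative_uu differentiable_def by blast
 next
  fix v :: "real^2"
  let ?g = "%x. ((s - of_int k) / 2 * cnj (zz v)) * uu (k + 1) (s - 1) x + ((s + of_int k) / 2 * zz v) * uu (k - 1) (s - 1) x"
  have "UC ?g" by (intro UC.intros)
  moreover have "frechet_derivative (uu k s) (at x) v = ?g x" if "x ~= 0" for x
  proof -
   let ?z = "zz x" and ?h = "zz v"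
   have z: "?z ~= 0" "cnj ?z ~= 0" using zz_nonzero[OF that] by auto
   have dot: "cor ((x$1 * v$1 + x$2 * v$2) / rsq x) = ((?h * cnj ?z + cnj ?h * ?z) / 2) / (?z * cnj ?z)"
   proof -
    have "cor (x$1 * v$1 + x$2 * v$2) = (?h * cnj ?z + cnj ?h * ?z) / 2"
     by (simp add: zz_def complex_eq_iff field_simps)
    then show ?thesis unfolding zz_cnj by (simp only: of_real_divide)
   qed
   have "frechet_derivative (uu k s) (at x) v = uu k s x * (of_int k * (?h / ?z) + (s - of_int k) * cor ((x$1 * v$1 + x$2 * v$2) / rsq x))"
    using fun_cong[OF frechet_derivative_at[OF has_derivative_uu[OF that, of k s]], of v] by (rule sym)
   also have "\<dots> = ?g x"
    unfolding dot uu_shift[OF that] using z by (simp add: field_simps)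
   finally show ?thesis .
  qed
  ultimately show "\<exists>g. UC g & (\<forall>x. x ~= 0 --> frechet_derivative (uu k s) (at x) v = g x)" by blast
 qed
next
 case (UC_add f g)
 show ?case
 proof (intro conjI allI impI)
  fix x :: "real^2" assume "x ~= 0"
  then show "(%x. f x + g x) differentiable at x" using UC_add by (intro differentiable_add) auto
 next
  fix v
  obtain f' g' where *: "UC f'" "UC g'" "!!x. x ~= 0 ==> frechet_derivative f (at x) v = f' x"
   "!!x. x ~= 0 ==> frechet_derivative g (at x) v = g' x" using UC_add by metis
  have "frechet_derivative (%x. f x + g x) (at x) v = f' x + g' x" if "x ~= 0" for x
  proof -
   have "(f has_derivative frechet_derivative f (at x)) (at x)" "(g has_derivative frechet_derivative g (at x)) (at x)"
    using UC_add that frechet_derivative_works by blast+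
   from fun_cong[OF frechet_derivative_at[OF has_derivative_add[OF this]], of v] show ?thesis using *(3,4)[OF that] by simp
  qed
  then show "\<exists>h. UC h & (\<forall>x. x ~= 0 --> frechet_derivative (%x. f x + g x) (at x) v = h x)"
   using UC.UC_add[OF *(1,2)] by blast
 qed
next
 case (UC_mult f c)
 show ?case
 proof (intro conjI allI impI)
  fix x :: "real^2" assume "x ~= 0"
  then show "(%x. c * f x) differentiable at x" using UC_mult by (intro differentiable_mult) auto
 next
  fix v
  obtain f' where *: "UC f'" "!!x. x ~= 0 ==> frechet_derivative f (at x) v = f' x"
   using UC_mult by metis
  have "frechet_derivative (%x. c * f x) (at x) v = c * f' x" if "x ~= 0" for x
  proof -
   have "(f has_derivative frechet_derivative f (at x)) (at x)"
    using UC_mult that frechet_derivative_works by blast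
   from fun_cong[OF frechet_derivative_at[OF has_derivative_mult_right[OF this, of c]], of v] show ?thesis using *(2)[OF that] by simp
  qed
  then show "\<exists>h. UC h & (\<forall>x. x ~= 0 --> frechet_derivative (%x. c * f x) (at x) v = h x)"
   using UC.UC_mult[OF *(1)] by blast
 qed
qed

lemma Ck_on_cong:
 "(!!x. x ~= 0 ==> f x = g x) ==> Ck_on n (- {0}) g ==> Ck_on n (- {0}) f"
proof (induction n arbitrary: f g)
 case 0
 then show ?case unfolding Ck_on.simps using continuous_on_cong[of "- {0}" "- {0}" f g] by blast
next
 case (Suc n)
 have d: "(f has_derivative D) (at x) \<longleftrightarrow> (g has_derivative D) (at x)" if "x ~= 0" for x D
  using has_derivative_transform_within_open[of f D x UNIV "- {0}" g]
   has_derivative_transform_within_open[of g D x UNIV "- {0}" f] Suc(2) that by auto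
 then have "f differentiable (at x) \<longleftrightarrow> g differentiable (at x)" if "x ~= 0" for x
  using that unfolding differentiable_def by simp
 moreover have "frechet_derivative f (at x) = frechet_derivative g (at x)" if "x ~= 0" for x
  unfolding frechet_derivative_def using d[OF that] by simp
 ultimately show ?case using Suc(3) Suc(1)[of "%x. frechet_derivative f (at x) v" "%x. frechet_derivative g (at x) v" for v]
  by simp
qed

lemma UC_Ck: "UC f ==> Ck_on n (- {0}) f"
proof (induction n arbitrary: f)
 case 0
 then have "f differentiable_on (- {0})"
  using UC_deriv by (simp add: differentiable_on_def differentiable_at_withinI)
 then show ?case by (simp add: differentiable_imp_continuous_on)
next
 case (Suc n)
 have "Ck_on n (- {0}) (%x. frechet_derivative f (at x) v)" for v
 proof -
  obtain g where g: "UC g" "!!x. x ~= 0 ==> frechet_derivative f (at x) v = g x"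
   using UC_deriv[OF Suc(2)] by metis
  show ?thesis by (rule Ck_on_cong[OF g(2) Suc(1)[OF g(1)]])
 qed
 then show ?case using UC_deriv[OF Suc(2)] by simp
qed

lemma UC_0: "UC 0"
proof -
 have "UC (%x. 0 * uu 0 0 x)" by (intro UC.intros)
 moreover have "(%x. 0 * uu 0 0 x) = 0" by (simp add: fun_eq_iff)
 ultimately show ?thesis by (simp only:)
qed

lemma UC_sum: "UC (\<Sum>m\<in>F. scaleF (c m) (ee lam m))"
proof (induction F rule: infinite_finite_induct)
 case (insert m F)
 have "(\<Sum>m\<in>insert m F. scaleF (c m) (ee lam m)) = (%x. c m * ee lam m x + (\<Sum>m\<in>F. scaleF (c m) (ee lam m)) x)"
  using insert by (simp add: fun_eq_iff)
 then show ?case using insert UC.intros by (simp add: ee_def)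
qed (simp_all only: sum.empty sum.infinite UC_0 not_False_eq_True)

lemma act_sum: "act g (\<Sum>i\<in>F. scaleF (c i) (f i)) = (\<Sum>i\<in>F. scaleF (c i) (act g (f i)))"
 by (simp add: fun_eq_iff act_def fn_sum_apply)

lemma inj_ee: "inj (ee lam)"
 by (rule injI) (metis cf_ee zero_neq_one)

lemma Vs_subset_principal_series: "Vs lam \<subseteq> principal_series lam"
proof
 fix v assume "v : Vs lam"
 then obtain F c where F: "finite F" "v = (\<Sum>m\<in>F. scaleF (c m) (ee lam m))" unfolding Vs_def by auto
 have "v (t *\<^sub>R x) = cor \<bar>t\<bar> powr (- 1 - lam) * v x" if "t ~= 0" "x ~= 0" for t x
  unfolding F(2) fn_sum_apply scaleF_apply ee_scale[OF that] by (simp add: sum_distrib_left mult_ac)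
 moreover have "v 0 = 0" unfolding F(2) fn_sum_apply by simp
 moreover have "Ck_on k (- {0}) v" for k unfolding F(2) by (rule UC_Ck[OF UC_sum])
 ultimately have "v : principal_series_smooth lam" by (simp add: principal_series_smooth_def)
 moreover have "\<exists>B. finite B & (\<forall>k\<in>SO2. \<exists>c. act k v = (\<Sum>b\<in>B. scaleF (c b) b))"
 proof (rule exI[of _ "ee lam ` F"], intro conjI ballI)
  show "finite (ee lam ` F)" using F by simp
  fix k assume "k : SO2"
  then obtain phh where k: "k = rot phh" using SO2_eq_rot by blast
  have "act k v = (\<Sum>m\<in>F. scaleF (c m * cis (- 2 * of_int m * phh)) (ee lam m))"
   unfolding F(2) act_sum k act_rot_ee scaleF_simps ..
  also have "\<dots> = (\<Sum>b\<in>ee lam ` F. scaleF ((%m. c m * cis (- 2 * of_int m * phh)) (the_inv (ee lam) b)) b)"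
   by (subst sum.reindex) (use inj_ee[of lam] in \<open>auto simp: inj_on_def the_inv_f_f inj_def\<close>)
  finally show "\<exists>c. act k v = (\<Sum>b\<in>ee lam ` F. scaleF (c b) b)"
   by (rule exI[of _ "%b. (%m. c m * cis (- 2 * of_int m * phh)) (the_inv (ee lam) b)"])
 qed
 ultimately show "v : principal_series lam" by (simp add: principal_series_def)
qed

section \<open>K-finite vectors are finite sums of weight vectors\<close>

lemma integral_I0_shift:
 fixes f :: "real => complex"
 assumes f: "continuous_on UNIV f" and p: "!!tta. f (tta + pi) = f tta" and c: "0 <= c" "c <= pi"
 shows "integral I0 (%tta. f (tta + c)) = integral I0 f"
proof -
 have i: "f integrable_on {a..b}" for a b
  by (rule integrable_continuous_real) (rule continuous_on_subset[OF f], simp)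
 have "integral I0 (%tta. f (tta + c)) = integral {- (pi/2) + c..pi/2 + c} f"
  using integral_shift_real_ivl[of "- (pi/2) + c" c "pi/2 + c" f] by (simp add: I0_def)
 also have "\<dots> = integral {- (pi/2) + c..pi/2} f + integral {pi/2..pi/2 + c} f"
  using c by (intro Henstock_Kurzweil_Integration.integral_combine[symmetric] i) auto
 also have "integral {pi/2..pi/2 + c} f = integral {- (pi/2)..- (pi/2) + c} (%x. f (x + pi))"
  using integral_shift_real_ivl[of "pi/2" pi "pi/2 + c" f] by simp
 also have "(%x. f (x + pi)) = f" using p by blast
 also have "integral {- (pi/2) + c..pi/2} f + integral {- (pi/2)..- (pi/2) + c} f = integral I0 f"
  unfolding I0_def using c Henstock_Kurzweil_Integration.integral_combine[of "- (pi/2)" "- (pi/2) + c" "pi/2" f] i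
  by (simp add: add.commute)
 finally show ?thesis .
qed

lemma fhat_sum:
 assumes "finite F" "!!j. j : F ==> continuous_on I0 (h j)"
 shows "fhat m (%tta. \<Sum>j\<in>F. y j * h j tta) = (\<Sum>j\<in>F. y j * fhat m (h j))"
 using assms
proof (induction F)
 case empty
 show ?case by (simp add: fhat_def)
next
 case (insert j F)
 have "fhat m (%tta. y j * h j tta + (\<Sum>j\<in>F. y j * h j tta)) = fhat m (%tta. y j * h j tta) + fhat m (%tta. \<Sum>j\<in>F. y j * h j tta)"
  by (rule fhat_add) (use insert in \<open>auto intro!: continuous_on_sum continuous_on_mult continuous_on_const\<close>)
 then show ?case using insert by (simp add: fhat_cmult)
qed

lemma circ_cont: "continuous_on S circ"
proof -
 have "continuous_on S (%tta. cos tta *\<^sub>R axis 1 1 + sin tta *\<^sub>R (axis 2 1 :: real^2))"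
  by (intro continuous_intros)
 moreover have "circ = (%tta. cos tta *\<^sub>R axis 1 1 + sin tta *\<^sub>R (axis 2 1 :: real^2))"
  by (simp add: fun_eq_iff vec_eq_iff forall_2 axis_def)
 ultimately show ?thesis by (simp only:)
qed

lemma scaleF_vector_space: "vector_space scaleF"
 by standard (simp_all add: scaleF_simps)

text \<open>Stated for an indexed family, so a repetition T i = T j has to supply a relation of its
  own; otherwise the dimension bound applies to the image set.\<close>

lemma linear_dependence:
 fixes T :: "nat => fn"
 assumes B: "finite B" and T: "!!j. \<exists>c. T j = (\<Sum>b\<in>B. scaleF (c b) b)"
 shows "\<exists>y. (\<exists>j\<le>card B. y j ~= 0) & (\<Sum>j\<le>card B. scaleF (y j) (T j)) = 0"
proof (cases "inj_on T {..card B}")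
 case False
 then obtain i j where ij: "i <= card B" "j <= card B" "i ~= j" "T i = T j" by (auto simp: inj_on_def)
 let ?y = "%k. if k = i then 1 else if k = j then -1 else (0::complex)"
 have "(\<Sum>k\<le>card B. scaleF (?y k) (T k)) x = (\<Sum>k\<in>{i, j}. ?y k * T k x)" for x
  unfolding fn_sum_apply scaleF_apply by (rule sum.mono_neutral_right) (use ij in auto)
 then have "(\<Sum>k\<le>card B. scaleF (?y k) (T k)) = 0" using ij by (simp add: fun_eq_iff)
 then show ?thesis using ij(1) by (intro exI[of _ ?y]) auto
next
 case True
 interpret VS: vector_space scaleF by (rule scaleF_vector_space)
 have "T j : VS.span B" for j
 proof -
  obtain c where "T j = (\<Sum>b\<in>B. scaleF (c b) b)" using T by blast
  then show ?thesis by (simp add: VS.span_sum VS.span_scale VS.span_base)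
 qed
 then have "T ` {..card B} \<subseteq> VS.span B" by blast
 moreover have "card (T ` {..card B}) = Suc (card B)" using True by (simp add: card_image)
 ultimately have "VS.dependent (T ` {..card B})"
  using VS.independent_span_bound[OF B, of "T ` {..card B}"] by auto
 then obtain u where u: "\<exists>v\<in>T ` {..card B}. u v ~= 0" "(\<Sum>v\<in>T ` {..card B}. scaleF (u v) v) = 0"
  using VS.dependent_finite[of "T ` {..card B}"] by auto
 have "(\<Sum>j\<le>card B. scaleF (u (T j)) (T j)) = 0"
  using u(2) by (subst (asm) sum.reindex[OF True]) (simp add: o_def)
 then show ?thesis using u(1) by (intro exI[of _ "%j. u (T j)"]) auto
qed

text \<open>K-finiteness confines the rotates of f to a space spanned by \<open>B\<close>. The card
  B + 1 rotates by multiples of one angle a satisfy a linear relation y, and its Fourier coefficient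
  of index m says that the polynomial with coefficients y vanishes at cis(2 m a) whenever the
  coefficient of f is nonzero. Such a polynomial has at most card B roots, so f has finitely many
  frequencies; subtracting the corresponding sum leaves a function without Fourier coefficients,
  hence 0.\<close>

lemma principal_series_subset_Vs: "principal_series lam \<subseteq> Vs lam"
proof
 fix f assume f: "f : principal_series lam"
 then have f0: "f 0 = 0" and fc: "continuous_on (- {0}) f"
  and hom: "!!t x. t ~= 0 ==> x ~= 0 ==> f (t *\<^sub>R x) = cor \<bar>t\<bar> powr (- 1 - lam) * f x"
  unfolding principal_series_def principal_series_smooth_def
  by (auto dest: spec[where x=0])
 from f obtain B where B: "finite B" "!!k. k : SO2 ==> \<exists>c. act k f = (\<Sum>b\<in>B. scaleF (c b) b)"
  unfolding principal_series_def by auto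
 have ev: "f (- x) = f x" for x
  using hom[of "-1" x] f0 by (cases "x = 0") auto
 have cc: "continuous_on S (%tta. f (circ (tta + c)))" for S c
 proof -
  have "continuous_on S (%tta. circ (tta + c))"
   by (rule continuous_on_compose2[OF circ_cont[of UNIV]]) (auto intro: continuous_intros)
  then show ?thesis by (rule continuous_on_compose2[OF fc]) auto
 qed
 have cc0: "continuous_on S (%tta. f (circ tta))" for S using cc[of S 0] by simp
 have shift: "fhat (- m) (%tta. f (circ (tta + c))) = cis (2 * of_int m * c) * cf m f" if "0 <= c" "c <= pi" for m c
 proof -
  let ?g = "%tta. f (circ tta) * cis (2 * of_int (- m) * tta)"
  have gp: "?g (tta + pi) = ?g tta" for tta
  proof -
   have "cis (2 * of_int (- m) * (tta + pi)) = cis (2 * of_int (- m) * tta) * cis (2 * pi * of_int (- m))"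
    unfolding cis_mult by (simp add: algebra_simps)
   also have "cis (2 * pi * of_int (- m)) = 1" by (rule cis_multiple_2pi) simp
   finally show ?thesis by (simp add: circ_shift ev)
  qed
  have "integral I0 (%tta. f (circ (tta + c)) * cis (2 * of_int (- m) * tta))
   = integral I0 (%tta. cis (2 * of_int m * c) * ?g (tta + c))"
  proof (rule arg_cong[where f="integral I0"], rule ext)
   fix tta
   have "cis (2 * of_int (- m) * tta) = cis (2 * of_int m * c) * cis (2 * of_int (- m) * (tta + c))"
    unfolding cis_mult by (simp add: algebra_simps)
   then show "f (circ (tta + c)) * cis (2 * of_int (- m) * tta) = cis (2 * of_int m * c) * ?g (tta + c)"
    by (simp only: mult_ac)
  qed
  also have "\<dots> = cis (2 * of_int m * c) * integral I0 (%tta. ?g (tta + c))" by simp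
  also have "integral I0 (%tta. ?g (tta + c)) = integral I0 ?g"
   by (rule integral_I0_shift) (use gp that in \<open>auto intro!: continuous_on_mult cc0 cis_cont continuous_intros\<close>)
  finally show ?thesis by (simp add: cf_def fhat_def)
 qed
 have fin: "finite {m. cf m f ~= 0}"
 proof (rule ccontr)
  let ?d = "card B"
  assume "infinite {m. cf m f ~= 0}"
  then obtain M where M: "finite M" "card M = Suc ?d" "M \<subseteq> {m. cf m f ~= 0}"
   using infinite_arbitrarily_large by blast
  \<comment> \<open>With a = pi/P, P above all differences in M makes the numbers cis(2 m a)
    distinct, and P above card B keeps the angles j a within [0, pi], where \<open>shift\<close>
    applies.\<close>
  define P where "P = Suc (?d + nat (\<Sum>m\<in>M. 2 * \<bar>m\<bar>))"
  have PM: "\<bar>m - m'\<bar> < int P" if "m : M" "m' : M" for m m'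
  proof -
   have "2 * \<bar>k\<bar> <= (\<Sum>m\<in>M. 2 * \<bar>m\<bar>)" if "k : M" for k
    by (rule member_le_sum[of k M "%m. 2 * \<bar>m\<bar>"]) (use that M in auto)
   from this[OF \<open>m : M\<close>] this[OF \<open>m' : M\<close>] show ?thesis unfolding P_def by linarith
  qed
  define a where "a = pi / real P"
  have a: "0 <= real j * a" "real j * a <= pi" if "j <= ?d" for j
  proof -
   have j: "real j <= real P" using that by (simp add: P_def)
   have P: "real P > 0" by (simp add: P_def)
   show "0 <= real j * a" using P by (simp add: a_def)
   have "real j * a = real j * pi / real P" by (simp add: a_def)
   also have "\<dots> <= pi" using j P by (simp only: pos_divide_le_eq) (simp add: mult.commute mult_left_mono)
   finally show "real j * a <= pi" .
  qed
  define T where "T j = act (rot (- (real j * a))) f" for j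
  have Tc: "T j (circ tta) = f (circ (tta + real j * a))" for j tta
  proof -
   have "rot c *v circ tta = circ (tta + c)" for c
    by (simp add: vec_eq_iff forall_2 rot_def cos_add sin_add algebra_simps)
   then show ?thesis by (simp add: T_def act_SL2 adj2_rot)
  qed
  obtain y where y: "\<exists>j\<le>?d. y j ~= 0" "(\<Sum>j\<le>?d. scaleF (y j) (T j)) = 0"
   using linear_dependence[OF B(1), of T] B(2) unfolding T_def by blast
  have root: "(\<Sum>j\<le>?d. y j * cis (2 * of_int m * a) ^ j) = 0" if "m : M" for m
  proof -
   have "(\<Sum>j\<le>?d. y j * f (circ (tta + real j * a))) = 0" for tta
    using fun_cong[OF y(2), of "circ tta"] by (simp add: fn_sum_apply Tc)
   then have "0 = fhat (- m) (%tta. \<Sum>j\<le>?d. y j * f (circ (tta + real j * a)))" by (simp add: fhat_def)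
   also have "\<dots> = (\<Sum>j\<le>?d. y j * fhat (- m) (%tta. f (circ (tta + real j * a))))"
    by (rule fhat_sum) (auto intro: cc)
   also have "\<dots> = (\<Sum>j\<le>?d. y j * (cis (2 * of_int m * a) ^ j * cf m f))"
   proof (intro sum.cong refl arg_cong2[where f="(*)"])
    fix j assume "j : {..?d}"
    then have "fhat (- m) (%tta. f (circ (tta + real j * a))) = cis (2 * of_int m * (real j * a)) * cf m f"
     using a by (intro shift) auto
    also have "cis (2 * of_int m * (real j * a)) = cis (2 * of_int m * a) ^ j"
    proof -
     have "real j * (2 * of_int m * a) = 2 * of_int m * (real j * a)" by simp
     then show ?thesis by (simp only: Complex.DeMoivre)
    qed
    finally show "fhat (- m) (%tta. f (circ (tta + real j * a))) = cis (2 * of_int m * a) ^ j * cf m f" .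
   qed
   also have "\<dots> = (\<Sum>j\<le>?d. y j * cis (2 * of_int m * a) ^ j) * cf m f"
    by (simp add: sum_distrib_right mult.assoc)
   finally show ?thesis using M(3) that by auto
  qed
  have inj: "inj_on (%m. cis (2 * of_int m * a)) M"
  proof (rule inj_onI)
   fix m m' assume mm: "m : M" "m' : M" "cis (2 * of_int m * a) = cis (2 * of_int m' * a)"
   then obtain n :: int where "2 * of_int m * a = 2 * of_int m' * a + 2 * pi * of_int n"
    using sin_cos_eq_iff[of "2 * of_int m * a" "2 * of_int m' * a"] by (auto simp: complex_eq_iff)
   then have "pi * (real_of_int m) = pi * (real_of_int m' + real_of_int n * real P)"
    by (simp add: a_def P_def field_simps)
   then have "real_of_int m = real_of_int (m' + n * int P)" by simp
   then have e: "m - m' = n * int P" by linarith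
   then have "\<bar>n\<bar> * int P < 1 * int P" using PM[OF mm(1,2)] by (simp add: abs_mult)
   moreover have "1 * int P <= \<bar>n\<bar> * int P" if "n ~= 0"
    using that by (intro mult_right_mono) auto
   ultimately have "n = 0" by fastforce
   then show "m = m'" using e by simp
  qed
  have "finite {z. (\<Sum>j\<le>?d. y j * z ^ j) = 0} & card {z. (\<Sum>j\<le>?d. y j * z ^ j) = 0} <= ?d"
   using y(1) Transcendental.polyfun_rootbound[of y] by blast
  moreover have "(%m. cis (2 * of_int m * a)) ` M \<subseteq> {z. (\<Sum>j\<le>?d. y j * z ^ j) = 0}" using root by blast
  ultimately have "card ((%m. cis (2 * of_int m * a)) ` M) <= ?d"
   by (meson card_mono order_trans)
  then show False using M(2) card_image[OF inj] by simp
 qed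
 define v where "v = (\<Sum>m | cf m f ~= 0. scaleF (cf m f) (ee lam m))"
 have vV: "v : Vs lam" unfolding v_def by (intro Vs_sum Vs_scale ee_in_Vs)
 have cfv: "cf m v = cf m f" for m unfolding v_def cf_sum[OF fin] by simp
 have zero: "f (circ tta) - v (circ tta) = 0" if "tta : I0" for tta
 proof (rule fhat_zero_imp_zero[OF _ _ _ that])
  have ve: "v (- x) = v x" for x unfolding v_def fn_sum_apply by (simp add: ee_uminus)
  have sph: "continuous_on (sphere 0 1) (%x. f x - v x)"
  proof (intro continuous_on_diff)
   show "continuous_on (sphere 0 1) f" by (rule continuous_on_subset[OF fc]) auto
   have "continuous_on (- {0}) v" using UC_Ck[OF UC_sum, of 0] unfolding v_def by simp
   then show "continuous_on (sphere 0 1) v" by (rule continuous_on_subset) auto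
  qed
  show "trig_approx (%tta. f (circ tta) - v (circ tta))"
   by (rule even_function_trig_approx(1)[OF sph]) (simp add: ev ve)
  show "continuous_on I0 (%tta. f (circ tta) - v (circ tta))"
   by (intro continuous_on_diff cc0 Vs_circ_cont[OF vV])
  fix m
  have "fhat m (%tta. f (circ tta) + (- 1) * v (circ tta)) = fhat m (%tta. f (circ tta)) + fhat m (%tta. (- 1) * v (circ tta))"
   by (rule fhat_add) (intro continuous_on_mult continuous_on_const cc0 Vs_circ_cont[OF vV])+
  then show "fhat m (%tta. f (circ tta) - v (circ tta)) = 0"
   using cfv[of "- m"] unfolding fhat_cmult by (simp add: cf_def)
 qed
 have vhom: "v (t *\<^sub>R x) = cor \<bar>t\<bar> powr (- 1 - lam) * v x" if "t ~= 0" "x ~= 0" for t x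
  unfolding v_def fn_sum_apply scaleF_apply ee_scale[OF that] by (simp add: sum_distrib_left mult_ac)
 have "f = v"
 proof
  fix x :: "real^2"
  show "f x = v x"
  proof (cases "x = 0")
   case True
   then show ?thesis using f0 by (simp add: v_def fn_sum_apply)
  next
   case False
   have "\<exists>t tta. t ~= 0 & tta : I0 & x = t *\<^sub>R circ tta"
   proof -
    define r where "r = sqrt (rsq x)"
    have r: "r > 0" "r\<^sup>2 = (x$1)\<^sup>2 + (x$2)\<^sup>2" using rsq_pos[OF False] by (simp_all add: r_def) (simp add: rsq_def)
    \<comment> \<open>The sign moves the point into the closed right half plane, so that its angle
      lies in \<open>I0\<close>; negative multiples are harmless because homogeneity holds for every
      nonzero t.\<close>
    define ep where "ep = (if x$1 >= 0 then 1 else (-1::real))"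
    have e: "ep * ep = 1" "ep * x$1 = \<bar>x$1\<bar>" "ep ~= 0" by (auto simp: ep_def)
    define S where "S = ep * x$2 / r"
    have sq: "S\<^sup>2 + (\<bar>x$1\<bar> / r)\<^sup>2 = 1"
    proof -
     have "S\<^sup>2 = (x$2)\<^sup>2 / r\<^sup>2"
      unfolding S_def using e(1) by (simp add: power_divide power_mult_distrib power2_eq_square[of ep])
     moreover have "(\<bar>x$1\<bar> / r)\<^sup>2 = (x$1)\<^sup>2 / r\<^sup>2" by (simp add: power_divide)
     ultimately have "S\<^sup>2 + (\<bar>x$1\<bar> / r)\<^sup>2 = ((x$1)\<^sup>2 + (x$2)\<^sup>2) / r\<^sup>2"
      by (simp only: add_divide_distrib add.commute)
     also have "\<dots> = 1" unfolding r(2)[symmetric] using r(1) by simp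
     finally show ?thesis .
    qed
    have "S\<^sup>2 <= 1" using sq zero_le_power2[of "\<bar>x$1\<bar> / r"] by linarith
    then have s1: "\<bar>S\<bar> <= 1" by (simp only: abs_square_le_1)
    have "1 - S\<^sup>2 = (\<bar>x$1\<bar> / r)\<^sup>2" using sq by linarith
    then have "sqrt (1 - S\<^sup>2) = \<bar>\<bar>x$1\<bar> / r\<bar>" by (simp only: real_sqrt_abs)
    also have "\<dots> = \<bar>x$1\<bar> / r" using r(1) by simp
    finally have c: "cos (arcsin S) = \<bar>x$1\<bar> / r" using s1 cos_arcsin[of S] by (simp add: abs_le_iff)
    have s: "sin (arcsin S) = S" using s1 by (intro sin_arcsin) (auto simp: abs_le_iff)
    have "x$1 = ep * r * (\<bar>x$1\<bar> / r)" using r(1) by (simp add: ep_def)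
    moreover have "x$2 = ep * r * S" unfolding S_def using r(1) e(1) by (simp add: mult.assoc[symmetric])
    ultimately have "x = (ep * r) *\<^sub>R circ (arcsin S)"
     by (simp add: vec_eq_iff forall_2 c s del: arcsin_eq_iff)
    moreover have "arcsin S : I0" using arcsin_bounded[of S] s1 by (auto simp: I0_iff abs_le_iff)
    moreover have "ep * r ~= 0" using r(1) e(3) by simp
    ultimately show ?thesis by (intro exI conjI)
   qed
   then obtain t tta where t: "t ~= 0" "tta : I0" "x = t *\<^sub>R circ tta" by blast
   then show ?thesis using hom[OF t(1) circ_nonzero] vhom[OF t(1) circ_nonzero] zero[OF t(2)] by simp
  qed
 qed
 then show "f : Vs lam" using vV by simp
qed

theorem principal_series_eq_Vs: "principal_series lam = Vs lam"
 using principal_series_subset_Vs Vs_subset_principal_series by blast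

section \<open>Families of matrix coefficients\<close>

lemma vector_deriv_bound:
 fixes h :: "real => complex"
 assumes d: "!!s. s : closed_segment 0 t ==> (h has_vector_derivative h' s) (at s)"
  and b: "!!s. s : closed_segment 0 t ==> cmod (h' s) <= B"
 shows "cmod (h t - h 0) <= B * \<bar>t\<bar>"
proof -
 have "norm (h t - h 0) <= B * norm (t - 0)"
 proof (rule differentiable_bound[of "closed_segment 0 t" h "%s x. x *\<^sub>R h' s"])
  fix s assume s: "s : closed_segment 0 t"
  show "(h has_derivative (%x. x *\<^sub>R h' s)) (at s within closed_segment 0 t)"
   using d[OF s] unfolding has_vector_derivative_def by (rule has_derivative_at_withinI)
  show "onorm (%x. x *\<^sub>R h' s) <= B"
  proof (rule onorm_bound)
   show "0 <= B" using order_trans[OF norm_ge_zero b[OF s]] .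
   show "norm (x *\<^sub>R h' s) <= B * norm x" for x
    using mult_left_mono[OF b[OF s], of "\<bar>x\<bar>"] by (simp add: mult.commute)
  qed
 qed auto
 then show ?thesis by simp
qed

lemma quadratic_imp_deriv:
 fixes F :: "real => complex"
 assumes "!!t. \<bar>t\<bar> <= 1 ==> cmod (F t - F 0 - cor t * D) <= B * t\<^sup>2"
 shows "(F has_vector_derivative D) (at 0)"
proof -
 have B: "B >= 0" using order_trans[OF norm_ge_zero assms[of 1]] by simp
 have "((%t. (F t - F 0 - cor t * D) /\<^sub>R \<bar>t\<bar>) \<longlongrightarrow> 0) (at 0)"
 proof (rule Lim_null_comparison)
  have "norm ((F t - F 0 - cor t * D) /\<^sub>R \<bar>t\<bar>) <= B * \<bar>t\<bar>" if "\<bar>t\<bar> <= 1" "t ~= 0" for t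
   using assms[OF that(1)] that(2) by (simp add: divide_simps power2_eq_square mult_ac abs_mult_self_eq)
  then show "\<forall>\<^sub>F t in at 0. norm ((F t - F 0 - cor t * D) /\<^sub>R \<bar>t\<bar>) <= B * \<bar>t\<bar>"
   unfolding eventually_at by (intro exI[of _ 1]) (auto simp: dist_real_def)
  show "((%t. B * \<bar>t\<bar>) \<longlongrightarrow> 0) (at 0)"
   by (rule tendsto_eq_intros refl | simp)+
 qed
 then show ?thesis
  using bounded_linear_scaleR_left[of D]
  unfolding has_vector_derivative_def has_derivative_at_within
  by (simp add: scaleR_conv_of_real)
qed

text \<open>\<open>Ph g v\<close> models l(g v) for a functional l. The vector g v need not belong
  to the module, so it is replaced by its values, and the Lie algebra acts on the argument
  \<open>v\<close>, which stays in \<open>Vs lam\<close>.\<close>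

locale coeff_family =
 fixes lam :: complex and Ph :: "mat2 => fn => complex"
 assumes Ph_add: "g : SL2 ==> v : Vs lam ==> w : Vs lam ==> Ph g (v + w) = Ph g v + Ph g w"
  and Ph_scale: "g : SL2 ==> v : Vs lam ==> Ph g (scaleF c v) = c * Ph g v"
  and Ph_deriv: "g : SL2 ==> v : Vs lam ==> X : sl2 ==>
   ((%t. Ph (g ** mxp t X) v) has_vector_derivative Ph g (lie_act X v)) (at 0)"
begin

lemma Ph_deriv_at:
 assumes "g : SL2" "v : Vs lam" "X : sl2"
 shows "((%t. Ph (g ** mxp t X) v) has_vector_derivative Ph (g ** mxp t X) (lie_act X v)) (at t)"
proof -
 let ?g = "g ** mxp t X"
 have "?g ** mxp (s - t) X = g ** mxp s X" for s
  using mexp_add[OF assms(3), of t "s - t"] by (simp add: matrix_mul_assoc)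
 moreover have "((%s. Ph (?g ** mxp s X) v) \<circ> (%s. s - t) has_vector_derivative 1 *\<^sub>R Ph ?g (lie_act X v)) (at t)"
 proof (rule vector_diff_chain_at)
  show "((%s. s - t) has_vector_derivative 1) (at t)"
   by (auto intro!: derivative_eq_intros)
  show "((%s. Ph (?g ** mxp s X) v) has_vector_derivative Ph ?g (lie_act X v)) (at (t - t))"
   using Ph_deriv[of ?g v X] assms by (simp add: SL2_mult mexp_scale_SL2)
 qed
 ultimately show ?thesis by (simp add: o_def)
qed

lemma Ph_cont:
 assumes "g : SL2" "v : Vs lam" "X : sl2"
 shows "continuous_on S (%t. Ph (g ** mxp t X) v)"
 by (intro continuous_at_imp_continuous_on ballI has_vector_derivative_continuous[OF Ph_deriv_at[OF assms]])

lemma Ph_bound1: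
 assumes "g : SL2" "v : Vs lam" "X : sl2"
  "!!s. s : closed_segment 0 t ==> cmod (Ph (g ** mxp s X) (lie_act X v)) <= B"
 shows "cmod (Ph (g ** mxp t X) v - Ph g v) <= B * \<bar>t\<bar>"
 using vector_deriv_bound[OF Ph_deriv_at[OF assms(1-3)] assms(4), of t] by simp

lemma Ph_bound2:
 assumes "g : SL2" "v : Vs lam" "X : sl2"
  "!!s. s : closed_segment 0 t ==> cmod (Ph (g ** mxp s X) (lie_act X (lie_act X v))) <= B"
 shows "cmod (Ph (g ** mxp t X) v - Ph g v - cor t * Ph g (lie_act X v)) <= B * t\<^sup>2"
proof -
 have B: "B >= 0" using assms(4)[of 0] norm_ge_zero order_trans by blast
 let ?h = "%s. Ph (g ** mxp s X) v - cor s * Ph g (lie_act X v)"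
 have "cmod (?h t - ?h 0) <= (B * \<bar>t\<bar>) * \<bar>t\<bar>"
 proof (rule vector_deriv_bound)
  fix s assume s: "s : closed_segment 0 t"
  have "((%s. cor s * Ph g (lie_act X v)) has_vector_derivative 1 * Ph g (lie_act X v)) (at s)"
   unfolding has_vector_derivative_def
   by (auto intro!: derivative_eq_intros simp: scaleR_conv_of_real)
  then show "(?h has_vector_derivative (Ph (g ** mxp s X) (lie_act X v) - Ph g (lie_act X v))) (at s)"
   using has_vector_derivative_diff[OF Ph_deriv_at[OF assms(1-3)]] by simp
  have "cmod (Ph (g ** mxp s X) (lie_act X v) - Ph g (lie_act X v)) <= B * \<bar>s\<bar>"
  proof (rule Ph_bound1)
   fix r assume "r : closed_segment 0 s"
   then have "r : closed_segment 0 t" using s by (auto simp: closed_segment_eq_real_ivl split: if_splits)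
   then show "cmod (Ph (g ** mxp r X) (lie_act X (lie_act X v))) <= B" by (rule assms(4))
  qed (use assms in \<open>auto intro: lie_act_Vs\<close>)
  also have "\<dots> <= B * \<bar>t\<bar>"
   using s B by (intro mult_left_mono) (auto simp: closed_segment_eq_real_ivl split: if_splits)
  finally show "cmod (Ph (g ** mxp s X) (lie_act X v) - Ph g (lie_act X v)) <= B * \<bar>t\<bar>" .
 qed
 then show ?thesis by (simp add: power2_eq_square algebra_simps)
qed

lemma Ph_zero: "g : SL2 ==> Ph g 0 = 0"
 using Ph_scale[of g 0 0] by (simp add: scaleF_simps)

lemma Ph_sum:
 assumes "g : SL2" "finite F" "!!i. i : F ==> f i : Vs lam"
 shows "Ph g (\<Sum>i\<in>F. f i) = (\<Sum>i\<in>F. Ph g (f i))"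
 using assms(2,3)
proof (induction F)
 case (insert i F)
 then have "Ph g (f i + (\<Sum>i\<in>F. f i)) = Ph g (f i) + Ph g (\<Sum>i\<in>F. f i)"
  by (intro Ph_add assms(1) Vs_sum) auto
 moreover have "(\<Sum>i\<in>insert i F. f i) = f i + (\<Sum>i\<in>F. f i)" using insert by (intro sum.insert)
 ultimately show ?case using insert by (simp only: sum.insert) simp
qed (simp only: sum.empty Ph_zero[OF assms(1)])

lemma lie_J_ee: "lie_act Jm (ee lam k) = scaleF (- 2 * \<i> * of_int k) (ee lam k)"
proof -
 have "alX Jm = 0" "beX Jm = 1" by (simp_all add: alX_def beX_def Jm_def complex_eq_iff)
 then show ?thesis by (simp add: lie_act_ee lie_ee_def fun_eq_iff)
qed

text \<open>Multiplied by cis(2 k tta), the left side has derivative 0 in tta, because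
  \<open>Jm\<close> acts on the weight vector by -2 i k.\<close>

lemma Ph_rot:
 assumes "g : SL2"
 shows "Ph (g ** rot tta) (ee lam k) = cis (- 2 * of_int k * tta) * Ph g (ee lam k)"
proof -
 let ?h = "%tta. cis (2 * of_int k * tta) * Ph (g ** mexp (tta *\<^sub>R Jm)) (ee lam k)"
 have "(?h has_vector_derivative 0) (at tta)" for tta
 proof -
  have c: "((%tta. cis (2 * of_int k * tta)) has_vector_derivative (2 * \<i> * of_int k * cis (2 * of_int k * tta))) (at tta)"
   unfolding has_vector_derivative_def
   by (auto intro!: derivative_eq_intros simp: scaleR_conv_of_real mult_ac)
  have "g ** mexp (tta *\<^sub>R Jm) : SL2" using assms by (intro SL2_mult mexp_scale_SL2) auto
  then show ?thesis
   using has_vector_derivative_mult[OF c Ph_deriv_at[OF assms ee_in_Vs[of lam k] basis_sl2(4)]]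
   by (simp add: lie_J_ee Ph_scale)
 qed
 then have "?h tta = ?h 0"
  using vector_deriv_bound[of tta ?h "%_. 0" 0] by simp
 then have e: "cis (2 * of_int k * tta) * Ph (g ** rot tta) (ee lam k) = Ph g (ee lam k)"
  by (simp add: mexp_Jm)
 show ?thesis unfolding e[symmetric] mult.assoc[symmetric] cis_mult by simp
qed

lemma Ph_even:
 assumes "g : SL2" "v : Vs lam" shows "Ph (- g) v = Ph g v"
proof -
 have S: "- g : SL2" using assms(1) by (simp add: SL2_iff)
 show ?thesis
  using assms(2)
 proof (induction rule: Vs_induct)
  case zero
  show ?case unfolding Ph_zero[OF S] Ph_zero[OF assms(1)] ..
 next
  case (ee m)
  have "g ** rot pi = - g" by (simp add: mat2_eq_iff)
  moreover have "cis (- 2 * of_int m * pi) = 1"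
   using cis_multiple_2pi[of "- of_int m"] by (simp add: mult_ac)
  ultimately show ?case using Ph_rot[OF assms(1), of pi m] by simp
 next
  case (add v w)
  show ?case unfolding Ph_add[OF S add(1,2)] Ph_add[OF assms(1) add(1,2)] add(3,4) ..
 next
  case (scale v c)
  show ?case unfolding Ph_scale[OF S scale(1)] Ph_scale[OF assms(1) scale(1)] scale(2) ..
 qed
qed

lemma Vs_bound:
 assumes "v : Vs lam" "A \<subseteq> SL2" "!!m. \<exists>B. \<forall>g\<in>A. cmod (Ph g (ee lam m)) <= B"
 shows "\<exists>B. \<forall>g\<in>A. cmod (Ph g v) <= B"
 using assms(1)
proof (induction rule: Vs_induct)
 case zero
 show ?case
 proof (intro exI[of _ 0] ballI)
  fix g assume "g : A"
  then have "g : SL2" using assms(2) by blast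
  then show "cmod (Ph g 0) <= 0" by (simp only: Ph_zero norm_zero order_refl)
 qed
next
 case (ee m)
 then show ?case using assms(3) by blast
next
 case (add v w)
 then obtain B C where B: "!!g. g : A ==> cmod (Ph g v) <= B" "!!g. g : A ==> cmod (Ph g w) <= C" by blast
 have "cmod (Ph g (v + w)) <= B + C" if "g : A" for g
 proof -
  have "Ph g (v + w) = Ph g v + Ph g w" using Ph_add add that assms(2) by blast
  then show ?thesis using B[OF that] norm_triangle_ineq[of "Ph g v" "Ph g w"] by simp
 qed
 then show ?case by blast
next
 case (scale v c)
 then obtain B where B: "!!g. g : A ==> cmod (Ph g v) <= B" by blast
 have "cmod (Ph g (scaleF c v)) <= cmod c * B" if "g : A" for g
 proof -
  have "Ph g (scaleF c v) = c * Ph g v" using Ph_scale scale that assms(2) by blast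
  then show ?thesis using B[OF that] by (simp add: norm_mult mult_left_mono)
 qed
 then show ?case by blast
qed

end

text \<open>Local boundedness, applied to second derivatives, gives Taylor remainders uniform on
  compact sets and thus permits differentiation under the average over K.\<close>

locale lb_family = coeff_family +
 assumes loc_bdd: "v : Vs lam ==> \<exists>B. \<forall>g\<in>SL2. norm g <= R --> cmod (Ph g v) <= B"

text \<open>Projection of g |-> Ph (x g) to left K-type m: the average over rotations inserted
  between x and g.\<close>

definition avg :: "(mat2 => fn => complex) => mat2 => int => mat2 => fn => complex" where
 "avg Ph x m g v = fhat m (%tta. Ph (x ** rot tta ** g) v)"

lemma fhat_diff:
 assumes "continuous_on I0 h" "continuous_on I0 h'"
 shows "fhat m (%tta. h tta - h' tta) = fhat m h - fhat m h'"
proof -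
 have "fhat m (%tta. h tta + (- 1) * h' tta) = fhat m h + fhat m (%tta. (- 1) * h' tta)"
  by (rule fhat_add) (intro continuous_on_mult continuous_on_const assms)+
 then show ?thesis unfolding fhat_cmult by simp
qed

text \<open>The generator of left rotations, transported to the right of g: rot tta g = g exp(tta Z)
  with Z = \<open>Ztwist g\<close>.\<close>

definition Ztwist :: "mat2 => mat2" where "Ztwist g = Ad (adj2 g) Jm"

lemma Ztwist_sl2 [intro]: "g : SL2 ==> Ztwist g : sl2"
 unfolding Ztwist_def by (intro Ad_sl2 adj2_SL2) auto

lemma rot_twist: "g : SL2 ==> rot tta ** g = g ** mexp (tta *\<^sub>R Ztwist g)"
 using mexp_right_Ad[of g Jm tta] by (simp add: mexp_Jm Ztwist_def)

context lb_family
begin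

lemma rot_conv: "g : SL2 ==> x ** rot tta ** g = (x ** g) ** mexp (tta *\<^sub>R Ztwist g)"
 using rot_twist[of g tta] by (simp flip: matrix_mul_assoc)

lemma avg_integrand_cont:
 assumes "x : SL2" "g : SL2" "v : Vs lam"
 shows "continuous_on S (%tta. Ph (x ** rot tta ** g) v)"
 unfolding rot_conv[OF assms(2)] using assms by (intro Ph_cont) auto

text \<open>For angles in \<open>I0\<close> and |s| <= 1 the arguments x rot tta g exp(sX) stay in a
  compact set. The second derivative is bounded there, so the first-order remainder is at most B t^2
  for all angles at once and survives averaging.\<close>

lemma avg_family:
 assumes x: "x : SL2"
 shows "coeff_family lam (avg Ph x m)"
proof
 fix g v w assume *: "g : SL2" "v : Vs lam" "w : Vs lam"
 have e: "Ph (x ** rot tta ** g) (v + w) = Ph (x ** rot tta ** g) v + Ph (x ** rot tta ** g) w" for tta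
  using * x by (intro Ph_add) auto
 show "avg Ph x m g (v + w) = avg Ph x m g v + avg Ph x m g w"
  unfolding avg_def e by (intro fhat_add avg_integrand_cont x *)
next
 fix g v c assume *: "g : SL2" "v : Vs lam"
 have e: "Ph (x ** rot tta ** g) (scaleF c v) = c * Ph (x ** rot tta ** g) v" for tta
  using * x by (intro Ph_scale) auto
 show "avg Ph x m g (scaleF c v) = c * avg Ph x m g v"
  unfolding avg_def e by (rule fhat_cmult)
next
 fix g v X assume *: "g : SL2" "v : Vs lam" "X : sl2"
 note Xv = lie_act_Vs[OF *(2,3)]
 note XXv = lie_act_Vs[OF Xv *(3)]
 have "compact ((%(tta, s). x ** rot tta ** g ** mxp s X) ` (I0 \<times> {-1..1}))"
 proof (rule compact_continuous_image)
  show "continuous_on (I0 \<times> {- 1..1}) (%(tta, s). x ** rot tta ** g ** mxp s X)"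
   unfolding split_beta
   by (intro mat2_mult_cont continuous_on_const rot_cont continuous_on_fst continuous_on_snd continuous_on_id
    continuous_on_compose2[OF mexp_cont[OF *(3), of UNIV]]) auto
 qed (intro compact_Times compact_I0 compact_Icc)
 then obtain R where R: "!!A. A : (%(tta, s). x ** rot tta ** g ** mxp s X) ` (I0 \<times> {-1..1}) ==> norm A <= R"
  using compact_imp_bounded bounded_iff by metis
 obtain B where B: "!!h. h : SL2 ==> norm h <= R ==> cmod (Ph h (lie_act X (lie_act X v))) <= B"
  using loc_bdd[OF XXv] by blast
 show "((%t. avg Ph x m (g ** mxp t X) v) has_vector_derivative avg Ph x m g (lie_act X v)) (at 0)"
 proof (rule quadratic_imp_deriv)
  fix t :: real assume t: "\<bar>t\<bar> <= 1"
  have gt: "g ** mxp t X : SL2" using * by blast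
  have b: "cmod (Ph (x ** rot tta ** (g ** mxp t X)) v - Ph (x ** rot tta ** g) v
    - cor t * Ph (x ** rot tta ** g) (lie_act X v)) <= B * t\<^sup>2" if th: "tta : I0" for tta
   unfolding matrix_mul_assoc
  proof (rule Ph_bound2)
   show xg: "x ** rot tta ** g : SL2" using x * by blast
   fix s assume s: "s : closed_segment 0 t"
   then have "s : {-1..1}" using t by (auto simp: closed_segment_eq_real_ivl split: if_splits)
   then have "norm (x ** rot tta ** g ** mxp s X) <= R" using th by (intro R image_eqI[of _ _ "(tta, s)"]) auto
   then show "cmod (Ph (x ** rot tta ** g ** mxp s X) (lie_act X (lie_act X v))) <= B"
    using xg *(3) by (intro B) auto
  qed (use * in auto)
  have "avg Ph x m (g ** mxp t X) v - avg Ph x m g v - cor t * avg Ph x m g (lie_act X v)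
   = fhat m (%tta. Ph (x ** rot tta ** (g ** mxp t X)) v - Ph (x ** rot tta ** g) v
    - cor t * Ph (x ** rot tta ** g) (lie_act X v))"
   unfolding avg_def fhat_cmult[symmetric]
   by (subst fhat_diff[symmetric] | intro avg_integrand_cont x gt * Xv continuous_on_diff continuous_on_mult continuous_on_const refl)+
  also have "cmod \<dots> <= B * t\<^sup>2"
   by (rule fhat_bound[OF _ b]) (intro avg_integrand_cont x gt * Xv continuous_on_diff continuous_on_mult continuous_on_const)
  finally show "cmod (avg Ph x m (g ** mxp t X) v - avg Ph x m (g ** mexp (0 *\<^sub>R X)) v
   - cor t * avg Ph x m g (lie_act X v)) <= B * t\<^sup>2" by simp
 qed
qed

text \<open>Integration by parts in the angle. The boundary terms cancel because the two endpoints
  differ by the central element -1, under which families of this kind are invariant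
  (\<open>Ph_even\<close>).\<close>

lemma avg_type:
 assumes x: "x : SL2" and g: "g : SL2" and v: "v : Vs lam"
 shows "avg Ph x m g (lie_act (Ztwist g) v) = - 2 * \<i> * of_int m * avg Ph x m g v"
proof -
 note Z = Ztwist_sl2[OF g]
 note Zv = lie_act_Vs[OF v Z]
 have xg: "x ** g : SL2" using x g by blast
 let ?h = "%tta. Ph (x ** rot tta ** g) v * cis (2 * of_int m * tta)"
 let ?h' = "%tta. Ph (x ** rot tta ** g) (lie_act (Ztwist g) v) * cis (2 * of_int m * tta)
   + 2 * \<i> * of_int m * (Ph (x ** rot tta ** g) v * cis (2 * of_int m * tta))"
 have "(?h' has_integral (?h (pi/2) - ?h (- (pi/2)))) I0"
  unfolding I0_def
 proof (rule fundamental_theorem_of_calculus)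
  fix tta :: real
  have c: "((%tta. cis (2 * of_int m * tta)) has_vector_derivative (2 * \<i> * of_int m * cis (2 * of_int m * tta))) (at tta)"
   unfolding has_vector_derivative_def
   by (auto intro!: derivative_eq_intros simp: scaleR_conv_of_real mult_ac)
  have "(?h has_vector_derivative ?h' tta) (at tta)"
   using has_vector_derivative_mult[OF Ph_deriv_at[OF xg v Z] c]
   unfolding rot_conv[OF g] by (simp add: algebra_simps)
  then show "(?h has_vector_derivative ?h' tta) (at tta within {- (pi / 2)..pi / 2})"
   by (rule has_vector_derivative_at_within)
 qed simp
 moreover have "?h (pi/2) = ?h (- (pi/2))"
 proof -
  have "x ** rot (pi/2) ** g = - (x ** rot (- (pi/2)) ** g)" by (simp add: mat2_eq_iff rot_def)
  moreover have "x ** rot (- (pi/2)) ** g : SL2" using x g by blast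
  ultimately have "Ph (x ** rot (pi/2) ** g) v = Ph (x ** rot (- (pi/2)) ** g) v"
   using Ph_even v by simp
  moreover have "cis (2 * of_int m * (pi/2)) = cis (2 * of_int m * (- (pi/2)))"
   using sin_npi_int[of m] by (simp add: complex_eq_iff mult.commute)
  ultimately show ?thesis by simp
 qed
 ultimately have z: "integral I0 ?h' = 0" by (simp add: integral_unique)
 have "integral I0 ?h' = integral I0 (%tta. Ph (x ** rot tta ** g) (lie_act (Ztwist g) v) * cis (2 * of_int m * tta))
  + integral I0 (%tta. 2 * \<i> * of_int m * (Ph (x ** rot tta ** g) v * cis (2 * of_int m * tta)))"
  by (intro integral_add integrable_I0 continuous_on_mult continuous_on_const avg_integrand_cont x g v Zv cis_cont continuous_on_id)
 then have "0 = avg Ph x m g (lie_act (Ztwist g) v) + 2 * \<i> * of_int m * avg Ph x m g v"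
  using z by (simp add: avg_def fhat_def field_simps)
 then show ?thesis by (simp add: eq_neg_iff_add_eq_0 add.commute)
qed

lemma avg_one:
 assumes x: "x : SL2"
 shows "avg Ph x m (mat 1) (ee lam k) = (if k = m then Ph x (ee lam m) else 0)"
proof -
 have "(%tta. Ph (x ** rot tta ** mat 1) (ee lam k)) = tpoly {k} (%_. Ph x (ee lam k))"
  by (simp add: fun_eq_iff Ph_rot[OF x] tpoly_def)
 then show ?thesis unfolding avg_def by (simp add: fhat_tpoly)
qed

end

section \<open>Uniqueness of families of a given \<open>K\<close>-type\<close>

lemma sinh_ge_self: "x >= 0 ==> sinh x >= (x::real)"
proof -
 assume x: "x >= 0"
 have "sinh 0 - 0 <= sinh x - x"
 proof (rule DERIV_nonneg_imp_nondecreasing[OF x])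
  fix u :: real assume "0 <= u" "u <= x"
  have "((%x. sinh x - x) has_real_derivative (cosh u - 1)) (at u)"
   by (auto intro!: derivative_eq_intros)
  then show "\<exists>y. ((%x. sinh x - x) has_real_derivative y) (at u) & 0 <= y"
   using cosh_real_ge_1[of u] by (intro exI[of _ "cosh u - 1"]) auto
 qed
 then show ?thesis by simp
qed

lemma lie_H_ee: "lie_act Hm (ee lam k) = scaleF (- (of_int k - (1 + lam) / 2)) (ee lam (k - 1))
  + scaleF (of_int k + (1 + lam) / 2) (ee lam (k + 1))"
proof -
 have "alX Hm = 1" "beX Hm = 0" by (simp_all add: alX_def beX_def Hm_def complex_eq_iff)
 then show ?thesis by (simp add: lie_act_ee lie_ee_def fun_eq_iff)
qed

lemma lie_Z_ee: "lie_act (Ztwist (diagm t)) (ee lam k) = scaleF (- 2 * \<i> * of_int k * of_real (cosh (2 * t))) (ee lam k)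
  + scaleF (- (of_int k - (1 + lam) / 2) * (\<i> * of_real (sinh (2 * t)))) (ee lam (k - 1))
  + scaleF (- (of_int k + (1 + lam) / 2) * (\<i> * of_real (sinh (2 * t)))) (ee lam (k + 1))"
proof -
 have Z: "Ztwist (diagm t) = mk 0 (- exp (- (2 * t))) (exp (2 * t)) 0"
  by (simp add: Ztwist_def Ad_def Jm_def adj2_def diagm_def mat2_eq_iff flip: exp_add)
 have a: "alX (Ztwist (diagm t)) = \<i> * of_real (sinh (2 * t))" "beX (Ztwist (diagm t)) = of_real (cosh (2 * t))"
  by (simp_all add: Z alX_def beX_def complex_eq_iff sinh_field_def cosh_field_def)
 have c: "cnj (\<i> * of_real (sinh (2 * t))) = - (\<i> * of_real (sinh (2 * t)))" by simp
 show ?thesis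
  unfolding lie_act_ee[OF Ztwist_sl2[OF diagm_SL2]] lie_ee_def a c
  by (simp only: mult_minus_left mult_minus_right)
qed

text \<open>Left K-type m in infinitesimal form: differentiation along left rotations, expressed on
  the right through \<open>Ztwist\<close>, is multiplication by -2 i m.\<close>

locale typed_family = coeff_family +
 fixes m :: int
 assumes Ph_type: "g : SL2 ==> v : Vs lam ==> Ph g (lie_act (Ztwist g) v) = - 2 * \<i> * of_int m * Ph g v"
begin

abbreviation "yy k t \<equiv> Ph (diagm t) (ee lam k)"
abbreviation "muu \<equiv> (1 + lam) / 2"
text \<open>The coefficient that appears when the type relation at a_t is solved for the two
  neighbours of index k (\<open>Z_rel\<close>). It has a simple pole at t = 0.\<close>

definition "Rk k t = 2 * (of_int m - of_int k * cosh (2 * t)) / sinh (2 * t)" for k :: int and t :: real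

lemma diagm_deriv:
 assumes "v : Vs lam"
 shows "((%t. Ph (diagm t) v) has_vector_derivative Ph (diagm t) (lie_act Hm v)) (at t)"
 using Ph_deriv_at[OF SL2_one assms basis_sl2(1), of t] by (simp add: mexp_Hm)

lemma H_rel: "Ph (diagm t) (lie_act Hm (ee lam k)) = - (of_int k - muu) * yy (k - 1) t + (of_int k + muu) * yy (k + 1) t"
 unfolding lie_H_ee by (simp add: Ph_add Ph_scale Vs_scale)

lemma Z_rel:
 assumes "t > 0"
 shows "(of_int k - muu) * yy (k - 1) t + (of_int k + muu) * yy (k + 1) t = of_real (Rk k t) * yy k t"
proof -
 let ?s = "cor (sinh (2 * t))" and ?c = "cor (cosh (2 * t))"
 have "(- 2 * \<i> * of_int k * ?c) * yy k t + (- (of_int k - muu) * (\<i> * ?s)) * yy (k - 1) t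
   + (- (of_int k + muu) * (\<i> * ?s)) * yy (k + 1) t = - 2 * \<i> * of_int m * yy k t"
  using Ph_type[OF diagm_SL2 ee_in_Vs[of lam k]] unfolding lie_Z_ee
  by (simp only: Ph_add Ph_scale Vs_scale Vs_add ee_in_Vs diagm_SL2)
 then have "\<i> * (?s * ((of_int k - muu) * yy (k - 1) t + (of_int k + muu) * yy (k + 1) t))
   = \<i> * (2 * (of_int m - of_int k * ?c) * yy k t)"
  by (simp add: algebra_simps)
 then have A: "?s * ((of_int k - muu) * yy (k - 1) t + (of_int k + muu) * yy (k + 1) t)
   = 2 * (of_int m - of_int k * ?c) * yy k t" by (simp only: mult_cancel_left) auto
 have s0: "?s ~= 0" using assms by simp
 have r: "of_real (Rk k t) = 2 * (of_int m - of_int k * ?c) / ?s" by (simp add: Rk_def)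
 have B: "2 * (of_int m - of_int k * ?c) = ?s * of_real (Rk k t)" unfolding r using s0 by simp
 have "?s * ((of_int k - muu) * yy (k - 1) t + (of_int k + muu) * yy (k + 1) t) = ?s * of_real (Rk k t) * yy k t"
  using A unfolding B .
 also have "\<dots> = ?s * (of_real (Rk k t) * yy k t)" by (rule mult.assoc)
 finally show ?thesis using s0 by (rule mult_left_cancel[THEN iffD1, rotated])
qed

text \<open>The derivative along \<open>Hm\<close> and the type relation both involve the neighbours
  k - 1 and k + 1. Adding or subtracting the relation eliminates one of them, which yields
  first-order equations going upwards or downwards in k.\<close>

lemma yy_deriv:
 assumes "t > 0"
 shows "(yy k has_vector_derivative (2 * (of_int k + muu) * yy (k + 1) t - of_real (Rk k t) * yy k t)) (at t)"
  "(yy k has_vector_derivative (of_real (Rk k t) * yy k t - 2 * (of_int k - muu) * yy (k - 1) t)) (at t)"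
proof -
 have "2 * (of_int k + muu) * yy (k + 1) t - of_real (Rk k t) * yy k t = Ph (diagm t) (lie_act Hm (ee lam k))"
  "of_real (Rk k t) * yy k t - 2 * (of_int k - muu) * yy (k - 1) t = Ph (diagm t) (lie_act Hm (ee lam k))"
  unfolding Z_rel[OF assms, of k, symmetric] H_rel by (simp_all add: algebra_simps)
 then show "(yy k has_vector_derivative (2 * (of_int k + muu) * yy (k + 1) t - of_real (Rk k t) * yy k t)) (at t)"
  "(yy k has_vector_derivative (of_real (Rk k t) * yy k t - 2 * (of_int k - muu) * yy (k - 1) t)) (at t)"
  using diagm_deriv[OF ee_in_Vs] by simp_all
qed

text \<open>The hypothesis covers all of \<open>Vs lam\<close>, so it also applies to the iterated
  derivatives along \<open>Hm\<close>; each integration from 0 gains one power of t.\<close>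

lemma flat:
 assumes one: "!!v. v : Vs lam ==> Ph (mat 1) v = 0" and v: "v : Vs lam"
 shows "\<exists>C\<ge>0. \<forall>t\<in>{0..T}. cmod (Ph (diagm t) v) <= C * t ^ M"
 using v
proof (induction M arbitrary: v)
 case 0
 have "continuous_on {0..T} (%t. Ph (diagm t) v)"
  by (intro continuous_at_imp_continuous_on ballI has_vector_derivative_continuous[OF diagm_deriv[OF 0]])
 then have "bounded ((%t. Ph (diagm t) v) ` {0..T})"
  by (intro compact_imp_bounded compact_continuous_image) auto
 then obtain C where C: "C > 0" "!!t. t : {0..T} ==> cmod (Ph (diagm t) v) <= C"
  unfolding bounded_pos by auto
 then show ?case by (intro exI[of _ C]) auto
next
 case (Suc M)
 obtain C where C: "C >= 0" "!!t. t : {0..T} ==> cmod (Ph (diagm t) (lie_act Hm v)) <= C * t ^ M"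
  using Suc.IH[OF lie_act_Vs[OF Suc.prems basis_sl2(1)]] by blast
 have "cmod (Ph (diagm t) v) <= C * t ^ Suc M" if t: "t : {0..T}" for t
 proof -
  have "cmod (Ph (diagm t) v - Ph (diagm 0) v) <= (C * t ^ M) * \<bar>t\<bar>"
  proof (rule vector_deriv_bound[OF diagm_deriv[OF Suc.prems]])
   fix s assume "s : closed_segment 0 t"
   then have s: "0 <= s" "s <= t" using t by (auto simp: closed_segment_eq_real_ivl)
   have "cmod (Ph (diagm s) (lie_act Hm v)) <= C * s ^ M" using s t by (intro C) auto
   also have "\<dots> <= C * t ^ M" using s C(1) by (intro mult_left_mono power_mono)
   finally show "cmod (Ph (diagm s) (lie_act Hm v)) <= C * t ^ M" .
  qed
  then show ?thesis using one[OF Suc.prems] t by (simp add: mult_ac)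
 qed
 then show ?case using C(1) by blast
qed

lemma Rk_bound:
 assumes "0 < t" "t <= T"
 shows "\<bar>Rk k t\<bar> <= (\<bar>of_int m\<bar> + \<bar>of_int k\<bar> * cosh (2 * T)) / t"
proof -
 have s: "sinh (2 * t) >= 2 * t" using sinh_ge_self[of "2 * t"] assms by simp
 have c: "cosh (2 * t) <= cosh (2 * T)" using assms by (intro cosh_real_nonneg_le_iff[THEN iffD2]) auto
 have "\<bar>of_int m - of_int k * cosh (2 * t)\<bar> <= \<bar>of_int m\<bar> + \<bar>of_int k\<bar> * cosh (2 * T)"
  using abs_triangle_ineq4[of "of_int m" "of_int k * cosh (2 * t)"] mult_left_mono[OF c, of "\<bar>of_int k\<bar>"]
  by (simp add: abs_mult)
 moreover have "\<bar>Rk k t\<bar> = \<bar>of_int m - of_int k * cosh (2 * t)\<bar> / (sinh (2 * t) / 2)"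
 proof -
  have "\<bar>2 * X / u\<bar> = \<bar>X\<bar> / (u / 2)" if "u > 0" for X u :: real
   using that by (simp add: abs_mult)
  moreover have "sinh (2 * t) > 0" using assms by simp
  ultimately show ?thesis unfolding Rk_def by blast
 qed
 ultimately show ?thesis using s assms by (simp only:) (intro frac_le, auto)
qed

text \<open>The pair \<open>(y\<^sub>0, y\<^sub>1)\<close> solves a linear system with a simple pole at \<open>t = 0\<close>, and it is flat there.\<close>

lemma zero_family:
 assumes one: "!!v. v : Vs lam ==> Ph (mat 1) v = 0" and T: "T >= 0"
 shows "Ph (diagm T) (ee lam 0) = 0"
proof (cases "T = 0")
 case True
 then show ?thesis using one by simp
next
 case False
 then have T: "T > 0" using T by simp
 \<comment> \<open>Arranged so that the derivative of \<open>N\<close> is at most (c/t) N on (0, T]: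
   the first term bounds the pole parts of \<open>Rk\<close>, and the bounded terms are multiplied
   by T to be absorbed into 1/t.\<close>
 define c where "c = 2 * (\<bar>of_int m\<bar> + cosh (2 * T)) + (4 * cmod muu + 4 * cmod (1 - muu)) * T"
 have c0: "c >= 0" using T unfolding c_def by (intro add_nonneg_nonneg mult_nonneg_nonneg) auto
 obtain K :: nat where K: "c <= real K" using real_arch_simple by blast
 define N where "N t = (cmod (yy 0 t))\<^sup>2 + (cmod (yy 1 t))\<^sup>2" for t
 have Nd: "\<exists>d. (N has_real_derivative d) (at t) & d <= real K / t * N t" if t: "0 < t" "t <= T" for t
 proof -
  let ?d0 = "2 * muu * yy 1 t - of_real (Rk 0 t) * yy 0 t"
  let ?d1 = "of_real (Rk 1 t) * yy 1 t - 2 * (1 - muu) * yy 0 t"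
  have sq: "((%t. (cmod (y t))\<^sup>2) has_real_derivative 2 * Re (cnj (y t) * d)) (at t)"
   if "(y has_vector_derivative d) (at t)" for y :: "real => complex" and d
  proof -
   have "((%t. Re (y t * cnj (y t))) has_vector_derivative Re (y t * cnj d + d * cnj (y t))) (at t)"
    by (intro bounded_linear.has_vector_derivative[OF bounded_linear_Re] has_vector_derivative_mult has_vector_derivative_cnj that)
   moreover have "(%t. Re (y t * cnj (y t))) = (%t. (cmod (y t))\<^sup>2)"
    unfolding fun_eq_iff cmod_power2 by (simp add: power2_eq_square)
   moreover have "Re (y t * cnj d + d * cnj (y t)) = 2 * Re (cnj (y t) * d)"
    by (simp add: algebra_simps)
   ultimately show ?thesis by (simp only: has_real_derivative_iff_has_vector_derivative)
  qed
  \<comment> \<open>Going upwards from index 0 and downwards from index 1 closes the system on these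
    two functions.\<close>
  have d0: "(yy 0 has_vector_derivative ?d0) (at t)" using yy_deriv(1)[OF t(1), of 0] by simp
  have d1: "(yy 1 has_vector_derivative ?d1) (at t)" using yy_deriv(2)[OF t(1), of 1] by simp
  have D: "(N has_real_derivative 2 * Re (cnj (yy 0 t) * ?d0) + 2 * Re (cnj (yy 1 t) * ?d1)) (at t)"
   unfolding N_def [abs_def] by (intro DERIV_add sq d0 d1)
  let ?a = "cmod (yy 0 t)" and ?b = "cmod (yy 1 t)"
  let ?C = "(\<bar>of_int m\<bar> + cosh (2 * T)) / t"
  have R: "\<bar>Rk 0 t\<bar> <= ?C" "\<bar>Rk 1 t\<bar> <= ?C"
  proof -
   have "\<bar>Rk 0 t\<bar> <= \<bar>of_int m\<bar> / t" using Rk_bound[OF t, of 0] by simp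
   also have "\<dots> <= ?C" using t by (intro divide_right_mono) auto
   finally show "\<bar>Rk 0 t\<bar> <= ?C" .
   show "\<bar>Rk 1 t\<bar> <= ?C" using Rk_bound[OF t, of 1] by simp
  qed
  have "Re (cnj (yy 0 t) * ?d0) <= ?a * (2 * cmod muu * ?b + ?C * ?a)"
  proof -
   have "Re (cnj (yy 0 t) * ?d0) <= cmod (cnj (yy 0 t) * ?d0)" by (rule complex_Re_le_cmod)
   also have "\<dots> = ?a * cmod ?d0" by (simp only: norm_mult complex_mod_cnj)
   also have "cmod ?d0 <= cmod (2 * muu * yy 1 t) + cmod (of_real (Rk 0 t) * yy 0 t)" by (rule norm_triangle_ineq4)
   also have "\<dots> = 2 * cmod muu * ?b + \<bar>Rk 0 t\<bar> * ?a" by (simp only: norm_mult norm_numeral norm_of_real)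
   also have "\<dots> <= 2 * cmod muu * ?b + ?C * ?a" using R by (intro add_left_mono mult_right_mono) auto
   finally show ?thesis by (simp add: mult_left_mono)
  qed
  moreover have "Re (cnj (yy 1 t) * ?d1) <= ?b * (?C * ?b + 2 * cmod (1 - muu) * ?a)"
  proof -
   have "Re (cnj (yy 1 t) * ?d1) <= cmod (cnj (yy 1 t) * ?d1)" by (rule complex_Re_le_cmod)
   also have "\<dots> = ?b * cmod ?d1" by (simp only: norm_mult complex_mod_cnj)
   also have "cmod ?d1 <= cmod (of_real (Rk 1 t) * yy 1 t) + cmod (2 * (1 - muu) * yy 0 t)" by (rule norm_triangle_ineq4)
   also have "\<dots> = \<bar>Rk 1 t\<bar> * ?b + 2 * cmod (1 - muu) * ?a" by (simp only: norm_mult norm_numeral norm_of_real)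
   also have "\<dots> <= ?C * ?b + 2 * cmod (1 - muu) * ?a" using R by (intro add_right_mono mult_right_mono) auto
   finally show ?thesis by (simp add: mult_left_mono)
  qed
  ultimately have "2 * Re (cnj (yy 0 t) * ?d0) + 2 * Re (cnj (yy 1 t) * ?d1)
   <= 2 * ?C * (?a\<^sup>2 + ?b\<^sup>2) + (4 * cmod muu + 4 * cmod (1 - muu)) * (?a * ?b)"
  proof -
   have gen: "2 * X0 + 2 * X1 <= 2 * C * (a\<^sup>2 + b\<^sup>2) + (4 * p + 4 * q) * (a * b)"
    if "X0 <= a * (2 * p * b + C * a)" "X1 <= b * (C * b + 2 * q * a)" for X0 X1 a b p q C :: real
    using that by (simp add: algebra_simps power2_eq_square)
   assume "Re (cnj (yy 0 t) * ?d0) <= ?a * (2 * cmod muu * ?b + ?C * ?a)"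
    "Re (cnj (yy 1 t) * ?d1) <= ?b * (?C * ?b + 2 * cmod (1 - muu) * ?a)"
   then show ?thesis by (rule gen)
  qed
  also have "\<dots> <= 2 * ?C * (?a\<^sup>2 + ?b\<^sup>2) + (4 * cmod muu + 4 * cmod (1 - muu)) * (?a\<^sup>2 + ?b\<^sup>2)"
  proof -
   have "x * y <= x\<^sup>2 + y\<^sup>2" if "x >= 0" "y >= 0" for x y :: real
    using sum_squares_bound[of x y] mult_nonneg_nonneg[OF that] by linarith
   then have "?a * ?b <= ?a\<^sup>2 + ?b\<^sup>2" by simp
   then show ?thesis by (intro add_left_mono mult_left_mono) auto
  qed
  also have "\<dots> = (2 * ?C + (4 * cmod muu + 4 * cmod (1 - muu))) * N t"
   unfolding N_def by (rule distrib_right[symmetric])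
  also have "\<dots> <= real K / t * N t"
  proof (rule mult_right_mono)
   have "(4 * cmod muu + 4 * cmod (1 - muu)) * t <= (4 * cmod muu + 4 * cmod (1 - muu)) * T"
    using t by (intro mult_left_mono) auto
   then have "2 * (\<bar>of_int m\<bar> + cosh (2 * T)) + (4 * cmod muu + 4 * cmod (1 - muu)) * t <= real K"
    using K unfolding c_def by linarith
   moreover have "2 * (X / t) + W <= k / t" if "2 * X + W * t <= k" for X W k
   proof -
    have "2 * (X / t) + W = (2 * X + W * t) / t" using t by (simp add: field_simps)
    then show ?thesis using divide_right_mono[OF that, of t] t by simp
   qed
   ultimately show "2 * ?C + (4 * cmod muu + 4 * cmod (1 - muu)) <= real K / t" by blast
  qed (simp add: N_def)
  finally show ?thesis using D by blast
 qed
 obtain C0 where C0: "C0 >= 0" "!!t. t : {0..T} ==> cmod (yy 0 t) <= C0 * t ^ (K + 1)"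
  using flat[OF one ee_in_Vs] by blast
 obtain C1 where C1: "C1 >= 0" "!!t. t : {0..T} ==> cmod (yy 1 t) <= C1 * t ^ (K + 1)"
  using flat[OF one ee_in_Vs] by blast
 have small: "N s / s ^ K <= (C0\<^sup>2 + C1\<^sup>2) * T ^ (K + 1) * s" if s: "0 < s" "s <= T" for s
 proof -
  have "N s <= (C0 * s ^ (K + 1))\<^sup>2 + (C1 * s ^ (K + 1))\<^sup>2"
   unfolding N_def using C0(2)[of s] C1(2)[of s] s by (intro add_mono power_mono) auto
  also have "\<dots> = (C0\<^sup>2 + C1\<^sup>2) * s ^ (K + 1) * s ^ (K + 1)"
   by (simp add: power_mult_distrib power2_eq_square algebra_simps)
  also have "\<dots> <= (C0\<^sup>2 + C1\<^sup>2) * T ^ (K + 1) * s ^ (K + 1)"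
   using s by (intro mult_right_mono mult_left_mono power_mono) auto
  finally show ?thesis using s by (simp add: divide_le_eq mult_ac)
 qed
 \<comment> \<open>Since K >= c, the quotient N/t^K does not increase; by flatness to order K + 1 it
   tends to 0 as t -> 0, so it cannot be positive at T.\<close>
 have mono: "N T / T ^ K <= N s / s ^ K" if s: "0 < s" "s <= T" for s
 proof (rule DERIV_nonpos_imp_nonincreasing[OF s(2)])
  fix t assume "s <= t" "t <= T"
  then have t: "0 < t" "t <= T" using s by auto
  obtain d where d: "(N has_real_derivative d) (at t)" "d <= real K / t * N t" using Nd[OF t] by blast
  have "((%t. N t / t ^ K) has_real_derivative (d * t ^ K - N t * (real K * t ^ (K - 1))) / (t ^ K * t ^ K)) (at t)"
   using t d(1) by (auto intro!: derivative_eq_intros)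
  moreover have "d * t ^ K - N t * (real K * t ^ (K - 1)) <= 0"
  proof (cases "K = 0")
   case True
   then show ?thesis using d(2) by simp
  next
   case False
   then have "t ^ K = t * t ^ (K - 1)" by (metis power_eq_if)
   moreover have "d * t <= real K * N t" using d(2) t by (simp add: field_simps)
   ultimately show ?thesis using mult_right_mono[of "d * t" "real K * N t" "t ^ (K - 1)"] t by (simp add: algebra_simps)
  qed
  ultimately show "\<exists>y. ((%t. N t / t ^ K) has_real_derivative y) (at t) & y <= 0"
   using t by (intro exI conjI) (assumption, simp add: divide_nonpos_nonneg)
 qed
 have "N T / T ^ K <= 0"
 proof (rule ccontr)
  assume "\<not> N T / T ^ K <= 0"
  define q where "q = N T / T ^ K"
  have p: "q > 0" using \<open>\<not> N T / T ^ K <= 0\<close> unfolding q_def by linarith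
  define B where "B = (C0\<^sup>2 + C1\<^sup>2) * T ^ (K + 1) + 1"
  have B: "B > 0" using T unfolding B_def by (intro add_nonneg_pos mult_nonneg_nonneg) auto
  define s where "s = min T (q / (2 * B))"
  have s: "0 < s" "s <= T" using p B T by (auto simp: s_def)
  have "q <= (C0\<^sup>2 + C1\<^sup>2) * T ^ (K + 1) * s" using mono[OF s] small[OF s] unfolding q_def by linarith
  also have "\<dots> <= B * s" using s unfolding B_def by (intro mult_right_mono) auto
  also have "\<dots> <= B * (q / (2 * B))" using B by (intro mult_left_mono) (auto simp: s_def)
  also have "\<dots> = q / 2" using B by simp
  finally show False using p by simp
 qed
 moreover have "T ^ K > 0" using T by simp
 ultimately have "N T <= 0" by (simp add: divide_le_0_iff)
 then have "(cmod (yy 0 T))\<^sup>2 <= 0" unfolding N_def using zero_le_power2[of "cmod (yy 1 T)"] by linarith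
 then show ?thesis by simp
qed

text \<open>If index 0 vanished for all t > 0, the two recursions would propagate this to every
  index: their factors k + (1+lam)/2 and k - (1+lam)/2 have half-integral real part and are nonzero.
  Index m would then vanish at t = 0 by continuity.\<close>

lemma yy_nonvanishing:
 assumes lam: "Re lam = 0" and one: "Ph (mat 1) (ee lam m) ~= 0"
 shows "\<exists>t>0. yy 0 t ~= 0"
proof (rule ccontr)
 assume "\<not> ?thesis"
 then have z: "!!t. t > 0 ==> yy 0 t = 0" by blast
 have d0: "d = 0" if "!!t. t > 0 ==> yy k t = 0" "(yy k has_vector_derivative d) (at t)" "t > 0" for k d t
 proof -
  have "((%t. 0) has_vector_derivative d) (at t)"
   by (rule has_vector_derivative_transform_within_open[OF that(2), of "{0<..}"]) (use that in auto)
  then show ?thesis using vector_derivative_unique_at[OF _ has_vector_derivative_const] by blast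
 qed
 have nz: "of_int k + muu ~= 0" "of_int k - muu ~= 0" for k :: int
 proof -
  have "Re (of_int k + muu) = of_int k + 1/2" "Re (of_int k - muu) = of_int k - 1/2" using lam by simp_all
  moreover have "of_int k + 1/2 ~= (0::real)" "of_int k - 1/2 ~= (0::real)"
  proof -
   have "2 * k + 1 ~= 0" "2 * k - 1 ~= 0" by presburger+
   then have "real_of_int (2 * k + 1) ~= 0" "real_of_int (2 * k - 1) ~= 0" by (simp_all only: of_int_eq_0_iff not_False_eq_True)
   then show "of_int k + 1/2 ~= (0::real)" "of_int k - 1/2 ~= (0::real)" by simp_all
  qed
  ultimately show "of_int k + muu ~= 0" "of_int k - muu ~= 0" by (metis zero_complex.simps(1))+
 qed
 have up: "yy (int n) t = 0" if "t > 0" for n t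
  using that
 proof (induction n arbitrary: t)
  case (Suc n)
  have "2 * (of_int (int n) + muu) * yy (int n + 1) t - of_real (Rk (int n) t) * yy (int n) t = 0"
   by (rule d0[OF Suc.IH yy_deriv(1)[OF Suc.prems] Suc.prems])
  then have "2 * (of_int (int n) + muu) * yy (int n + 1) t = 0" using Suc.IH[OF Suc.prems] by (simp only: mult_zero_right diff_zero)
  then have "yy (int n + 1) t = 0" using nz(1)[of "int n"] by (simp only: mult_eq_0_iff) simp
  then show ?case by (simp add: add.commute)
 qed (use z in simp)
 have down: "yy (- int n) t = 0" if "t > 0" for n t
  using that
 proof (induction n arbitrary: t)
  case (Suc n)
  have "of_real (Rk (- int n) t) * yy (- int n) t - 2 * (of_int (- int n) - muu) * yy (- int n - 1) t = 0"
   by (rule d0[OF Suc.IH yy_deriv(2)[OF Suc.prems] Suc.prems])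
  then have "2 * (of_int (- int n) - muu) * yy (- int n - 1) t = 0" using Suc.IH[OF Suc.prems] by (simp only: mult_zero_right diff_0 neg_equal_0_iff_equal)
  then have "yy (- int n - 1) t = 0" using nz(2)[of "- int n"] by (simp only: mult_eq_0_iff) simp
  moreover have "- int (Suc n) = - int n - 1" by simp
  ultimately show ?case by (simp only:)
 qed (use z in simp)
 have "yy m t = 0" if "t > 0" for t
  using up[OF that, of "nat m"] down[OF that, of "nat (- m)"] by (cases "m >= 0") auto
 moreover have "continuous (at 0) (yy m)"
  by (rule has_vector_derivative_continuous[OF diagm_deriv[OF ee_in_Vs]])
 ultimately have "yy m 0 = 0"
 proof -
  assume z: "!!t. t > 0 ==> yy m t = 0" and c: "continuous (at 0) (yy m)"
  have "(yy m \<longlongrightarrow> yy m 0) (at_right 0)"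
   using c unfolding continuous_at by (rule tendsto_within_subset[OF _ subset_UNIV])
  moreover have "(yy m \<longlongrightarrow> 0) (at_right 0)"
   by (rule tendsto_eventually) (use z in \<open>auto simp: eventually_at_filter\<close>)
  ultimately show ?thesis using tendsto_unique[OF trivial_limit_at_right_real] by blast
 qed
 then show False using one by simp
qed

end

section \<open>The spherical matrix coefficients\<close>

text \<open>Evaluation of g v at the point (1, 0). It equals 1 on every weight vector at g = 1 and
  serves as the explicit family with which all others are compared.\<close>

definition PSI :: "mat2 => fn => complex" where
 "PSI g v = v (adj2 g *v circ 0)"

lemma PSI_ee_norm:
 assumes "Re lam = 0"
 shows "cmod (PSI g (ee lam k)) = rsq (adj2 g *v circ 0) powr (- (1 / 2))"
 using assms by (simp add: PSI_def ee_norm)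

lemma PSI_lb_family:
 assumes lam: "Re lam = 0"
 shows "lb_family lam PSI"
proof -
 interpret coeff_family lam PSI
 proof
  fix g v X assume *: "g : SL2" "v : Vs lam" "X : sl2"
  have "PSI (g ** mxp t X) v = act (mxp t X) v (adj2 g *v circ 0)" for t
   using * by (simp add: PSI_def act_SL2 mexp_scale_SL2 adj2_mult_distrib matrix_vector_mul_assoc)
  then show "((%t. PSI (g ** mxp t X) v) has_vector_derivative PSI g (lie_act X v)) (at 0)"
   using lie_deriv_Vs[OF *(2,3)] by (simp add: PSI_def)
 qed (simp_all add: PSI_def)
 show ?thesis
 proof
  fix v R assume v: "v : Vs lam"
  have "\<exists>B. \<forall>g\<in>{g\<in>SL2. norm g <= R}. cmod (PSI g v) <= B"
  proof (rule Vs_bound[OF v])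
   fix k
   have "cmod (PSI g (ee lam k)) <= 2 * R" if g: "g : SL2" "norm g <= R" for g
   proof -
    let ?y = "adj2 g *v circ 0"
    have r: "rsq ?y = (g$2$2)\<^sup>2 + (g$2$1)\<^sup>2" by (simp add: rsq_def adj2_def)
    have d: "g$1$1 * g$2$2 - g$1$2 * g$2$1 = 1" using g(1) by (simp add: SL2_iff)
    have "rsq ?y ~= 0"
    proof
     assume "rsq ?y = 0"
     then have "g$2$2 = 0" "g$2$1 = 0" unfolding r by (simp_all add: sum_power2_eq_zero_iff)
     then show False using d by simp
    qed
    moreover have "rsq ?y >= 0" unfolding r by (rule sum_power2_ge_zero)
    ultimately have pos: "rsq ?y > 0" by linarith
    have s: "\<bar>g$2$2\<bar> <= sqrt (rsq ?y)" "\<bar>g$2$1\<bar> <= sqrt (rsq ?y)"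
     unfolding r by (rule real_sqrt_ge_abs1, rule real_sqrt_ge_abs2)
    have e: "\<bar>g$1$1\<bar> <= R" "\<bar>g$1$2\<bar> <= R"
     using mat2_norm_entry[of g 1 1] mat2_norm_entry[of g 1 2] g(2) by simp_all
    \<comment> \<open>The determinant keeps the second row away from 0 when the first is bounded,
      which bounds the singular power of \<open>rsq\<close>.\<close>
    have "1 <= \<bar>g$1$1\<bar> * \<bar>g$2$2\<bar> + \<bar>g$1$2\<bar> * \<bar>g$2$1\<bar>"
     unfolding abs_mult[symmetric] using d by linarith
    also have "\<dots> <= R * sqrt (rsq ?y) + R * sqrt (rsq ?y)"
     using s e by (intro add_mono mult_mono) auto
    finally have "1 <= 2 * R * sqrt (rsq ?y)" by simp
    moreover have "rsq ?y powr (- (1 / 2)) = 1 / sqrt (rsq ?y)"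
     using pos by (simp add: powr_minus powr_half_sqrt inverse_eq_divide)
    ultimately show ?thesis using pos by (simp add: PSI_ee_norm[OF lam] divide_le_eq)
   qed
   then show "\<exists>B. \<forall>g\<in>{g : SL2. norm g <= R}. cmod (PSI g (ee lam k)) <= B" by blast
  qed auto
  then show "\<exists>B. \<forall>g\<in>SL2. norm g <= R --> cmod (PSI g v) <= B" by auto
 qed
qed

text \<open>The spherical matrix coefficient <a_t e_0, e_m>, computed in the function model;
  \<open>co_spherical\<close> recovers it in every bounded globalization.\<close>

definition Mco :: "complex => int => real => complex" where
 "Mco lam m t = avg PSI (mat 1) m (diagm t) (ee lam 0)"

lemma (in lb_family) avg_typed:
 assumes "x : SL2" shows "typed_family lam (avg Ph x m) m"
proof -
 interpret A: coeff_family lam "avg Ph x m" by (rule avg_family[OF assms])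
 show ?thesis by standard (rule avg_type[OF assms])
qed

lemma PSI_one: "PSI (mat 1) (ee lam m) = 1"
proof -
 have "adj2 (mat 1) *v circ 0 = circ 0" by (simp add: adj2_def vec_eq_iff forall_2)
 then show ?thesis by (simp add: PSI_def ee_circ)
qed

text \<open>Both sides come from families of left type m that agree at the identity; their
  difference falls under \<open>zero_family\<close>. The family enters only through the number
  \<open>Ph x (ee lam m)\<close>.\<close>

lemma (in lb_family) avg_spherical:
 assumes lam: "Re lam = 0" and x: "x : SL2" and t: "t >= 0"
 shows "avg Ph x m (diagm t) (ee lam 0) = Ph x (ee lam m) * Mco lam m t"
proof -
 interpret P: lb_family lam PSI by (rule PSI_lb_family[OF lam])
 interpret A: typed_family lam "avg Ph x m" m by (rule avg_typed[OF x])
 interpret B: typed_family lam "avg PSI (mat 1) m" m by (rule P.avg_typed) simp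
 define c where "c = Ph x (ee lam m)"
 let ?D = "%g v. avg Ph x m g v - c * avg PSI (mat 1) m g v"
 have "typed_family lam ?D m"
 proof
  fix g v w assume *: "g : SL2" "v : Vs lam" "w : Vs lam"
  show "?D g (v + w) = ?D g v + ?D g w"
   unfolding A.Ph_add[OF *] B.Ph_add[OF *] by (simp add: algebra_simps)
 next
  fix g v d assume *: "g : SL2" "v : Vs lam"
  show "?D g (scaleF d v) = d * ?D g v"
   unfolding A.Ph_scale[OF *] B.Ph_scale[OF *] by (simp add: algebra_simps)
 next
  fix g v X assume *: "g : SL2" "v : Vs lam" "X : sl2"
  show "((%t. ?D (g ** mxp t X) v) has_vector_derivative ?D g (lie_act X v)) (at 0)"
   by (intro has_vector_derivative_diff has_vector_derivative_mult_right A.Ph_deriv B.Ph_deriv *)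
 next
  fix g v assume *: "g : SL2" "v : Vs lam"
  show "?D g (lie_act (Ztwist g) v) = - 2 * \<i> * of_int m * ?D g v"
   unfolding A.Ph_type[OF *] B.Ph_type[OF *] by (simp add: algebra_simps)
 qed
 then interpret D: typed_family lam ?D m .
 have one: "?D (mat 1) v = 0" if "v : Vs lam" for v
  using that
 proof (induction rule: Vs_induct)
  case zero
  show ?case by (rule D.Ph_zero[OF SL2_one])
 next
  case (ee k)
  show ?case using avg_one[OF x, of m k] P.avg_one[OF SL2_one, of m k] PSI_one[of lam m] by (simp add: c_def)
 next
  case (add v w)
  show ?case unfolding D.Ph_add[OF SL2_one add(1,2)] add(3,4) by simp
 next
  case (scale v d)
  show ?case unfolding D.Ph_scale[OF SL2_one scale(1)] scale(2) by simp
 qed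
 have "?D (diagm t) (ee lam 0) = 0" by (rule D.zero_family[OF one t])
 then show ?thesis by (simp add: Mco_def c_def)
qed

text \<open>The K-average of |Ph (x k a_t) e_0|^2 is at most B^2, and by
  \<open>avg_spherical\<close> its Fourier coefficients are products. A supremum bound for the
  single vector e_0 thereby controls all weight vectors at once.\<close>

lemma (in lb_family) spherical_Bessel:
 assumes lam: "Re lam = 0" and x: "x : SL2" and t: "t >= 0" and F: "finite F"
  and B: "!!g. g : SL2 ==> cmod (Ph g (ee lam 0)) <= B"
 shows "(\<Sum>m\<in>F. (cmod (Ph x (ee lam m)))\<^sup>2 * (cmod (Mco lam m t))\<^sup>2) <= B\<^sup>2"
proof -
 let ?h = "%tta. Ph (x ** rot tta ** diagm t) (ee lam 0)"
 have c: "continuous_on I0 ?h" by (rule avg_integrand_cont[OF x]) auto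
 have "(\<Sum>m\<in>F. (cmod (Ph x (ee lam m)))\<^sup>2 * (cmod (Mco lam m t))\<^sup>2) = (\<Sum>m\<in>F. (cmod (fhat m ?h))\<^sup>2)"
  using avg_spherical[OF lam x t] by (simp add: avg_def norm_mult power_mult_distrib)
 also have "\<dots> <= msq ?h" by (rule Bessel[OF F c])
 also have "\<dots> <= B\<^sup>2" by (rule msq_le[OF c]) (intro B SL2_mult x rot_SL2 diagm_SL2)
 finally show ?thesis .
qed

lemma Mco_nonvanishing: "Re lam = 0 ==> \<exists>t>0. Mco lam m t ~= 0"
proof -
 assume lam: "Re lam = 0"
 interpret P: lb_family lam PSI by (rule PSI_lb_family[OF lam])
 interpret B: typed_family lam "avg PSI (mat 1) m" m by (rule P.avg_typed) simp
 have "avg PSI (mat 1) m (mat 1) (ee lam m) ~= 0"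
  using P.avg_one[OF SL2_one, of m m] PSI_one by simp
 then show ?thesis using B.yy_nonvanishing[OF lam] by (simp add: Mco_def)
qed

section \<open>Size of the spherical matrix coefficients\<close>

text \<open>The squared length of the point at which \<open>PSI\<close> evaluates for g = rot tta
  a_t. The modulus of the coefficient is \<open>Qf\<close>^(-1/2) for every weight
  (\<open>psi_norm\<close>), so the size estimates become integrals of elementary functions.\<close>

definition Qf :: "real => real => real" where
 "Qf t tta = exp (- 2 * t) * (cos tta)\<^sup>2 + exp (2 * t) * (sin tta)\<^sup>2"

abbreviation "psi t k tta \<equiv> PSI (mat 1 ** rot tta ** diagm t) k"

lemma rsq_Qf: "rsq (adj2 (mat 1 ** rot tta ** diagm t) *v circ 0) = Qf t tta"
proof -
 have "rsq (adj2 (mat 1 ** rot tta ** diagm t) *v circ 0) = (exp (- t) * cos tta)\<^sup>2 + (exp t * sin tta)\<^sup>2"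
  by (simp add: rsq_def adj2_def rot_def diagm_def mult.commute)
 also have "(exp (- t))\<^sup>2 = exp (- 2 * t)" "(exp t)\<^sup>2 = exp (2 * t)"
  by (simp_all add: power2_eq_square flip: exp_add)
 ultimately show ?thesis by (simp add: Qf_def power_mult_distrib)
qed

text \<open>Up to pi/3 the cosine is at least 1/2 and sin x >= x/2; beyond, sin x >= 1/2 while x <=
  pi/2 < 2.\<close>

lemma sin_lower:
 assumes "\<bar>tta\<bar> <= pi / 2" shows "\<bar>sin tta\<bar> >= \<bar>tta\<bar> / 4"
proof -
 have *: "sin x >= x / 4" if x: "0 <= x" "x <= pi / 2" for x
 proof (cases "x <= pi / 3")
  case True
  have "sin 0 - 0 / 2 <= sin x - x / 2"
  proof (rule DERIV_nonneg_imp_nondecreasing[OF x(1)])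
   fix u assume u: "0 <= u" "u <= x"
   have "cos (pi / 3) <= cos u" using u True pi_gt_zero by (intro cos_monotone_0_pi_le) auto
   then have "0 <= cos u - 1 / 2" by (simp add: cos_60)
   moreover have "((%x. sin x - x / 2) has_real_derivative (cos u - 1 / 2)) (at u)"
    by (auto intro!: derivative_eq_intros)
   ultimately show "\<exists>y. ((%x. sin x - x / 2) has_real_derivative y) (at u) & 0 <= y" by blast
  qed
  then show ?thesis using x by simp
 next
  case False
  have "sin (pi / 6) <= sin x" using False x pi_gt_zero by (intro sin_monotone_2pi_le) auto
  then have "1 / 2 <= sin x" by (simp add: sin_30)
  then show ?thesis using x pi_less_4 by linarith
 qed
 show ?thesis
 proof (cases "tta >= 0")
  case True
  then show ?thesis using *[of tta] assms by simp
 next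
  case False
  then show ?thesis using *[of "- tta"] assms by simp
 qed
qed

text \<open>Written as p^2 + q^2 tta^2 so that \<open>int_arctan\<close> and
  \<open>int_arsinh\<close> apply. If sin^2 <= 1/2, the cosine term supplies p^2 and half of the
  sine term q^2 tta^2; otherwise the two halves of the sine term supply one each.\<close>

lemma Qf_lower:
 assumes "tta : I0" "t >= 0"
 shows "(exp (- t) / 2)\<^sup>2 + (exp t / sqrt 32)\<^sup>2 * tta\<^sup>2 <= Qf t tta"
proof -
 let ?A = "exp (- 2 * t)" and ?B = "exp (2 * t)"
 have e: "(exp (- t) / 2)\<^sup>2 = ?A / 4" "(exp t / sqrt 32)\<^sup>2 = ?B / 32"
  by (simp_all add: power_divide power2_eq_square flip: exp_add)
 have AB: "?A <= ?B" using assms(2) by simp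
 have s: "tta\<^sup>2 / 16 <= (sin tta)\<^sup>2"
 proof -
  have "(\<bar>tta\<bar> / 4)\<^sup>2 <= \<bar>sin tta\<bar>\<^sup>2" using sin_lower assms(1) by (intro power_mono) (auto simp: I0_iff)
  then show ?thesis by (simp add: power_divide)
 qed
 have Bs: "?B * (tta\<^sup>2 / 16) <= ?B * (sin tta)\<^sup>2" using s by (intro mult_left_mono) auto
 have p: "(cos tta)\<^sup>2 = 1 - (sin tta)\<^sup>2" by (rule cos_squared_eq)
 have t: "?B * (tta\<^sup>2 / 16) = 2 * (?B / 32 * tta\<^sup>2)" by simp
 have nn: "0 <= ?B / 32 * tta\<^sup>2" by simp
 show ?thesis
 proof (cases "(sin tta)\<^sup>2 <= 1 / 2")
  case True
  then have "?A * (1 / 2) <= ?A * (cos tta)\<^sup>2" unfolding p by (intro mult_left_mono) auto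
  moreover have "0 < ?A" by simp
  ultimately show ?thesis unfolding e Qf_def using Bs t nn by linarith
 next
  case False
  then have "?B * (1 / 2) <= ?B * (sin tta)\<^sup>2" by (intro mult_left_mono) auto
  moreover have "0 <= ?A * (cos tta)\<^sup>2" by simp
  ultimately show ?thesis unfolding e Qf_def using Bs t AB nn by linarith
 qed
qed

lemma Qf_upper: "Qf t tta <= (exp (- t))\<^sup>2 + (exp t)\<^sup>2 * tta\<^sup>2"
proof -
 have e: "(exp (- t))\<^sup>2 = exp (- 2 * t)" "(exp t)\<^sup>2 = exp (2 * t)"
  by (simp_all add: power2_eq_square flip: exp_add)
 have "(cos tta)\<^sup>2 <= 1" using abs_cos_le_one[of tta] by (simp add: abs_square_le_1)
 moreover have "(sin tta)\<^sup>2 <= tta\<^sup>2" using abs_sin_x_le_abs_x[of tta] by (simp add: abs_le_square_iff)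
 ultimately have "exp (- 2 * t) * (cos tta)\<^sup>2 <= exp (- 2 * t) * 1" "exp (2 * t) * (sin tta)\<^sup>2 <= exp (2 * t) * tta\<^sup>2"
  by (intro mult_left_mono; simp)+
 then show ?thesis unfolding Qf_def e by linarith
qed

lemma Qf_pos: "Qf t tta > 0"
proof -
 have n: "rot tta ** diagm t : SL2" by blast
 show ?thesis
 proof (cases "sin tta = 0")
  case True
  then have "cos tta ~= 0" using sin_cos_squared_add[of tta] by auto
  then show ?thesis by (simp add: Qf_def True)
 next
  case False
  then show ?thesis unfolding Qf_def by (intro add_nonneg_pos) auto
 qed
qed

lemma int_arctan:
 assumes "p > 0" "q > 0"
 shows "integral I0 (%tta. 1 / (p\<^sup>2 + q\<^sup>2 * tta\<^sup>2)) = 2 * arctan (pi / 2 * (q / p)) / (p * q)"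
proof -
 have "((%tta. 1 / (p\<^sup>2 + q\<^sup>2 * tta\<^sup>2)) has_integral
   (arctan (pi / 2 * (q / p)) / (p * q) - arctan (- (pi / 2) * (q / p)) / (p * q))) I0"
  unfolding I0_def
 proof (rule fundamental_theorem_of_calculus)
  fix tta
  have "((%tta. arctan (tta * (q / p)) / (p * q)) has_real_derivative
    (inverse (1 + (tta * (q / p))\<^sup>2) * (q / p)) / (p * q)) (at tta)"
   by (intro DERIV_cdivide DERIV_chain2[where g="%tta. tta * (q / p)", OF DERIV_arctan]) (use assms in \<open>auto intro!: derivative_eq_intros\<close>)
  moreover have "(inverse (1 + (tta * (q / p))\<^sup>2) * (q / p)) / (p * q) = 1 / (p\<^sup>2 + q\<^sup>2 * tta\<^sup>2)"
  proof -
   have pp: "p\<^sup>2 + q\<^sup>2 * tta\<^sup>2 > 0" using assms by (intro add_pos_nonneg) auto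
   have pn: "p ~= 0" using assms by auto
   have "1 + (tta * (q / p))\<^sup>2 = (p\<^sup>2 + q\<^sup>2 * tta\<^sup>2) / p\<^sup>2" using pn by (simp add: field_simps power2_eq_square)
   then have "inverse (1 + (tta * (q / p))\<^sup>2) = p\<^sup>2 / (p\<^sup>2 + q\<^sup>2 * tta\<^sup>2)"
    by (simp only: inverse_eq_divide divide_divide_eq_right mult_1_left)
   moreover have "c * (q / p) / (p * q) = c / p\<^sup>2" for c using assms by (simp add: power2_eq_square)
   ultimately have "(inverse (1 + (tta * (q / p))\<^sup>2) * (q / p)) / (p * q) = p\<^sup>2 / (p\<^sup>2 + q\<^sup>2 * tta\<^sup>2) / p\<^sup>2"
    by (simp only:)
   also have "\<dots> = 1 / (p\<^sup>2 + q\<^sup>2 * tta\<^sup>2)" using pn by simp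
   finally show ?thesis .
  qed
  ultimately show "((%tta. arctan (tta * (q / p)) / (p * q)) has_vector_derivative 1 / (p\<^sup>2 + q\<^sup>2 * tta\<^sup>2)) (at tta within {- (pi / 2)..pi / 2})"
   by (simp add: has_real_derivative_iff_has_vector_derivative has_vector_derivative_at_within)
 qed simp
 then show ?thesis by (simp add: integral_unique arctan_minus)
qed

lemma int_arsinh:
 assumes "p > 0" "q > 0"
 shows "integral I0 (%tta. 1 / sqrt (p\<^sup>2 + q\<^sup>2 * tta\<^sup>2)) = 2 * arsinh (pi / 2 * (q / p)) / q"
proof -
 have "((%tta. 1 / sqrt (p\<^sup>2 + q\<^sup>2 * tta\<^sup>2)) has_integral
   (arsinh (pi / 2 * (q / p)) / q - arsinh (- (pi / 2) * (q / p)) / q)) I0"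
  unfolding I0_def
 proof (rule fundamental_theorem_of_calculus)
  fix tta
  have "((%tta. arsinh (tta * (q / p)) / q) has_real_derivative
    (1 / sqrt ((tta * (q / p))\<^sup>2 + 1) * (q / p)) / q) (at tta)"
   by (intro DERIV_cdivide DERIV_chain2[where g="%tta. tta * (q / p)", OF arsinh_real_has_field_derivative]) (use assms in \<open>auto intro!: derivative_eq_intros\<close>)
  moreover have "(1 / sqrt ((tta * (q / p))\<^sup>2 + 1) * (q / p)) / q = 1 / sqrt (p\<^sup>2 + q\<^sup>2 * tta\<^sup>2)"
  proof -
   have pn: "p ~= 0" using assms by auto
   have "(tta * (q / p))\<^sup>2 + 1 = (p\<^sup>2 + q\<^sup>2 * tta\<^sup>2) / p\<^sup>2" using pn by (simp add: field_simps power2_eq_square)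
   then have "sqrt ((tta * (q / p))\<^sup>2 + 1) = sqrt (p\<^sup>2 + q\<^sup>2 * tta\<^sup>2) / p"
    using assms by (simp add: real_sqrt_divide)
   then show ?thesis using pn assms by simp
  qed
  ultimately show "((%tta. arsinh (tta * (q / p)) / q) has_vector_derivative 1 / sqrt (p\<^sup>2 + q\<^sup>2 * tta\<^sup>2)) (at tta within {- (pi / 2)..pi / 2})"
   by (simp add: has_real_derivative_iff_has_vector_derivative has_vector_derivative_at_within)
 qed simp
 moreover have "arsinh (- (pi / 2) * (q / p)) = - arsinh (pi / 2 * (q / p))"
  using arsinh_minus_real[of "pi / 2 * (q / p)"] by simp
 ultimately show ?thesis by (simp add: integral_unique)
qed

lemma psi_norm: "Re lam = 0 ==> cmod (psi t (ee lam k) tta) = 1 / sqrt (Qf t tta)"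
 using Qf_pos[of t tta] unfolding PSI_ee_norm rsq_Qf by (simp add: powr_minus powr_half_sqrt inverse_eq_divide)

lemma psi_cont: "Re lam = 0 ==> v : Vs lam ==> continuous_on S (psi t v)"
 using lb_family.avg_integrand_cont[OF PSI_lb_family SL2_one diagm_SL2] by blast

lemma quad_cont: "p > 0 ==> continuous_on S (%tta. 1 / (p\<^sup>2 + q\<^sup>2 * tta\<^sup>2))"
 "p > 0 ==> continuous_on S (%tta. 1 / sqrt (p\<^sup>2 + q\<^sup>2 * tta\<^sup>2))" for p q :: real
proof -
 assume "p > 0"
 then have "p\<^sup>2 + q\<^sup>2 * tta\<^sup>2 > 0" for tta by (intro add_pos_nonneg) auto
 then have "p\<^sup>2 + q\<^sup>2 * tta\<^sup>2 ~= 0" for tta by (metis less_irrefl)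
 then show "continuous_on S (%tta. 1 / (p\<^sup>2 + q\<^sup>2 * tta\<^sup>2))" "continuous_on S (%tta. 1 / sqrt (p\<^sup>2 + q\<^sup>2 * tta\<^sup>2))"
  by (intro continuous_intros; simp)+
qed

lemma psi_le:
 assumes "Re lam = 0" "tta : I0" "t >= 0"
 shows "cmod (psi t (ee lam k) tta) <= 1 / sqrt ((exp (- t) / 2)\<^sup>2 + (exp t / sqrt 32)\<^sup>2 * tta\<^sup>2)"
proof -
 have "(exp (- t) / 2)\<^sup>2 + (exp t / sqrt 32)\<^sup>2 * tta\<^sup>2 > 0" by (intro add_pos_nonneg) auto
 then show ?thesis
  unfolding psi_norm[OF assms(1)] using Qf_lower[OF assms(2,3)] by (intro frac_le) auto
qed

text \<open>The mean of \<open>Qf\<close>^(-1/2) bounds every Fourier coefficient, for all weights k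
  alike. The logarithmic growth of arsinh at arguments up to e^(2t) produces the factor 1 +
  t.\<close>

lemma avg_psi_bound:
 assumes "Re lam = 0" "t >= 0"
 shows "cmod (avg PSI (mat 1) m (diagm t) (ee lam k)) <= 8 * (1 + t) * exp (- t)"
proof -
 let ?p = "exp (- t) / 2" and ?q = "exp t / sqrt 32"
 let ?y = "pi / 2 * (?q / ?p)"
 have y: "?y <= exp (2 * t)"
 proof -
  have "?q / ?p = 2 * exp (2 * t) / sqrt 32" by (simp add: exp_minus field_simps flip: exp_add)
  then have "?y = (pi / sqrt 32) * exp (2 * t)" by simp
  moreover have "pi / sqrt 32 <= 1" using pi_less_4 real_less_rsqrt[of 4 32] by (simp add: divide_le_eq)
  moreover have "(pi / sqrt 32) * exp (2 * t) <= 1 * exp (2 * t)" if "pi / sqrt 32 <= 1"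
   using that by (rule mult_right_mono) simp
  ultimately show ?thesis by simp
 qed
 have y0: "?y >= 0" by simp
 have "arsinh ?y <= 2 * (1 + t)"
 proof -
  have "sqrt (?y\<^sup>2 + 1) <= ?y + 1" using y0 by (intro real_le_lsqrt) (auto simp: power2_sum)
  then have "?y + sqrt (?y\<^sup>2 + 1) <= 3 * exp (2 * t)" using y assms(2) one_le_exp_iff[of "2 * t"] by linarith
  moreover have "3 * exp (2 * t) <= exp (2 * (1 + t))"
  proof -
   have "(3::real) <= exp 2" using exp_ge_add_one_self[of 2] by simp
   then have "3 * exp (2 * t) <= exp 2 * exp (2 * t)" by (intro mult_right_mono) auto
   then show ?thesis by (simp add: distrib_left flip: exp_add)
  qed
  ultimately have "?y + sqrt (?y\<^sup>2 + 1) <= exp (2 * (1 + t))" by linarith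
  moreover have "?y + sqrt (?y\<^sup>2 + 1) > 0" using y0 by (intro add_nonneg_pos) (auto intro: add_nonneg_pos)
  ultimately have "ln (?y + sqrt (?y\<^sup>2 + 1)) <= 2 * (1 + t)" by (metis exp_gt_zero ln_exp ln_le_cancel_iff)
  then show ?thesis by (simp only: arsinh_real_def)
 qed
 have "cmod (avg PSI (mat 1) m (diagm t) (ee lam k)) <= (1 / pi) * integral I0 (%tta. 1 / sqrt (?p\<^sup>2 + ?q\<^sup>2 * tta\<^sup>2))"
  unfolding avg_def
  by (rule fhat_bound_integral[OF psi_cont[OF assms(1) ee_in_Vs] quad_cont(2) psi_le[OF assms(1) _ assms(2)]]) auto
 also have "\<dots> = (1 / pi) * (2 * arsinh ?y / ?q)" by (subst int_arsinh) auto
 also have "\<dots> <= (1 / pi) * (2 * (2 * (1 + t)) / ?q)"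
  using \<open>arsinh ?y <= 2 * (1 + t)\<close> by (intro mult_left_mono divide_right_mono) auto
 also have "\<dots> = (sqrt 32 / pi) * (4 * (1 + t) * exp (- t))" by (simp add: exp_minus field_simps)
 also have "\<dots> <= 2 * (4 * (1 + t) * exp (- t))"
 proof (rule mult_right_mono)
  have "sqrt 32 <= 6" by (rule real_le_lsqrt) auto
  then show "sqrt 32 / pi <= 2" using pi_gt3 by (simp add: divide_le_eq)
 qed (use assms(2) in simp)
 also have "2 * (4 * (1 + t) * exp (- t)) = 8 * (1 + t) * exp (- t)" by simp
 finally show ?thesis .
qed

text \<open>Unitarity gives the exact value 1; together with \<open>psi_msq_ge\<close> the constants
  12 and 1/2 are enough and follow from the comparison of \<open>Qf\<close> with p^2 + q^2
  tta^2.\<close>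

lemma psi_msq_le:
 assumes "Re lam = 0" "t >= 0"
 shows "msq (psi t (ee lam k)) <= 12"
proof -
 let ?p = "exp (- t) / 2" and ?q = "exp t / sqrt 32"
 have "integral I0 (%tta. (cmod (psi t (ee lam k) tta))\<^sup>2) <= integral I0 (%tta. 1 / (?p\<^sup>2 + ?q\<^sup>2 * tta\<^sup>2))"
 proof (rule integral_le)
  show "(%tta. (cmod (psi t (ee lam k) tta))\<^sup>2) integrable_on I0"
   by (intro integrable_I0 continuous_on_power continuous_on_norm psi_cont[OF assms(1) ee_in_Vs])
  show "(%tta. 1 / (?p\<^sup>2 + ?q\<^sup>2 * tta\<^sup>2)) integrable_on I0" by (intro integrable_I0 quad_cont) simp
  fix tta assume "tta : I0"
  have pos: "?p\<^sup>2 + ?q\<^sup>2 * tta\<^sup>2 > 0" by (intro add_pos_nonneg) auto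
  have "(cmod (psi t (ee lam k) tta))\<^sup>2 = 1 / Qf t tta"
   unfolding psi_norm[OF assms(1)] using Qf_pos[of t tta] by (simp add: power_divide)
  also have "\<dots> <= 1 / (?p\<^sup>2 + ?q\<^sup>2 * tta\<^sup>2)" using pos Qf_lower[OF \<open>tta : I0\<close> assms(2)] by (intro frac_le) auto
  finally show "(cmod (psi t (ee lam k) tta))\<^sup>2 <= 1 / (?p\<^sup>2 + ?q\<^sup>2 * tta\<^sup>2)" .
 qed
 also have "\<dots> = 2 * arctan (pi / 2 * (?q / ?p)) / (?p * ?q)" by (rule int_arctan) auto
 also have "\<dots> <= pi / (?p * ?q)"
  using arctan_ubound[of "pi / 2 * (?q / ?p)"] by (intro divide_right_mono) auto
 also have "?p * ?q = 1 / (2 * sqrt 32)" by (simp add: exp_minus)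
 finally have "integral I0 (%tta. (cmod (psi t (ee lam k) tta))\<^sup>2) <= pi * (2 * sqrt 32)" by simp
 also have "\<dots> <= pi * 12" by (intro mult_left_mono) (auto intro: real_le_lsqrt)
 finally show ?thesis by (simp add: msq_def field_simps)
qed

lemma psi_msq_ge:
 assumes "Re lam = 0" "t >= 0"
 shows "msq (psi t (ee lam k)) >= 1 / 2"
proof -
 let ?p = "exp (- t)" and ?q = "exp t"
 have "pi / 2 <= 2 * arctan (pi / 2 * (?q / ?p)) / (?p * ?q)"
 proof -
  have "1 <= pi / 2 * (?q / ?p)"
  proof -
   have "?p <= ?q" using assms(2) by simp
   then have "1 <= ?q / ?p" by (subst le_divide_eq_1_pos) auto
   moreover have "1 <= pi / 2" using pi_gt3 by simp
   ultimately have "1 * 1 <= pi / 2 * (?q / ?p)" by (intro mult_mono) auto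
   then show ?thesis by simp
  qed
  then have "arctan 1 <= arctan (pi / 2 * (?q / ?p))" by (simp only: arctan_le_iff)
  moreover have "?p * ?q = 1" by (simp add: exp_minus)
  ultimately show ?thesis by (simp only: arctan_one)
 qed
 also have "\<dots> = integral I0 (%tta. 1 / (?p\<^sup>2 + ?q\<^sup>2 * tta\<^sup>2))" by (rule int_arctan[symmetric]) auto
 also have "\<dots> <= integral I0 (%tta. (cmod (psi t (ee lam k) tta))\<^sup>2)"
 proof (rule integral_le)
  show "(%tta. (cmod (psi t (ee lam k) tta))\<^sup>2) integrable_on I0"
   by (intro integrable_I0 continuous_on_power continuous_on_norm psi_cont[OF assms(1) ee_in_Vs])
  show "(%tta. 1 / (?p\<^sup>2 + ?q\<^sup>2 * tta\<^sup>2)) integrable_on I0" by (intro integrable_I0 quad_cont) simp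
  fix tta :: real
  have "(cmod (psi t (ee lam k) tta))\<^sup>2 = 1 / Qf t tta"
   unfolding psi_norm[OF assms(1)] using Qf_pos[of t tta] by (simp add: power_divide)
  then show "1 / (?p\<^sup>2 + ?q\<^sup>2 * tta\<^sup>2) <= (cmod (psi t (ee lam k) tta))\<^sup>2"
   using Qf_pos[of t tta] Qf_upper[of t tta] by (simp only:) (intro frac_le, auto)
 qed
 finally show ?thesis by (simp add: msq_def field_simps)
qed

text \<open>As a function of the angle this is an even function on the plane, continuous away from
  0, restricted to the circle run through backwards. It makes Parseval available in
  \<open>Mco_mass\<close>.\<close>

lemma psi_trig_approx: "trig_approx (psi t (ee lam k))"
proof -
 let ?f = "%y. ee lam k (diagm (- t) *v y)"
 have n: "diagm (- t) *v y ~= 0" if "y ~= 0" for y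
  using that by (simp add: vec2_zero_iff diagm_def)
 have "continuous_on (- {0}) (ee lam k)"
  unfolding ee_def by (intro continuous_at_imp_continuous_on ballI has_derivative_continuous) (use has_derivative_uu in blast)
 then have "continuous_on (sphere 0 1) ?f"
 proof (rule continuous_on_compose2[where s="sphere 0 1" and f="%y. diagm (- t) *v y", OF _ matrix_vector_mult_linear_continuous_on])
  show "(*v) (diagm (- t)) ` sphere 0 1 \<subseteq> - {0}"
  proof
   fix z assume "z : (*v) (diagm (- t)) ` sphere 0 1"
   then obtain y :: "real^2" where y: "y : sphere 0 1" "z = diagm (- t) *v y" by (rule imageE)
   then have "norm y = 1" by simp
   then have "y ~= 0" by fastforce
   then show "z : - {0}" using n y(2) by simp
  qed
 qed
 then have "trig_approx (%tta. ?f (circ (- tta)))"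
  by (rule even_function_trig_approx(2)) (simp add: linear_neg[OF matrix_vector_mul_linear] ee_uminus)
 moreover have "?f (circ (- tta)) = psi t (ee lam k) tta" for tta
 proof -
  have "diagm (- t) *v circ (- tta) = adj2 (mat 1 ** rot tta ** diagm t) *v circ 0"
   by (simp add: vec_eq_iff forall_2 adj2_def rot_def diagm_def)
  then show ?thesis by (simp only: PSI_def)
 qed
 ultimately show ?thesis by (simp only:)
qed

lemma Mco_fhat: "Mco lam m t = fhat m (psi t (ee lam 0))"
 by (simp add: Mco_def avg_def)

lemma Mco_bound: "Re lam = 0 ==> t >= 0 ==> cmod (Mco lam m t) <= 8 * (1 + t) * exp (- t)"
 unfolding Mco_def by (rule avg_psi_bound)

lemma Mco_Bessel: "Re lam = 0 ==> t >= 0 ==> finite F ==> (\<Sum>m\<in>F. (cmod (Mco lam m t))\<^sup>2) <= 12"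
 unfolding Mco_fhat by (rule order_trans[OF Bessel[OF _ psi_cont[OF _ ee_in_Vs]] psi_msq_le])

text \<open>The derivative along left rotations multiplies the coefficient of index m by 2|m| in
  modulus, but enlarges the function pointwise by at most |1 + lam| sinh(2t); Bessel's inequality
  for the derivative gives the weighted sum. Frequencies far above e^(2t) therefore carry little
  mass.\<close>

lemma Mco_tail:
 assumes lam: "Re lam = 0" and t: "t >= 0" and F: "finite F"
 shows "(\<Sum>m\<in>F. (real_of_int m)\<^sup>2 * (cmod (Mco lam m t))\<^sup>2) <= 3 * (cmod (1 + lam))\<^sup>2 * exp (4 * t)"
proof -
 interpret P: lb_family lam PSI by (rule PSI_lb_family[OF lam])
 let ?Z = "lie_act (Ztwist (diagm t)) (ee lam 0)" and ?muu = "(1 + lam) / 2"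
 let ?c = "cmod (1 + lam) * sinh (2 * t)"
 have ZV: "?Z : Vs lam" by blast
 have s0: "sinh (2 * t) >= 0" using t by simp
 have Zb: "cmod (psi t ?Z tta) <= ?c * cmod (psi t (ee lam 0) tta)" for tta
 proof -
  let ?n = "cmod (psi t (ee lam 0) tta)"
  have n: "cmod (psi t (ee lam k) tta) = ?n" for k using psi_norm[OF lam] by simp
  have "psi t ?Z tta = - (?muu * (- \<i> * of_real (sinh (2 * t)) * psi t (ee lam (-1)) tta)) - ?muu * (\<i> * of_real (sinh (2 * t))) * psi t (ee lam 1) tta"
   unfolding lie_Z_ee by (simp add: PSI_def)
  then have "cmod (psi t ?Z tta) <= cmod (?muu * (- \<i> * of_real (sinh (2 * t)) * psi t (ee lam (-1)) tta)) + cmod (?muu * (\<i> * of_real (sinh (2 * t))) * psi t (ee lam 1) tta)"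
   using norm_triangle_ineq4[of "- (?muu * (- \<i> * of_real (sinh (2 * t)) * psi t (ee lam (-1)) tta))"] by (simp only: norm_minus_cancel)
  also have "\<dots> = cmod ?muu * sinh (2 * t) * ?n + cmod ?muu * sinh (2 * t) * ?n"
   unfolding norm_mult n[of 1] n[of "-1"] norm_minus_cancel norm_ii norm_of_real using s0 by simp
  also have "\<dots> = ?c * ?n" by (simp add: norm_divide)
  finally show ?thesis .
 qed
 have eq: "cmod (fhat m (psi t ?Z)) = 2 * \<bar>real_of_int m\<bar> * cmod (Mco lam m t)" for m
 proof -
  have "fhat m (psi t ?Z) = - 2 * \<i> * of_int m * Mco lam m t"
   using P.avg_type[OF SL2_one diagm_SL2 ee_in_Vs, of m t 0] by (simp add: avg_def Mco_def)
  then show ?thesis by (simp add: norm_mult)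
 qed
 have "4 * (\<Sum>m\<in>F. (real_of_int m)\<^sup>2 * (cmod (Mco lam m t))\<^sup>2) = (\<Sum>m\<in>F. (cmod (fhat m (psi t ?Z)))\<^sup>2)"
  unfolding eq sum_distrib_left by (simp add: power_mult_distrib mult.assoc)
 also have "\<dots> <= msq (psi t ?Z)" by (rule Bessel[OF F psi_cont[OF lam ZV]])
 also have "\<dots> <= ?c\<^sup>2 * msq (psi t (ee lam 0))"
 proof -
  have "integral I0 (%tta. (cmod (psi t ?Z tta))\<^sup>2) <= integral I0 (%tta. ?c\<^sup>2 * (cmod (psi t (ee lam 0) tta))\<^sup>2)"
  proof (rule integral_le)
   show "(%tta. (cmod (psi t ?Z tta))\<^sup>2) integrable_on I0"
    by (intro integrable_I0 continuous_on_power continuous_on_norm psi_cont[OF lam ZV])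
   show "(%tta. ?c\<^sup>2 * (cmod (psi t (ee lam 0) tta))\<^sup>2) integrable_on I0"
    by (intro integrable_I0 continuous_on_mult continuous_on_const continuous_on_power continuous_on_norm psi_cont[OF lam ee_in_Vs])
   show "(cmod (psi t ?Z tta))\<^sup>2 <= ?c\<^sup>2 * (cmod (psi t (ee lam 0) tta))\<^sup>2" for tta
    unfolding power_mult_distrib[symmetric] by (rule power_mono[OF Zb norm_ge_zero])
  qed
  then show ?thesis by (simp add: msq_def field_simps)
 qed
 also have "\<dots> <= ?c\<^sup>2 * 12" by (intro mult_left_mono psi_msq_le lam t zero_le_power2)
 also have "\<dots> <= ((cmod (1 + lam))\<^sup>2 * exp (4 * t)) * 12"
 proof -
  have "sinh (2 * t) <= exp (2 * t)"
  proof -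
   have "(a - b) / 2 <= a" if "0 < a" "0 < b" for a b :: real using that by simp
   from this[OF exp_gt_zero exp_gt_zero] show ?thesis unfolding sinh_field_def .
  qed
  then have "(sinh (2 * t))\<^sup>2 <= (exp (2 * t))\<^sup>2" using s0 by (rule power_mono)
  also have "(exp (2 * t))\<^sup>2 = exp (4 * t)" by (simp add: power2_eq_square flip: exp_add)
  finally show ?thesis by (simp add: power_mult_distrib mult_left_mono)
 qed
 finally show ?thesis by (simp add: mult.commute mult.left_commute)
qed

text \<open>The total mass is at least 1/2; Parseval loses 1/8 to approximation, and
  \<open>Mco_tail\<close> bounds the mass outside [-L, L] by another 1/8, because the factor 6 makes
  36 |1 + lam|^2 e^(4t) <= L^2.\<close>

lemma Mco_mass:
 assumes lam: "Re lam = 0" and t: "t >= 0" and L: "6 * (cmod (1 + lam) + 1) * exp (2 * t) <= real L"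
 shows "(\<Sum>m\<in>{- int L..int L}. (cmod (Mco lam m t))\<^sup>2) >= 1 / 4"
proof -
 let ?M = "%m. (cmod (Mco lam m t))\<^sup>2" and ?S = "{- int L..int L}"
 have "0 < 6 * (cmod (1 + lam) + 1) * exp (2 * t)" by (intro mult_pos_pos add_nonneg_pos) auto
 then have Lp: "real L > 0" using L by linarith
 obtain F where F: "finite F" "!!F'. finite F' ==> F \<subseteq> F' ==> msq (psi t (ee lam 0)) <= (\<Sum>m\<in>F'. ?M m) + 1 / 8"
  using trig_approx_Parseval[OF psi_trig_approx psi_cont[OF lam ee_in_Vs], of "1/8" t 0] unfolding Mco_fhat by auto
 have "(\<Sum>m\<in>F - ?S. ?M m) <= 1 / 8"
 proof -
  have "(real L)\<^sup>2 * (\<Sum>m\<in>F - ?S. ?M m) <= (\<Sum>m\<in>F - ?S. (real_of_int m)\<^sup>2 * ?M m)"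
   unfolding sum_distrib_left
  proof (intro sum_mono mult_right_mono zero_le_power2)
   fix m assume "m : F - ?S"
   then have "real L <= \<bar>real_of_int m\<bar>" by auto
   then show "(real L)\<^sup>2 <= (real_of_int m)\<^sup>2" using Lp by (simp add: abs_le_square_iff[symmetric])
  qed
  also have "\<dots> <= 3 * (cmod (1 + lam))\<^sup>2 * exp (4 * t)" by (intro Mco_tail lam t) (use F in simp)
  also have "\<dots> <= (real L)\<^sup>2 / 8"
  proof -
   have "6 * (cmod (1 + lam) + 1) * exp (2 * t) = 6 * cmod (1 + lam) * exp (2 * t) + 6 * exp (2 * t)"
    by (simp add: algebra_simps)
   then have "6 * cmod (1 + lam) * exp (2 * t) <= real L" using L exp_gt_zero[of "2 * t"] by linarith
   then have "(6 * cmod (1 + lam) * exp (2 * t))\<^sup>2 <= (real L)\<^sup>2" by (rule power_mono) simp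
   moreover have "(exp (2 * t))\<^sup>2 = exp (4 * t)" by (simp add: power2_eq_square flip: exp_add)
   ultimately have "36 * ((cmod (1 + lam))\<^sup>2 * exp (4 * t)) <= (real L)\<^sup>2" by (simp add: power_mult_distrib)
   moreover have "0 <= (cmod (1 + lam))\<^sup>2 * exp (4 * t)" by simp
   ultimately show ?thesis by linarith
  qed
  finally have "(real L)\<^sup>2 * (\<Sum>m\<in>F - ?S. ?M m) <= (real L)\<^sup>2 * (1 / 8)" by simp
  then show ?thesis using Lp by (subst (asm) mult_le_cancel_left_pos) auto
 qed
 moreover have "msq (psi t (ee lam 0)) <= (\<Sum>m\<in>F \<union> ?S. ?M m) + 1 / 8" using F by auto
 moreover have "(\<Sum>m\<in>F \<union> ?S. ?M m) = (\<Sum>m\<in>?S. ?M m) + (\<Sum>m\<in>F - ?S. ?M m)"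
 proof -
  have "F \<union> ?S = ?S \<union> (F - ?S)" by auto
  then show ?thesis using F(1) by (simp only:) (intro sum.union_disjoint, auto)
 qed
 ultimately show ?thesis using psi_msq_ge[OF lam t, of 0] by linarith
qed

text \<open>The derivative along \<open>Hm\<close> of the coefficient of e_0 involves the weights 1
  and -1 with factor (1 + lam)/2 each, both bounded by 8 since (1 + t) e^(-t) <= 1. Used to pass
  from a net of times t to all times.\<close>

lemma Mco_lipschitz:
 assumes lam: "Re lam = 0" and t: "t >= 0" "t' >= 0"
 shows "cmod (Mco lam m t' - Mco lam m t) <= 8 * cmod (1 + lam) * \<bar>t' - t\<bar>"
proof -
 interpret P: lb_family lam PSI by (rule PSI_lb_family[OF lam])
 interpret B: coeff_family lam "avg PSI (mat 1) m" by (rule P.avg_family) simp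
 have dd: "diagm t ** diagm s = diagm (t + s)" for s by (simp add: diagm_def mat2_eq_iff flip: exp_add)
 have "cmod (avg PSI (mat 1) m (diagm t ** mxp (t' - t) Hm) (ee lam 0) - avg PSI (mat 1) m (diagm t) (ee lam 0))
  <= 8 * cmod (1 + lam) * \<bar>t' - t\<bar>"
 proof (rule B.Ph_bound1)
  fix s assume "s : closed_segment 0 (t' - t)"
  then have s: "t + s >= 0" using t by (auto simp: closed_segment_eq_real_ivl split: if_splits)
  have b: "cmod (avg PSI (mat 1) m (diagm (t + s)) (ee lam k)) <= 8" for k
  proof -
   have "(1 + (t + s)) * exp (- (t + s)) <= exp (t + s) * exp (- (t + s))"
    by (intro mult_right_mono) (use exp_ge_add_one_self[of "t + s"] in auto)
   then have "(1 + (t + s)) * exp (- (t + s)) <= 1" by (simp only: exp_add[symmetric]) simp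
   then have "8 * (1 + (t + s)) * exp (- (t + s)) <= 8" by linarith
   then show ?thesis using avg_psi_bound[OF lam s, of m k] by linarith
  qed
  have "avg PSI (mat 1) m (diagm (t + s)) (lie_act Hm (ee lam 0))
   = (1 + lam) / 2 * avg PSI (mat 1) m (diagm (t + s)) (ee lam (-1)) + (1 + lam) / 2 * avg PSI (mat 1) m (diagm (t + s)) (ee lam 1)"
   unfolding lie_H_ee B.Ph_add[OF diagm_SL2 Vs_scale[OF ee_in_Vs] Vs_scale[OF ee_in_Vs]] B.Ph_scale[OF diagm_SL2 ee_in_Vs]
   by simp
  then have "cmod (avg PSI (mat 1) m (diagm (t + s)) (lie_act Hm (ee lam 0)))
   <= cmod ((1 + lam) / 2) * cmod (avg PSI (mat 1) m (diagm (t + s)) (ee lam (-1))) + cmod ((1 + lam) / 2) * cmod (avg PSI (mat 1) m (diagm (t + s)) (ee lam 1))"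
   by (simp only: norm_mult[symmetric] norm_triangle_ineq)
  also have "\<dots> <= cmod ((1 + lam) / 2) * 8 + cmod ((1 + lam) / 2) * 8"
   by (intro add_mono mult_left_mono b) auto
  finally show "cmod (avg PSI (mat 1) m (diagm t ** mxp s Hm) (lie_act Hm (ee lam 0))) <= 8 * cmod (1 + lam)"
   by (simp add: mexp_Hm dd norm_divide)
 qed auto
 then show ?thesis by (simp add: mexp_Hm dd Mco_def)
qed

section \<open>The completion\<close>

text \<open>Points of the completion are classes of Cauchy sequences, with operations defined
  through chosen representatives. Lemmas such as \<open>cadd_cls\<close> remove the choice; after
  that, identities are checked termwise on sequences.\<close>

locale nspace =
 fixes V :: "fn set" and p :: "fn => real"
 assumes norm: "is_norm V p"
  and V_zero: "0 : V"
  and V_add: "u : V ==> v : V ==> u + v : V"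
  and V_scale: "v : V ==> scaleF c v : V"
begin

abbreviation "W \<equiv> completion V p"
abbreviation "C \<equiv> cauchy_seqs V p"
abbreviation "dd a b \<equiv> cnorm p (cdiff V p a b)"
abbreviation "add2 a b \<equiv> cadd V p a b"
abbreviation "sc c a \<equiv> cscale V p c a"
abbreviation "em v \<equiv> emb V p v"

lemma V_minus: "v : V ==> - v : V"
 unfolding scaleF_minus_one by (rule V_scale)

lemma V_diff: "u : V ==> v : V ==> u - v : V"
 using V_add[OF _ V_minus, of u v] by simp

lemma V_sum: "(!!i. i : F ==> f i : V) ==> (\<Sum>i\<in>F. f i) : V"
 by (induction F rule: infinite_finite_induct) (auto intro: V_zero V_add)

lemma p_nonneg: "v : V ==> 0 <= p v" and p_eq_0: "v : V ==> p v = 0 \<longleftrightarrow> v = 0"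
 and p_scale: "v : V ==> p (scaleF c v) = cmod c * p v"
 and p_add: "u : V ==> v : V ==> p (u + v) <= p u + p v"
 using norm unfolding is_norm_def by blast+

lemma p_0 [simp]: "p 0 = 0"
 using p_eq_0[OF V_zero] by (simp only:)

lemma p_minus: "v : V ==> p (- v) = p v"
 using p_scale[of v "-1"] by (simp add: scaleF_minus_one)

lemma p_diff_sym: "u : V ==> v : V ==> p (u - v) = p (v - u)"
 using p_minus[of "u - v"] V_diff[of u v] by simp

lemma p_tri: "u : V ==> v : V ==> w : V ==> p (u - w) <= p (u - v) + p (v - w)"
 using p_add[of "u - v" "v - w"] V_diff by simp

lemma p_rev: "u : V ==> v : V ==> \<bar>p u - p v\<bar> <= p (u - v)"
 using p_add[of "u - v" v] p_add[of "v - u" u] p_diff_sym[of u v] V_diff[of u v] V_diff[of v u]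
 by (simp add: abs_le_iff)

lemma p_sum: "(!!i. i : F ==> f i : V) ==> p (\<Sum>i\<in>F. f i) <= (\<Sum>i\<in>F. p (f i))"
proof (induction F rule: infinite_finite_induct)
 case (insert i F)
 then have "p (f i + (\<Sum>i\<in>F. f i)) <= p (f i) + p (\<Sum>i\<in>F. f i)" by (intro p_add V_sum) auto
 moreover have "(\<Sum>i\<in>insert i F. f i) = f i + (\<Sum>i\<in>F. f i)" using insert by (intro sum.insert)
 moreover have "(\<Sum>i\<in>insert i F. p (f i)) = p (f i) + (\<Sum>i\<in>F. p (f i))" using insert by (intro sum.insert)
 moreover have "p (\<Sum>i\<in>F. f i) <= (\<Sum>i\<in>F. p (f i))" using insert by auto
 ultimately show ?case by (simp only:)
qed (simp_all only: sum.empty sum.infinite p_0 order_refl not_False_eq_True)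

lemma C_in: "x : C ==> x n : V"
 unfolding cauchy_seqs_def by auto

lemma C_D: "x : C ==> e > 0 ==> \<exists>N. \<forall>m\<ge>N. \<forall>n\<ge>N. p (x m - x n) < e"
 unfolding cauchy_seqs_def by blast

lemma C_I: "(!!n. x n : V) ==> (!!e. e > 0 ==> \<exists>N. \<forall>m\<ge>N. \<forall>n\<ge>N. p (x m - x n) < e) ==> x : C"
 unfolding cauchy_seqs_def by auto

lemma C_const [intro]: "v : V ==> (%_. v) : C"
 by (rule C_I) simp_all

lemma C_add [intro]:
 assumes "x : C" "y : C" shows "(%n. x n + y n) : C"
proof (rule C_I)
 show "x n + y n : V" for n using assms by (intro V_add C_in)
 fix e :: real assume e: "e > 0"
 obtain N where N: "!!m n. m >= N ==> n >= N ==> p (x m - x n) < e/2" using C_D[OF assms(1), of "e/2"] e by auto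
 obtain M where M: "!!m n. m >= M ==> n >= M ==> p (y m - y n) < e/2" using C_D[OF assms(2), of "e/2"] e by auto
 have "p (x m + y m - (x n + y n)) < e" if "m >= max N M" "n >= max N M" for m n
 proof -
  have "x m + y m - (x n + y n) = (x m - x n) + (y m - y n)" by simp
  moreover have "p ((x m - x n) + (y m - y n)) <= p (x m - x n) + p (y m - y n)"
   using assms by (intro p_add V_diff C_in)
  ultimately show ?thesis using N[of m n] M[of m n] that by (simp only:) linarith
 qed
 then show "\<exists>N. \<forall>m\<ge>N. \<forall>n\<ge>N. p (x m + y m - (x n + y n)) < e" by blast
qed

lemma C_scale [intro]:
 assumes "x : C" shows "(%n. scaleF c (x n)) : C"
proof (rule C_I)
 show "scaleF c (x n) : V" for n using assms by (intro V_scale C_in)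
 fix e :: real assume e: "e > 0"
 have c: "cmod c + 1 > 0" by (intro add_nonneg_pos) auto
 then obtain N where N: "!!m n. m >= N ==> n >= N ==> p (x m - x n) < e / (cmod c + 1)"
  using C_D[OF assms, of "e / (cmod c + 1)"] e by auto
 have "p (scaleF c (x m) - scaleF c (x n)) < e" if "m >= N" "n >= N" for m n
 proof -
  have V: "x m - x n : V" using assms by (intro V_diff C_in)
  have "p (scaleF c (x m) - scaleF c (x n)) = cmod c * p (x m - x n)"
   using p_scale[OF V, of c] by (simp only: scaleF_simps)
  also have "\<dots> <= (cmod c + 1) * p (x m - x n)" using p_nonneg[OF V] by (intro mult_right_mono) auto
  also have "\<dots> < (cmod c + 1) * (e / (cmod c + 1))" using N[OF that] c by (rule mult_strict_left_mono)
  also have "\<dots> = e" using c by simp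
  finally show ?thesis .
 qed
 then show "\<exists>N. \<forall>m\<ge>N. \<forall>n\<ge>N. p (scaleF c (x m) - scaleF c (x n)) < e" by blast
qed

lemma C_diff [intro]: "x : C ==> y : C ==> (%n. x n - y n) : C"
 using C_add[OF _ C_scale, of x y "-1"] by (simp add: scaleF_minus_one[symmetric])

lemma C_convergent: "x : C ==> convergent (%n. p (x n))"
proof -
 assume x: "x : C"
 have "Cauchy (%n. p (x n))"
  unfolding Cauchy_def
 proof (intro allI impI)
  fix e :: real assume "e > 0"
  then obtain N where N: "!!m n. m >= N ==> n >= N ==> p (x m - x n) < e" using C_D[OF x] by blast
  have "dist (p (x m)) (p (x n)) < e" if "m >= N" "n >= N" for m n
   using p_rev[OF C_in[OF x, of m] C_in[OF x, of n]] N[OF that] by (simp add: dist_real_def)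
  then show "\<exists>M. \<forall>m\<ge>M. \<forall>n\<ge>M. dist (p (x m)) (p (x n)) < e" by blast
 qed
 then show ?thesis by (rule Cauchy_convergent)
qed

lemma null_iff: "(x, y) : null_rel V p \<longleftrightarrow> x : C & y : C & (%n. p (x n - y n)) \<longlonglongrightarrow> 0"
 by (simp add: null_rel_def)

lemma null_refl: "x : C ==> (x, x) : null_rel V p"
 by (simp add: null_iff)

lemma null_sym: "(x, y) : null_rel V p ==> (y, x) : null_rel V p"
 unfolding null_iff using p_diff_sym[OF C_in C_in, of x y] by simp

lemma null_trans: "(x, y) : null_rel V p ==> (y, z) : null_rel V p ==> (x, z) : null_rel V p"
proof -
 assume a: "(x, y) : null_rel V p" "(y, z) : null_rel V p"
 then have xyz: "x : C" "y : C" "z : C" by (auto simp: null_iff)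
 have "(%n. p (x n - y n) + p (y n - z n)) \<longlonglongrightarrow> 0 + 0" using a by (intro tendsto_add) (auto simp: null_iff)
 then have "(%n. p (x n - z n)) \<longlonglongrightarrow> 0"
  by (intro tendsto_sandwich[of "%_. 0" "%n. p (x n - z n)" sequentially "%n. p (x n - y n) + p (y n - z n)"])
   (use xyz in \<open>auto intro!: always_eventually p_nonneg V_diff C_in p_tri\<close>)
 then show ?thesis using xyz by (simp add: null_iff)
qed

lemma cls_eq: "x : C ==> y : C ==> cls V p x = cls V p y \<longleftrightarrow> (%n. p (x n - y n)) \<longlonglongrightarrow> 0"
proof -
 assume x: "x : C" and y: "y : C"
 have "cls V p x = cls V p y \<longleftrightarrow> (x, y) : null_rel V p"
 proof
  assume "cls V p x = cls V p y"
  moreover have "y : cls V p y" unfolding cls_def using null_refl[OF y] by simp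
  ultimately have "y : cls V p x" by (simp only:)
  then show "(x, y) : null_rel V p" by (simp add: cls_def)
 next
  assume r: "(x, y) : null_rel V p"
  show "cls V p x = cls V p y"
   unfolding cls_def
  proof (rule subset_antisym; rule subsetI)
   fix z assume "z : null_rel V p `` {x}"
   then have "(x, z) : null_rel V p" by simp
   then show "z : null_rel V p `` {y}" using null_trans[OF null_sym[OF r]] by simp
  next
   fix z assume "z : null_rel V p `` {y}"
   then have "(y, z) : null_rel V p" by simp
   then show "z : null_rel V p `` {x}" using null_trans[OF r] by simp
  qed
 qed
 then show ?thesis using x y by (simp add: null_iff)
qed

lemma cls_in [intro]: "x : C ==> cls V p x : W"
 unfolding completion_def cls_def by (rule quotientI)

lemma W_cases: "a : W ==> (!!x. x : C ==> a = cls V p x ==> thesis) ==> thesis"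
 unfolding completion_def cls_def by (auto elim: quotientE)

lemma rep_null: "x : C ==> (x, rep (cls V p x)) : null_rel V p"
proof -
 assume "x : C"
 then have "x : cls V p x" using null_refl by (simp add: cls_def)
 then have "rep (cls V p x) : cls V p x" unfolding rep_def by (rule someI[of "%z. z : cls V p x"])
 then show ?thesis by (simp add: cls_def)
qed

lemma rep_C: "a : W ==> rep a : C"
 using rep_null by (auto elim!: W_cases simp: null_iff)

lemma cls_rep: "a : W ==> cls V p (rep a) = a"
 using rep_null cls_eq by (auto elim!: W_cases simp: null_iff)

lemma cnorm_cls: "x : C ==> (%n. p (x n)) \<longlonglongrightarrow> cnorm p (cls V p x)"
proof -
 assume x: "x : C"
 let ?y = "rep (cls V p x)"
 have y: "?y : C" "(%n. p (x n - ?y n)) \<longlonglongrightarrow> 0" using rep_null[OF x] by (auto simp: null_iff)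
 have l: "(%n. p (?y n)) \<longlonglongrightarrow> cnorm p (cls V p x)"
  using C_convergent[OF y(1)] by (simp add: cnorm_def convergent_LIMSEQ_iff)
 have "(%n. p (x n) - p (?y n)) \<longlonglongrightarrow> 0"
  by (rule Lim_null_comparison[OF _ y(2)]) (use p_rev[OF C_in[OF x] C_in[OF y(1)]] in simp)
 from tendsto_add[OF this l] show ?thesis by simp
qed

lemma cnorm_unique: "x : C ==> (%n. p (x n)) \<longlonglongrightarrow> l ==> cnorm p (cls V p x) = l"
 using LIMSEQ_unique[OF cnorm_cls] by blast

lemma cadd_cls: "x : C ==> y : C ==> add2 (cls V p x) (cls V p y) = cls V p (%n. x n + y n)"
proof -
 assume x: "x : C" and y: "y : C"
 let ?x = "rep (cls V p x)" and ?y = "rep (cls V p y)"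
 have *: "?x : C" "(%n. p (x n - ?x n)) \<longlonglongrightarrow> 0" "?y : C" "(%n. p (y n - ?y n)) \<longlonglongrightarrow> 0"
  using rep_null[OF x] rep_null[OF y] by (auto simp: null_iff)
 have "(%n. p (x n - ?x n) + p (y n - ?y n)) \<longlonglongrightarrow> 0" using tendsto_add[OF *(2,4)] by simp
 then have "(%n. p (x n + y n - (?x n + ?y n))) \<longlonglongrightarrow> 0"
 proof (rule tendsto_sandwich[OF _ _ tendsto_const, rotated 2])
  show "\<forall>\<^sub>F n in sequentially. 0 <= p (x n + y n - (?x n + ?y n))"
   using x y * by (intro always_eventually allI p_nonneg V_diff V_add C_in)
  have "p (x n + y n - (?x n + ?y n)) <= p (x n - ?x n) + p (y n - ?y n)" for n
   using p_add[of "x n - ?x n" "y n - ?y n"] x y * by (simp add: V_diff C_in add_diff_add)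
  then show "\<forall>\<^sub>F n in sequentially. p (x n + y n - (?x n + ?y n)) <= p (x n - ?x n) + p (y n - ?y n)"
   by (intro always_eventually allI)
 qed
 then have "cls V p (%n. x n + y n) = cls V p (%n. ?x n + ?y n)"
  by (subst cls_eq) (use x y * in auto)
 then show ?thesis by (simp only: cadd_def)
qed

lemma cscale_cls: "x : C ==> sc c (cls V p x) = cls V p (%n. scaleF c (x n))"
proof -
 assume x: "x : C"
 let ?x = "rep (cls V p x)"
 have *: "?x : C" "(%n. p (x n - ?x n)) \<longlonglongrightarrow> 0" using rep_null[OF x] by (auto simp: null_iff)
 have "p (scaleF c (x n) - scaleF c (?x n)) = cmod c * p (x n - ?x n)" for n
  using p_scale[of "x n - ?x n" c] x * by (simp add: V_diff C_in scaleF_simps)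
 then have "(%n. p (scaleF c (x n) - scaleF c (?x n))) \<longlonglongrightarrow> 0"
  using tendsto_mult_right_zero[OF *(2), of "cmod c"] by (simp only:)
 then have "cls V p (%n. scaleF c (x n)) = cls V p (%n. scaleF c (?x n))"
  by (subst cls_eq) (use x * in auto)
 then show ?thesis by (simp only: cscale_def)
qed

lemma cdiff_eq: "a : W ==> b : W ==> cdiff V p a b = add2 a (sc (- 1) b)"
proof -
 assume a: "a : W" and b: "b : W"
 have "add2 a (sc (- 1) b) = add2 (cls V p (rep a)) (sc (- 1) (cls V p (rep b)))" by (simp only: cls_rep a b)
 also have "\<dots> = cls V p (%n. rep a n + scaleF (- 1) (rep b n))"
  using rep_C[OF a] rep_C[OF b] by (simp only: cscale_cls cadd_cls C_scale)
 finally show ?thesis by (simp add: cdiff_def scaleF_minus_one[symmetric])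
qed

lemma cdiff_cls: "x : C ==> y : C ==> cdiff V p (cls V p x) (cls V p y) = cls V p (%n. x n - y n)"
 using cadd_cls[OF _ C_scale, of x y "-1"] by (simp add: cdiff_eq cls_in cscale_cls scaleF_minus_one[symmetric])

lemma emb_in [intro]: "v : V ==> em v : W"
 unfolding emb_def by (intro cls_in C_const)

lemma add2_in [intro]: "a : W ==> b : W ==> add2 a b : W"
 by (auto elim!: W_cases simp: cadd_cls cls_in C_add)

lemma sc_in [intro]: "a : W ==> sc c a : W"
 by (auto elim!: W_cases simp: cscale_cls cls_in C_scale)

lemma cdiff_in [intro]: "a : W ==> b : W ==> cdiff V p a b : W"
 by (simp add: cdiff_eq add2_in sc_in)

lemmas cls_simps = cadd_cls cscale_cls cdiff_cls C_add C_scale C_diff C_const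

lemma emb_add: "u : V ==> v : V ==> add2 (em u) (em v) = em (u + v)"
 unfolding emb_def by (simp only: cls_simps)

lemma emb_scale: "v : V ==> sc c (em v) = em (scaleF c v)"
 unfolding emb_def by (simp only: cls_simps)

lemma emb_diff: "u : V ==> v : V ==> cdiff V p (em u) (em v) = em (u - v)"
 unfolding emb_def by (simp only: cls_simps)

lemma cnorm_emb: "v : V ==> cnorm p (em v) = p v"
 unfolding emb_def by (rule cnorm_unique) auto

lemma cnorm_nonneg: "a : W ==> 0 <= cnorm p a"
 by (elim W_cases) (auto intro!: LIMSEQ_le_const[OF cnorm_cls] p_nonneg C_in)

lemma cnorm_add: "a : W ==> b : W ==> cnorm p (add2 a b) <= cnorm p a + cnorm p b"
proof (elim W_cases)
 fix x y assume *: "x : C" "a = cls V p x" "y : C" "b = cls V p y"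
 show ?thesis
  unfolding *(2,4) cadd_cls[OF *(1,3)]
  by (rule LIMSEQ_le[OF cnorm_cls[OF C_add[OF *(1,3)]] tendsto_add[OF cnorm_cls[OF *(1)] cnorm_cls[OF *(3)]]])
   (use * in \<open>auto intro!: p_add C_in\<close>)
qed

lemma cnorm_sc: "a : W ==> cnorm p (sc c a) = cmod c * cnorm p a"
proof (elim W_cases)
 fix x assume *: "x : C" "a = cls V p x"
 have "(%n. p (scaleF c (x n))) = (%n. cmod c * p (x n))" using * by (simp add: p_scale C_in)
 then show ?thesis
  unfolding *(2) cscale_cls[OF *(1)]
  by (intro cnorm_unique C_scale *) (simp only: tendsto_mult_left[OF cnorm_cls[OF *(1)]])
qed

lemma dd_eq_0: "a : W ==> b : W ==> dd a b = 0 \<longleftrightarrow> a = b"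
proof (elim W_cases)
 fix x y assume *: "x : C" "a = cls V p x" "y : C" "b = cls V p y"
 show ?thesis
  unfolding *(2,4) cdiff_cls[OF *(1,3)] cls_eq[OF *(1,3)]
 proof
  assume "cnorm p (cls V p (%n. x n - y n)) = 0"
  then show "(%n. p (x n - y n)) \<longlonglongrightarrow> 0" using cnorm_cls[OF C_diff[OF *(1,3)]] by (simp only:)
 qed (rule cnorm_unique[OF C_diff[OF *(1,3)]])
qed

lemma dd_nonneg: "a : W ==> b : W ==> 0 <= dd a b"
 by (intro cnorm_nonneg cdiff_in)

lemma dd_sym: "a : W ==> b : W ==> dd a b = dd b a"
proof (elim W_cases)
 fix x y assume *: "x : C" "a = cls V p x" "y : C" "b = cls V p y"
 have "(%n. p (x n - y n)) = (%n. p (y n - x n))" using * by (intro ext p_diff_sym C_in)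
 then show ?thesis
  unfolding *(2,4) cdiff_cls[OF *(1,3)] cdiff_cls[OF *(3,1)]
  using cnorm_cls[OF C_diff[OF *(3,1)]] by (intro cnorm_unique C_diff *) simp
qed

lemma W_identity2:
 "a : W ==> b : W ==> c : W ==> cdiff V p a c = add2 (cdiff V p a b) (cdiff V p b c)"
 "a : W ==> b : W ==> add2 b (cdiff V p a b) = a"
 by (elim W_cases; simp add: cls_simps)+

lemma dd_tri: "a : W ==> b : W ==> c : W ==> dd a c <= dd a b + dd b c"
 using cnorm_add[of "cdiff V p a b" "cdiff V p b c"] W_identity2(1)[of a b c] by (simp add: cdiff_in)

lemma cnorm_le_dd: "a : W ==> b : W ==> cnorm p a <= cnorm p b + dd a b"
 using cnorm_add[of b "cdiff V p a b"] W_identity2(2)[of a b] by (simp add: cdiff_in)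

lemma cdiff_add2:
 assumes "a : W" "b : W" "a' : W" "b' : W"
 shows "cdiff V p (add2 a b) (add2 a' b') = add2 (cdiff V p a a') (cdiff V p b b')"
proof -
 obtain x y x' y' where *: "x : C" "a = cls V p x" "y : C" "b = cls V p y"
  "x' : C" "a' = cls V p x'" "y' : C" "b' = cls V p y'" using assms by (meson W_cases)
 show ?thesis unfolding *(2,4,6,8) using *(1,3,5,7) by (simp add: cls_simps add_diff_add)
qed

lemma cdiff_sc: "a : W ==> b : W ==> cdiff V p (sc c a) (sc c b) = sc c (cdiff V p a b)"
 by (elim W_cases) (simp add: cls_simps scaleF_simps)

lemma dd_add2: "a : W ==> b : W ==> a' : W ==> b' : W ==> dd (add2 a b) (add2 a' b') <= dd a a' + dd b b'"
 by (simp add: cdiff_add2 cnorm_add cdiff_in)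

lemma dd_sc: "a : W ==> b : W ==> dd (sc c a) (sc c b) = cmod c * dd a b"
 by (simp add: cdiff_sc cnorm_sc cdiff_in)

lemma cls_limit:
 assumes "x : C" shows "(%n. dd (em (x n)) (cls V p x)) \<longlonglongrightarrow> 0"
proof (rule LIMSEQ_I)
 fix e :: real assume e: "e > 0"
 then obtain N where N: "!!m n. m >= N ==> n >= N ==> p (x m - x n) < e/2" using C_D[OF assms, of "e/2"] by auto
 have "dd (em (x m)) (cls V p x) <= e/2" if "m >= N" for m
 proof -
  have V: "x m : V" by (rule C_in[OF assms])
  have c: "(%n. x m - x n) : C" using C_diff[OF C_const[OF V] assms] .
  have "cdiff V p (em (x m)) (cls V p x) = cls V p (%n. x m - x n)"
   unfolding emb_def by (rule cdiff_cls[OF C_const[OF V] assms])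
  moreover have "cnorm p (cls V p (%n. x m - x n)) <= e/2"
   by (rule LIMSEQ_le_const2[OF cnorm_cls[OF c]]) (use N that less_imp_le in blast)
  ultimately show ?thesis by simp
 qed
 moreover have "0 <= dd (em (x m)) (cls V p x)" for m
  using assms by (intro dd_nonneg emb_in cls_in C_in)
 ultimately have "norm (dd (em (x m)) (cls V p x) - 0) < e" if "m >= N" for m
  using that e by (smt (verit) real_norm_def field_sum_of_halves)
 then show "\<exists>N. \<forall>n\<ge>N. norm (dd (em (x n)) (cls V p x) - 0) < e" by blast
qed

lemma dense: "a : W ==> e > 0 ==> \<exists>v\<in>V. dd a (em v) < e"
proof (elim W_cases)
 fix x assume e: "e > 0" and x: "x : C" "a = cls V p x"
 obtain N where "!!n. n >= N ==> norm (dd (em (x n)) (cls V p x) - 0) < e"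
  using LIMSEQ_D[OF cls_limit[OF x(1)] e] by blast
 then have "dd (em (x N)) a < e" using x(2) by force
 moreover have "dd (em (x N)) a = dd a (em (x N))"
  unfolding x(2) using x(1) by (intro dd_sym emb_in cls_in C_in)
 ultimately show ?thesis using C_in[OF x(1), of N] by auto
qed

abbreviation "dq ga t \<equiv> sc (cor (1 / t)) (cdiff V p (ga t) (ga 0))"

lemma hc_iff: "has_cderiv_at0 V p ga z \<longleftrightarrow> z : W & ((%t. dd (dq ga t) z) \<longlongrightarrow> 0) (at 0)"
 by (simp add: has_cderiv_at0_def)

lemma dq_in: "(!!t. ga t : W) ==> dq ga t : W"
 by (intro sc_in cdiff_in)

lemma tendsto0I:
 assumes "(g \<longlongrightarrow> (0::real)) F" "!!t. 0 <= f t" "!!t. f t <= g t"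
 shows "(f \<longlongrightarrow> 0) F"
 by (rule tendsto_sandwich[OF _ _ tendsto_const assms(1)]) (use assms in auto)

lemma hc_unique:
 assumes ga: "!!t. ga t : W" and "has_cderiv_at0 V p ga z" "has_cderiv_at0 V p ga z'"
 shows "z = z'"
proof -
 have z: "z : W" "z' : W" using assms by (auto simp: hc_iff)
 have "((%t. dd (dq ga t) z + dd (dq ga t) z') \<longlongrightarrow> 0 + 0) (at 0)"
  using assms by (intro tendsto_add) (auto simp: hc_iff)
 then have "((%t. dd (dq ga t) z + dd (dq ga t) z') \<longlongrightarrow> 0) (at 0)" by simp
 then have "((%t. dd z z') \<longlongrightarrow> 0) (at (0::real))"
 proof (rule tendsto0I)
  show "0 <= dd z z'" using z by (rule dd_nonneg)
  fix t
  have "dd z z' <= dd z (dq ga t) + dd (dq ga t) z'" using z dq_in[of ga t, OF ga] by (intro dd_tri)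
  then show "dd z z' <= dd (dq ga t) z + dd (dq ga t) z'" using dd_sym[OF z(1) dq_in[of ga t, OF ga]] by simp
 qed
 then have "dd z z' = 0" using tendsto_unique[OF _ tendsto_const] trivial_limit_at by blast
 then show ?thesis using dd_eq_0[OF z] by simp
qed

lemma hc_add:
 assumes ga: "!!t. ga t : W" and dlt: "!!t. dlt t : W"
  and "has_cderiv_at0 V p ga z" "has_cderiv_at0 V p dlt w"
 shows "has_cderiv_at0 V p (%t. add2 (ga t) (dlt t)) (add2 z w)"
proof -
 have z: "z : W" "w : W" using assms by (auto simp: hc_iff)
 have sa: "sc c (add2 a b) = add2 (sc c a) (sc c b)" if "a : W" "b : W" for a b c
  using that by (elim W_cases) (simp add: cls_simps scaleF_simps)
 have e: "dq (%t. add2 (ga t) (dlt t)) t = add2 (dq ga t) (dq dlt t)" for t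
  using ga dlt by (simp add: cdiff_add2 sa cdiff_in)
 have "((%t. dd (dq ga t) z + dd (dq dlt t) w) \<longlongrightarrow> 0 + 0) (at 0)"
  using assms by (intro tendsto_add) (auto simp: hc_iff)
 then have "((%t. dd (dq ga t) z + dd (dq dlt t) w) \<longlongrightarrow> 0) (at 0)" by simp
 then have "((%t. dd (dq (%t. add2 (ga t) (dlt t)) t) (add2 z w)) \<longlongrightarrow> 0) (at 0)"
 proof (rule tendsto0I)
  fix t
  show "0 <= dd (dq (%t. add2 (ga t) (dlt t)) t) (add2 z w)"
   unfolding e using z dq_in[of ga t, OF ga] dq_in[of dlt t, OF dlt] by (intro dd_nonneg add2_in)
  show "dd (dq (%t. add2 (ga t) (dlt t)) t) (add2 z w) <= dd (dq ga t) z + dd (dq dlt t) w"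
   unfolding e using z dq_in[of ga t, OF ga] dq_in[of dlt t, OF dlt] by (intro dd_add2)
 qed
 then show ?thesis using z by (auto simp: hc_iff)
qed

lemma hc_linear_map:
 assumes ga: "!!t. ga t : W" and d: "has_cderiv_at0 V p ga z"
  and T: "!!a. a : W ==> T a : W" "!!a b. a : W ==> b : W ==> T (add2 a b) = add2 (T a) (T b)"
   "!!a c. a : W ==> T (sc c a) = sc c (T a)" "!!a. a : W ==> cnorm p (T a) <= K * cnorm p a"
 shows "has_cderiv_at0 V p (%t. T (ga t)) (T z)"
proof -
 have z: "z : W" using d by (simp add: hc_iff)
 have Td: "T (cdiff V p a b) = cdiff V p (T a) (T b)" if "a : W" "b : W" for a b
  using that by (simp add: cdiff_eq T sc_in)
 have e: "dq (%t. T (ga t)) t = T (dq ga t)" for t using ga by (simp add: T Td cdiff_in)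
 have "((%t. K * dd (dq ga t) z) \<longlongrightarrow> 0) (at 0)"
  using tendsto_mult_right_zero[of "%t. dd (dq ga t) z" "at 0" K] d by (simp add: hc_iff)
 then have "((%t. dd (dq (%t. T (ga t)) t) (T z)) \<longlongrightarrow> 0) (at 0)"
 proof (rule tendsto0I)
  fix t
  show "0 <= dd (dq (%t. T (ga t)) t) (T z)"
   unfolding e using z dq_in[of ga t, OF ga] by (intro dd_nonneg T)
  show "dd (dq (%t. T (ga t)) t) (T z) <= K * dd (dq ga t) z"
   unfolding e using Td[OF dq_in[of ga t, OF ga] z] T(4)[OF cdiff_in[OF dq_in[of ga t, OF ga] z]] by simp
 qed
 then show ?thesis using T(1)[OF z] by (simp add: hc_iff)
qed

lemma functional_deriv:
 assumes ga: "!!t. ga t : W" and d: "has_cderiv_at0 V p ga z"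
  and T: "!!a b. a : W ==> b : W ==> T (add2 a b) = T a + T b"
   "!!a c. a : W ==> T (sc c a) = c * T a" "!!a. a : W ==> cmod (T a) <= K * cnorm p a"
 shows "((%t. T (ga t)) has_vector_derivative T z) (at 0)"
proof -
 have z: "z : W" using d by (simp add: hc_iff)
 have Td: "T (cdiff V p a b) = T a - T b" if "a : W" "b : W" for a b
  using that by (simp add: cdiff_eq T sc_in)
 have "((%t. K * dd (dq ga t) z) \<longlongrightarrow> 0) (at 0)"
  using tendsto_mult_right_zero[of "%t. dd (dq ga t) z" "at 0" K] d by (simp add: hc_iff)
 moreover have "\<forall>\<^sub>F t in at 0. norm ((T (ga t) - T (ga 0) - t *\<^sub>R T z) /\<^sub>R \<bar>t\<bar>) <= K * dd (dq ga t) z"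
  unfolding eventually_at_filter
 proof (intro always_eventually allI impI)
  fix t :: real assume t: "t ~= 0"
  have "T (cdiff V p (dq ga t) z) = cor (1 / t) * (T (ga t) - T (ga 0)) - T z"
   using Td[OF dq_in[of ga t, OF ga] z] T(2)[OF cdiff_in[OF ga ga]] Td[OF ga ga] by simp
  also have "\<dots> = cor (1 / t) * (T (ga t) - T (ga 0) - t *\<^sub>R T z)"
   using t by (simp add: scaleR_conv_of_real field_simps)
  finally have "cmod (T (cdiff V p (dq ga t) z)) = cmod (T (ga t) - T (ga 0) - t *\<^sub>R T z) / \<bar>t\<bar>"
   by (simp only: norm_mult norm_of_real abs_divide abs_one) simp
  then show "norm ((T (ga t) - T (ga 0) - t *\<^sub>R T z) /\<^sub>R \<bar>t\<bar>) <= K * dd (dq ga t) z"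
   using T(3)[OF cdiff_in[OF dq_in[of ga t, OF ga] z]] by (simp add: divide_inverse_commute)
 qed
 ultimately have "((%t. (T (ga t) - T (ga 0) - t *\<^sub>R T z) /\<^sub>R \<bar>t\<bar>) \<longlongrightarrow> 0) (at 0)"
  by (rule Lim_null_comparison[rotated])
 then show ?thesis
  unfolding has_vector_derivative_def has_derivative_at_within
  by (simp add: bounded_linear_scaleR_left)
qed

text \<open>Product rule for a scalar function times a curve. The scalars will be entries of Ad,
  which vary along an orbit (\<open>LX_deriv\<close>).\<close>

lemma hc_scale:
 assumes ga: "!!t. ga t : W" and d: "has_cderiv_at0 V p ga z"
  and ka: "(ka has_vector_derivative ka') (at 0)"
 shows "has_cderiv_at0 V p (%t. sc (ka t) (ga t)) (add2 (sc ka' (ga 0)) (sc (ka 0) z))"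
proof -
 have z: "z : W" using d by (simp add: hc_iff)
 let ?k = "%t. cor (1 / t) * (ka t - ka 0)"
 have kl: "(?k \<longlongrightarrow> ka') (at 0)"
 proof -
  have l: "((%t. norm ((ka t - ka 0 - t *\<^sub>R ka') /\<^sub>R \<bar>t\<bar>)) \<longlongrightarrow> 0) (at 0)"
   using ka unfolding has_vector_derivative_def has_derivative_at_within by (intro tendsto_norm_zero) simp
  have "\<forall>\<^sub>F t in at 0. norm (?k t - ka') <= norm ((ka t - ka 0 - t *\<^sub>R ka') /\<^sub>R \<bar>t\<bar>)"
   unfolding eventually_at_filter
  proof (intro always_eventually allI impI)
   fix t :: real assume t: "t ~= 0"
   have "?k t - ka' = cor (1 / t) * (ka t - ka 0 - t *\<^sub>R ka')"
    using t by (simp add: scaleR_conv_of_real field_simps)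
   then have "norm (?k t - ka') = \<bar>1 / t\<bar> * norm (ka t - ka 0 - t *\<^sub>R ka')"
    by (simp only: norm_mult norm_of_real)
   also have "\<dots> = norm ((ka t - ka 0 - t *\<^sub>R ka') /\<^sub>R \<bar>t\<bar>)"
    by (simp add: divide_inverse)
   finally show "norm (?k t - ka') <= norm ((ka t - ka 0 - t *\<^sub>R ka') /\<^sub>R \<bar>t\<bar>)" by simp
  qed
  then have "((%t. ?k t - ka') \<longlongrightarrow> 0) (at 0)" using l by (rule Lim_null_comparison)
  then show ?thesis by (rule LIM_zero_cancel)
 qed
 have c: "((%t. dd (ga t) (ga 0)) \<longlongrightarrow> 0) (at 0)"
 proof -
  have "((%t. \<bar>t\<bar> * (cnorm p z + dd (dq ga t) z)) \<longlongrightarrow> \<bar>0\<bar> * (cnorm p z + 0)) (at 0)"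
   using d by (intro tendsto_intros) (simp add: hc_iff)
  then have "((%t. \<bar>t\<bar> * (cnorm p z + dd (dq ga t) z)) \<longlongrightarrow> 0) (at 0)" by simp
  then show ?thesis
  proof (rule tendsto0I)
   fix t
   show "0 <= dd (ga t) (ga 0)" by (intro dd_nonneg ga)
   show "dd (ga t) (ga 0) <= \<bar>t\<bar> * (cnorm p z + dd (dq ga t) z)"
   proof (cases "t = 0")
    case True
    then show ?thesis using dd_eq_0[OF ga ga, of 0 0] by simp
   next
    case False
    have "cnorm p (dq ga t) = dd (ga t) (ga 0) / \<bar>t\<bar>"
     using cnorm_sc[OF cdiff_in[OF ga ga], of "cor (1 / t)" t 0] by (simp add: norm_divide)
    moreover have "cnorm p (dq ga t) <= cnorm p z + dd (dq ga t) z" by (intro cnorm_le_dd dq_in ga z)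
    ultimately have "dd (ga t) (ga 0) / \<bar>t\<bar> <= cnorm p z + dd (dq ga t) z" by (simp only:)
    then show ?thesis using False by (simp only: pos_divide_le_eq zero_less_abs_iff mult.commute[of _ "\<bar>t\<bar>"] not_False_eq_True)
   qed
  qed
 qed
 have e: "dd (dq (%t. sc (ka t) (ga t)) t) (add2 (sc ka' (ga 0)) (sc (ka 0) z))
  <= (cmod (?k t) * dd (ga t) (ga 0) + cmod (?k t - ka') * cnorm p (ga 0)) + cmod (ka 0) * dd (dq ga t) z" for t
 proof -
  obtain x where x: "x : C" "ga t = cls V p x" using ga by (meson W_cases)
  obtain y where y: "y : C" "ga 0 = cls V p y" using ga by (meson W_cases)
  have e0: "dq (%t. sc (ka t) (ga t)) t = add2 (sc (?k t) (ga t)) (sc (ka 0) (dq ga t))"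
   unfolding x(2) y(2) using x(1) y(1)
   by (simp add: cls_simps) (rule arg_cong[where f="cls V p"], simp add: fun_eq_iff algebra_simps diff_divide_distrib)
  have "dd (add2 (sc (?k t) (ga t)) (sc (ka 0) (dq ga t))) (add2 (sc ka' (ga 0)) (sc (ka 0) z))
   <= dd (sc (?k t) (ga t)) (sc ka' (ga 0)) + dd (sc (ka 0) (dq ga t)) (sc (ka 0) z)"
   by (intro dd_add2 sc_in dq_in ga z)
  moreover have "dd (sc (?k t) (ga t)) (sc ka' (ga 0)) <= dd (sc (?k t) (ga t)) (sc (?k t) (ga 0)) + dd (sc (?k t) (ga 0)) (sc ka' (ga 0))"
   by (intro dd_tri sc_in ga)
  moreover have "dd (sc (?k t) (ga 0)) (sc ka' (ga 0)) = cmod (?k t - ka') * cnorm p (ga 0)"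
  proof -
   have "cdiff V p (sc (?k t) (ga 0)) (sc ka' (ga 0)) = sc (?k t - ka') (ga 0)"
    unfolding y(2) using y(1)
    by (simp only: cls_simps) (rule arg_cong[where f="cls V p"], simp add: fun_eq_iff algebra_simps)
   then show ?thesis by (simp only: cnorm_sc ga)
  qed
  moreover have "dd (sc (?k t) (ga t)) (sc (?k t) (ga 0)) = cmod (?k t) * dd (ga t) (ga 0)" by (intro dd_sc ga)
  moreover have "dd (sc (ka 0) (dq ga t)) (sc (ka 0) z) = cmod (ka 0) * dd (dq ga t) z" by (intro dd_sc dq_in ga z)
  ultimately show ?thesis unfolding e0 by linarith
 qed
 have "((%t. (cmod (?k t) * dd (ga t) (ga 0) + cmod (?k t - ka') * cnorm p (ga 0)) + cmod (ka 0) * dd (dq ga t) z)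
  \<longlongrightarrow> (cmod ka' * 0 + cmod (ka' - ka') * cnorm p (ga 0)) + cmod (ka 0) * 0) (at 0)"
  using d by (intro tendsto_intros kl c) (simp add: hc_iff)
 then have "((%t. (cmod (?k t) * dd (ga t) (ga 0) + cmod (?k t - ka') * cnorm p (ga 0)) + cmod (ka 0) * dd (dq ga t) z)
  \<longlongrightarrow> 0) (at 0)" by simp
 then have "((%t. dd (dq (%t. sc (ka t) (ga t)) t) (add2 (sc ka' (ga 0)) (sc (ka 0) z))) \<longlongrightarrow> 0) (at 0)"
  by (rule tendsto0I[OF _ _ e]) (intro dd_nonneg sc_in add2_in cdiff_in ga z)
 moreover have "add2 (sc ka' (ga 0)) (sc (ka 0) z) : W" by (intro add2_in sc_in ga z)
 ultimately show ?thesis by (simp add: hc_iff)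
qed

end

section \<open>Representations on the completion\<close>

lemma mat2_right_mult_cont:
 fixes h g :: mat2
 assumes "e > 0"
 shows "\<exists>d>0. \<forall>g'. dist g' g < d --> dist (g' ** h) (g ** h) < e"
proof -
 have "continuous_on UNIV (%x::mat2. x ** h)" by (intro mat2_mult_cont continuous_on_id continuous_on_const)
 then have "isCont (%x::mat2. x ** h) g" by (simp add: continuous_on_eq_continuous_at)
 then show ?thesis using assms unfolding continuous_at_eps_delta by blast
qed

lemma closed_SL2_ball: "compact {g : SL2. norm g <= R}"
proof -
 have "closed {g :: mat2. g$1$1 * g$2$2 - g$1$2 * g$2$1 = 1}"
  by (intro closed_Collect_eq continuous_intros)
 moreover have "{g : SL2. norm g <= R} = cball 0 R \<inter> {g. g$1$1 * g$2$2 - g$1$2 * g$2$1 = 1}"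
  by (auto simp: SL2_iff)
 ultimately show ?thesis by (simp add: compact_Int_closed)
qed

locale glob =
 fixes lam :: complex and p :: "fn => real" and rh :: "mat2 => cvec => cvec"
 assumes G: "globalization (Vs lam) p rh"

sublocale glob \<subseteq> nspace "Vs lam" p
 using G by unfold_locales (auto simp: globalization_def)

context glob
begin

abbreviation "V \<equiv> Vs lam"

lemma rep_facts: "continuous_rep V p rh"
 using G by (simp add: globalization_def)

lemma rh_in [intro]: "g : SL2 ==> a : W ==> rh g a : W"
 and rh_add: "g : SL2 ==> a : W ==> b : W ==> rh g (add2 a b) = add2 (rh g a) (rh g b)"
 and rh_sc: "g : SL2 ==> a : W ==> rh g (sc c a) = sc c (rh g a)"
 and rh_one: "a : W ==> rh (mat 1) a = a"
 and rh_mult: "g : SL2 ==> h : SL2 ==> a : W ==> rh (g ** h) a = rh g (rh h a)"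
 and rh_joint: "g : SL2 ==> a : W ==> e > 0 ==>
  \<exists>d>0. \<forall>h\<in>SL2. \<forall>b\<in>W. dist h g < d & dd b a < d --> dd (rh h b) (rh g a) < e"
 using rep_facts unfolding continuous_rep_def by meson+

lemma rh_K: "k : SO2 ==> v : V ==> rh k (em v) = em (act k v)"
 and rh_lie: "X : sl2 ==> v : V ==> has_cderiv_at0 V p (%t. rh (mxp t X) (em v)) (em (lie_act X v))"
 and rh_Kfin: "K_finite_vectors V p rh = em ` V"
 using G unfolding globalization_def by blast+

lemma rh_cdiff: "g : SL2 ==> a : W ==> b : W ==> rh g (cdiff V p a b) = cdiff V p (rh g a) (rh g b)"
 by (simp add: cdiff_eq rh_add rh_sc sc_in rh_in)

lemma rh_em_in [intro]: "g : SL2 ==> v : V ==> rh g (em v) : W"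
 by (intro rh_in emb_in)

lemma em0:
 assumes "a : W" shows "em 0 = sc 0 a"
proof -
 obtain x where x: "x : C" "a = cls V p x" using assms by (rule W_cases)
 show ?thesis unfolding x(2) cscale_cls[OF x(1)] emb_def by (simp add: scaleF_simps)
qed

lemma cdiff_em0: "a : W ==> cdiff V p a (em 0) = a"
 by (elim W_cases) (simp add: emb_def cls_simps V_zero)

lemma rh_em0: "g : SL2 ==> rh g (em 0) = em 0"
 using em0[OF emb_in[OF V_zero]] em0[OF rh_in[OF _ emb_in[OF V_zero]], of g] rh_sc[OF _ emb_in[OF V_zero], of g 0] by simp

text \<open>Joint continuity at (g, 0) bounds the operators near g by 1 on vectors of norm below d;
  homogeneity turns this into the operator bound 2/d.\<close>

lemma local_op_bound:
 assumes g: "g : SL2"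
 shows "\<exists>d>0. \<exists>K\<ge>0. \<forall>h\<in>SL2. dist h g < d --> (\<forall>a\<in>W. cnorm p (rh h a) <= K * cnorm p a)"
proof -
 have z: "em 0 : W" by (intro emb_in V_zero)
 obtain d where d: "d > 0" "!!h b. h : SL2 ==> b : W ==> dist h g < d ==> dd b (em 0) < d ==> dd (rh h b) (rh g (em 0)) < 1"
  using rh_joint[OF g z, of 1] by auto
 have 1: "cnorm p (rh h b) < 1" if "h : SL2" "b : W" "dist h g < d" "cnorm p b < d" for h b
  using d(2)[OF that(1-3)] that by (simp add: cdiff_em0 rh_em0 g rh_in)
 have "cnorm p (rh h a) <= 2 / d * cnorm p a" if h: "h : SL2" "dist h g < d" and a: "a : W" for h a
 proof (rule ccontr)
  assume n: "\<not> ?thesis"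
  define N where "N = cnorm p (rh h a)"
  have Np: "N > 0" using n cnorm_nonneg[OF a] d(1) unfolding N_def
   by (meson dual_order.strict_trans1 mult_nonneg_nonneg divide_nonneg_pos not_le zero_le_numeral)
  have "cnorm p a * 2 < N * d" using n d(1) unfolding N_def by (simp add: field_simps)
  then have "1 / N * cnorm p a < d" using Np cnorm_nonneg[OF a] d(1) by (simp add: field_simps)
  then have "cnorm p (sc (cor (1 / N)) a) < d" using Np by (simp add: cnorm_sc[OF a] norm_divide)
  then have "cnorm p (rh h (sc (cor (1 / N)) a)) < 1" by (intro 1 h sc_in a)
  moreover have "cnorm p (rh h (sc (cor (1 / N)) a)) = 1"
   unfolding rh_sc[OF h(1) a] cnorm_sc[OF rh_in[OF h(1) a]] using Np by (simp add: N_def norm_divide)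
  ultimately show False by simp
 qed
 then show ?thesis using d(1) by (intro exI[of _ d] conjI exI[of _ "2/d"]) auto
qed

lemma op_bound_compact: "\<exists>K\<ge>0. \<forall>h\<in>SL2. norm h <= R --> (\<forall>a\<in>W. cnorm p (rh h a) <= K * cnorm p a)"
proof -
 let ?S = "{g : SL2. norm g <= R}"
 obtain d K where dK: "!!g. g : SL2 ==> d g > 0" "!!g. g : SL2 ==> K g >= 0"
  "!!g h a. g : SL2 ==> h : SL2 ==> dist h g < d g ==> a : W ==> cnorm p (rh h a) <= K g * cnorm p a"
  using local_op_bound by metis
 obtain T where T: "T \<subseteq> ?S" "finite T" "?S \<subseteq> (\<Union>g\<in>T. ball g (d g))"
  by (rule compactE_image[OF closed_SL2_ball[of R], of ?S "%g. ball g (d g)"]) (use dK(1) in auto)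
 have "cnorm p (rh h a) <= (\<Sum>g\<in>T. K g) * cnorm p a" if h: "h : SL2" "norm h <= R" and a: "a : W" for h a
 proof -
  obtain g where g: "g : T" "h : ball g (d g)" using T(3) h by blast
  then have "cnorm p (rh h a) <= K g * cnorm p a" using T(1) h a by (intro dK(3)) (auto simp: dist_commute)
  also have "\<dots> <= (\<Sum>g\<in>T. K g) * cnorm p a"
   using T dK(2) g by (intro mult_right_mono cnorm_nonneg a member_le_sum) auto
  finally show ?thesis .
 qed
 moreover have "(\<Sum>g\<in>T. K g) >= 0" using T dK(2) by (intro sum_nonneg) auto
 ultimately show ?thesis by blast
qed

lemma op_bound: "g : SL2 ==> \<exists>K\<ge>0. \<forall>a\<in>W. cnorm p (rh g a) <= K * cnorm p a"
 using op_bound_compact[of "norm g"] by blast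

lemma hc_rh:
 assumes "g : SL2" "!!t. ga t : W" "has_cderiv_at0 V p ga z"
 shows "has_cderiv_at0 V p (%t. rh g (ga t)) (rh g z)"
proof -
 obtain K where K: "!!a. a : W ==> cnorm p (rh g a) <= K * cnorm p a" using op_bound[OF assms(1)] by blast
 show ?thesis by (rule hc_linear_map[OF assms(2,3) rh_in[OF assms(1)] rh_add[OF assms(1)] rh_sc[OF assms(1)] K])
qed

lemma rh_right_deriv:
 assumes "g : SL2" "X : sl2" "v : V"
 shows "has_cderiv_at0 V p (%t. rh (g ** mxp t X) (em v)) (rh g (em (lie_act X v)))"
proof -
 have "(%t. rh (g ** mxp t X) (em v)) = (%t. rh g (rh (mxp t X) (em v)))"
  using assms by (intro ext rh_mult mexp_scale_SL2 emb_in)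
 then show ?thesis using hc_rh[OF assms(1) _ rh_lie[OF assms(2,3)]] assms by (simp only: rh_in emb_in mexp_scale_SL2)
qed

lemma functional_family:
 assumes T: "!!a b. a : W ==> b : W ==> T (add2 a b) = T a + T b"
  "!!a c. a : W ==> T (sc c a) = c * T a" "!!a. a : W ==> cmod (T a) <= K * cnorm p a" and K: "K >= 0"
 shows "lb_family lam (%g v. T (rh g (em v)))"
proof
 fix g v w assume g: "g : SL2" and v: "v : V"
 show "T (rh g (em (v + w))) = T (rh g (em v)) + T (rh g (em w))" if w: "w : V"
  using g v w by (simp only: emb_add[symmetric] rh_add emb_in T(1) rh_in)
 show "T (rh g (em (scaleF c v))) = c * T (rh g (em v))" for c
  using g v by (simp only: emb_scale[symmetric] rh_sc emb_in T(2) rh_in)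
 show "((%t. T (rh (g ** mxp t X) (em v))) has_vector_derivative T (rh g (em (lie_act X v)))) (at 0)" if X: "X : sl2" for X
  by (rule functional_deriv[OF _ rh_right_deriv[OF g X v] T]) (use g X v in \<open>auto intro!: rh_em_in SL2_mult\<close>)
next
 fix v and R :: real assume v: "v : V"
 obtain L where L: "L >= 0" "!!h a. h : SL2 ==> norm h <= R ==> a : W ==> cnorm p (rh h a) <= L * cnorm p a"
  using op_bound_compact[of R] by blast
 have "cmod (T (rh g (em v))) <= K * (L * p v)" if "g : SL2" "norm g <= R" for g
 proof -
  have "cmod (T (rh g (em v))) <= K * cnorm p (rh g (em v))" using that v by (intro T rh_em_in)
  also have "\<dots> <= K * (L * p v)" using L(2)[OF that emb_in[OF v]] K by (intro mult_left_mono) (simp_all add: cnorm_emb v)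
  finally show ?thesis .
 qed
 then show "\<exists>B. \<forall>g\<in>SL2. norm g <= R --> cmod (T (rh g (em v))) <= B" by blast
qed

subsection \<open>Smooth vectors\<close>

abbreviation "S \<equiv> smooth_vectors V p rh"
abbreviation "Ld X a \<equiv> lie_deriv V p rh X a"
abbreviation "LX Xs a \<equiv> foldr (lie_deriv V p rh) Xs a"

lemma Ck_cong:
 assumes "!!g. g : SL2 ==> F g = F2 g" "Ck_group k V p F" shows "Ck_group k V p F2"
proof -
 have c: "C0_group V p F ==> C0_group V p F2" using assms(1) unfolding C0_group_def by simp
 have e: "(%t. F (g ** mxp t X)) = (%t. F2 (g ** mxp t X))" if "g : SL2" "X : sl2" for g X
  using that by (intro ext assms(1) SL2_mult mexp_scale_SL2)
 show ?thesis
 proof (cases k)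
  case 0
  then show ?thesis using c assms(2) by simp
 next
  case (Suc n)
  show ?thesis unfolding Suc Ck_group.simps
  proof (intro conjI ballI)
   show "C0_group V p F2" using c assms(2) Suc by simp
   fix X assume X: "X : sl2"
   then obtain F' where F': "Ck_group n V p F'" "!!g. g : SL2 ==> has_cderiv_at0 V p (%t. F (g ** mxp t X)) (F' g)"
    using assms(2) Suc by auto
   show "\<exists>F'. Ck_group n V p F' & (\<forall>g\<in>SL2. has_cderiv_at0 V p (%t. F2 (g ** mxp t X)) (F' g))"
    using F'(1) F'(2)[unfolded e[OF _ X]] by (intro exI[of _ F'] conjI ballI) (use F'(2) e[OF _ X] in metis)+
  qed
 qed
qed

lemma C0_in: "C0_group V p F ==> g : SL2 ==> F g : W"
 by (simp add: C0_group_def)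

lemma sc_add2: "a : W ==> b : W ==> sc c (add2 a b) = add2 (sc c a) (sc c b)"
 by (elim W_cases) (simp add: cls_simps scaleF_simps)

lemma sc_comm: "a : W ==> sc c (sc d a) = sc d (sc c a)"
 by (elim W_cases) (simp add: cls_simps scaleF_simps mult.commute)

lemma hc_sc:
 assumes "!!t. ga t : W" "has_cderiv_at0 V p ga z"
 shows "has_cderiv_at0 V p (%t. sc c (ga t)) (sc c z)"
 by (rule hc_linear_map[where K="cmod c", OF assms]) (simp_all add: sc_in sc_add2 sc_comm cnorm_sc)

lemma C0_D: "C0_group V p F ==> g : SL2 ==> e > 0 ==> \<exists>d>0. \<forall>h\<in>SL2. dist h g < d --> dd (F h) (F g) < e"
 by (simp add: C0_group_def)

lemma C0_I: "(!!g. g : SL2 ==> F g : W) ==>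
  (!!g e. g : SL2 ==> e > 0 ==> \<exists>d>0. \<forall>h\<in>SL2. dist h g < d --> dd (F h) (F g) < e) ==> C0_group V p F"
 by (simp add: C0_group_def)

lemma C0_add:
 assumes F: "C0_group V p F" and F2: "C0_group V p F2" shows "C0_group V p (%g. add2 (F g) (F2 g))"
proof (rule C0_I)
 fix g and e :: real assume g: "g : SL2" and e: "e > 0"
 then have e2: "e / 2 > 0" by simp
 obtain d where d: "d > 0" "!!h. h : SL2 ==> dist h g < d ==> dd (F h) (F g) < e/2" using C0_D[OF F g e2] by blast
 obtain d' where d': "d' > 0" "!!h. h : SL2 ==> dist h g < d' ==> dd (F2 h) (F2 g) < e/2" using C0_D[OF F2 g e2] by blast
 have "dd (add2 (F h) (F2 h)) (add2 (F g) (F2 g)) < e" if h: "h : SL2" "dist h g < min d d'" for h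
 proof -
  have "dd (add2 (F h) (F2 h)) (add2 (F g) (F2 g)) <= dd (F h) (F g) + dd (F2 h) (F2 g)"
   by (intro dd_add2 C0_in[OF F] C0_in[OF F2] g h)
  then show ?thesis using d(2)[of h] d'(2)[of h] h by simp
 qed
 then show "\<exists>d>0. \<forall>h\<in>SL2. dist h g < d --> dd (add2 (F h) (F2 h)) (add2 (F g) (F2 g)) < e"
  using d(1) d'(1) by (intro exI[of _ "min d d'"]) simp
qed (intro add2_in C0_in[OF F] C0_in[OF F2])

lemma C0_sc:
 assumes F: "C0_group V p F" shows "C0_group V p (%g. sc c (F g))"
proof (rule C0_I)
 fix g and e :: real assume g: "g : SL2" and e: "e > 0"
 have c: "cmod c + 1 > 0" by (intro add_nonneg_pos) auto
 then have e2: "e / (cmod c + 1) > 0" using e by simp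
 obtain d where d: "d > 0" "!!h. h : SL2 ==> dist h g < d ==> dd (F h) (F g) < e / (cmod c + 1)" using C0_D[OF F g e2] by blast
 have "dd (sc c (F h)) (sc c (F g)) < e" if h: "h : SL2" "dist h g < d" for h
 proof -
  have "dd (sc c (F h)) (sc c (F g)) = cmod c * dd (F h) (F g)" by (intro dd_sc C0_in[OF F] g h)
  also have "\<dots> <= (cmod c + 1) * dd (F h) (F g)" by (intro mult_right_mono dd_nonneg C0_in[OF F] g h) simp
  also have "\<dots> < (cmod c + 1) * (e / (cmod c + 1))" using d(2)[OF h] c by (rule mult_strict_left_mono)
  finally show ?thesis using c by simp
 qed
 then show "\<exists>d>0. \<forall>h\<in>SL2. dist h g < d --> dd (sc c (F h)) (sc c (F g)) < e" using d(1) by blast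
qed (intro sc_in C0_in[OF F])

lemma C0_right:
 assumes F: "C0_group V p F" and h: "h : SL2" shows "C0_group V p (%g. F (g ** h))"
proof (rule C0_I)
 fix g and e :: real assume g: "g : SL2" and e: "e > 0"
 obtain d where d: "d > 0" "!!g'. g' : SL2 ==> dist g' (g ** h) < d ==> dd (F g') (F (g ** h)) < e"
  using C0_D[OF F SL2_mult[OF g h] e] by blast
 obtain d' where d': "d' > 0" "!!g'. dist g' g < d' ==> dist (g' ** h) (g ** h) < d"
  using mat2_right_mult_cont[OF d(1)] by blast
 show "\<exists>d>0. \<forall>g'\<in>SL2. dist g' g < d --> dd (F (g' ** h)) (F (g ** h)) < e"
  using d'(1) by (intro exI[of _ d'] conjI ballI impI d(2) d'(2) SL2_mult h)
qed (intro C0_in[OF F] SL2_mult h)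

lemma Ck_Suc: "Ck_group (Suc k) V p F ==> X : sl2 ==>
  \<exists>F'. Ck_group k V p F' & (\<forall>g\<in>SL2. has_cderiv_at0 V p (%t. F (g ** mxp t X)) (F' g))"
 by (simp only: Ck_group.simps)

lemma Ck_add: "Ck_group k V p F ==> Ck_group k V p F2 ==> Ck_group k V p (%g. add2 (F g) (F2 g))"
proof (induction k arbitrary: F F2)
 case (Suc k)
 show ?case unfolding Ck_group.simps
 proof (intro conjI ballI)
  show "C0_group V p (%g. add2 (F g) (F2 g))" using Suc.prems by (intro C0_add) auto
  fix X assume X: "X : sl2"
  obtain F' where F': "Ck_group k V p F'" "!!g. g : SL2 ==> has_cderiv_at0 V p (%t. F (g ** mxp t X)) (F' g)"
   using Ck_Suc[OF Suc.prems(1) X] by blast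
  obtain F2' where F2': "Ck_group k V p F2'" "!!g. g : SL2 ==> has_cderiv_at0 V p (%t. F2 (g ** mxp t X)) (F2' g)"
   using Ck_Suc[OF Suc.prems(2) X] by blast
  show "\<exists>F'. Ck_group k V p F' & (\<forall>g\<in>SL2. has_cderiv_at0 V p (%t. add2 (F (g ** mxp t X)) (F2 (g ** mxp t X))) (F' g))"
  proof (intro exI[of _ "%g. add2 (F' g) (F2' g)"] conjI ballI)
   show "Ck_group k V p (%g. add2 (F' g) (F2' g))" by (rule Suc.IH[OF F'(1) F2'(1)])
   fix g assume g: "g : SL2"
   show "has_cderiv_at0 V p (%t. add2 (F (g ** mxp t X)) (F2 (g ** mxp t X))) (add2 (F' g) (F2' g))"
    by (rule hc_add[OF _ _ F'(2)[OF g] F2'(2)[OF g]])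
     (use g X Suc.prems in \<open>auto intro!: C0_in SL2_mult mexp_scale_SL2\<close>)
  qed
 qed
qed (simp add: C0_add)

lemma Ck_sc: "Ck_group k V p F ==> Ck_group k V p (%g. sc c (F g))"
proof (induction k arbitrary: F)
 case (Suc k)
 show ?case unfolding Ck_group.simps
 proof (intro conjI ballI)
  show "C0_group V p (%g. sc c (F g))" using Suc.prems by (intro C0_sc) auto
  fix X assume X: "X : sl2"
  obtain F' where F': "Ck_group k V p F'" "!!g. g : SL2 ==> has_cderiv_at0 V p (%t. F (g ** mxp t X)) (F' g)"
   using Ck_Suc[OF Suc.prems(1) X] by blast
  show "\<exists>F'. Ck_group k V p F' & (\<forall>g\<in>SL2. has_cderiv_at0 V p (%t. sc c (F (g ** mxp t X))) (F' g))"
  proof (intro exI[of _ "%g. sc c (F' g)"] conjI ballI)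
   show "Ck_group k V p (%g. sc c (F' g))" by (rule Suc.IH[OF F'(1)])
   fix g assume g: "g : SL2"
   show "has_cderiv_at0 V p (%t. sc c (F (g ** mxp t X))) (sc c (F' g))"
    by (rule hc_sc[OF _ F'(2)[OF g]])
     (use g X Suc.prems in \<open>auto intro!: C0_in SL2_mult mexp_scale_SL2\<close>)
  qed
 qed
qed (simp add: C0_sc)

text \<open>Right translation by h exchanges the derivative along X for the one along Ad(h^-1) X, so
  quantifying over all of \<open>sl2\<close> in \<open>Ck_group\<close> makes the class
  invariant.\<close>

lemma Ck_right: "Ck_group k V p F ==> h : SL2 ==> Ck_group k V p (%g. F (g ** h))"
proof (induction k arbitrary: F)
 case (Suc k)
 show ?case unfolding Ck_group.simps
 proof (intro conjI ballI)
  show "C0_group V p (%g. F (g ** h))" using Suc.prems by (intro C0_right) auto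
  fix X assume X: "X : sl2"
  have X': "Ad (adj2 h) X : sl2" by (intro Ad_sl2 adj2_SL2 Suc.prems X)
  obtain F' where F': "Ck_group k V p F'" "!!g. g : SL2 ==> has_cderiv_at0 V p (%t. F (g ** mexp (t *\<^sub>R Ad (adj2 h) X))) (F' g)"
   using Ck_Suc[OF Suc.prems(1) X'] by blast
  show "\<exists>F'. Ck_group k V p F' & (\<forall>g\<in>SL2. has_cderiv_at0 V p (%t. F (g ** mxp t X ** h)) (F' g))"
  proof (intro exI[of _ "%g. F' (g ** h)"] conjI ballI)
   show "Ck_group k V p (%g. F' (g ** h))" by (rule Suc.IH[OF F'(1) Suc.prems(2)])
   fix g assume g: "g : SL2"
   have "g ** mxp t X ** h = (g ** h) ** mexp (t *\<^sub>R Ad (adj2 h) X)" for t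
    by (simp only: matrix_mul_assoc[symmetric] mexp_right_Ad[OF Suc.prems(2) X])
   then show "has_cderiv_at0 V p (%t. F (g ** mxp t X ** h)) (F' (g ** h))"
    using F'(2)[OF SL2_mult[OF g Suc.prems(2)]] by (simp only:)
  qed
 qed
qed (simp add: C0_right)

lemma C0_orbit:
 assumes a: "a : W" shows "C0_group V p (%g. rh g a)"
proof (rule C0_I)
 fix g and e :: real assume g: "g : SL2" and e: "e > 0"
 obtain d where d: "d > 0" "\<forall>h\<in>SL2. \<forall>b\<in>W. dist h g < d & dd b a < d --> dd (rh h b) (rh g a) < e"
  using rh_joint[OF g a e] by blast
 have "dd a a < d" using dd_eq_0[OF a a] d(1) by simp
 then show "\<exists>d>0. \<forall>h\<in>SL2. dist h g < d --> dd (rh h a) (rh g a) < e"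
  using d a by (intro exI[of _ d]) simp
qed (intro rh_in a)

lemma S_iff: "a : S \<longleftrightarrow> a : W & (\<forall>k. Ck_group k V p (%g. rh g a))"
 by (simp add: smooth_vectors_def)

lemma S_W: "a : S ==> a : W" by (simp add: S_iff)

lemma S_Ck: "a : S ==> Ck_group k V p (%g. rh g a)" by (simp add: S_iff)

lemma S_I: "a : W ==> (!!k. Ck_group k V p (%g. rh g a)) ==> a : S" by (simp add: S_iff)

lemma S_add:
 assumes a: "a : S" and b: "b : S" shows "add2 a b : S"
proof (rule S_I[OF add2_in[OF S_W[OF a] S_W[OF b]]])
 show "Ck_group k V p (%g. rh g (add2 a b))" for k
  by (rule Ck_cong[OF _ Ck_add[OF S_Ck[OF a] S_Ck[OF b]]]) (simp only: rh_add S_W a b)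
qed

lemma S_sc:
 assumes a: "a : S" shows "sc c a : S"
proof (rule S_I[OF sc_in[OF S_W[OF a]]])
 show "Ck_group k V p (%g. rh g (sc c a))" for k
  by (rule Ck_cong[OF _ Ck_sc[OF S_Ck[OF a]]]) (simp only: rh_sc S_W a)
qed

lemma S_rh:
 assumes a: "a : S" and h: "h : SL2" shows "rh h a : S"
proof (rule S_I[OF rh_in[OF h S_W[OF a]]])
 show "Ck_group k V p (%g. rh g (rh h a))" for k
  by (rule Ck_cong[OF _ Ck_right[OF S_Ck[OF a] h]]) (simp only: rh_mult S_W a h)
qed

text \<open>The derivative of the orbit map of v along X is the orbit map of
  \<open>lie_act X v\<close>, again from \<open>Vs lam\<close>; hence the induction on the
  order.\<close>

lemma S_em: "v : V ==> em v : S"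
proof (rule S_I[OF emb_in])
 fix k show "v : V ==> Ck_group k V p (%g. rh g (em v))"
 proof (induction k arbitrary: v)
  case (Suc k)
  show ?case unfolding Ck_group.simps
  proof (intro conjI ballI)
   show "C0_group V p (%g. rh g (em v))" by (intro C0_orbit emb_in Suc.prems)
   fix X assume X: "X : sl2"
   show "\<exists>F'. Ck_group k V p F' & (\<forall>g\<in>SL2. has_cderiv_at0 V p (%t. rh (g ** mxp t X) (em v)) (F' g))"
    by (intro exI[of _ "%g. rh g (em (lie_act X v))"] conjI ballI Suc.IH lie_act_Vs Suc.prems X rh_right_deriv)
  qed
 qed (simp add: C0_orbit emb_in)
qed

lemma Ld_eq: "a : W ==> X : sl2 ==> has_cderiv_at0 V p (%t. rh (mxp t X) a) z ==> Ld X a = z"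
 unfolding lie_deriv_def
 by (rule the_equality, assumption, rule hc_unique[of "%t. rh (mxp t X) a"]; (intro rh_in mexp_scale_SL2)?; assumption)

lemma S_hc:
 assumes a: "a : S" and X: "X : sl2"
 shows "has_cderiv_at0 V p (%t. rh (mxp t X) a) (Ld X a)"
proof -
 obtain F' where "\<forall>g\<in>SL2. has_cderiv_at0 V p (%t. rh (g ** mxp t X) a) (F' g)"
  using Ck_Suc[OF S_Ck[OF a] X, of 0] by (elim exE conjE)
 from bspec[OF this SL2_one] have "has_cderiv_at0 V p (%t. rh (mxp t X) a) (F' (mat 1))" by (simp only: matrix_mul_lid)
 then show ?thesis using Ld_eq[OF S_W[OF a] X] by simp
qed

lemma S_Ld:
 assumes a: "a : S" and X: "X : sl2" shows "Ld X a : S"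
proof (rule S_I)
 show L: "Ld X a : W" using S_hc[OF assms] by (simp add: hc_iff)
 fix k
 obtain F' where F': "Ck_group k V p F'" "\<forall>g\<in>SL2. has_cderiv_at0 V p (%t. rh (g ** mxp t X) a) (F' g)"
  using Ck_Suc[OF S_Ck[OF a] X, of k] by (elim exE conjE)
 have "F' g = rh g (Ld X a)" if g: "g : SL2" for g
 proof -
  have "(%t. rh (g ** mxp t X) a) = (%t. rh g (rh (mxp t X) a))"
   using g X S_W[OF a] by (intro ext rh_mult mexp_scale_SL2)
  then have "has_cderiv_at0 V p (%t. rh (g ** mxp t X) a) (rh g (Ld X a))"
   using hc_rh[OF g _ S_hc[OF a X]] X S_W[OF a] by (simp only: rh_in mexp_scale_SL2)
  then show ?thesis
   by (intro hc_unique[OF _ bspec[OF F'(2) g]] rh_in SL2_mult g mexp_scale_SL2 X S_W[OF a])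
 qed
 then show "Ck_group k V p (%g. rh g (Ld X a))" using F'(1) by (rule Ck_cong)
qed

lemma Ld_add:
 assumes "a : S" "b : S" "X : sl2" shows "Ld X (add2 a b) = add2 (Ld X a) (Ld X b)"
proof (rule Ld_eq)
 have "(%t. rh (mxp t X) (add2 a b)) = (%t. add2 (rh (mxp t X) a) (rh (mxp t X) b))"
  using assms S_W by (intro ext rh_add mexp_scale_SL2)
 then show "has_cderiv_at0 V p (%t. rh (mxp t X) (add2 a b)) (add2 (Ld X a) (Ld X b))"
  using hc_add[OF _ _ S_hc[OF assms(1,3)] S_hc[OF assms(2,3)]] assms S_W by (simp only: rh_in mexp_scale_SL2)
qed (use assms S_W in auto)

lemma Ld_sc:
 assumes "a : S" "X : sl2" shows "Ld X (sc c a) = sc c (Ld X a)"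
proof (rule Ld_eq)
 have "(%t. rh (mxp t X) (sc c a)) = (%t. sc c (rh (mxp t X) a))"
  using assms S_W by (intro ext rh_sc mexp_scale_SL2)
 then show "has_cderiv_at0 V p (%t. rh (mxp t X) (sc c a)) (sc c (Ld X a))"
  using hc_sc[OF _ S_hc[OF assms]] assms S_W by (simp only: rh_in mexp_scale_SL2)
qed (use assms S_W in auto)

lemma LX_S: "a : S ==> Xs : lists sl2 ==> LX Xs a : S"
 by (induction Xs) (auto intro: S_Ld)

lemma LX_add: "a : S ==> b : S ==> Xs : lists sl2 ==> LX Xs (add2 a b) = add2 (LX Xs a) (LX Xs b)"
 by (induction Xs) (auto simp: Ld_add LX_S)

lemma LX_sc: "a : S ==> Xs : lists sl2 ==> LX Xs (sc c a) = sc c (LX Xs a)"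
 by (induction Xs) (auto simp: Ld_sc LX_S)

lemma S_orbit: "h : SL2 ==> v : V ==> rh h (em v) : S"
 by (intro S_rh S_em)

text \<open>A derivation applied to g v is carried past g to v, where it becomes the explicit action
  on \<open>Vs lam\<close> in the direction Ad(g^-1) X.\<close>

lemma Ld_orbit:
 assumes "h : SL2" "X : sl2" "v : V"
 shows "Ld X (rh h (em v)) = rh h (em (lie_act (Ad (adj2 h) X) v))"
proof (rule Ld_eq)
 have "rh (mxp t X) (rh h (em v)) = rh (h ** mexp (t *\<^sub>R Ad (adj2 h) X)) (em v)" for t
  using assms by (simp only: rh_mult[symmetric] mexp_scale_SL2 emb_in mexp_right_Ad)
 then show "has_cderiv_at0 V p (%t. rh (mxp t X) (rh h (em v))) (rh h (em (lie_act (Ad (adj2 h) X) v)))"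
  using rh_right_deriv[OF assms(1) Ad_sl2[OF adj2_SL2[OF assms(1)] assms(2)] assms(3)] by (simp only:)
qed (use assms in auto)

end

section \<open>Orbits in the Frechet topology and distribution vectors\<close>

lemma lie_act_decomp:
 assumes v: "v : Vs lam" and X: "X : sl2"
 shows "lie_act X v = scaleF (cor (X$1$1)) (lie_act Hm v) + scaleF (cor (X$1$2)) (lie_act Em v)
  + scaleF (cor (X$2$1)) (lie_act Fm v)"
proof -
 have "lie_act X v = lie_act (1 *\<^sub>R (X$1$1 *\<^sub>R Hm + X$1$2 *\<^sub>R Em) + X$2$1 *\<^sub>R Fm) v"
  using sl2_decomp[OF X] by (simp only: scaleR_one)
 also have "\<dots> = scaleF (cor 1) (lie_act (X$1$1 *\<^sub>R Hm + X$1$2 *\<^sub>R Em) v) + scaleF (cor (X$2$1)) (lie_act Fm v)"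
  by (rule lie_act_linear_left[OF v]) auto
 also have "lie_act (X$1$1 *\<^sub>R Hm + X$1$2 *\<^sub>R Em) v = scaleF (cor (X$1$1)) (lie_act Hm v) + scaleF (cor (X$1$2)) (lie_act Em v)"
  by (rule lie_act_linear_left[OF v]) auto
 finally show ?thesis by (simp only: of_real_1 scaleF_simps mult_1)
qed

text \<open>With K = Ad(g^-1) X the curve is e^(-sZ) K e^(sZ), whose derivative at 0 is the
  commutator KZ - ZK.\<close>

lemma Ad_entry_deriv:
 assumes g: "g : SL2" and X: "X : sl2" and Z: "Z : sl2"
 shows "((%s. cor (Ad (adj2 (g ** mxp s Z)) X $ i $ j)) has_vector_derivative
  cor ((Ad (adj2 g) X ** Z - Z ** Ad (adj2 g) X) $ i $ j)) (at 0)"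
proof -
 let ?K = "Ad (adj2 g) X"
 have e: "Ad (adj2 (g ** mxp s Z)) X = adj2 (mxp s Z) ** ?K ** mxp s Z" for s
  by (simp add: Ad_def mat2_eq_iff adj2_def algebra_simps)
 have d: "((%s. mxp s Z $ i $ j) has_real_derivative Z $ i $ j) (at 0)" for i j
  using mexp_entry_deriv[OF Z, of i j 0] by (simp only: scaleR_zero_left mexp_0 matrix_mul_rid)
 have m0: "mexp (0 *\<^sub>R Z) = mat 1" by simp
 have gen: "((%s. (a s * k1 + b s * k2) * c s + (a s * k3 + b s * k4) * e s) has_real_derivative
   (a' * k1 + b' * k2) * c 0 + (a 0 * k1 + b 0 * k2) * c' + (a' * k3 + b' * k4) * e 0 + (a 0 * k3 + b 0 * k4) * e') (at 0)"
  if "(a has_real_derivative a') (at 0)" "(b has_real_derivative b') (at 0)" "(c has_real_derivative c') (at 0)"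
   "(e has_real_derivative e') (at 0)" for a b c e :: "real => real" and a' b' c' e' k1 k2 k3 k4
  by (auto intro!: derivative_eq_intros that simp: algebra_simps)
 have da: "((%s. adj2 (mxp s Z) $ i $ j) has_real_derivative adj2 Z $ i $ j) (at 0)" for i j
  using exhaust_2[of i] exhaust_2[of j] d DERIV_minus[OF d] by (elim disjE) (simp_all add: adj2_def)
 have a1: "adj2 (mat 1) = mat 1" "adj2 Z = - Z" using Z by (simp_all add: adj2_def mat2_eq_iff sl2_iff)
 have "((%s. Ad (adj2 (g ** mxp s Z)) X $ i $ j) has_real_derivative (?K ** Z - Z ** ?K) $ i $ j) (at 0)"
  unfolding e mat2_mult_entry
 proof (rule DERIV_cong[OF gen[OF da da d d]])
  show "(adj2 Z $ i $ 1 * ?K $ 1 $ 1 + adj2 Z $ i $ 2 * ?K $ 2 $ 1) * mexp (0 *\<^sub>R Z) $ 1 $ j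
   + (adj2 (mexp (0 *\<^sub>R Z)) $ i $ 1 * ?K $ 1 $ 1 + adj2 (mexp (0 *\<^sub>R Z)) $ i $ 2 * ?K $ 2 $ 1) * Z $ 1 $ j
   + (adj2 Z $ i $ 1 * ?K $ 1 $ 2 + adj2 Z $ i $ 2 * ?K $ 2 $ 2) * mexp (0 *\<^sub>R Z) $ 2 $ j
   + (adj2 (mexp (0 *\<^sub>R Z)) $ i $ 1 * ?K $ 1 $ 2 + adj2 (mexp (0 *\<^sub>R Z)) $ i $ 2 * ?K $ 2 $ 2) * Z $ 2 $ j
   = (?K ** Z - Z ** ?K) $ i $ j"
   unfolding m0 a1 using exhaust_2[of i] exhaust_2[of j] by (elim disjE) simp_all
 qed
 then show ?thesis
  unfolding has_real_derivative_iff_has_vector_derivative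
  by (rule bounded_linear.has_vector_derivative[OF bounded_linear_of_real])
qed

lemma slope_imp_deriv:
 fixes F :: "real => complex"
 assumes l: "((%t. cmod (cor (1 / t) * (F t - F 0) - D)) \<longlongrightarrow> 0) (at 0)"
 shows "(F has_vector_derivative D) (at 0)"
proof -
 have "\<forall>\<^sub>F t in at 0. norm ((F t - F 0 - t *\<^sub>R D) /\<^sub>R \<bar>t\<bar>) <= cmod (cor (1 / t) * (F t - F 0) - D)"
  unfolding eventually_at_filter
 proof (intro always_eventually allI impI)
  fix t :: real assume t: "t ~= 0"
  have "cor (1 / t) * (F t - F 0) - D = cor (1 / t) * (F t - F 0 - t *\<^sub>R D)"
   using t by (simp add: scaleR_conv_of_real field_simps)
  then have "cmod (cor (1 / t) * (F t - F 0) - D) = cmod (F t - F 0 - t *\<^sub>R D) / \<bar>t\<bar>"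
   by (simp only: norm_mult norm_of_real abs_divide abs_one) simp
  then show "norm ((F t - F 0 - t *\<^sub>R D) /\<^sub>R \<bar>t\<bar>) <= cmod (cor (1 / t) * (F t - F 0) - D)"
   by (simp add: divide_inverse_commute)
 qed
 then have "((%t. (F t - F 0 - t *\<^sub>R D) /\<^sub>R \<bar>t\<bar>) \<longlongrightarrow> 0) (at 0)" using l by (rule Lim_null_comparison)
 then show ?thesis
  unfolding has_vector_derivative_def has_derivative_at_within
  by (simp add: bounded_linear_scaleR_left)
qed

context glob
begin

lemma Q_lin:
 assumes "Xs : lists sl2" "g : SL2"
 shows "v : V ==> w : V ==> LX Xs (rh g (em (v + w))) = add2 (LX Xs (rh g (em v))) (LX Xs (rh g (em w)))"
  "v : V ==> LX Xs (rh g (em (scaleF c v))) = sc c (LX Xs (rh g (em v)))"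
 using assms by (simp_all only: emb_add[symmetric] emb_scale[symmetric] rh_add rh_sc emb_in LX_add LX_sc S_orbit)

lemma Q_in: "Xs : lists sl2 ==> g : SL2 ==> v : V ==> LX Xs (rh g (em v)) : W"
 by (intro S_W LX_S S_orbit)

lemma LX_snoc:
 assumes Xs: "Xs : lists sl2" and X: "X : sl2" and g: "g : SL2" and v: "v : V"
 shows "LX (Xs @ [X]) (rh g (em v)) = LX Xs (rh g (em (lie_act (Ad (adj2 g) X) v)))"
  and "LX (Xs @ [X]) (rh g (em v)) = add2 (add2 (sc (cor (Ad (adj2 g) X $ 1 $ 1)) (LX Xs (rh g (em (lie_act Hm v)))))
   (sc (cor (Ad (adj2 g) X $ 1 $ 2)) (LX Xs (rh g (em (lie_act Em v))))))
   (sc (cor (Ad (adj2 g) X $ 2 $ 1)) (LX Xs (rh g (em (lie_act Fm v)))))"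
proof -
 have K: "Ad (adj2 g) X : sl2" by (intro Ad_sl2 adj2_SL2 g X)
 show 1: "LX (Xs @ [X]) (rh g (em v)) = LX Xs (rh g (em (lie_act (Ad (adj2 g) X) v)))"
  by (simp only: foldr_append foldr_Cons foldr_Nil comp_def id_def Ld_orbit[OF g X v])
 have B: "lie_act Hm v : V" "lie_act Em v : V" "lie_act Fm v : V" using v by auto
 show "LX (Xs @ [X]) (rh g (em v)) = add2 (add2 (sc (cor (Ad (adj2 g) X $ 1 $ 1)) (LX Xs (rh g (em (lie_act Hm v)))))
   (sc (cor (Ad (adj2 g) X $ 1 $ 2)) (LX Xs (rh g (em (lie_act Em v))))))
   (sc (cor (Ad (adj2 g) X $ 2 $ 1)) (LX Xs (rh g (em (lie_act Fm v)))))"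
  unfolding 1 lie_act_decomp[OF v K] by (simp only: Q_lin[OF Xs g] B Vs_add Vs_scale)
qed

text \<open>Differentiability of s |-> g exp(sZ) v in each defining seminorm of the smooth vectors.
  The last letter of the word acts first; moved past the group element it becomes a combination of
  \<open>Hm\<close>, \<open>Em\<close>, \<open>Fm\<close> with coefficients depending on s. The
  induction hypothesis handles the vectors, and \<open>hc_scale\<close> and
  \<open>Ad_entry_deriv\<close> the coefficients.\<close>

lemma LX_deriv:
 assumes "Xs : lists sl2" and g: "g : SL2" and Z: "Z : sl2" and "v : V"
 shows "has_cderiv_at0 V p (%s. LX Xs (rh (g ** mxp s Z) (em v))) (LX Xs (rh g (em (lie_act Z v))))"
 using assms(1,4)
proof (induction Xs arbitrary: v rule: rev_induct)
 case Nil
 then show ?case using rh_right_deriv[OF g Z] by simp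
next
 case (snoc X Xs)
 have X: "X : sl2" and Xs: "Xs : lists sl2" using snoc.prems(1) by auto
 have v: "v : V" by (rule snoc.prems(2))
 have gs: "g ** mxp s Z : SL2" for s by (intro SL2_mult g mexp_scale_SL2 Z)
 let ?k = "%i j s. cor (Ad (adj2 (g ** mxp s Z)) X $ i $ j)"
 let ?K = "Ad (adj2 g) X"
 let ?k' = "%i j. cor ((?K ** Z - Z ** ?K) $ i $ j)"
 let ?q = "%B s. LX Xs (rh (g ** mxp s Z) (em (lie_act B v)))"
 have K: "?K : sl2" by (intro Ad_sl2 adj2_SL2 g X)
 have C: "?K ** Z - Z ** ?K : sl2" using K Z by (simp add: sl2_iff algebra_simps)
 have g0: "g ** mexp (0 *\<^sub>R Z) = g" by (simp only: scaleR_zero_left mexp_0 matrix_mul_rid)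
 have qin: "?q B s : W" if "B : sl2" for B s by (intro Q_in Xs gs lie_act_Vs v that)
 have t: "has_cderiv_at0 V p (%s. sc (?k i j s) (?q B s))
   (add2 (sc (?k' i j) (?q B 0)) (sc (?k i j 0) (LX Xs (rh g (em (lie_act Z (lie_act B v)))))))" if B: "B : sl2" for B i j
  by (rule hc_scale[OF qin[OF B] snoc.IH[OF Xs lie_act_Vs[OF v B]] Ad_entry_deriv[OF g X Z]])
 have "has_cderiv_at0 V p (%s. add2 (add2 (sc (?k 1 1 s) (?q Hm s)) (sc (?k 1 2 s) (?q Em s))) (sc (?k 2 1 s) (?q Fm s)))
  (add2 (add2 (add2 (sc (?k' 1 1) (?q Hm 0)) (sc (?k 1 1 0) (LX Xs (rh g (em (lie_act Z (lie_act Hm v)))))))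
   (add2 (sc (?k' 1 2) (?q Em 0)) (sc (?k 1 2 0) (LX Xs (rh g (em (lie_act Z (lie_act Em v))))))))
   (add2 (sc (?k' 2 1) (?q Fm 0)) (sc (?k 2 1 0) (LX Xs (rh g (em (lie_act Z (lie_act Fm v))))))))"
  by (intro hc_add t sc_in add2_in qin basis_sl2)
 also have "(add2 (add2 (add2 (sc (?k' 1 1) (?q Hm 0)) (sc (?k 1 1 0) (LX Xs (rh g (em (lie_act Z (lie_act Hm v)))))))
   (add2 (sc (?k' 1 2) (?q Em 0)) (sc (?k 1 2 0) (LX Xs (rh g (em (lie_act Z (lie_act Em v))))))))
   (add2 (sc (?k' 2 1) (?q Fm 0)) (sc (?k 2 1 0) (LX Xs (rh g (em (lie_act Z (lie_act Fm v))))))))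
  = LX Xs (rh g (em (((scaleF (?k' 1 1) (lie_act Hm v) + scaleF (?k 1 1 0) (lie_act Z (lie_act Hm v)))
   + (scaleF (?k' 1 2) (lie_act Em v) + scaleF (?k 1 2 0) (lie_act Z (lie_act Em v))))
   + (scaleF (?k' 2 1) (lie_act Fm v) + scaleF (?k 2 1 0) (lie_act Z (lie_act Fm v))))))"
  unfolding g0 by (simp only: Q_lin[OF Xs g] Vs_add Vs_scale lie_act_Vs v Z basis_sl2)
 also have "((scaleF (?k' 1 1) (lie_act Hm v) + scaleF (?k 1 1 0) (lie_act Z (lie_act Hm v)))
   + (scaleF (?k' 1 2) (lie_act Em v) + scaleF (?k 1 2 0) (lie_act Z (lie_act Em v))))
   + (scaleF (?k' 2 1) (lie_act Fm v) + scaleF (?k 2 1 0) (lie_act Z (lie_act Fm v)))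
  = lie_act (?K ** Z - Z ** ?K) v + lie_act Z (lie_act ?K v)"
  unfolding g0 lie_act_decomp[OF v C] lie_act_decomp[OF v K]
  by (simp only: lie_act_add[where lam=lam, OF _ _ Z] lie_act_scale[where lam=lam, OF _ Z] Vs_add Vs_scale lie_act_Vs v basis_sl2) (simp only: ac_simps)
 \<comment> \<open>The commutator produced by the varying coefficients reverses the order of the two
   actions: [K, Z] v + Z K v = K Z v.\<close>
 also have "\<dots> = lie_act ?K (lie_act Z v)"
  using lie_act_commutator[OF v K Z] by (simp only: diff_eq_eq add.commute)
 also have "LX Xs (rh g (em (lie_act ?K (lie_act Z v)))) = LX (Xs @ [X]) (rh g (em (lie_act Z v)))"
  by (rule LX_snoc(1)[OF Xs X g lie_act_Vs[OF v Z], symmetric])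
 finally show ?case by (simp only: LX_snoc(2)[OF Xs X gs v])
qed

lemma Ad_bounded: "\<exists>M. \<forall>g\<in>SL2. norm g <= R --> norm (Ad (adj2 g) X) <= M"
proof -
 have "continuous_on {g : SL2. norm g <= R} (%g. Ad (adj2 g) X)"
  unfolding Ad_def by (rule continuous_mat2I; simp only: mat2_mult_entry adj2_def mk_entries; intro continuous_intros)
 then have "compact ((%g. Ad (adj2 g) X) ` {g : SL2. norm g <= R})"
  by (rule compact_continuous_image[OF _ closed_SL2_ball])
 then have "bounded ((%g. Ad (adj2 g) X) ` {g : SL2. norm g <= R})" by (rule compact_imp_bounded)
 then show ?thesis unfolding bounded_iff by blast
qed

lemma LX_bounded:
 assumes "Xs : lists sl2" "v : V"
 shows "\<exists>B. \<forall>g\<in>SL2. norm g <= R --> cnorm p (LX Xs (rh g (em v))) <= B"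
 using assms
proof (induction Xs arbitrary: v rule: rev_induct)
 case Nil
 obtain K where K: "!!h a. h : SL2 ==> norm h <= R ==> a : W ==> cnorm p (rh h a) <= K * cnorm p a"
  using op_bound_compact[of R] by blast
 show ?case using K[OF _ _ emb_in[OF Nil.prems(2)]] by (intro exI[of _ "K * cnorm p (em v)"]) simp
next
 case (snoc X Xs)
 have X: "X : sl2" and Xs: "Xs : lists sl2" using snoc.prems(1) by auto
 have v: "v : V" by (rule snoc.prems(2))
 obtain M where M: "!!g. g : SL2 ==> norm g <= R ==> norm (Ad (adj2 g) X) <= M" using Ad_bounded by blast
 obtain B1 where B1: "!!g. g : SL2 ==> norm g <= R ==> cnorm p (LX Xs (rh g (em (lie_act Hm v)))) <= B1"
  using snoc.IH[OF Xs lie_act_Vs[OF v basis_sl2(1)]] by blast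
 obtain B2 where B2: "!!g. g : SL2 ==> norm g <= R ==> cnorm p (LX Xs (rh g (em (lie_act Em v)))) <= B2"
  using snoc.IH[OF Xs lie_act_Vs[OF v basis_sl2(2)]] by blast
 obtain B3 where B3: "!!g. g : SL2 ==> norm g <= R ==> cnorm p (LX Xs (rh g (em (lie_act Fm v)))) <= B3"
  using snoc.IH[OF Xs lie_act_Vs[OF v basis_sl2(3)]] by blast
 have "cnorm p (LX (Xs @ [X]) (rh g (em v))) <= M * B1 + M * B2 + M * B3" if g: "g : SL2" "norm g <= R" for g
 proof -
  have e: "cmod (cor (Ad (adj2 g) X $ i $ j)) <= M" for i j
   unfolding norm_of_real using order_trans[OF mat2_norm_entry M[OF g]] .
  have M0: "M >= 0" using order_trans[OF norm_ge_zero M[OF g]] .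
  have q: "LX Xs (rh g (em (lie_act B v))) : W" if "B : sl2" for B by (intro Q_in Xs g lie_act_Vs v that)
  have s: "cnorm p (sc (cor (Ad (adj2 g) X $ i $ j)) (LX Xs (rh g (em (lie_act B v))))) <= M * b"
   if "B : sl2" "cnorm p (LX Xs (rh g (em (lie_act B v)))) <= b" for B b i j
   unfolding cnorm_sc[OF q[OF that(1)]] by (intro mult_mono e that(2) M0 cnorm_nonneg q that(1))
  have "cnorm p (LX (Xs @ [X]) (rh g (em v))) <= cnorm p (sc (cor (Ad (adj2 g) X $ 1 $ 1)) (LX Xs (rh g (em (lie_act Hm v)))))
   + cnorm p (sc (cor (Ad (adj2 g) X $ 1 $ 2)) (LX Xs (rh g (em (lie_act Em v)))))
   + cnorm p (sc (cor (Ad (adj2 g) X $ 2 $ 1)) (LX Xs (rh g (em (lie_act Fm v)))))"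
   unfolding LX_snoc(2)[OF Xs X g(1) v]
   by (rule order_trans[OF cnorm_add add_right_mono[OF cnorm_add]]; intro add2_in sc_in q basis_sl2)
  then show ?thesis
   using s[OF basis_sl2(1) B1[OF g], of 1 1] s[OF basis_sl2(2) B2[OF g], of 1 2] s[OF basis_sl2(3) B3[OF g], of 2 1]
   by linarith
 qed
 then show ?case by blast
qed

lemma S_cdiff: "a : S ==> b : S ==> cdiff V p a b : S"
 by (simp only: cdiff_eq S_W S_add S_sc)

lemma LX_cdiff: "a : S ==> b : S ==> Xs : lists sl2 ==> LX Xs (cdiff V p a b) = cdiff V p (LX Xs a) (LX Xs b)"
 by (simp only: cdiff_eq S_W LX_S S_sc LX_add LX_sc)

text \<open>A distribution vector is dominated by finitely many seminorms of the form
  \<open>LX Xs\<close>, so convergence of the difference quotients in each of them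
  (\<open>LX_deriv\<close>) suffices; local boundedness is inherited from
  \<open>LX_bounded\<close>.\<close>

lemma distribution_family:
 assumes "\<eta> : distribution_vectors V p rh"
 shows "lb_family lam (%g v. \<eta> (rh g (em v)))"
proof -
 have add: "\<eta> (add2 a b) = \<eta> a + \<eta> b" if "a : S" "b : S" for a b
  using assms that by (simp add: distribution_vectors_def)
 have scl: "\<eta> (sc c a) = c * \<eta> a" if "a : S" for c a
  using assms that by (simp add: distribution_vectors_def)
 obtain Ws K where Ws: "finite Ws" "Ws \<subseteq> lists sl2"
  "\<forall>a\<in>S. cmod (\<eta> a) <= K * (\<Sum>Xs\<in>Ws. cnorm p (LX Xs a))"
  using assms unfolding distribution_vectors_def mem_Collect_eq by (elim conjE exE)
 have diff: "\<eta> (cdiff V p a b) = \<eta> a - \<eta> b" if "a : S" "b : S" for a b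
  using that by (simp add: cdiff_eq S_W add S_sc scl)
 show ?thesis
 proof
  fix g v assume g: "g : SL2" and v: "v : V"
  show "\<eta> (rh g (em (v + w))) = \<eta> (rh g (em v)) + \<eta> (rh g (em w))" if w: "w : V" for w
   using g v w by (simp only: emb_add[symmetric] rh_add emb_in add S_orbit)
  show "\<eta> (rh g (em (scaleF c v))) = c * \<eta> (rh g (em v))" for c
   using g v by (simp only: emb_scale[symmetric] rh_sc emb_in scl S_orbit)
  show "((%t. \<eta> (rh (g ** mxp t X) (em v))) has_vector_derivative \<eta> (rh g (em (lie_act X v)))) (at 0)" if X: "X : sl2" for X
  proof (rule slope_imp_deriv)
   let ?g = "%t. rh (g ** mxp t X) (em v)" and ?z = "rh g (em (lie_act X v))"
   have gS: "?g t : S" for t by (intro S_orbit SL2_mult g mexp_scale_SL2 X v)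
   have zS: "?z : S" by (intro S_orbit g lie_act_Vs v X)
   have dS: "dq ?g t : S" for t by (intro S_sc S_cdiff gS)
   have "((%t. K * (\<Sum>Xs\<in>Ws. dd (dq (%t. LX Xs (?g t)) t) (LX Xs ?z))) \<longlongrightarrow> K * (\<Sum>Xs\<in>Ws. 0)) (at 0)"
   proof (intro tendsto_mult tendsto_const tendsto_sum)
    fix Xs assume "Xs : Ws"
    then have "Xs : lists sl2" using Ws(2) by blast
    from LX_deriv[OF this g X v] show "((%t. dd (dq (%t. LX Xs (?g t)) t) (LX Xs ?z)) \<longlongrightarrow> 0) (at 0)"
     unfolding hc_iff by (rule conjunct2)
   qed
   then have "((%t. K * (\<Sum>Xs\<in>Ws. dd (dq (%t. LX Xs (?g t)) t) (LX Xs ?z))) \<longlongrightarrow> 0) (at 0)" by simp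
   then show "((%t. cmod (cor (1 / t) * (\<eta> (?g t) - \<eta> (?g 0)) - \<eta> ?z)) \<longlongrightarrow> 0) (at 0)"
   proof (rule tendsto0I)
    fix t
    have "cmod (cor (1 / t) * (\<eta> (?g t) - \<eta> (?g 0)) - \<eta> ?z) = cmod (\<eta> (cdiff V p (dq ?g t) ?z))"
     by (simp only: diff[OF dS zS] scl[OF S_cdiff[OF gS gS]] diff[OF gS gS])
    also have "\<dots> <= K * (\<Sum>Xs\<in>Ws. cnorm p (LX Xs (cdiff V p (dq ?g t) ?z)))"
     by (rule bspec[OF Ws(3) S_cdiff[OF dS zS]])
    also have "(\<Sum>Xs\<in>Ws. cnorm p (LX Xs (cdiff V p (dq ?g t) ?z))) = (\<Sum>Xs\<in>Ws. dd (dq (%t. LX Xs (?g t)) t) (LX Xs ?z))"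
    proof (rule sum.cong[OF refl])
     fix Xs assume "Xs : Ws"
     then have Xs: "Xs : lists sl2" using Ws(2) by blast
     show "cnorm p (LX Xs (cdiff V p (dq ?g t) ?z)) = dd (dq (%t. LX Xs (?g t)) t) (LX Xs ?z)"
      by (simp only: LX_cdiff[OF dS zS Xs] LX_sc[OF S_cdiff[OF gS gS] Xs] LX_cdiff[OF gS gS Xs])
    qed
    finally show "cmod (cor (1 / t) * (\<eta> (?g t) - \<eta> (?g 0)) - \<eta> ?z) <= K * (\<Sum>Xs\<in>Ws. dd (dq (%t. LX Xs (?g t)) t) (LX Xs ?z))" .
   qed simp
  qed
 next
  fix v and R :: real assume v: "v : V"
  have "\<forall>Xs\<in>Ws. \<exists>B. \<forall>g\<in>SL2. norm g <= R --> cnorm p (LX Xs (rh g (em v))) <= B"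
   using LX_bounded[OF _ v] Ws(2) by blast
  from bchoice[OF this] obtain B where B0: "\<forall>Xs\<in>Ws. \<forall>g\<in>SL2. norm g <= R --> cnorm p (LX Xs (rh g (em v))) <= B Xs"
   by (elim exE)
  have B: "cnorm p (LX Xs (rh g (em v))) <= B Xs" if "Xs : Ws" "g : SL2" "norm g <= R" for Xs g
   using B0 that by simp
  have "cmod (\<eta> (rh g (em v))) <= \<bar>K\<bar> * (\<Sum>Xs\<in>Ws. B Xs)" if g: "g : SL2" "norm g <= R" for g
  proof -
   have nn: "0 <= (\<Sum>Xs\<in>Ws. cnorm p (LX Xs (rh g (em v))))"
    using Ws(2) by (intro sum_nonneg cnorm_nonneg Q_in g v) blast
   have "cmod (\<eta> (rh g (em v))) <= K * (\<Sum>Xs\<in>Ws. cnorm p (LX Xs (rh g (em v))))"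
    by (rule bspec[OF Ws(3) S_orbit[OF g(1) v]])
   also have "\<dots> <= \<bar>K\<bar> * (\<Sum>Xs\<in>Ws. cnorm p (LX Xs (rh g (em v))))" using nn by (intro mult_right_mono) auto
   also have "\<dots> <= \<bar>K\<bar> * (\<Sum>Xs\<in>Ws. B Xs)" by (intro mult_left_mono sum_mono B g) auto
   finally show ?thesis .
  qed
  then show "\<exists>B. \<forall>g\<in>SL2. norm g <= R --> cmod (\<eta> (rh g (em v))) <= B" by blast
 qed
qed

lemma automorphic_bounded:
 assumes L: "cocompact_lattice \<Gamma>" and \<eta>: "\<eta> : distribution_vectors V p rh" and inv: "invariant_under \<Gamma> V p rh \<eta>"
  and v: "v : V"
 shows "\<exists>B. \<forall>g\<in>SL2. cmod (\<eta> (rh g (em v))) <= B"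
proof -
 interpret E: lb_family lam "%g v. \<eta> (rh g (em v))" by (rule distribution_family[OF \<eta>])
 have sub: "\<Gamma> \<subseteq> SL2" using L subgroup.subset unfolding cocompact_lattice_def SL2_group_def by fastforce
 obtain R where R: "!!g. g : SL2 ==> \<exists>ga\<in>\<Gamma>. \<exists>w\<in>SL2. norm w <= R & g = ga ** w"
  using cocompact_bounded_representatives[OF L] by blast
 obtain B where B: "!!g. g : SL2 ==> norm g <= R ==> cmod (\<eta> (rh g (em v))) <= B" using E.loc_bdd[OF v] by blast
 have "cmod (\<eta> (rh g (em v))) <= B" if g: "g : SL2" for g
 proof -
  obtain ga w where w: "ga : \<Gamma>" "w : SL2" "norm w <= R" "g = ga ** w" using R[OF g] by blast
  have "\<eta> (rh g (em v)) = \<eta> (rh ga (rh w (em v)))" unfolding w(4) using w sub v by (subst rh_mult) auto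
  also have "\<dots> = \<eta> (rh w (em v))"
   by (rule inv[unfolded invariant_under_def, rule_format, OF w(1) S_orbit[OF w(2) v]])
  finally show ?thesis using B[OF w(2,3)] by simp
 qed
 then show ?thesis by blast
qed

end

section \<open>Averages over the maximal compact subgroup\<close>

text \<open>Averages over K are taken over J equally spaced rotations. They are exact on frequencies
  below J and are finite sums of vectors, so no vector-valued integral is required.\<close>

lemma roots_sum:
 fixes d :: int
 assumes "\<bar>d\<bar> < int J" "J > 0"
 shows "(\<Sum>j<J. cis (2 * of_int d * (pi * real j / real J))) = (if d = 0 then of_nat J else 0)"
proof (cases "d = 0")
 case False
 let ?x = "pi * (of_int d / real J)"
 let ?z = "cis (2 * ?x)"
 have "?z ~= 1"
 proof
  assume "?z = 1"
  then have "cos (2 * ?x) = 1" by (simp add: complex_eq_iff)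
  then have "sin ?x = 0" unfolding cos_double_sin by simp
  then obtain i :: int where "?x = of_int i * pi" unfolding sin_zero_iff_int2 by blast
  then have "pi * (of_int d / real J) = pi * of_int i" by (simp only: mult.commute)
  then have "of_int d / real J = real_of_int i" by (metis mult_left_cancel pi_neq_zero)
  then have "real_of_int d = real_of_int i * real J" using assms(2) by (simp add: field_simps)
  then have "real_of_int d = real_of_int (i * int J)" by simp
  then have "d = i * int J" by (simp only: of_int_eq_iff)
  then have "int J dvd d" by simp
  then show False using False assms(1) zdvd_not_zless[of "\<bar>d\<bar>" "int J"] by simp
 qed
 have zp: "?z ^ j = cis (real j * (2 * ?x))" for j by (rule Complex.DeMoivre)
 have "(\<Sum>j<J. cis (2 * of_int d * (pi * real j / real J))) = (\<Sum>j<J. ?z ^ j)"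
  unfolding zp by (intro sum.cong refl) (simp add: mult_ac)
 also have "\<dots> = (?z ^ J - 1) / (?z - 1)" by (rule geometric_sum[OF \<open>?z ~= 1\<close>])
 also have "?z ^ J = cis (2 * pi * of_int d)" unfolding zp using assms(2) by (simp add: field_simps)
 also have "\<dots> = 1" using cos_int_2pin[of d] sin_int_2pin[of d] by (simp add: complex_eq_iff)
 finally show ?thesis using False by simp
qed simp

lemma act_rot_Vs [intro]:
 assumes "v : Vs lam" shows "act (rot tta) v : Vs lam"
 using assms
proof (induction rule: Vs_induct)
 case zero
 have "act (rot tta) 0 = 0" by (simp add: act_def fun_eq_iff)
 then show ?case by (simp only: Vs_0)
next
 case (ee m)
 show ?case unfolding act_rot_ee by blast
next
 case (add v w)
 have "act (rot tta) (v + w) = act (rot tta) v + act (rot tta) w" by (simp add: act_def fun_eq_iff)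
 then show ?case using add by (simp only: Vs_add)
next
 case (scale v c)
 have "act (rot tta) (scaleF c v) = scaleF c (act (rot tta) v)" by (simp add: act_def fun_eq_iff)
 then show ?case using scale by (simp only: Vs_scale)
qed

text \<open>A trigonometric kernel sampled at the angle pi j/J. The frequencies n i may repeat,
  which allows kernels given as products of sums.\<close>

abbreviation kw where
 "kw I a n J j == \<Sum>i\<in>I. a i * cis (2 * of_int (n i) * (pi * real j / real J))"

lemma avg_pointwise:
 assumes I: "finite I" and x: "x : Vs lam"
 shows "\<exists>J0>0. \<forall>J\<ge>J0. \<forall>y. (\<Sum>j<J. (kw I a n J j) * act (rot (pi * real j / real J)) x y)
  = of_nat J * (\<Sum>i\<in>I. a i * cf (n i) x * ee lam (n i) y)"
 using x
proof (induction rule: Vs_induct)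
 case zero
 have a0: "act g 0 y = 0" for g y by (simp add: act_def)
 show ?case by (intro exI[of _ 1] conjI allI impI, simp, simp only: a0 cf_0 mult_zero_right mult_zero_left sum.neutral_const)
next
 case (ee m)
 let ?J0 = "Suc (\<Sum>i\<in>I. nat \<bar>n i - m\<bar>)"
 have "(\<Sum>j<J. (kw I a n J j) * act (rot (pi * real j / real J)) (ee lam m) y)
  = of_nat J * (\<Sum>i\<in>I. a i * cf (n i) (ee lam m) * ee lam (n i) y)" if J: "J >= ?J0" for J y
 proof -
  have d: "\<bar>n i - m\<bar> < int J" if "i : I" for i
  proof -
   have "nat \<bar>n i - m\<bar> <= (\<Sum>i\<in>I. nat \<bar>n i - m\<bar>)" using I that by (intro member_le_sum) auto
   then show ?thesis using J by linarith
  qed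
  have c: "cis (2 * of_int (n i) * t) * cis (- 2 * of_int m * t) = cis (2 * of_int (n i - m) * t)" for i t
   by (simp add: cis_mult algebra_simps)
  have "(\<Sum>j<J. (kw I a n J j) * act (rot (pi * real j / real J)) (ee lam m) y)
   = (\<Sum>j<J. \<Sum>i\<in>I. a i * ee lam m y * cis (2 * of_int (n i - m) * (pi * real j / real J)))"
   unfolding act_rot_ee scaleF_apply c[symmetric] by (simp add: sum_distrib_right sum_distrib_left mult_ac)
  also have "\<dots> = (\<Sum>i\<in>I. a i * ee lam m y * (\<Sum>j<J. cis (2 * of_int (n i - m) * (pi * real j / real J))))"
   by (subst sum.swap) (simp add: sum_distrib_left)
  also have "\<dots> = (\<Sum>i\<in>I. a i * ee lam m y * (if n i - m = 0 then of_nat J else 0))"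
   using J by (intro sum.cong refl arg_cong2[where f="(*)"] roots_sum d) auto
  also have "\<dots> = of_nat J * (\<Sum>i\<in>I. a i * cf (n i) (ee lam m) * ee lam (n i) y)"
   unfolding cf_ee sum_distrib_left by (intro sum.cong refl) auto
  finally show ?thesis .
 qed
 then show ?case by (intro exI[of _ ?J0]) blast
next
 case (add v w)
 obtain J1 where J1: "J1 > 0" "!!J y. J >= J1 ==> (\<Sum>j<J. (kw I a n J j) * act (rot (pi * real j / real J)) v y)
  = of_nat J * (\<Sum>i\<in>I. a i * cf (n i) v * ee lam (n i) y)" using add.IH(1) by blast
 obtain J2 where J2: "J2 > 0" "!!J y. J >= J2 ==> (\<Sum>j<J. (kw I a n J j) * act (rot (pi * real j / real J)) w y)
  = of_nat J * (\<Sum>i\<in>I. a i * cf (n i) w * ee lam (n i) y)" using add.IH(2) by blast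
 have e: "act g (v + w) y = act g v y + act g w y" for g y by (simp add: act_def)
 have H: "(\<Sum>j<J. (kw I a n J j) * act (rot (pi * real j / real J)) (v + w) y)
  = of_nat J * (\<Sum>i\<in>I. a i * cf (n i) (v + w) * ee lam (n i) y)" if "J >= max J1 J2" for J y
  unfolding e cf_add[OF add.hyps] ring_distribs sum.distrib using J1(2)[of J y] J2(2)[of J y] that by simp
 show ?case
 proof (intro exI[of _ "max J1 J2"] conjI allI impI)
  show "0 < max J1 J2" using J1(1) by simp
 qed (rule H)
next
 case (scale v c)
 obtain J1 where J1: "J1 > 0" "!!J y. J >= J1 ==> (\<Sum>j<J. (kw I a n J j) * act (rot (pi * real j / real J)) v y)
  = of_nat J * (\<Sum>i\<in>I. a i * cf (n i) v * ee lam (n i) y)" using scale.IH by blast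
 have e: "act g (scaleF c v) y = c * act g v y" for g y by (simp add: act_def)
 have H: "(\<Sum>j<J. (kw I a n J j) * act (rot (pi * real j / real J)) (scaleF c v) y)
  = of_nat J * (\<Sum>i\<in>I. a i * cf (n i) (scaleF c v) * ee lam (n i) y)" if "J >= J1" for J y
 proof -
  have "(\<Sum>j<J. (kw I a n J j) * act (rot (pi * real j / real J)) (scaleF c v) y)
   = c * (\<Sum>j<J. (kw I a n J j) * act (rot (pi * real j / real J)) v y)"
   unfolding e sum_distrib_left by (intro sum.cong refl) (simp only: mult_ac)
  also have "\<dots> = c * (of_nat J * (\<Sum>i\<in>I. a i * cf (n i) v * ee lam (n i) y))"
   by (simp only: J1(2)[OF that])
  also have "\<dots> = of_nat J * (\<Sum>i\<in>I. a i * (c * cf (n i) v) * ee lam (n i) y)"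
   unfolding sum_distrib_left by (intro sum.cong refl) (simp only: mult_ac)
  finally show ?thesis by (simp only: cf_scale)
 qed
 show ?case by (intro exI[of _ J1] conjI allI impI) (rule J1(1), rule H)
qed

text \<open>Convolution over K with a kernel of mean absolute value at most A. For J large the
  discrete average equals the convolution exactly on the given vector x, so the triangle inequality
  yields the bound.\<close>

lemma avg_seminorm:
 fixes r :: "fn => real"
 assumes I: "finite I" and x: "x : Vs lam"
  and r_sum: "!!F f. (!!j::nat. j : F ==> f j : Vs lam) ==> r (\<Sum>j\<in>F. f j) <= (\<Sum>j\<in>F. r (f j))"
  and r_scale: "!!v c. v : Vs lam ==> r (scaleF c v) = cmod c * r v"
  and B: "!!tta. r (act (rot tta) x) <= B" and B0: "B >= 0"
  and A: "!!J. J >= J1 ==> (\<Sum>j<J. cmod (kw I a n J j)) <= A * real J"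
 shows "r (\<Sum>i\<in>I. scaleF (a i * cf (n i) x) (ee lam (n i))) <= A * B"
proof -
 obtain J0 where J0: "J0 > 0" "\<forall>J\<ge>J0. \<forall>y. (\<Sum>j<J. (kw I a n J j) * act (rot (pi * real j / real J)) x y)
  = of_nat J * (\<Sum>i\<in>I. a i * cf (n i) x * ee lam (n i) y)" using avg_pointwise[OF I x, of a n] by (elim exE conjE)
 define J where "J = max J0 J1"
 let ?w = "%j. \<Sum>i\<in>I. a i * cis (2 * of_int (n i) * (pi * real j / real J))"
 let ?s = "\<Sum>i\<in>I. scaleF (a i * cf (n i) x) (ee lam (n i))"
 have J: "J > 0" "J >= J0" "J >= J1" using J0(1) by (auto simp: J_def)
 have sV: "?s : Vs lam" by (intro Vs_sum Vs_scale ee_in_Vs)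
 have "scaleF (of_nat J) ?s = (\<Sum>j<J. scaleF (?w j) (act (rot (pi * real j / real J)) x))"
 proof
  fix y
  show "scaleF (of_nat J) ?s y = (\<Sum>j<J. scaleF (?w j) (act (rot (pi * real j / real J)) x)) y"
   using J0(2)[rule_format, OF J(2), of y] unfolding scaleF_apply fn_sum_apply by simp
 qed
 then have "real J * r ?s = r (\<Sum>j<J. scaleF (?w j) (act (rot (pi * real j / real J)) x))"
  using r_scale[OF sV, of "of_nat J"] by (simp only: norm_of_nat)
 also have "\<dots> <= (\<Sum>j<J. r (scaleF (?w j) (act (rot (pi * real j / real J)) x)))"
  by (rule r_sum) (intro Vs_scale act_rot_Vs x)
 also have "\<dots> = (\<Sum>j<J. cmod (?w j) * r (act (rot (pi * real j / real J)) x))"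
  by (simp only: r_scale[OF act_rot_Vs[OF x]])
 also have "\<dots> <= (\<Sum>j<J. cmod (?w j) * B)" by (intro sum_mono mult_left_mono B) simp
 also have "\<dots> = (\<Sum>j<J. cmod (?w j)) * B" by (simp only: sum_distrib_right)
 also have "\<dots> <= (A * real J) * B" by (intro mult_right_mono A J B0)
 finally have "real J * r ?s <= real J * (A * B)" by (simp only: mult_ac)
 then show ?thesis using J(1) by (simp only: mult_le_cancel_left_pos of_nat_0_less_iff)
qed

lemma disc_Parseval:
 fixes K :: "int set"
 assumes K: "finite K" "!!k l. k : K ==> l : K ==> \<bar>k - l\<bar> < int J" and J: "J > 0"
 shows "(\<Sum>j<J. (cmod (\<Sum>k\<in>K. cis (2 * of_int k * (pi * real j / real J))))\<^sup>2) = real J * real (card K)"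
proof -
 let ?c = "%k j. cis (2 * of_int k * (pi * real j / real J))"
 have e: "cor ((cmod (\<Sum>k\<in>K. ?c k j))\<^sup>2) = (\<Sum>k\<in>K. \<Sum>l\<in>K. ?c (k - l) j)" for j
 proof -
  have "cor ((cmod (\<Sum>k\<in>K. ?c k j))\<^sup>2) = (\<Sum>k\<in>K. ?c k j) * cnj (\<Sum>k\<in>K. ?c k j)"
   by (rule complex_norm_square)
  also have "\<dots> = (\<Sum>k\<in>K. \<Sum>l\<in>K. ?c k j * cis (- (2 * of_int l * (pi * real j / real J))))"
   unfolding cnj_sum cis_cnj sum_product ..
  also have "\<dots> = (\<Sum>k\<in>K. \<Sum>l\<in>K. ?c (k - l) j)"
   by (intro sum.cong refl) (simp add: cis_mult algebra_simps diff_divide_distrib)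
  finally show ?thesis .
 qed
 have "cor (\<Sum>j<J. (cmod (\<Sum>k\<in>K. ?c k j))\<^sup>2) = (\<Sum>j<J. \<Sum>k\<in>K. \<Sum>l\<in>K. ?c (k - l) j)"
  unfolding of_real_sum e ..
 also have "\<dots> = (\<Sum>k\<in>K. \<Sum>j<J. \<Sum>l\<in>K. ?c (k - l) j)" by (rule sum.swap)
 also have "\<dots> = (\<Sum>k\<in>K. \<Sum>l\<in>K. \<Sum>j<J. ?c (k - l) j)" by (intro sum.cong refl sum.swap)
 also have "\<dots> = (\<Sum>k\<in>K. \<Sum>l\<in>K. if k - l = 0 then of_nat J else 0)"
  by (intro sum.cong refl roots_sum K J)
 also have "\<dots> = (\<Sum>k\<in>K. of_nat J)"
 proof (intro sum.cong refl)
  fix k assume k: "k : K"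
  have "(\<Sum>l\<in>K. if k - l = 0 then (of_nat J :: complex) else 0) = (\<Sum>l\<in>K. if k = l then of_nat J else 0)"
   by (intro sum.cong refl) simp
  then show "(\<Sum>l\<in>K. if k - l = 0 then (of_nat J :: complex) else 0) = of_nat J" using K(1) k by simp
 qed
 also have "\<dots> = cor (real J * real (card K))" by simp
 finally show ?thesis by (simp only: of_real_eq_iff)
qed

text \<open>A kernel of de la Vallee Poussin type: its coefficients are 1 on the frequencies of size at most
 \<open>L\<close>, and its mean absolute value is at most 3.\<close>

lemma vp_bound:
 assumes L: "L > 0" and J: "J >= 10 * L"
 shows "(\<Sum>j<J. cmod (\<Sum>i\<in>{0..<int L} \<times> {- 2 * int L..2 * int L}. cor (1 / real L) * cis (2 * of_int (fst i + snd i) * (pi * real j / real J))))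
  <= 3 * real J"
proof -
 let ?c = "%k j. cis (2 * of_int k * (pi * real j / real J))"
 let ?A = "{0..<int L}" and ?B = "{- 2 * int L..2 * int L}"
 \<comment> \<open>The kernel is a product of two exponential sums divided by L. The
   arithmetic-geometric inequality separates the factors, and discrete Parseval evaluates both
   squares, frequency differences being at most 4L < J; with L and 4L + 1 frequencies the mean is at
   most (5L + 1)/(2L) <= 3.\<close>
 have e: "(\<Sum>i\<in>?A \<times> ?B. cor (1 / real L) * ?c (fst i + snd i) j)
  = cor (1 / real L) * ((\<Sum>k\<in>?A. ?c k j) * (\<Sum>k\<in>?B. ?c k j))" for j
 proof -
  have "(\<Sum>i\<in>?A \<times> ?B. cor (1 / real L) * ?c (fst i + snd i) j) = (\<Sum>(k, l)\<in>?A \<times> ?B. cor (1 / real L) * (?c k j * ?c l j))"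
   by (intro sum.cong refl) (simp add: cis_mult case_prod_beta algebra_simps add_divide_distrib)
  also have "\<dots> = cor (1 / real L) * ((\<Sum>k\<in>?A. ?c k j) * (\<Sum>k\<in>?B. ?c k j))"
   unfolding sum_product unfolding sum.cartesian_product unfolding sum_distrib_left by (simp add: case_prod_beta)
  finally show ?thesis .
 qed
 have b: "cmod (\<Sum>i\<in>?A \<times> ?B. cor (1 / real L) * ?c (fst i + snd i) j)
  <= 1 / (2 * real L) * ((cmod (\<Sum>k\<in>?A. ?c k j))\<^sup>2 + (cmod (\<Sum>k\<in>?B. ?c k j))\<^sup>2)" for j
 proof -
  have "u * w <= (u\<^sup>2 + w\<^sup>2) / 2" for u w :: real using sum_squares_bound[of u w] by simp
  then have "1 / real L * (cmod (\<Sum>k\<in>?A. ?c k j) * cmod (\<Sum>k\<in>?B. ?c k j))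
   <= 1 / real L * (((cmod (\<Sum>k\<in>?A. ?c k j))\<^sup>2 + (cmod (\<Sum>k\<in>?B. ?c k j))\<^sup>2) / 2)"
   by (intro mult_left_mono) auto
  then show ?thesis unfolding e norm_mult norm_of_real by simp
 qed
 have "(\<Sum>j<J. cmod (\<Sum>i\<in>?A \<times> ?B. cor (1 / real L) * ?c (fst i + snd i) j))
  <= (\<Sum>j<J. 1 / (2 * real L) * ((cmod (\<Sum>k\<in>?A. ?c k j))\<^sup>2 + (cmod (\<Sum>k\<in>?B. ?c k j))\<^sup>2))"
  by (intro sum_mono b)
 also have "\<dots> = 1 / (2 * real L) * ((\<Sum>j<J. (cmod (\<Sum>k\<in>?A. ?c k j))\<^sup>2) + (\<Sum>j<J. (cmod (\<Sum>k\<in>?B. ?c k j))\<^sup>2))"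
  unfolding sum_distrib_left[symmetric] sum.distrib ..
 also have "(\<Sum>j<J. (cmod (\<Sum>k\<in>?A. ?c k j))\<^sup>2) = real J * real (card ?A)"
  by (rule disc_Parseval) (use L J in auto)
 also have "(\<Sum>j<J. (cmod (\<Sum>k\<in>?B. ?c k j))\<^sup>2) = real J * real (card ?B)"
  by (rule disc_Parseval) (use L J in auto)
 also have "1 / (2 * real L) * (real J * real (card ?A) + real J * real (card ?B)) = real J * ((5 * real L + 1) / (2 * real L))"
  by (simp add: nat_add_distrib nat_mult_distrib add_divide_distrib algebra_simps)
 also have "\<dots> <= real J * 3" using L by (intro mult_left_mono) (auto simp: field_simps)
 finally show ?thesis by (simp only: mult.commute)
qed

text \<open>For every l in [0, L) the window l + [-2L, 2L] contains [-L, L], so each inner sum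
  already equals v, and the outer sum averages L copies of it.\<close>

lemma vp_reproduce:
 assumes v: "v : Vs lam" and L: "L > 0" and supp: "{m. cf m v ~= 0} \<subseteq> {- int L..int L}"
 shows "(\<Sum>i\<in>{0..<int L} \<times> {- 2 * int L..2 * int L}. scaleF (cor (1 / real L) * cf (fst i + snd i) v) (ee lam (fst i + snd i))) = v"
proof
 fix y
 let ?A = "{0..<int L}" and ?B = "{- 2 * int L..2 * int L}"
 have inner: "(\<Sum>k\<in>?B. cf (l + k) v * ee lam (l + k) y) = v y" if "l : ?A" for l
 proof -
  have "(\<Sum>k\<in>?B. cf (l + k) v * ee lam (l + k) y) = (\<Sum>m\<in>(%k. l + k) ` ?B. cf m v * ee lam m y)"
   by (subst sum.reindex) (auto simp: inj_on_def)
  also have "\<dots> = (\<Sum>m\<in>(%k. l + k) ` ?B. scaleF (cf m v) (ee lam m)) y" by (simp add: fn_sum_apply)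
  also have "(\<Sum>m\<in>(%k. l + k) ` ?B. scaleF (cf m v) (ee lam m)) = v"
  proof (rule Vs_expand_finite[OF v, symmetric])
   show "{m. cf m v ~= 0} \<subseteq> (%k. l + k) ` ?B"
   proof
    fix m assume "m : {m. cf m v ~= 0}"
    then have "m : {- int L..int L}" using supp by blast
    then have "m - l : ?B" using that by auto
    then show "m : (%k. l + k) ` ?B" by (intro image_eqI[of _ _ "m - l"]) auto
   qed
  qed simp
  finally show ?thesis .
 qed
 have "(\<Sum>i\<in>?A \<times> ?B. scaleF (cor (1 / real L) * cf (fst i + snd i) v) (ee lam (fst i + snd i))) y
  = (\<Sum>l\<in>?A. \<Sum>k\<in>?B. cor (1 / real L) * (cf (l + k) v * ee lam (l + k) y))"
  unfolding fn_sum_apply scaleF_apply sum.cartesian_product by (intro sum.cong refl) (simp add: case_prod_beta)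
 also have "\<dots> = (\<Sum>l\<in>?A. cor (1 / real L) * v y)"
  unfolding sum_distrib_left[symmetric] by (intro sum.cong refl arg_cong2[where f="(*)"] inner)
 also have "\<dots> = v y" using L by simp
 finally show "(\<Sum>i\<in>?A \<times> ?B. scaleF (cor (1 / real L) * cf (fst i + snd i) v) (ee lam (fst i + snd i))) y = v y" .
qed

lemma cf_act_rot:
 assumes "v : Vs lam" shows "cf m (act (rot tta) v) = cis (- 2 * of_int m * tta) * cf m v"
 using assms
proof (induction rule: Vs_induct)
 case zero
 have "act (rot tta) 0 = 0" by (simp add: act_def fun_eq_iff)
 then show ?case by (simp only: cf_0 mult_zero_right)
next
 case (ee k)
 show ?case unfolding act_rot_ee cf_scale cf_ee by simp
next
 case (add v w)
 have "act (rot tta) (v + w) = act (rot tta) v + act (rot tta) w" by (simp add: act_def fun_eq_iff)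
 then show ?case
  using cf_add[OF act_rot_Vs[OF add.hyps(1)] act_rot_Vs[OF add.hyps(2)], of m tta tta] cf_add[OF add.hyps, of m] add.IH
  by (simp only: distrib_left)
next
 case (scale v c)
 have "act (rot tta) (scaleF c v) = scaleF c (act (rot tta) v)" by (simp add: act_def fun_eq_iff)
 then show ?case using scale by (simp only: cf_scale mult.left_commute)
qed

section \<open>K-type coefficients in a uniformly bounded globalization\<close>

locale bglob = glob +
 fixes Cb :: real
 assumes Cb: "Cb > 0" and bdd: "g : SL2 ==> v : Vs lam ==> cnorm p (rh g (emb (Vs lam) p v)) <= Cb * p v"
begin

lemma bddW:
 assumes g: "g : SL2" and a: "a : W" shows "cnorm p (rh g a) <= Cb * cnorm p a"
proof -
 obtain x where x: "x : C" "a = cls V p x" using a by (rule W_cases)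
 obtain K where K: "K >= 0" "!!b. b : W ==> cnorm p (rh g b) <= K * cnorm p b" using op_bound[OF g] by blast
 have xV: "x n : V" for n by (rule C_in[OF x(1)])
 have "cnorm p (rh g a) <= Cb * p (x n) + K * dd (em (x n)) a" for n
 proof -
  have e: "em (x n) : W" by (rule emb_in[OF xV])
  have "cnorm p (rh g a) <= cnorm p (rh g (em (x n))) + dd (rh g a) (rh g (em (x n)))"
   by (intro cnorm_le_dd rh_in g a e)
  also have "dd (rh g a) (rh g (em (x n))) = cnorm p (rh g (cdiff V p (em (x n)) a))"
   by (simp only: rh_cdiff[OF g e a]) (intro dd_sym rh_in g a e)
  also have "\<dots> <= K * dd (em (x n)) a" by (intro K cdiff_in e a)
  finally show ?thesis using bdd[OF g xV, of n] by linarith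
 qed
 moreover have "(%n. Cb * p (x n) + K * dd (em (x n)) a) \<longlonglongrightarrow> Cb * cnorm p a + K * 0"
  unfolding x(2) by (intro tendsto_intros cnorm_cls cls_limit x(1))
 ultimately show ?thesis using LIMSEQ_le_const[of "%n. Cb * p (x n) + K * dd (em (x n)) a" _ "cnorm p (rh g a)"] by simp
qed

lemma p_act: "v : V ==> p (act (rot tta) v) <= Cb * p v"
 using bdd[OF SO2_SL2[OF rot_SO2], of v tta] by (simp only: rh_K[OF rot_SO2] cnorm_emb act_rot_Vs)

lemma p_avg:
 assumes "finite I" "x : V"
  "!!J. J >= J1 ==> (\<Sum>j<J. cmod (kw I a n J j)) <= A * real J"
 shows "p (\<Sum>i\<in>I. scaleF (a i * cf (n i) x) (ee lam (n i))) <= A * (Cb * p x)"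
 by (rule avg_seminorm[OF assms(1,2) p_sum p_scale p_act[OF assms(2)] _ assms(3)])
  (use Cb p_nonneg[OF assms(2)] in auto)

text \<open>Isolating a single weight is convolution with a kernel of modulus 1, which costs no more
  than the bound \<open>Cb\<close> for rotations.\<close>

lemma cf_bound: "x : V ==> cmod (cf m x) * p (ee lam m) <= Cb * p x"
 using p_avg[of "{0::nat}" x 0 "%_. 1" "%_. m" 1] p_scale[OF ee_in_Vs[of lam m], of "cf m x"] by simp

lemma p_ee_pos: "p (ee lam m) > 0"
proof -
 have "ee lam m ~= 0" using cf_ee[of m lam m] cf_0[of m] by force
 then show ?thesis using p_nonneg[OF ee_in_Vs[of lam m]] p_eq_0[OF ee_in_Vs[of lam m]] by linarith
qed

lemma cf_bound': "x : V ==> cmod (cf m x) <= Cb / p (ee lam m) * p x"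
 using cf_bound[of x m] p_ee_pos[of m] by (simp add: field_simps)

definition co :: "int => cvec => complex" where "co m a = lim (%n. cf m (rep a n))"

lemma cf_convergent:
 assumes "x : C" shows "convergent (%n. cf m (x n))"
proof -
 let ?K = "Cb / p (ee lam m)"
 have K: "?K > 0" using Cb p_ee_pos by simp
 have "Cauchy (%n. cf m (x n))"
 proof (rule metric_CauchyI)
  fix e :: real assume "e > 0"
  then have "e / ?K > 0" using K by (rule divide_pos_pos)
  then obtain N where N: "!!k n. k >= N ==> n >= N ==> p (x k - x n) < e / ?K" using C_D[OF assms] by blast
  have "dist (cf m (x k)) (cf m (x n)) < e" if "k >= N" "n >= N" for k n
  proof -
   have "dist (cf m (x k)) (cf m (x n)) = cmod (cf m (x k - x n))"
    unfolding dist_norm using cf_diff[OF C_in[OF assms] C_in[OF assms]] by simp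
   also have "\<dots> <= ?K * p (x k - x n)" by (intro cf_bound' V_diff C_in[OF assms])
   also have "\<dots> < ?K * (e / ?K)" using N[OF that] K by (rule mult_strict_left_mono)
   also have "\<dots> = e" using K by (simp only: times_divide_eq_right nonzero_mult_div_cancel_left less_imp_neq[symmetric] not_False_eq_True)
   finally show ?thesis .
  qed
  then show "\<exists>N. \<forall>k\<ge>N. \<forall>n\<ge>N. dist (cf m (x k)) (cf m (x n)) < e" by blast
 qed
 then show ?thesis by (rule Cauchy_convergent)
qed

lemma co_cls:
 assumes x: "x : C" shows "(%n. cf m (x n)) \<longlonglongrightarrow> co m (cls V p x)"
proof -
 let ?y = "rep (cls V p x)"
 have y: "?y : C" "(%n. p (x n - ?y n)) \<longlonglongrightarrow> 0" using rep_null[OF x] by (auto simp: null_iff)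
 have l: "(%n. cf m (?y n)) \<longlonglongrightarrow> co m (cls V p x)"
  using cf_convergent[OF y(1)] by (simp add: co_def convergent_LIMSEQ_iff)
 have "(%n. Cb / p (ee lam m) * p (x n - ?y n)) \<longlonglongrightarrow> 0" using tendsto_mult_right_zero[OF y(2)] .
 then have "(%n. cf m (x n) - cf m (?y n)) \<longlonglongrightarrow> 0"
  by (rule Lim_null_comparison[rotated])
   (use cf_bound'[OF V_diff[OF C_in[OF x] C_in[OF y(1)]]] cf_diff[OF C_in[OF x] C_in[OF y(1)]] in simp)
 from tendsto_add[OF this l] show ?thesis by simp
qed

lemma co_em: "v : V ==> co m (em v) = cf m v"
 unfolding emb_def using LIMSEQ_unique[OF co_cls[OF C_const] tendsto_const] by blast

lemma co_add: "a : W ==> b : W ==> co m (add2 a b) = co m a + co m b"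
proof (elim W_cases)
 fix x y assume *: "x : C" "a = cls V p x" "y : C" "b = cls V p y"
 have "(%n. cf m (x n + y n)) \<longlonglongrightarrow> co m a + co m b"
  using tendsto_add[OF co_cls[OF *(1)] co_cls[OF *(3)]] cf_add[OF C_in[OF *(1)] C_in[OF *(3)]] *(2,4) by simp
 then show ?thesis unfolding *(2,4) cadd_cls[OF *(1,3)]
  using LIMSEQ_unique[OF co_cls[OF C_add[OF *(1,3)]]] by blast
qed

lemma co_sc: "a : W ==> co m (sc c a) = c * co m a"
proof (elim W_cases)
 fix x assume *: "x : C" "a = cls V p x"
 have "(%n. cf m (scaleF c (x n))) \<longlonglongrightarrow> c * co m a"
  unfolding cf_scale *(2) by (intro tendsto_intros co_cls *(1))
 then show ?thesis unfolding *(2) cscale_cls[OF *(1)]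
  using LIMSEQ_unique[OF co_cls[OF C_scale[OF *(1)]]] by blast
qed

lemma co_bound: "a : W ==> cmod (co m a) <= Cb / p (ee lam m) * cnorm p a"
proof (elim W_cases)
 fix x assume *: "x : C" "a = cls V p x"
 show ?thesis unfolding *(2)
  by (rule LIMSEQ_le[OF tendsto_norm[OF co_cls[OF *(1)]] tendsto_mult_left[OF cnorm_cls[OF *(1)]]])
   (use cf_bound'[OF C_in[OF *(1)]] in blast)
qed

lemma co_family: "lb_family lam (%g v. co m (rh g (em v)))"
 by (rule functional_family[OF co_add co_sc co_bound]) (use Cb p_ee_pos in \<open>auto intro: less_imp_le\<close>)

text \<open>Approximate a by v in \<open>V\<close> within e, and let T be convolution with the
  kernel of \<open>vp_bound\<close>, where L covers the frequencies of v. Then T v = v, while T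
  tends to 0 along a Cauchy sequence representing a, so p v <= 3 Cb e. The argument relies on the
  norm of T being bounded independently of L, hence on this kernel instead of the Dirichlet
  kernel.\<close>

lemma co_zero_imp_zero:
 assumes a: "a : W" and z: "!!m. co m a = 0" shows "cnorm p a = 0"
proof -
 obtain x where x: "x : C" "a = cls V p x" using a by (rule W_cases)
 have H: "cnorm p a <= (1 + 3 * Cb) * e" if e: "e > 0" for e
 proof -
  obtain v where v: "v : V" "dd a (em v) < e" using dense[OF a e] by blast
  obtain L where L: "L > 0" "{m. cf m v ~= 0} \<subseteq> {- int L..int L}"
  proof -
   obtain M where M: "!!m. m : {m. cf m v ~= 0} ==> \<bar>m\<bar> <= M"
    using finite_abs_int_segment Vs_expand(1)[OF v(1)] by (metis bdd_above_def bdd_above_finite finite_imageI imageI)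
   have "m : {- int (Suc (nat M))..int (Suc (nat M))}" if "m : {m. cf m v ~= 0}" for m
    using M[OF that] unfolding atLeastAtMost_iff by linarith
   then show thesis by (intro that[of "Suc (nat M)"] subsetI) (simp, blast)
  qed
  let ?I = "{0..<int L} \<times> {- 2 * int L..2 * int L}"
  define T where "T u = (\<Sum>i\<in>?I. scaleF (cor (1 / real L) * cf (fst i + snd i) u) (ee lam (fst i + snd i)))" for u
  have TV: "T u : V" for u unfolding T_def by (intro Vs_sum Vs_scale ee_in_Vs)
  have xV: "x n : V" for n by (rule C_in[OF x(1)])
  have T3: "p (T u) <= 3 * (Cb * p u)" if "u : V" for u
   unfolding T_def by (rule p_avg[OF _ that vp_bound[OF L(1)]]) simp_all
  have Tv: "T v = v" unfolding T_def by (rule vp_reproduce[OF v(1) L])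
  have Td: "T (v - x n) = T v - T (x n)" for n
   unfolding T_def cf_diff[OF v(1) xV] sum_subtractf[symmetric] by (intro sum.cong refl) (simp add: fun_eq_iff algebra_simps)
  have "p v <= 3 * (Cb * p (v - x n)) + p (T (x n))" for n
  proof -
   have "p v = p (T (v - x n) + T (x n))" unfolding Td Tv by simp
   also have "\<dots> <= p (T (v - x n)) + p (T (x n))" by (intro p_add TV)
   finally show ?thesis using T3[OF V_diff[OF v(1) xV], of n] by linarith
  qed
  moreover have "(%n. 3 * (Cb * p (v - x n)) + p (T (x n))) \<longlonglongrightarrow> 3 * (Cb * dd (em v) a) + 0"
  proof (intro tendsto_add tendsto_mult tendsto_const)
   have "cdiff V p (em v) a = cls V p (%n. v - x n)" unfolding x(2) emb_def by (rule cdiff_cls[OF C_const[OF v(1)] x(1)])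
   then show "(%n. p (v - x n)) \<longlonglongrightarrow> dd (em v) a" using cnorm_cls[OF C_diff[OF C_const[OF v(1)] x(1)]] by simp
   have "(%n. \<Sum>i\<in>?I. cmod (cor (1 / real L) * cf (fst i + snd i) (x n)) * p (ee lam (fst i + snd i))) \<longlonglongrightarrow> (\<Sum>i\<in>?I. 0)"
   proof (rule tendsto_sum)
    fix i
    have "(%n. cf (fst i + snd i) (x n)) \<longlonglongrightarrow> 0" using co_cls[OF x(1)] z x(2) by metis
    then have "(%n. cmod (cor (1 / real L) * cf (fst i + snd i) (x n)) * p (ee lam (fst i + snd i)))
     \<longlonglongrightarrow> cmod (cor (1 / real L) * 0) * p (ee lam (fst i + snd i))" by (intro tendsto_intros)
    then show "(%n. cmod (cor (1 / real L) * cf (fst i + snd i) (x n)) * p (ee lam (fst i + snd i))) \<longlonglongrightarrow> 0" by simp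
   qed
   then have l: "(%n. \<Sum>i\<in>?I. cmod (cor (1 / real L) * cf (fst i + snd i) (x n)) * p (ee lam (fst i + snd i))) \<longlonglongrightarrow> 0" by simp
   have "p (T (x n)) <= (\<Sum>i\<in>?I. cmod (cor (1 / real L) * cf (fst i + snd i) (x n)) * p (ee lam (fst i + snd i)))" for n
    unfolding T_def p_scale[OF ee_in_Vs, symmetric] by (rule p_sum) (intro Vs_scale ee_in_Vs)
   then show "(%n. p (T (x n))) \<longlonglongrightarrow> 0" by (intro tendsto0I[OF l] p_nonneg TV)
  qed
  ultimately have "p v <= 3 * (Cb * dd (em v) a) + 0" by (intro LIMSEQ_le_const[where X="%n. 3 * (Cb * p (v - x n)) + p (T (x n))"]) blast+
  then have "p v <= 3 * (Cb * dd a (em v))" using dd_sym[OF a emb_in[OF v(1)]] by simp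
  also have "\<dots> <= 3 * (Cb * e)" using v(2) Cb by (intro mult_left_mono) auto
  finally have "p v <= 3 * (Cb * e)" .
  moreover have "cnorm p a <= p v + dd a (em v)" using cnorm_le_dd[OF a emb_in[OF v(1)]] cnorm_emb[OF v(1)] by simp
  ultimately show ?thesis using v(2) by (simp add: algebra_simps)
 qed
 have "cnorm p a <= 0"
 proof (rule field_le_epsilon)
  fix e :: real assume e: "e > 0"
  have c: "1 + 3 * Cb > 0" using Cb by simp
  then have "e / (1 + 3 * Cb) > 0" using e by simp
  from H[OF this] show "cnorm p a <= 0 + e" using c by simp
 qed
 then show ?thesis using cnorm_nonneg[OF a] by simp
qed

lemma rh_rot_limit:
 assumes "x : C" shows "(%n. act (rot tta) (x n)) : C" "rh (rot tta) (cls V p x) = cls V p (%n. act (rot tta) (x n))"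
proof -
 have xV: "x n : V" for n by (rule C_in[OF assms])
 have ad: "act (rot tta) (x m - x n) = act (rot tta) (x m) - act (rot tta) (x n)" for m n by (simp add: act_def fun_eq_iff)
 show y: "(%n. act (rot tta) (x n)) : C"
 proof (rule C_I)
  show "act (rot tta) (x n) : V" for n by (intro act_rot_Vs xV)
  fix e :: real assume "e > 0"
  then have "e / Cb > 0" using Cb by simp
  then obtain N where N: "!!m n. m >= N ==> n >= N ==> p (x m - x n) < e / Cb" using C_D[OF assms] by blast
  have "p (act (rot tta) (x m) - act (rot tta) (x n)) < e" if "m >= N" "n >= N" for m n
   using p_act[OF V_diff[OF xV xV], of tta m n] N[OF that] Cb unfolding ad by (simp add: field_simps)
  then show "\<exists>N. \<forall>m\<ge>N. \<forall>n\<ge>N. p (act (rot tta) (x m) - act (rot tta) (x n)) < e" by blast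
 qed
 have R: "rot tta : SL2" by (intro SO2_SL2 rot_SO2)
 have c: "cls V p x : W" by (rule cls_in[OF assms])
 have "dd (rh (rot tta) (cls V p x)) (cls V p (%n. act (rot tta) (x n))) = 0"
 proof (rule LIMSEQ_unique[OF tendsto_const])
  have "(%n. Cb * dd (em (x n)) (cls V p x) + dd (em (act (rot tta) (x n))) (cls V p (%n. act (rot tta) (x n)))) \<longlonglongrightarrow> Cb * 0 + 0"
   by (intro tendsto_intros cls_limit[OF assms] cls_limit[OF y])
  then have l: "(%n. Cb * dd (em (x n)) (cls V p x) + dd (em (act (rot tta) (x n))) (cls V p (%n. act (rot tta) (x n)))) \<longlonglongrightarrow> 0" by simp
  show "(%n. dd (rh (rot tta) (cls V p x)) (cls V p (%n. act (rot tta) (x n)))) \<longlonglongrightarrow> 0"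
  proof (rule tendsto0I[OF l])
   show "0 <= dd (rh (rot tta) (cls V p x)) (cls V p (%n. act (rot tta) (x n)))" by (intro dd_nonneg rh_in R c cls_in y)
   fix n
   have e: "em (x n) : W" by (rule emb_in[OF xV])
   have "dd (rh (rot tta) (cls V p x)) (em (act (rot tta) (x n))) = dd (rh (rot tta) (cls V p x)) (rh (rot tta) (em (x n)))"
    by (simp only: rh_K[OF rot_SO2 xV])
   also have "\<dots> = cnorm p (rh (rot tta) (cdiff V p (em (x n)) (cls V p x)))"
    by (simp only: rh_cdiff[OF R e c]) (intro dd_sym rh_in R c e)
   also have "\<dots> <= Cb * dd (em (x n)) (cls V p x)" by (intro bddW R cdiff_in e c)
   finally have "dd (rh (rot tta) (cls V p x)) (em (act (rot tta) (x n))) <= Cb * dd (em (x n)) (cls V p x)" .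
   moreover have "dd (rh (rot tta) (cls V p x)) (cls V p (%n. act (rot tta) (x n)))
    <= dd (rh (rot tta) (cls V p x)) (em (act (rot tta) (x n))) + dd (em (act (rot tta) (x n))) (cls V p (%n. act (rot tta) (x n)))"
    by (intro dd_tri rh_in R c cls_in y emb_in act_rot_Vs xV)
   ultimately show "dd (rh (rot tta) (cls V p x)) (cls V p (%n. act (rot tta) (x n)))
    <= Cb * dd (em (x n)) (cls V p x) + dd (em (act (rot tta) (x n))) (cls V p (%n. act (rot tta) (x n)))" by linarith
  qed
 qed
 then show "rh (rot tta) (cls V p x) = cls V p (%n. act (rot tta) (x n))"
  using dd_eq_0[OF rh_in[OF R c] cls_in[OF y]] by simp
qed

lemma co_rot:
 assumes a: "a : W" shows "co m (rh (rot tta) a) = cis (- 2 * of_int m * tta) * co m a"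
proof -
 obtain x where x: "x : C" "a = cls V p x" using a by (rule W_cases)
 have "(%n. cf m (act (rot tta) (x n))) \<longlonglongrightarrow> cis (- 2 * of_int m * tta) * co m a"
  unfolding cf_act_rot[OF C_in[OF x(1)]] x(2) by (intro tendsto_intros co_cls x(1))
 then show ?thesis unfolding x(2) rh_rot_limit(2)[OF x(1)]
  using LIMSEQ_unique[OF co_cls[OF rh_rot_limit(1)[OF x(1)]]] by blast
qed

text \<open>Left rotations multiply \<open>co m\<close> by a character; differentiating this
  identity after moving the rotation to the right of g gives the type relation.\<close>

lemma co_twist:
 assumes g: "g : SL2" and v: "v : V"
 shows "co m (rh g (em (lie_act (Ztwist g) v))) = - 2 * \<i> * of_int m * co m (rh g (em v))"
proof -
 interpret F: lb_family lam "%g v. co m (rh g (em v))" by (rule co_family)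
 have "((%t. co m (rh (g ** mexp (t *\<^sub>R Ztwist g)) (em v))) has_vector_derivative co m (rh g (em (lie_act (Ztwist g) v)))) (at 0)"
  by (rule F.Ph_deriv[OF g v Ztwist_sl2[OF g]])
 moreover have "co m (rh (g ** mexp (t *\<^sub>R Ztwist g)) (em v)) = cis (- 2 * of_int m * t) * co m (rh g (em v))" for t
  unfolding rot_twist[OF g, symmetric] rh_mult[OF SO2_SL2[OF rot_SO2] g emb_in[OF v]] by (rule co_rot[OF rh_em_in[OF g v]])
 moreover have "((%t. cis (- 2 * of_int m * t) * co m (rh g (em v))) has_vector_derivative (- 2 * \<i> * of_int m * co m (rh g (em v)))) (at 0)"
 proof -
  have e: "cis (- 2 * of_int m * t) = exp (t *\<^sub>R (- 2 * \<i> * of_int m))" for t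
   by (simp add: cis_conv_exp scaleR_conv_of_real mult_ac)
  show ?thesis unfolding e
   using has_vector_derivative_mult_left[OF exp_scaleR_has_vector_derivative_right[of "- 2 * \<i> * of_int m" 0 UNIV], of "co m (rh g (em v))"]
   by simp
 qed
 ultimately show ?thesis using vector_derivative_unique_at by (simp only:) blast
qed

text \<open>The Fourier coefficient of index m of k |-> T(k a) is \<open>co m a\<close> times
  T(e_m), so its modulus is at most the supremum B. It is proved first on a Cauchy sequence in
  \<open>V\<close>, with an error that tends to 0.\<close>

lemma co_functional_bound:
 assumes a: "a : W"
  and T: "!!a b. a : W ==> b : W ==> T (add2 a b) = T a + T b"
   "!!a c. a : W ==> T (sc c a) = c * T a" "!!a. a : W ==> cmod (T a) <= K * cnorm p a"
  and K: "K >= 0" and B: "!!tta. cmod (T (rh (rot tta) a)) <= B"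
 shows "cmod (co m a) * cmod (T (em (ee lam m))) <= B"
proof -
 obtain x where x: "x : C" "a = cls V p x" using a by (rule W_cases)
 have xV: "x n : V" for n by (rule C_in[OF x(1)])
 have B0: "B >= 0" using order_trans[OF norm_ge_zero B] .
 have T0: "T (em 0) = 0"
  using T(2)[OF emb_in[OF V_zero], of 0] em0[OF emb_in[OF V_zero]] by (simp only: mult_zero_left)
 have Tsum: "T (em (\<Sum>j\<in>F. f j)) = (\<Sum>j\<in>F. T (em (f j)))" if "!!j::nat. j : F ==> f j : V" for F f
  using that
 proof (induction F rule: infinite_finite_induct)
  case (insert j F)
  have fj: "f j : V" using insert.prems by simp
  have sV: "(\<Sum>j\<in>F. f j) : V" by (intro V_sum insert.prems) simp
  have "T (em (f j + (\<Sum>j\<in>F. f j))) = T (em (f j)) + T (em (\<Sum>j\<in>F. f j))"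
   unfolding emb_add[OF fj sV, symmetric] by (rule T(1)[OF emb_in[OF fj] emb_in[OF sV]])
  moreover have "(\<Sum>j\<in>insert j F. f j) = f j + (\<Sum>j\<in>F. f j)" using insert by (intro sum.insert)
  moreover have "T (em (\<Sum>j\<in>F. f j)) = (\<Sum>j\<in>F. T (em (f j)))" by (intro insert.IH insert.prems) simp
  moreover have "(\<Sum>j\<in>insert j F. T (em (f j))) = T (em (f j)) + (\<Sum>j\<in>F. T (em (f j)))" using insert by (intro sum.insert)
  ultimately show ?case by (simp only:)
 qed (simp_all only: sum.empty sum.infinite T0 not_False_eq_True)
 have "cmod (cf m (x n)) * cmod (T (em (ee lam m))) <= B + K * (Cb * dd (em (x n)) a)" for n
 proof -
  let ?r = "%v. cmod (T (em v))"
  have Bn: "?r (act (rot tta) (x n)) <= B + K * (Cb * dd (em (x n)) a)" for tta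
  proof -
   have R: "rot tta : SL2" by (intro SO2_SL2 rot_SO2)
   have e: "em (x n) : W" by (rule emb_in[OF xV])
   have "add2 (rh (rot tta) a) (rh (rot tta) (cdiff V p (em (x n)) a)) = rh (rot tta) (em (x n))"
    unfolding rh_add[OF R a cdiff_in[OF e a], symmetric] W_identity2(2)[OF e a] ..
   then have "T (em (act (rot tta) (x n))) = T (rh (rot tta) a) + T (rh (rot tta) (cdiff V p (em (x n)) a))"
    using T(1)[OF rh_in[OF R a] rh_in[OF R cdiff_in[OF e a]]] by (simp only: rh_K[OF rot_SO2 xV])
   then have "?r (act (rot tta) (x n)) <= cmod (T (rh (rot tta) a)) + cmod (T (rh (rot tta) (cdiff V p (em (x n)) a)))"
    by (simp only: norm_triangle_ineq)
   also have "\<dots> <= B + K * (Cb * dd (em (x n)) a)"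
    by (intro add_mono B order_trans[OF T(3)] mult_left_mono K bddW rh_in R cdiff_in e a)
   finally show ?thesis .
  qed
  have "?r (\<Sum>i\<in>{0::nat}. scaleF (1 * cf m (x n)) (ee lam m)) <= 1 * (B + K * (Cb * dd (em (x n)) a))"
  proof (rule avg_seminorm[where r="?r" and a="%_. 1" and n="%_. m" and ?J1.0=0, OF _ xV])
   show "?r (\<Sum>j\<in>F. f j) <= (\<Sum>j\<in>F. ?r (f j))" if "!!j::nat. j : F ==> f j : Vs lam" for F f
   proof -
    have "T (em (\<Sum>j\<in>F. f j)) = (\<Sum>j\<in>F. T (em (f j)))" by (rule Tsum) (rule that)
    then show ?thesis by (simp only: norm_sum)
   qed
   show "?r (scaleF c v) = cmod c * ?r v" if "v : Vs lam" for v c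
    using that by (simp only: emb_scale[symmetric] T(2) emb_in norm_mult)
   show "0 <= B + K * (Cb * dd (em (x n)) a)" using B0 K Cb dd_nonneg[OF emb_in[OF xV] a] by (intro add_nonneg_nonneg mult_nonneg_nonneg) auto
  qed (use Bn in simp_all)
  then show ?thesis by (simp add: emb_scale[symmetric] T(2) emb_in norm_mult)
 qed
 moreover have "(%n. B + K * (Cb * dd (em (x n)) a)) \<longlonglongrightarrow> B + K * (Cb * 0)"
  unfolding x(2) by (intro tendsto_intros cls_limit x(1))
 moreover have "(%n. cmod (cf m (x n)) * cmod (T (em (ee lam m)))) \<longlonglongrightarrow> cmod (co m a) * cmod (T (em (ee lam m)))"
  unfolding x(2) by (intro tendsto_intros co_cls x(1))
 ultimately show ?thesis using LIMSEQ_le by fastforce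
qed

end

section \<open>Enlarging a bounded norm\<close>

text \<open>Three moves of length at most 2 dlt each. The derivative bound B is assumed at all group
  elements, which makes the estimate uniform in x.\<close>

lemma (in coeff_family) LDU_lipschitz:
 assumes B: "!!g X. g : SL2 ==> X : {Fm, Hm, Em} ==> cmod (Ph g (lie_act X v)) <= B"
  and v: "v : Vs lam" and x: "x : SL2" and w: "w : SL2"
  and dlt: "!!i j. \<bar>w$i$j - (mat 1::mat2)$i$j\<bar> <= dlt" "dlt <= 1/2"
 shows "cmod (Ph (x ** w) v - Ph x v) <= 6 * dlt * B"
proof -
 obtain a b c where e: "w = mxp a Fm ** mxp b Hm ** mxp c Em"
  and s: "\<bar>a\<bar> <= 2 * dlt" "\<bar>b\<bar> <= 2 * dlt" "\<bar>c\<bar> <= 2 * dlt" using LDU[OF w dlt] by blast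
 have B0: "B >= 0" using order_trans[OF norm_ge_zero B[OF SL2_one, of Fm]] by simp
 have st: "cmod (Ph (g ** mxp t X) v - Ph g v) <= B * \<bar>t\<bar>" if "g : SL2" "X : {Fm, Hm, Em}" for g X t
 proof (rule Ph_bound1[OF that(1) v])
  show X: "X : sl2" using that(2) by auto
  show "cmod (Ph (g ** mxp s X) (lie_act X v)) <= B" for s
   by (rule B[OF SL2_mult[OF that(1) mexp_scale_SL2[OF X]] that(2)])
 qed
 let ?x1 = "x ** mxp a Fm"
 let ?x2 = "?x1 ** mxp b Hm"
 have x1: "?x1 : SL2" by (intro SL2_mult x mexp_scale_SL2) simp
 have x2: "?x2 : SL2" by (intro SL2_mult x1 mexp_scale_SL2) simp
 have "x ** w = ?x2 ** mxp c Em" unfolding e by (simp only: matrix_mul_assoc)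
 then have "Ph (x ** w) v - Ph x v = (Ph (?x2 ** mxp c Em) v - Ph ?x2 v) + (Ph ?x2 v - Ph ?x1 v) + (Ph ?x1 v - Ph x v)" by simp
 then have "cmod (Ph (x ** w) v - Ph x v) <= cmod (Ph (?x2 ** mxp c Em) v - Ph ?x2 v) + cmod (Ph ?x2 v - Ph ?x1 v) + cmod (Ph ?x1 v - Ph x v)"
  by (metis norm_triangle_mono norm_triangle_ineq order_refl)
 also have "\<dots> <= B * \<bar>c\<bar> + B * \<bar>b\<bar> + B * \<bar>a\<bar>" by (intro add_mono st x x1 x2) simp_all
 also have "\<dots> <= B * (2 * dlt) + B * (2 * dlt) + B * (2 * dlt)" by (intro add_mono mult_left_mono s B0)
 finally show ?thesis by (simp add: mult_ac)
qed

context nspace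
begin

lemma sum_rep_C: "finite B ==> B \<subseteq> W ==> (%n. \<Sum>b\<in>B. scaleF (c b) (rep b n)) : C"
proof (induction B rule: finite_induct)
 case empty
 show ?case unfolding sum.empty by (rule C_const[OF V_zero])
next
 case (insert b B)
 have b: "b : W" and B: "B \<subseteq> W" using insert.prems by auto
 have "(%n. scaleF (c b) (rep b n) + (\<Sum>b\<in>B. scaleF (c b) (rep b n))) : C"
  by (rule C_add[OF C_scale[OF rep_C[OF b]] insert.IH[OF B]])
 then show ?case unfolding sum.insert[OF insert.hyps] .
qed

lemma clincomb_empty: "clincomb V p {} c = em 0"
 unfolding clincomb_def emb_def sum.empty ..

lemma clincomb_insert:
 assumes "finite B" "B \<subseteq> W" "b : W" "b \<notin> B"
 shows "clincomb V p (insert b B) c = add2 (sc (c b) b) (clincomb V p B c)"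
proof -
 have "clincomb V p (insert b B) c = cls V p (%n. scaleF (c b) (rep b n) + (\<Sum>b\<in>B. scaleF (c b) (rep b n)))"
  unfolding clincomb_def sum.insert[OF assms(1,4)] ..
 also have "\<dots> = add2 (cls V p (%n. scaleF (c b) (rep b n))) (clincomb V p B c)"
  unfolding clincomb_def by (rule cadd_cls[symmetric]) (intro C_scale rep_C assms sum_rep_C)+
 also have "cls V p (%n. scaleF (c b) (rep b n)) = sc (c b) b"
  using cscale_cls[OF rep_C[OF assms(3)], of "c b"] cls_rep[OF assms(3)] by simp
 finally show ?thesis .
qed

lemma clincomb_in: "finite B ==> B \<subseteq> W ==> clincomb V p B c : W"
 unfolding clincomb_def by (intro cls_in sum_rep_C)

lemma emb_inj: "u : V ==> w : V ==> em u = em w ==> u = w"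
proof -
 assume V: "u : V" "w : V" and e: "em u = em w"
 have "p (u - w) = dd (em u) (em w)" by (simp only: emb_diff[OF V] cnorm_emb[OF V_diff[OF V]])
 also have "\<dots> = 0" unfolding e using dd_eq_0[OF emb_in emb_in] V by simp
 finally have "u - w = 0" using p_eq_0[OF V_diff[OF V]] by (simp only:)
 then show ?thesis by (simp only: right_minus_eq)
qed

text \<open>\<open>clincomb\<close> sums over a set of classes and attaches coefficients to classes,
  so distinct indices must have distinct images.\<close>

lemma emb_clincomb:
 assumes "finite F" "!!m. m : F ==> e m : V" "inj_on e F" "!!m. m : F ==> c (em (e m)) = d m"
 shows "em (\<Sum>m\<in>F. scaleF (d m) (e m)) = clincomb V p ((%m. em (e m)) ` F) c"
 using assms
proof (induction F rule: finite_induct)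
 case empty
 show ?case unfolding image_empty clincomb_empty sum.empty ..
next
 case (insert m F)
 have m: "e m : V" and F: "!!k. k : F ==> e k : V" using insert.prems(1) by auto
 have sV: "(\<Sum>m\<in>F. scaleF (d m) (e m)) : V" by (intro V_sum V_scale F)
 have ni: "em (e m) \<notin> (%m. em (e m)) ` F"
 proof
  assume "em (e m) : (%m. em (e m)) ` F"
  then obtain k where k: "k : F" "em (e m) = em (e k)" by (rule imageE)
  have "e m = e k" by (rule emb_inj[OF m F[OF k(1)] k(2)])
  then have "m = k" using insert.prems(2) k(1) by (auto simp: inj_on_def)
  then show False using k(1) insert.hyps(2) by simp
 qed
 have IH: "em (\<Sum>m\<in>F. scaleF (d m) (e m)) = clincomb V p ((%m. em (e m)) ` F) c"
  by (rule insert.IH) (use insert.prems in \<open>auto simp: inj_on_def\<close>)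
 have "em (\<Sum>m\<in>insert m F. scaleF (d m) (e m)) = em (scaleF (d m) (e m) + (\<Sum>m\<in>F. scaleF (d m) (e m)))"
  unfolding sum.insert[OF insert.hyps] ..
 also have "\<dots> = add2 (sc (d m) (em (e m))) (em (\<Sum>m\<in>F. scaleF (d m) (e m)))"
  by (simp only: emb_add[OF V_scale[OF m] sV] emb_scale[OF m])
 also have "\<dots> = add2 (sc (c (em (e m))) (em (e m))) (clincomb V p ((%m. em (e m)) ` F) c)"
  unfolding IH using insert.prems(3)[of m] by simp
 also have "\<dots> = clincomb V p (insert (em (e m)) ((%m. em (e m)) ` F)) c"
  by (rule clincomb_insert[symmetric]) (use insert.hyps F m ni in auto)
 finally show ?case unfolding image_insert .
qed

end

text \<open>A G-stable set of p-continuous functionals, bounded on each vector of \<open>V\<close>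
  but possibly unbounded elsewhere on the completion. The aim is that p plus their supremum is again
  a uniformly bounded G-continuous norm.\<close>

locale newnorm = bglob +
 fixes Ls :: "(cvec => complex) set"
 assumes Ls_ne: "Ls ~= {}"
  and L_add: "!!l a b. l : Ls ==> a : completion (Vs lam) p ==> b : completion (Vs lam) p ==> l (cadd (Vs lam) p a b) = l a + l b"
  and L_sc: "!!l a c. l : Ls ==> a : completion (Vs lam) p ==> l (cscale (Vs lam) p c a) = c * l a"
  and L_bd: "!!l. l : Ls ==> \<exists>K\<ge>0. \<forall>a\<in>completion (Vs lam) p. cmod (l a) <= K * cnorm p a"
  and L_inv: "!!l g. l : Ls ==> g : SL2 ==> \<exists>l'\<in>Ls. \<forall>a\<in>completion (Vs lam) p. l' a = l (rh g a)"
  and L_V: "!!v. v : Vs lam ==> \<exists>B. \<forall>l\<in>Ls. cmod (l (emb (Vs lam) p v)) <= B"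
begin

definition "NN a = (SUP l\<in>Ls. cmod (l a))"

definition "q v = p v + NN (em v)"

lemma NN_least: "(!!l. l : Ls ==> cmod (l a) <= B) ==> NN a <= B"
 unfolding NN_def by (rule cSUP_least[OF Ls_ne])

lemma NN_upper: "(!!l. l : Ls ==> cmod (l a) <= B) ==> l : Ls ==> cmod (l a) <= NN a"
 unfolding NN_def by (rule cSUP_upper) (auto intro!: bdd_aboveI[of _ B])

lemma NN_em: "v : V ==> l : Ls ==> cmod (l (em v)) <= NN (em v)"
 using L_V[of v] NN_upper[of "em v"] by blast

lemma NN_em_nonneg: "v : V ==> 0 <= NN (em v)"
 using Ls_ne NN_em[of v] norm_ge_zero order_trans by (metis all_not_in_conv)

lemma L_cdiff: "l : Ls ==> a : W ==> b : W ==> l (cdiff V p a b) = l a - l b"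
 by (simp add: cdiff_eq L_add L_sc sc_in)

lemma NN_scale: "v : V ==> NN (em (scaleF c v)) = cmod c * NN (em v)"
proof -
 have le: "NN (em (scaleF c v)) <= cmod c * NN (em v)" if v: "v : V" for c v
  unfolding emb_scale[OF v, symmetric]
  by (rule NN_least) (simp add: L_sc emb_in v norm_mult mult_left_mono NN_em)
 assume v: "v : V"
 show ?thesis
 proof (cases "c = 0")
  case True
  then show ?thesis using le[OF v, of 0] NN_em_nonneg[OF V_scale[OF v], of 0] by simp
 next
  case False
  have "scaleF (1 / c) (scaleF c v) = v" using False by (simp add: fun_eq_iff)
  then have "NN (em v) <= cmod (1 / c) * NN (em (scaleF c v))" using le[OF V_scale[OF v], of "1 / c" c] by (simp only:)
  then have "cmod c * NN (em v) <= NN (em (scaleF c v))" using False by (simp add: norm_divide field_simps)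
  then show ?thesis using le[OF v, of c] by linarith
 qed
qed

lemma NN_add: "u : V ==> v : V ==> NN (em (u + v)) <= NN (em u) + NN (em v)"
 unfolding emb_add[symmetric]
 by (rule NN_least) (auto simp: L_add emb_in intro!: order_trans[OF norm_triangle_ineq] add_mono NN_em)

lemma q_norm: "is_norm V q"
 unfolding is_norm_def
proof (intro conjI ballI allI)
 fix v c assume v: "v : V"
 show "0 <= q v" unfolding q_def by (intro add_nonneg_nonneg p_nonneg v NN_em_nonneg)
 show "q (scaleF c v) = cmod c * q v" unfolding q_def NN_scale[OF v] p_scale[OF v] by (rule distrib_left[symmetric])
 show "(q v = 0) = (v = 0)"
 proof
  assume "q v = 0"
  then have "p v = 0" unfolding q_def using p_nonneg[OF v] NN_em_nonneg[OF v] by linarith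
  then show "v = 0" using p_eq_0[OF v] by (simp only:)
 next
  assume v0: "v = 0"
  have "NN (em (scaleF 0 0)) = 0" using NN_scale[OF V_zero, of 0] by (simp only: norm_zero mult_zero_left)
  moreover have "scaleF 0 (0::fn) = 0" by (simp add: fun_eq_iff)
  ultimately show "q v = 0" unfolding q_def v0 by (simp only: p_0 add_0)
 qed
next
 fix u v assume "u : V" "v : V"
 then show "q (u + v) <= q u + q v" unfolding q_def using p_add[of u v] NN_add[of u v] by linarith
qed

end

section \<open>The completion for the enlarged norm, realized inside the old one\<close>

sublocale newnorm \<subseteq> Q: nspace "Vs lam" q
 by (unfold_locales) (auto intro: q_norm)

context newnorm
begin

abbreviation "Wq \<equiv> completion V q"
abbreviation "Cq \<equiv> cauchy_seqs V q"
abbreviation "eq' v \<equiv> emb V q v"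

lemma p_le_q: "v : V ==> p v <= q v" and NN_le_q: "v : V ==> NN (em v) <= q v"
 unfolding q_def using NN_em_nonneg p_nonneg by auto

lemma Cq_C:
 assumes x: "x : Cq" shows "x : C"
proof (rule C_I[OF Q.C_in[OF x]])
 fix e :: real assume "e > 0"
 then obtain N where N: "!!m n. m >= N ==> n >= N ==> q (x m - x n) < e" using Q.C_D[OF x] by blast
 have "p (x m - x n) < e" if "m >= N" "n >= N" for m n
  using N[OF that] p_le_q[OF V_diff[OF Q.C_in[OF x] Q.C_in[OF x]], of m n] by linarith
 then show "\<exists>N. \<forall>m\<ge>N. \<forall>n\<ge>N. p (x m - x n) < e" by blast
qed

lemma L_cont:
 assumes l: "l : Ls" and x: "x : C" shows "(%n. l (em (x n))) \<longlonglongrightarrow> l (cls V p x)"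
proof -
 obtain K where K: "!!a. a : W ==> cmod (l a) <= K * cnorm p a" using L_bd[OF l] by blast
 have xV: "em (x n) : W" for n by (intro emb_in C_in x)
 have "(%n. K * dd (em (x n)) (cls V p x)) \<longlonglongrightarrow> 0" using tendsto_mult_right_zero[OF cls_limit[OF x]] .
 then have "(%n. l (em (x n)) - l (cls V p x)) \<longlonglongrightarrow> 0"
  by (rule Lim_null_comparison[rotated])
   (use K[OF cdiff_in[OF xV cls_in[OF x]]] L_cdiff[OF l xV cls_in[OF x]] in simp)
 then show ?thesis by (rule LIM_zero_cancel)
qed

text \<open>Closeness in the enlarged norm phrased through the individual functionals, because a
  supremum over \<open>Ls\<close> is meaningful only where it is known to be finite.\<close>

definition near :: "cvec => fn => real => bool" where
 "near a v e \<longleftrightarrow> dd a (em v) <= e & (\<forall>l\<in>Ls. cmod (l a - l (em v)) <= e)"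

text \<open>The closure of \<open>V\<close> under \<open>near\<close>; \<open>io\<close> identifies
  the new completion with it.\<close>

definition W' :: "cvec set" where "W' = {a : W. \<forall>e>0. \<exists>v\<in>V. near a v e}"

lemma W'_W: "a : W' ==> a : W" by (simp add: W'_def)

lemma W'_near: "a : W' ==> e > 0 ==> \<exists>v\<in>V. near a v e" by (simp add: W'_def)

lemma NN_W':
 assumes a: "a : W'" and l: "l : Ls" shows "cmod (l a) <= NN a"
proof -
 obtain v where v: "v : V" "near a v 1" using W'_near[OF a, of 1] by auto
 have "cmod (l a) <= NN (em v) + 1" if l: "l : Ls" for l
 proof -
  have "cmod (l a) <= cmod (l (em v)) + cmod (l a - l (em v))" by (metis add.commute diff_add_cancel norm_triangle_ineq)
  moreover have "cmod (l a - l (em v)) <= 1" using v(2) l by (simp add: near_def)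
  ultimately show ?thesis using NN_em[OF v(1) l] by linarith
 qed
 then show ?thesis using l by (rule NN_upper)
qed

lemma near_cls:
 assumes x: "x : Cq" and e: "e > 0"
 shows "\<exists>N. \<forall>n\<ge>N. near (cls V p x) (x n) e"
proof -
 have xC: "x : C" by (rule Cq_C[OF x])
 have xV: "x n : V" for n by (rule C_in[OF xC])
 obtain N where N: "!!m n. m >= N ==> n >= N ==> q (x m - x n) < e" using Q.C_D[OF x e] by blast
 have "near (cls V p x) (x n) e" if n: "n >= N" for n
  unfolding near_def
 proof (intro conjI ballI)
  have c: "(%m. x m - x n) : C" using C_diff[OF xC C_const[OF xV]] .
  have "cdiff V p (cls V p x) (em (x n)) = cls V p (%m. x m - x n)"
   unfolding emb_def by (rule cdiff_cls[OF xC C_const[OF xV]])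
  moreover have "cnorm p (cls V p (%m. x m - x n)) <= e"
  proof (rule LIMSEQ_le_const2[OF cnorm_cls[OF c]])
   have "p (x m - x n) <= e" if "m >= N" for m
    using N[OF that n] p_le_q[OF V_diff[OF xV xV], of m n] by linarith
   then show "\<exists>N. \<forall>m\<ge>N. p (x m - x n) <= e" by blast
  qed
  ultimately show "dd (cls V p x) (em (x n)) <= e" by simp
  fix l assume l: "l : Ls"
  have "(%m. cmod (l (em (x m)) - l (em (x n)))) \<longlonglongrightarrow> cmod (l (cls V p x) - l (em (x n)))"
   by (intro tendsto_intros L_cont l xC)
  then show "cmod (l (cls V p x) - l (em (x n))) <= e"
  proof (rule LIMSEQ_le_const2)
   have "cmod (l (em (x m)) - l (em (x n))) <= e" if "m >= N" for m
   proof -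
    have "l (em (x m)) - l (em (x n)) = l (em (x m - x n))"
     by (simp only: emb_diff[OF xV xV, symmetric] L_cdiff[OF l emb_in[OF xV] emb_in[OF xV]])
    then show ?thesis
     using NN_em[OF V_diff[OF xV xV] l, of m n] NN_le_q[OF V_diff[OF xV xV], of m n] N[OF that n] by simp
   qed
   then show "\<exists>N. \<forall>m\<ge>N. cmod (l (em (x m)) - l (em (x n))) <= e" by blast
  qed
 qed
 then show ?thesis by blast
qed

lemma cls_W': "x : Cq ==> cls V p x : W'"
 unfolding W'_def using near_cls[of x] cls_in[OF Cq_C, of x] C_in[OF Cq_C, of x] by blast

text \<open>The canonical map between completions: a sequence that is Cauchy for the larger norm is
  Cauchy for p.\<close>

definition io :: "cvec => cvec" where "io A = cls V p (rep A)"

lemma io_cls: "x : Cq ==> io (cls V q x) = cls V p x"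
proof -
 assume x: "x : Cq"
 let ?y = "rep (cls V q x)"
 have y: "?y : Cq" "(%n. q (x n - ?y n)) \<longlonglongrightarrow> 0" using Q.rep_null[OF x] by (auto simp: Q.null_iff)
 have V: "x n - ?y n : V" for n by (intro V_diff Q.C_in x y)
 have "(%n. p (x n - ?y n)) \<longlonglongrightarrow> 0" by (rule tendsto0I[OF y(2) p_nonneg[OF V] p_le_q[OF V]])
 then show ?thesis unfolding io_def using cls_eq[OF Cq_C[OF x] Cq_C[OF y(1)]] by simp
qed

lemma io_in: "A : Wq ==> io A : W'"
 unfolding io_def by (intro cls_W' Q.rep_C)

lemma io_W: "A : Wq ==> io A : W"
 by (intro W'_W io_in)

lemma io_add: "A : Wq ==> B : Wq ==> io (cadd V q A B) = add2 (io A) (io B)"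
 by (elim Q.W_cases) (simp only: Q.cadd_cls io_cls Q.C_add cadd_cls Cq_C)

lemma io_sc: "A : Wq ==> io (cscale V q c A) = sc c (io A)"
 by (elim Q.W_cases) (simp only: Q.cscale_cls io_cls Q.C_scale cscale_cls Cq_C)

lemma io_cdiff: "A : Wq ==> B : Wq ==> io (cdiff V q A B) = cdiff V p (io A) (io B)"
 by (elim Q.W_cases) (simp only: Q.cdiff_cls io_cls Q.C_diff cdiff_cls Cq_C)

lemma io_em: "v : V ==> io (eq' v) = em v"
 unfolding emb_def by (rule io_cls[OF Q.C_const])

lemma em_W': "v : V ==> em v : W'"
 using io_in[OF Q.emb_in] io_em by fastforce

text \<open>Along a q-Cauchy sequence the functionals converge uniformly over \<open>Ls\<close>, so
  the supremum passes to the limit.\<close>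

lemma cnorm_q: "A : Wq ==> cnorm q A = cnorm p (io A) + NN (io A)"
proof (elim Q.W_cases)
 fix x assume x: "x : Cq" "A = cls V q x"
 have xV: "x n : V" for n by (rule Q.C_in[OF x(1)])
 have aW: "cls V p x : W'" by (rule cls_W'[OF x(1)])
 have "(%n. NN (em (x n))) \<longlonglongrightarrow> NN (cls V p x)"
 proof (rule LIMSEQ_I)
  fix e :: real assume e: "e > 0"
  then have "e / 2 > 0" by simp
  then obtain N where N: "!!n. n >= N ==> near (cls V p x) (x n) (e / 2)" using near_cls[OF x(1)] by blast
  have "norm (NN (em (x n)) - NN (cls V p x)) < e" if "n >= N" for n
  proof -
   have d: "cmod (l (cls V p x) - l (em (x n))) <= e / 2" if "l : Ls" for l using N[OF \<open>n >= N\<close>] that by (simp add: near_def)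
   have t: "cmod z <= cmod w + cmod (z - w)" "cmod w <= cmod z + cmod (z - w)" for z w :: complex
    using norm_triangle_ineq[of w "z - w"] norm_triangle_ineq4[of z "z - w"] by simp_all
   have "NN (em (x n)) <= NN (cls V p x) + e / 2"
   proof (rule NN_least)
    fix l assume l: "l : Ls"
    show "cmod (l (em (x n))) <= NN (cls V p x) + e / 2"
     using t(2)[of "l (em (x n))" "l (cls V p x)"] d[OF l] NN_W'[OF aW l] by linarith
   qed
   moreover have "NN (cls V p x) <= NN (em (x n)) + e / 2"
   proof (rule NN_least)
    fix l assume l: "l : Ls"
    show "cmod (l (cls V p x)) <= NN (em (x n)) + e / 2"
     using t(1)[of "l (cls V p x)" "l (em (x n))"] d[OF l] NN_em[OF xV l, of n] by linarith
   qed
   ultimately show ?thesis using e by (simp add: abs_if)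
  qed
  then show "\<exists>N. \<forall>n\<ge>N. norm (NN (em (x n)) - NN (cls V p x)) < e" by blast
 qed
 from tendsto_add[OF cnorm_cls[OF Cq_C[OF x(1)]] this]
 have "(%n. q (x n)) \<longlonglongrightarrow> cnorm p (cls V p x) + NN (cls V p x)" by (simp only: q_def)
 then show ?thesis unfolding x(2) io_cls[OF x(1)] by (rule Q.cnorm_unique[OF x(1)])
qed

text \<open>The functionals are p-continuous, hence determined by the class for p; two preimages of
  one class have q-distance 0.\<close>

lemma io_inj:
 assumes A: "A : Wq" and B: "B : Wq" and e: "io A = io B" shows "A = B"
proof -
 have "cnorm q (cdiff V q A B) = dd (io B) (io B) + NN (cdiff V p (io B) (io B))"
  unfolding cnorm_q[OF Q.cdiff_in[OF A B]] io_cdiff[OF A B] e ..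
 also have "dd (io B) (io B) = 0" using dd_eq_0[OF io_W[OF B] io_W[OF B]] by simp
 finally have "cnorm q (cdiff V q A B) <= 0"
  using NN_least[of "cdiff V p (io B) (io B)" 0] L_cdiff[OF _ io_W[OF B] io_W[OF B]] by simp
 then have "cnorm q (cdiff V q A B) = 0" using Q.dd_nonneg[OF A B] by simp
 then show ?thesis using Q.dd_eq_0[OF A B] by simp
qed

text \<open>Approximants with error 1/(n+1) in the sense of \<open>near\<close> form a q-Cauchy
  sequence, as both parts of q of a difference are controlled by the two errors; its p-limit is
  b.\<close>

lemma io_surj:
 assumes b: "b : W'" shows "\<exists>A\<in>Wq. io A = b"
proof -
 have bW: "b : W" by (rule W'_W[OF b])
 have "\<forall>n. \<exists>v. v : V & near b v (1 / real (Suc n))" using W'_near[OF b] by (metis of_nat_0_less_iff zero_less_Suc zero_less_divide_1_iff)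
 then obtain v where v: "!!n. v n : V" "!!n. near b (v n) (1 / real (Suc n))" by metis
 define r where "r n = 1 / real (Suc n)" for n
 have d: "dd b (em (v n)) <= r n" for n using v(2) by (simp add: near_def r_def)
 have l: "cmod (l b - l (em (v n))) <= r n" if "l : Ls" for l n using v(2) that by (simp add: near_def r_def)
 have qb: "q (v m - v n) <= 2 * (r m + r n)" for m n
 proof -
  have "p (v m - v n) = dd (em (v m)) (em (v n))" by (simp only: emb_diff[OF v(1) v(1)] cnorm_emb[OF V_diff[OF v(1) v(1)]])
  also have "\<dots> <= dd b (em (v m)) + dd b (em (v n))"
   using dd_tri[OF emb_in[OF v(1)] bW emb_in[OF v(1)], of m n] dd_sym[OF bW emb_in[OF v(1)], of m] by simp
  finally have 1: "p (v m - v n) <= r m + r n" using d[of m] d[of n] by linarith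
  have 2: "NN (em (v m - v n)) <= r m + r n"
  proof (rule NN_least)
   fix k assume k: "k : Ls"
   have e: "k (em (v m - v n)) = (k b - k (em (v n))) - (k b - k (em (v m)))"
    unfolding emb_diff[OF v(1) v(1), symmetric] L_cdiff[OF k emb_in[OF v(1)] emb_in[OF v(1)]] by simp
   show "cmod (k (em (v m - v n))) <= r m + r n"
    unfolding e
    using norm_triangle_ineq4[of "k b - k (em (v n))" "k b - k (em (v m))"] l[OF k, of m] l[OF k, of n] by linarith
  qed
  show ?thesis using add_mono[OF 1 2] by (simp only: q_def mult_2)
 qed
 have vC: "v : Cq"
 proof (rule Q.C_I[OF v(1)])
  fix e :: real assume e: "e > 0"
  obtain N :: nat where N: "4 / e < real N" using reals_Archimedean2 by blast
  have i: "r m < e / 4" if "m >= N" for m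
  proof -
   have "4 / e < real (Suc m)" using N that by linarith
   then show ?thesis using e by (simp add: r_def field_simps del: of_nat_Suc)
  qed
  have "q (v m - v n) < e" if "m >= N" "n >= N" for m n
  proof (rule le_less_trans[OF qb])
   have "2 * (x + y) < e" if "x < e / 4" "y < e / 4" for x y :: real using that by simp
   then show "2 * (r m + r n) < e" using i[OF that(1)] i[OF that(2)] by blast
  qed
  then show "\<exists>N. \<forall>m\<ge>N. \<forall>n\<ge>N. q (v m - v n) < e" by blast
 qed
 have "dd b (cls V p v) = 0"
 proof (rule LIMSEQ_unique[OF tendsto_const])
  have "(%n. r n + dd (em (v n)) (cls V p v)) \<longlonglongrightarrow> 0 + 0"
   by (intro tendsto_add cls_limit Cq_C vC) (unfold r_def, rule LIMSEQ_Suc[OF lim_1_over_n])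
  then have t: "(%n. r n + dd (em (v n)) (cls V p v)) \<longlonglongrightarrow> 0" by simp
  have cW: "cls V p v : W" by (intro cls_in Cq_C vC)
  show "(%n. dd b (cls V p v)) \<longlonglongrightarrow> 0"
  proof (rule tendsto0I[OF t dd_nonneg[OF bW cW]])
   show "dd b (cls V p v) <= r n + dd (em (v n)) (cls V p v)" for n
    by (rule order_trans[OF dd_tri[OF bW emb_in[OF v(1)] cW] add_right_mono[OF d]])
  qed
 qed
 then have "b = cls V p v" using dd_eq_0[OF bW cls_in[OF Cq_C[OF vC]]] by simp
 then show ?thesis using io_cls[OF vC] Q.cls_in[OF vC] by metis
qed

definition ka :: "cvec => cvec" where "ka b = (SOME A. A : Wq & io A = b)"

lemma ka: "b : W' ==> ka b : Wq" "b : W' ==> io (ka b) = b"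
 using someI_ex[of "%A. A : Wq & io A = b"] io_surj[of b] unfolding ka_def by blast+

lemma ka_io: "A : Wq ==> ka (io A) = A"
 using io_inj[OF ka(1)[OF io_in] _ ka(2)[OF io_in]] by blast

lemma ka_em: "v : V ==> ka (em v) = eq' v"
 using ka_io[OF Q.emb_in, of v] io_em[of v] by simp

lemma W'_sc: "a : W' ==> sc c a : W'"
 using io_in[OF Q.sc_in[OF ka(1)], of a c] io_sc[OF ka(1), of a c] ka(2) by simp

lemma W'_cdiff: "a : W' ==> b : W' ==> cdiff V p a b : W'"
 using io_in[OF Q.cdiff_in[OF ka(1) ka(1)], of a b] io_cdiff[OF ka(1) ka(1), of a b] ka(2) by simp

lemma L_rh:
 assumes "l : Ls" "g : SL2" "a : W'" shows "cmod (l (rh g a)) <= NN a"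
proof -
 obtain l' where "l' : Ls" "\<forall>a\<in>W. l' a = l (rh g a)" using L_inv[OF assms(1,2)] by blast
 then show ?thesis using NN_W'[OF assms(3)] W'_W[OF assms(3)] by metis
qed

end

section \<open>The group action on the completion for the enlarged norm\<close>

context newnorm
begin

lemma W'_I: "a : W ==> (!!e. e > 0 ==> \<exists>v\<in>V. near a v e) ==> a : W'"
 by (simp add: W'_def)

text \<open>Two derivatives along left rotations multiply the weight component of g v by -4 m^2 and
  replace v by a fixed vector v2 of \<open>V\<close>. The p-part of q is then bounded by
  \<open>co_bound\<close>, the supremum part by \<open>co_functional_bound\<close>.\<close>

lemma term_bound:
 assumes g: "g : SL2" and v: "v : V"
 defines "v2 \<equiv> lie_act (Ztwist g) (lie_act (Ztwist g) v)"
 shows "4 * (real_of_int m)\<^sup>2 * q (scaleF (co m (rh g (em v))) (ee lam m)) <= Cb * (Cb * p v2) + NN (em v2)"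
proof -
 have Z: "Ztwist g : sl2" using g by blast
 have v1: "lie_act (Ztwist g) v : V" and v2: "v2 : V" unfolding v2_def using v Z by auto
 let ?b = "rh g (em v2)" and ?c = "co m (rh g (em v))"
 have bW: "?b : W" by (intro rh_em_in g v2)
 have "co m ?b = - 2 * \<i> * of_int m * (- 2 * \<i> * of_int m * ?c)"
  unfolding v2_def co_twist[OF g v1] co_twist[OF g v] ..
 then have n: "cmod (co m ?b) = 4 * (real_of_int m)\<^sup>2 * cmod ?c"
  by (simp add: norm_mult power2_eq_square)
 have 1: "cmod (co m ?b) * p (ee lam m) <= Cb * (Cb * p v2)"
 proof -
  have "cmod (co m ?b) * p (ee lam m) <= Cb * cnorm p ?b"
   using co_bound[OF bW, of m] p_ee_pos[of m] by (simp add: field_simps)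
  also have "\<dots> <= Cb * (Cb * p v2)" using bdd[OF g v2] Cb by (intro mult_left_mono) auto
  finally show ?thesis .
 qed
 have 2: "cmod (co m ?b) * NN (em (ee lam m)) <= NN (em v2)"
 proof (cases "co m ?b = 0")
  case True
  then show ?thesis using NN_em_nonneg[OF v2] by simp
 next
  case False
  have "NN (em (ee lam m)) <= NN (em v2) / cmod (co m ?b)"
  proof (rule NN_least)
   fix l assume l: "l : Ls"
   obtain K where K: "K >= 0" "!!a. a : W ==> cmod (l a) <= K * cnorm p a" using L_bd[OF l] by blast
   have "cmod (co m ?b) * cmod (l (em (ee lam m))) <= NN (em v2)"
   proof (rule co_functional_bound[OF bW L_add[OF l] L_sc[OF l] K(2) K(1)])
    fix tta
    have R: "rot tta : SL2" by (intro SO2_SL2 rot_SO2)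
    show "cmod (l (rh (rot tta) ?b)) <= NN (em v2)"
     unfolding rh_mult[OF R g emb_in[OF v2], symmetric] by (rule L_rh[OF l SL2_mult[OF R g] em_W'[OF v2]])
   qed
   then show "cmod (l (em (ee lam m))) <= NN (em v2) / cmod (co m ?b)" using False by (simp add: field_simps)
  qed
  then show ?thesis using False by (simp add: field_simps)
 qed
 have "q (scaleF ?c (ee lam m)) = cmod ?c * p (ee lam m) + cmod ?c * NN (em (ee lam m))"
  unfolding q_def p_scale[OF ee_in_Vs] NN_scale[OF ee_in_Vs] ..
 then have "4 * (real_of_int m)\<^sup>2 * q (scaleF ?c (ee lam m)) = cmod (co m ?b) * p (ee lam m) + cmod (co m ?b) * NN (em (ee lam m))"
  unfolding n by (simp add: algebra_simps)
 then show ?thesis using 1 2 by linarith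
qed

text \<open>By \<open>term_bound\<close> the weight components of g v are summable in q, so the
  partial sums are q-Cauchy. Their limit has the same coefficients \<open>co\<close> as g v, and
  these determine a vector (\<open>co_zero_imp_zero\<close>). This is where invariance of the
  smaller space under G is decided.\<close>

lemma orbit_W':
 assumes g: "g : SL2" and v: "v : V" shows "rh g (em v) : W'"
proof -
 define c where "c m = co m (rh g (em v))" for m
 obtain D where D: "!!m. 4 * (real_of_int m)\<^sup>2 * q (scaleF (c m) (ee lam m)) <= D"
  using term_bound[OF g v] unfolding c_def by blast
 have D0: "D >= 0" using D[of 0] by simp
 define u where "u n = (\<Sum>m\<in>{- int n..int n}. scaleF (c m) (ee lam m))" for n
 have uV: "u n : V" for n unfolding u_def by (intro V_sum V_scale ee_in_Vs)
 have t: "q (scaleF (c m) (ee lam m)) <= D / (4 * (real (Suc n))\<^sup>2)" if "\<bar>m\<bar> = int (Suc n)" for m n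
 proof -
  have "(real_of_int m)\<^sup>2 = (real_of_int \<bar>m\<bar>)\<^sup>2" by simp
  also have "\<dots> = (real (Suc n))\<^sup>2" unfolding that by simp
  finally have e: "(real_of_int m)\<^sup>2 = (real (Suc n))\<^sup>2" .
  have "0 < 4 * (real (Suc n))\<^sup>2" by simp
  then show ?thesis using D[of m] unfolding e by (simp add: field_simps)
 qed
 have st: "q (u (Suc n) - u n) <= D / 2 * (1 / (real (Suc n))\<^sup>2)" for n
 proof -
  let ?a = "int (Suc n)"
  have ins: "{- int (Suc n)..int (Suc n)} = insert ?a (insert (- ?a) {- int n..int n})" by auto
  have "u (Suc n) = scaleF (c ?a) (ee lam ?a) + (scaleF (c (- ?a)) (ee lam (- ?a)) + u n)"
   unfolding u_def ins by (subst sum.insert; simp)+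
  then have "u (Suc n) - u n = scaleF (c ?a) (ee lam ?a) + scaleF (c (- ?a)) (ee lam (- ?a))"
   by (simp only: add.assoc[symmetric] add_diff_cancel_right')
  then have "q (u (Suc n) - u n) <= q (scaleF (c ?a) (ee lam ?a)) + q (scaleF (c (- ?a)) (ee lam (- ?a)))"
   using Q.p_add[OF V_scale[OF ee_in_Vs] V_scale[OF ee_in_Vs]] by (simp only:)
  also have "\<dots> <= D / (4 * (real (Suc n))\<^sup>2) + D / (4 * (real (Suc n))\<^sup>2)" by (intro add_mono t) simp_all
  also have "\<dots> = D / 2 * (1 / (real (Suc n))\<^sup>2)" by simp
  finally show ?thesis .
 qed
 \<comment> \<open>Telescoping through 1/(n+1)^2 <= 1/n - 1/(n+1).\<close>
 have tele: "q (u n - u k) <= D / 2 * (1 / real k - 1 / real n)" if k: "k >= 1" and n: "n >= k" for n k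
  using n
 proof (induction n rule: nat_induct_at_least)
  case base
  show ?case by (simp only: diff_self Q.p_0 mult_zero_right order_refl)
 next
  case (Suc n)
  have n1: "real n >= 1" using k Suc.hyps by simp
  have "1 / (real (Suc n))\<^sup>2 <= 1 / real n - 1 / real (Suc n)"
  proof -
   have "1 / (real (Suc n))\<^sup>2 <= 1 / (real n * real (Suc n))"
    unfolding power2_eq_square using n1 by (intro divide_left_mono mult_right_mono mult_pos_pos) auto
   also have "\<dots> = 1 / real n - 1 / real (Suc n)" using n1 by (simp add: field_simps)
   finally show ?thesis .
  qed
  then have "D / 2 * (1 / (real (Suc n))\<^sup>2) <= D / 2 * (1 / real n - 1 / real (Suc n))"
   using D0 by (intro mult_left_mono) auto
  moreover have "q (u (Suc n) - u k) <= q (u (Suc n) - u n) + q (u n - u k)" by (intro Q.p_tri uV)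
  moreover have "a <= F * (x - z)" if "a <= b + c'" "b <= e" "c' <= F * (x - y)" "e <= F * (y - z)" for a b c' e F x y z :: real
   using that by (simp add: algebra_simps)
  ultimately show ?case using Suc.IH st[of n] by blast
 qed
 have uC: "u : Cq"
 proof (rule Q.C_I[OF uV])
  fix e :: real assume e: "e > 0"
  obtain N0 :: nat where N0: "D / e < real N0" using reals_Archimedean2 by blast
  let ?N = "Suc N0"
  have N: "D / 2 * (1 / real ?N) < e / 2"
  proof -
   have "D / e < real ?N" using N0 by simp
   then show ?thesis using e by (simp add: field_simps)
  qed
  have b: "q (u n - u ?N) < e / 2" if "n >= ?N" for n
  proof -
   have "q (u n - u ?N) <= D / 2 * (1 / real ?N - 1 / real n)" by (rule tele) (use that in auto)
   also have "\<dots> <= D / 2 * (1 / real ?N)" using D0 by (intro mult_left_mono) auto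
   finally show ?thesis using N by linarith
  qed
  have "q (u m - u n) < e" if "m >= ?N" "n >= ?N" for m n
   using Q.p_tri[OF uV uV uV, of m n ?N] Q.p_diff_sym[OF uV uV, of ?N n] b[OF that(1)] b[OF that(2)] by linarith
  then show "\<exists>N. \<forall>m\<ge>N. \<forall>n\<ge>N. q (u m - u n) < e" by blast
 qed
 have bW: "rh g (em v) : W" by (intro rh_em_in g v)
 have sW: "cls V p u : W" by (intro cls_in Cq_C uC)
 have cu: "co k (cls V p u) = c k" for k
 proof (rule LIMSEQ_unique[OF co_cls[OF Cq_C[OF uC]]])
  have "\<forall>\<^sub>F n in sequentially. cf k (u n) = c k"
   using eventually_ge_at_top[of "nat \<bar>k\<bar>"]
  proof eventually_elim
   case (elim n)
   then have "k : {- int n..int n}" by auto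
   then show ?case unfolding u_def by (simp add: cf_sum)
  qed
  then show "(%n. cf k (u n)) \<longlonglongrightarrow> c k" by (rule tendsto_eventually)
 qed
 have "co m (cdiff V p (rh g (em v)) (cls V p u)) = 0" for m
  unfolding cdiff_eq[OF bW sW] co_add[OF bW sc_in[OF sW]] co_sc[OF sW] cu by (simp add: c_def)
 then have "dd (rh g (em v)) (cls V p u) = 0" by (rule co_zero_imp_zero[OF cdiff_in[OF bW sW]])
 then have "rh g (em v) = cls V p u" using dd_eq_0[OF bW sW] by simp
 then show ?thesis using cls_W'[OF uC] by simp
qed

lemma near_rh:
 assumes n: "near a v e" and a: "a : W" and v: "v : V" and l: "l : Ls" and h: "h : SL2"
 shows "cmod (l (rh h a) - l (rh h (em v))) <= e"
proof -
 obtain l' where l': "l' : Ls" "\<forall>a\<in>W. l' a = l (rh h a)" using L_inv[OF l h] by blast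
 have "l (rh h a) - l (rh h (em v)) = l' a - l' (em v)" using l'(2) a emb_in[OF v] by simp
 then show ?thesis using n l'(1) by (simp add: near_def)
qed

lemma rh_W':
 assumes g: "g : SL2" and a: "a : W'" shows "rh g a : W'"
proof (rule W'_I)
 have aW: "a : W" by (rule W'_W[OF a])
 show "rh g a : W" by (intro rh_in g aW)
 fix e :: real assume e: "e > 0"
 \<comment> \<open>Small enough that both d and Cb d are at most e/2.\<close>
 define d where "d = e / (2 * (Cb + 1))"
 have d: "d > 0" "Cb * d <= e / 2" "d <= e / 2" using e Cb unfolding d_def by (auto simp: field_simps)
 obtain v where v: "v : V" "near a v d" using W'_near[OF a d(1)] by blast
 have e2: "e / 2 > 0" using e by simp
 obtain u where u: "u : V" "near (rh g (em v)) u (e / 2)" using W'_near[OF orbit_W'[OF g v(1)] e2] by blast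
 have "near (rh g a) u e"
  unfolding near_def
 proof (intro conjI ballI)
  have "dd (rh g a) (rh g (em v)) <= Cb * dd a (em v)"
   unfolding rh_cdiff[OF g aW emb_in[OF v(1)], symmetric] by (intro bddW g cdiff_in aW emb_in v)
  also have "\<dots> <= Cb * d" using v(2) Cb by (intro mult_left_mono) (auto simp: near_def)
  finally have "dd (rh g a) (rh g (em v)) <= e / 2" using d(2) by linarith
  moreover have "dd (rh g (em v)) (em u) <= e / 2" using u(2) by (simp add: near_def)
  moreover have "dd (rh g a) (em u) <= dd (rh g a) (rh g (em v)) + dd (rh g (em v)) (em u)"
   by (intro dd_tri rh_in g aW emb_in v u)
  ultimately show "dd (rh g a) (em u) <= e" by linarith
  fix l assume l: "l : Ls"
  have "cmod (l (rh g a) - l (rh g (em v))) <= d" by (rule near_rh[OF v(2) aW v(1) l g])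
  moreover have "cmod (l (rh g (em v)) - l (em u)) <= e / 2" using u(2) l by (simp add: near_def)
  moreover have "cmod (l (rh g a) - l (em u)) <= cmod (l (rh g a) - l (rh g (em v))) + cmod (l (rh g (em v)) - l (em u))"
   using norm_triangle_ineq[of "l (rh g a) - l (rh g (em v))" "l (rh g (em v)) - l (em u)"] by simp
  ultimately show "cmod (l (rh g a) - l (em u)) <= e" using d(3) by linarith
 qed
 then show "\<exists>u\<in>V. near (rh g a) u e" using u(1) by blast
qed

lemma NN_W'_nonneg: "a : W' ==> 0 <= NN a"
 using Ls_ne NN_W'[of a] norm_ge_zero order_trans by (metis all_not_in_conv)

lemma L_family: "l : Ls ==> lb_family lam (%g v. l (rh g (em v)))"
 using L_bd[of l] functional_family[of l, OF L_add L_sc] by blast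

lemma mat2_left_mult_cont:
 fixes h g :: mat2
 assumes "e > 0"
 shows "\<exists>d>0. \<forall>g'. dist g' g < d --> dist (h ** g') (h ** g) < e"
proof -
 have "continuous_on UNIV (%x::mat2. h ** x)" by (intro mat2_mult_cont continuous_on_id continuous_on_const)
 then have "isCont (%x::mat2. h ** x) g" by (simp add: continuous_on_eq_continuous_at)
 then show ?thesis using assms unfolding continuous_at_eps_delta by blast
qed

text \<open>Equicontinuity of h |-> l(h a) over all l in \<open>Ls\<close>. For v in
  \<open>V\<close> it follows from \<open>LDU_lipschitz\<close>, since G-stability bounds
  derivatives at every point by the suprema at the identity; for a in \<open>W'\<close> an
  approximation by v is enough.\<close>

lemma N_osc:
 assumes g: "g : SL2" and a: "a : W'" and e: "e > 0"
 shows "\<exists>d>0. \<forall>h\<in>SL2. dist h g < d --> (\<forall>l\<in>Ls. cmod (l (rh h a) - l (rh g a)) <= e)"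
proof -
 have aW: "a : W" by (rule W'_W[OF a])
 have e3: "e / 3 > 0" using e by simp
 obtain v where v: "v : V" "near a v (e / 3)" using W'_near[OF a e3] by blast
 define B where "B = NN (em (lie_act Fm v)) + NN (em (lie_act Hm v)) + NN (em (lie_act Em v))"
 have nn: "0 <= NN (em (lie_act X v))" if "X : sl2" for X by (intro NN_em_nonneg lie_act_Vs v that)
 have BX: "NN (em (lie_act X v)) <= B" if "X : {Fm, Hm, Em}" for X
  using that nn[OF basis_sl2(1)] nn[OF basis_sl2(2)] nn[OF basis_sl2(3)] unfolding B_def by auto
 have B0: "B >= 0" using BX[of Fm] nn[OF basis_sl2(3)] by simp
 \<comment> \<open>Makes 6 dlt B <= e/3 even if B = 0, and keeps dlt within the range of
   \<open>LDU\<close>.\<close>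
 define dlt where "dlt = min (1 / 2) (e / (18 * (B + 1)))"
 have dlt: "dlt > 0" using e B0 unfolding dlt_def by auto
 have dlt2: "dlt <= 1 / 2" unfolding dlt_def by (rule min.cobounded1)
 have "6 * dlt * B <= 6 * (e / (18 * (B + 1))) * B" using B0 unfolding dlt_def by (intro mult_right_mono mult_left_mono) auto
 also have "\<dots> <= e / 3" using B0 e by (simp add: field_simps)
 finally have dltB: "6 * dlt * B <= e / 3" .
 obtain d where d: "d > 0" "!!h. dist h g < d ==> dist (adj2 g ** h) (adj2 g ** g) < dlt"
  using mat2_left_mult_cont[OF dlt] by blast
 have "cmod (l (rh h a) - l (rh g a)) <= e" if h: "h : SL2" "dist h g < d" and l: "l : Ls" for h l
 proof -
  interpret F: lb_family lam "%g v. l (rh g (em v))" by (rule L_family[OF l])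
  have gg: "adj2 g ** g = mat 1" "g ** adj2 g = mat 1" using g by (simp_all add: adj2_mult)
  have w: "adj2 g ** h : SL2" by (intro SL2_mult adj2_SL2 g h)
  have "\<bar>(adj2 g ** h) $ i $ j - (mat 1 :: mat2) $ i $ j\<bar> <= dlt" for i j
  proof -
   have "\<bar>(adj2 g ** h - mat 1) $ i $ j\<bar> <= norm (adj2 g ** h - mat 1)" by (rule mat2_norm_entry)
   then show ?thesis using d(2)[OF h(2)] unfolding gg(1) dist_norm by simp
  qed
  then have "cmod (l (rh (g ** (adj2 g ** h)) (em v)) - l (rh g (em v))) <= 6 * dlt * B"
  proof (intro F.LDU_lipschitz v g w dlt2)
   fix k X assume k: "k : SL2" and X: "X : {Fm, Hm, Em}"
   have "cmod (l (rh k (em (lie_act X v)))) <= NN (em (lie_act X v))"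
    by (rule L_rh[OF l k em_W'[OF lie_act_Vs[OF v(1)]]]) (use X in auto)
   then show "cmod (l (rh k (em (lie_act X v)))) <= B" using BX[OF X] by linarith
  qed
  moreover have "g ** (adj2 g ** h) = h" by (simp only: matrix_mul_assoc gg matrix_mul_lid)
  ultimately have 1: "cmod (l (rh h (em v)) - l (rh g (em v))) <= e / 3" using dltB by (simp only:)
  have tri: "cmod (A - D) <= cmod (A - B) + cmod (B - E) + cmod (D - E)" for A B D E :: complex
   using norm_triangle_ineq4[of "(A - B) + (B - E)" "D - E"] norm_triangle_ineq[of "A - B" "B - E"] by simp
  have "cmod (l (rh h a) - l (rh g a)) <= cmod (l (rh h a) - l (rh h (em v))) + cmod (l (rh h (em v)) - l (rh g (em v))) + cmod (l (rh g a) - l (rh g (em v)))"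
   by (rule tri)
  then show ?thesis using 1 near_rh[OF v(2) aW v(1) l h(1)] near_rh[OF v(2) aW v(1) l g] by linarith
 qed
 then show ?thesis using d(1) by blast
qed

definition "rh' g A = ka (rh g (io A))"

lemma rh'_in: "g : SL2 ==> A : Wq ==> rh' g A : Wq"
 unfolding rh'_def by (intro ka rh_W' io_in)

lemma io_rh': "g : SL2 ==> A : Wq ==> io (rh' g A) = rh g (io A)"
 unfolding rh'_def by (intro ka rh_W' io_in)

text \<open>For joint continuity, l(h b - g a) is split into l(h(b - a)), bounded by G-stability,
  and l(h a - g a), bounded by \<open>N_osc\<close>; the p-part is joint continuity of the given
  representation. Each contributes a third of e.\<close>

lemma continuous_rep_q: "continuous_rep V q rh'"
 unfolding continuous_rep_def
proof (intro conjI ballI allI impI)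
 fix g A assume g: "g : SL2" and A: "A : Wq"
 show "rh' g A : Wq" by (rule rh'_in[OF g A])
 show "rh' g (cadd V q A B) = cadd V q (rh' g A) (rh' g B)" if B: "B : Wq" for B
  by (rule io_inj) (intro rh'_in Q.add2_in g A B
   | simp only: io_rh' io_add rh'_in Q.add2_in g A B rh_add io_W)+
 show "rh' g (cscale V q c A) = cscale V q c (rh' g A)" for c
  by (rule io_inj) (intro rh'_in Q.sc_in g A
   | simp only: io_rh' io_sc rh'_in Q.sc_in g A rh_sc io_W)+
 show "rh' (g ** h) A = rh' g (rh' h A)" if h: "h : SL2" for h
  by (rule io_inj) (intro rh'_in SL2_mult g h A
   | simp only: io_rh' rh'_in SL2_mult g h A rh_mult io_W)+
next
 fix A assume A: "A : Wq"
 show "rh' (mat 1) A = A"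
  by (rule io_inj) (intro rh'_in SL2_one A | simp only: io_rh' SL2_one A rh_one io_W)+
next
 fix g A and e :: real assume g: "g : SL2" and A: "A : Wq" and e: "e > 0"
 let ?a = "io A"
 have a: "?a : W'" "?a : W" by (intro io_in io_W A)+
 have e3: "e / 3 > 0" using e by simp
 obtain d1 where d1: "d1 > 0" "\<forall>h\<in>SL2. \<forall>b\<in>W. dist h g < d1 & dd b ?a < d1 --> dd (rh h b) (rh g ?a) < e / 3"
  using rh_joint[OF g a(2) e3] by blast
 obtain d2 where d2: "d2 > 0" "!!h l. h : SL2 ==> dist h g < d2 ==> l : Ls ==> cmod (l (rh h ?a) - l (rh g ?a)) <= e / 3"
  using N_osc[OF g a(1) e3] by blast
 let ?d = "min d1 (min d2 (e / 3))"
 show "\<exists>d>0. \<forall>h\<in>SL2. \<forall>B\<in>Wq. dist h g < d & cnorm q (cdiff V q B A) < d --> cnorm q (cdiff V q (rh' h B) (rh' g A)) < e"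
 proof (intro exI[of _ ?d] conjI ballI impI)
  show "?d > 0" using d1(1) d2(1) e3 by simp
  fix h B assume h: "h : SL2" and B: "B : Wq" and H: "dist h g < ?d & cnorm q (cdiff V q B A) < ?d"
  let ?b = "io B"
  have b: "?b : W'" "?b : W" by (intro io_in io_W B)+
  have ba: "cdiff V p ?b ?a : W'" by (intro W'_cdiff a b)
  have s: "dd ?b ?a + NN (cdiff V p ?b ?a) < ?d" using H cnorm_q[OF Q.cdiff_in[OF B A]] by (simp only: io_cdiff[OF B A])
  have n1: "0 <= NN (cdiff V p ?b ?a)" by (rule NN_W'_nonneg[OF ba])
  have n2: "0 <= dd ?b ?a" by (rule dd_nonneg[OF b(2) a(2)])
  have 1: "dd (rh h ?b) (rh g ?a) < e / 3" using d1(2) h b(2) H s n1 by auto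
  have 2: "NN (cdiff V p (rh h ?b) (rh g ?a)) <= e / 3 + e / 3"
  proof (rule NN_least)
   fix l assume l: "l : Ls"
   have "l (cdiff V p (rh h ?b) (rh g ?a)) = l (rh h (cdiff V p ?b ?a)) + (l (rh h ?a) - l (rh g ?a))"
    by (simp add: rh_cdiff h a b L_cdiff l rh_in g)
   also have "cmod \<dots> <= cmod (l (rh h (cdiff V p ?b ?a))) + cmod (l (rh h ?a) - l (rh g ?a))" by (rule norm_triangle_ineq)
   also have "\<dots> <= e / 3 + e / 3"
    using L_rh[OF l h ba] s n2 d2(2)[OF h _ l] H by (intro add_mono) auto
   finally show "cmod (l (cdiff V p (rh h ?b) (rh g ?a))) <= e / 3 + e / 3" .
  qed
  have "cnorm q (cdiff V q (rh' h B) (rh' g A)) = dd (rh h ?b) (rh g ?a) + NN (cdiff V p (rh h ?b) (rh g ?a))"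
   by (simp only: cnorm_q Q.cdiff_in rh'_in h g A B io_cdiff io_rh')
  then show "cnorm q (cdiff V q (rh' h B) (rh' g A)) < e" using 1 2 by linarith
 qed
qed

lemma rh'_eq: "g : SL2 ==> v : V ==> io (rh' g (eq' v)) = rh g (em v)"
 by (simp only: io_rh' Q.emb_in io_em)

lemma rh'_K:
 assumes k: "k : SO2" and v: "v : V" shows "rh' k (eq' v) = eq' (act k v)"
proof -
 obtain tta where tta: "k = rot tta" using SO2_eq_rot[OF k] by blast
 have "act k v : V" unfolding tta by (rule act_rot_Vs[OF v])
 then show ?thesis
  unfolding rh'_def io_em[OF v] rh_K[OF k v] by (rule ka_em)
qed

text \<open>The second-order Taylor remainder of l along the orbit is at most the supremum at
  \<open>lie_act X (lie_act X v)\<close> times t^2, uniformly in l, so the difference quotients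
  converge in the supremum part as well.\<close>

lemma rh'_lie:
 assumes X: "X : sl2" and v: "v : V"
 shows "has_cderiv_at0 V q (%t. rh' (mxp t X) (eq' v)) (eq' (lie_act X v))"
proof -
 let ?g = "%t. rh (mxp t X) (em v)" and ?z = "em (lie_act X v)"
 let ?g' = "%t. rh' (mxp t X) (eq' v)" and ?z' = "eq' (lie_act X v)"
 have Xv: "lie_act X v : V" "lie_act X (lie_act X v) : V" using X v by auto
 have e: "mxp t X : SL2" for t using X by blast
 have gW': "?g t : W'" for t by (rule orbit_W'[OF e v])
 have gW: "?g t : W" for t by (rule W'_W[OF gW'])
 have g'W: "?g' t : Wq" for t by (intro rh'_in e Q.emb_in v)
 have z'W: "?z' : Wq" by (rule Q.emb_in[OF Xv(1)])
 have zW: "?z : W" by (rule emb_in[OF Xv(1)])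
 have ig: "io (?g' t) = ?g t" for t by (rule rh'_eq[OF e v])
 have iz: "io ?z' = ?z" by (rule io_em[OF Xv(1)])
 have eq: "cnorm q (cdiff V q (cscale V q (cor (1 / t)) (cdiff V q (?g' t) (?g' 0))) ?z')
  = dd (dq ?g t) ?z + NN (cdiff V p (dq ?g t) ?z)" for t
  by (simp only: cnorm_q Q.cdiff_in Q.sc_in g'W z'W io_cdiff io_sc ig iz)
 have dW: "cdiff V p (dq ?g t) ?z : W'" for t by (intro W'_cdiff W'_sc gW' em_W' Xv)
 have b: "NN (cdiff V p (dq ?g t) ?z) <= NN (em (lie_act X (lie_act X v))) * \<bar>t\<bar>" if t: "t ~= 0" for t
 proof (rule NN_least)
  fix l assume l: "l : Ls"
  interpret F: lb_family lam "%g v. l (rh g (em v))" by (rule L_family[OF l])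
  have "cmod (l (rh (mat 1 ** mxp t X) (em v)) - l (rh (mat 1) (em v)) - cor t * l (rh (mat 1) ?z))
   <= NN (em (lie_act X (lie_act X v))) * t\<^sup>2"
  proof (rule F.Ph_bound2[OF SL2_one v X])
   fix s show "cmod (l (rh (mat 1 ** mxp s X) (em (lie_act X (lie_act X v))))) <= NN (em (lie_act X (lie_act X v)))"
    by (rule L_rh[OF l SL2_mult[OF SL2_one e] em_W'[OF Xv(2)]])
  qed
  then have bd: "cmod (l (?g t) - l (?g 0) - cor t * l ?z) <= NN (em (lie_act X (lie_act X v))) * t\<^sup>2"
   by (simp only: matrix_mul_lid scaleR_zero_left mexp_0 rh_one zW)
  have "l (cdiff V p (dq ?g t) ?z) = cor (1 / t) * (l (?g t) - l (?g 0)) - l ?z"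
   by (simp only: L_cdiff[OF l] sc_in cdiff_in gW zW L_sc[OF l])
  also have "\<dots> = cor (1 / t) * (l (?g t) - l (?g 0) - cor t * l ?z)"
   using t by (simp add: field_simps)
  finally have "cmod (l (cdiff V p (dq ?g t) ?z)) = \<bar>1 / t\<bar> * cmod (l (?g t) - l (?g 0) - cor t * l ?z)"
   by (simp only: norm_mult norm_of_real)
  also have "\<dots> <= \<bar>1 / t\<bar> * (NN (em (lie_act X (lie_act X v))) * t\<^sup>2)" by (intro mult_left_mono bd) simp
  also have "\<dots> = NN (em (lie_act X (lie_act X v))) * (\<bar>1 / t\<bar> * (\<bar>t\<bar> * \<bar>t\<bar>))" by (simp add: power2_eq_square)
  also have "\<bar>1 / t\<bar> * (\<bar>t\<bar> * \<bar>t\<bar>) = \<bar>1 / t * t\<bar> * \<bar>t\<bar>" by (simp only: abs_mult mult.assoc)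
  also have "\<bar>1 / t * t\<bar> * \<bar>t\<bar> = \<bar>t\<bar>" using t by simp
  finally show "cmod (l (cdiff V p (dq ?g t) ?z)) <= NN (em (lie_act X (lie_act X v))) * \<bar>t\<bar>" .
 qed
 have nl: "((%t. NN (cdiff V p (dq ?g t) ?z)) \<longlongrightarrow> 0) (at 0)"
 proof (rule tendsto_sandwich[OF _ _ tendsto_const])
  show "\<forall>\<^sub>F t in at 0. 0 <= NN (cdiff V p (dq ?g t) ?z)" by (intro always_eventually allI NN_W'_nonneg dW)
  show "\<forall>\<^sub>F t in at 0. NN (cdiff V p (dq ?g t) ?z) <= NN (em (lie_act X (lie_act X v))) * \<bar>t\<bar>"
   unfolding eventually_at_filter by (intro always_eventually allI impI b)
  have "((%t. NN (em (lie_act X (lie_act X v))) * \<bar>t\<bar>) \<longlongrightarrow> NN (em (lie_act X (lie_act X v))) * \<bar>0\<bar>) (at 0)"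
   by (intro tendsto_intros)
  then show "((%t. NN (em (lie_act X (lie_act X v))) * \<bar>t\<bar>) \<longlongrightarrow> 0) (at 0)" by simp
 qed
 have "((%t. dd (dq ?g t) ?z) \<longlongrightarrow> 0) (at 0)" using rh_lie[OF X v] unfolding hc_iff by (rule conjunct2)
 from tendsto_add[OF this nl] have "((%t. dd (dq ?g t) ?z + NN (cdiff V p (dq ?g t) ?z)) \<longlongrightarrow> 0) (at 0)" by simp
 then show ?thesis unfolding has_cderiv_at0_def eq using z'W by blast
qed

lemma io_clincomb:
 assumes "finite B" "B \<subseteq> Wq"
 shows "io (clincomb V q B c) = clincomb V p (io ` B) (%b. c (ka b))"
 using assms
proof (induction B rule: finite_induct)
 case empty
 show ?case unfolding image_empty clincomb_empty Q.clincomb_empty by (rule io_em[OF V_zero])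
next
 case (insert A B)
 have A: "A : Wq" and B: "B \<subseteq> Wq" using insert.prems by auto
 have ni: "io A \<notin> io ` B"
 proof
  assume "io A : io ` B"
  then obtain A2 where "A2 : B" "io A = io A2" by (rule imageE)
  then have "A = A2" using io_inj[OF A] B by blast
  then show False using \<open>A2 : B\<close> insert.hyps(2) by simp
 qed
 have "io (clincomb V q (insert A B) c) = io (cadd V q (cscale V q (c A) A) (clincomb V q B c))"
  by (simp only: Q.clincomb_insert[OF insert.hyps(1) B A insert.hyps(2)])
 also have "\<dots> = add2 (sc (c A) (io A)) (clincomb V p (io ` B) (%b. c (ka b)))"
  by (simp only: io_add[OF Q.sc_in[OF A] Q.clincomb_in[OF insert.hyps(1) B]] io_sc[OF A] insert.IH[OF B])
 also have "\<dots> = add2 (sc (c (ka (io A))) (io A)) (clincomb V p (io ` B) (%b. c (ka b)))"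
  by (simp only: ka_io[OF A])
 also have "\<dots> = clincomb V p (insert (io A) (io ` B)) (%b. c (ka b))"
  by (rule clincomb_insert[symmetric]) (use insert.hyps B A ni io_W in auto)
 finally show ?case unfolding image_insert .
qed

text \<open>A K-finite vector of the new completion maps to one of the old, hence to some v in
  \<open>V\<close>, and \<open>io\<close> is injective. Conversely, the rotates of v lie in the span
  of its finitely many weights.\<close>

lemma K_finite_q: "K_finite_vectors V q rh' = eq' ` V"
proof (rule subset_antisym; rule subsetI)
 fix A assume "A : K_finite_vectors V q rh'"
 then obtain B where A: "A : Wq" and B: "finite B" "B \<subseteq> Wq" "\<forall>k\<in>SO2. \<exists>c. rh' k A = clincomb V q B c"
  unfolding K_finite_vectors_def mem_Collect_eq by (elim conjE exE)
 have "\<exists>c. rh k (io A) = clincomb V p (io ` B) c" if k: "k : SO2" for k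
 proof -
  obtain c where c: "rh' k A = clincomb V q B c" using B(3) k by blast
  have "rh k (io A) = clincomb V p (io ` B) (%b. c (ka b))"
   unfolding io_rh'[OF SO2_SL2[OF k] A, symmetric] c by (rule io_clincomb[OF B(1,2)])
  then show ?thesis by (rule exI[of _ "%b. c (ka b)"])
 qed
 moreover have "io ` B \<subseteq> W" using B(2) io_W by blast
 moreover have "finite (io ` B)" using B(1) by simp
 ultimately have "io A : K_finite_vectors V p rh"
  unfolding K_finite_vectors_def mem_Collect_eq by (intro conjI io_W[OF A] exI[of _ "io ` B"] ballI)
 then obtain v where v: "v : V" "io A = em v" unfolding rh_Kfin by blast
 have "A = eq' v" using io_inj[OF A Q.emb_in[OF v(1)]] v io_em by simp
 then show "A : eq' ` V" using v(1) by blast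
next
 fix A assume "A : eq' ` V"
 then obtain v where v: "v : V" "A = eq' v" by blast
 let ?F = "{m. cf m v ~= 0}"
 let ?B = "(%m. eq' (ee lam m)) ` ?F"
 have F: "finite ?F" by (rule Vs_expand(1)[OF v(1)])
 have inj: "inj (%m. eq' (ee lam m))"
  by (rule injI) (rule injD[OF inj_ee], rule Q.emb_inj[OF ee_in_Vs ee_in_Vs], assumption)
 have "\<exists>c. rh' k A = clincomb V q ?B c" if k: "k : SO2" for k
 proof -
  obtain tta where tta: "k = rot tta" using SO2_eq_rot[OF k] by blast
  have aV: "act k v : V" unfolding tta by (rule act_rot_Vs[OF v(1)])
  have "act k v = (\<Sum>m\<in>?F. scaleF (cf m (act k v)) (ee lam m))"
   by (rule Vs_expand_finite[OF aV F]) (auto simp: tta cf_act_rot[OF v(1)])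
  then have "rh' k A = eq' (\<Sum>m\<in>?F. scaleF (cf m (act k v)) (ee lam m))"
   unfolding v(2) rh'_K[OF k v(1)] by (rule arg_cong)
  also have "\<dots> = clincomb V q ?B (%b. cf (inv_into UNIV (%m. eq' (ee lam m)) b) (act k v))"
   by (rule Q.emb_clincomb[OF F ee_in_Vs inj_on_subset[OF inj_ee subset_UNIV]]) (simp only: inv_f_f[OF inj])
  finally show ?thesis by (rule exI[of _ "%b. cf (inv_into UNIV (%m. eq' (ee lam m)) b) (act k v)"])
 qed
 moreover have "finite ?B" using F by (rule finite_imageI)
 moreover have "?B \<subseteq> Wq" using Q.emb_in[OF ee_in_Vs] by blast
 moreover have "A : Wq" unfolding v(2) by (rule Q.emb_in[OF v(1)])
 ultimately show "A : K_finite_vectors V q rh'"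
  unfolding K_finite_vectors_def mem_Collect_eq by (intro conjI exI[of _ ?B] ballI)
qed

lemma globalization_q: "globalization V q rh'"
 unfolding globalization_def
 by (intro conjI ballI q_norm continuous_rep_q K_finite_q rh'_K rh'_lie lie_act_Vs)

lemma q_bounded: "q : bounded_norms V"
 unfolding bounded_norms_def mem_Collect_eq
proof (intro exI conjI)
 show "globalization V q rh'" by (rule globalization_q)
 show "Cb + 1 > 0" using Cb by simp
 show "\<forall>g\<in>SL2. \<forall>v\<in>V. cnorm q (rh' g (eq' v)) <= (Cb + 1) * q v"
 proof (intro ballI)
  fix g v assume g: "g : SL2" and v: "v : V"
  have "cnorm q (rh' g (eq' v)) = cnorm p (rh g (em v)) + NN (rh g (em v))"
   by (simp only: cnorm_q rh'_in g Q.emb_in v rh'_eq)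
  also have "\<dots> <= Cb * p v + NN (em v)"
   by (intro add_mono bdd g v NN_least L_rh em_W')
  also have "\<dots> <= (Cb + 1) * q v"
  proof -
   have "0 <= p v" "0 <= Cb * NN (em v)" using Cb p_nonneg[OF v] NN_em_nonneg[OF v] by auto
   then show ?thesis unfolding q_def by (simp add: algebra_simps)
  qed
  finally show "cnorm q (rh' g (eq' v)) <= (Cb + 1) * q v" .
 qed
qed

end

section \<open>A lower bound for the maximal norm\<close>

context bglob
begin

text \<open>Translates of finite combinations of coefficient functionals, normalized by their
  supremum on the orbit of e_0. Stability under G is built in through g, and the normalization is
  what \<open>spherical_Bessel\<close> requires.\<close>

definition Lset :: "(cvec => complex) set" where
 "Lset = {%a. \<Sum>m\<in>F. w m * co m (rh g a) | g F w. g : SL2 & finite F &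
  (\<forall>h\<in>SL2. cmod (\<Sum>m\<in>F. w m * co m (rh h (em (ee lam 0)))) <= 1)}"

lemma Lset_cases:
 assumes "l : Lset"
 obtains g F w where "g : SL2" "finite F" "\<forall>h\<in>SL2. cmod (\<Sum>m\<in>F. w m * co m (rh h (em (ee lam 0)))) <= 1"
  "l = (%a. \<Sum>m\<in>F. w m * co m (rh g a))"
 using assms unfolding Lset_def by blast

lemma LsetI:
 assumes "g : SL2" "finite F" "\<forall>h\<in>SL2. cmod (\<Sum>m\<in>F. w m * co m (rh h (em (ee lam 0)))) <= 1"
 shows "(%a. \<Sum>m\<in>F. w m * co m (rh g a)) : Lset"
 unfolding Lset_def mem_Collect_eq using assms by (intro exI[of _ g] exI[of _ F] exI[of _ w]) simp

lemma Lset_add: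
 assumes "l : Lset" "a : W" "b : W" shows "l (add2 a b) = l a + l b"
proof -
 obtain g F w where l: "g : SL2" "l = (%a. \<Sum>m\<in>F. w m * co m (rh g a))" using assms(1) by (elim Lset_cases) blast
 show ?thesis unfolding l(2) rh_add[OF l(1) assms(2,3)] co_add[OF rh_in[OF l(1) assms(2)] rh_in[OF l(1) assms(3)]]
  by (simp only: distrib_left sum.distrib)
qed

lemma Lset_sc:
 assumes "l : Lset" "a : W" shows "l (sc c a) = c * l a"
proof -
 obtain g F w where l: "g : SL2" "l = (%a. \<Sum>m\<in>F. w m * co m (rh g a))" using assms(1) by (elim Lset_cases) blast
 show ?thesis unfolding l(2) rh_sc[OF l(1) assms(2)] co_sc[OF rh_in[OF l(1) assms(2)]]
  by (simp only: sum_distrib_left mult.left_commute)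
qed

lemma Lset_bd:
 assumes "l : Lset" shows "\<exists>K\<ge>0. \<forall>a\<in>W. cmod (l a) <= K * cnorm p a"
proof -
 obtain g F w where l: "g : SL2" "l = (%a. \<Sum>m\<in>F. w m * co m (rh g a))" using assms(1) by (elim Lset_cases) blast
 let ?K = "\<Sum>m\<in>F. cmod (w m) * (Cb / p (ee lam m) * Cb)"
 have k: "Cb / p (ee lam m) >= 0" for m using Cb p_ee_pos[of m] by simp
 have "cmod (l a) <= ?K * cnorm p a" if a: "a : W" for a
 proof -
  have "cmod (l a) <= (\<Sum>m\<in>F. cmod (w m * co m (rh g a)))" unfolding l(2) by (rule norm_sum)
  also have "\<dots> <= (\<Sum>m\<in>F. cmod (w m) * (Cb / p (ee lam m) * (Cb * cnorm p a)))"
   unfolding norm_mult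
   by (intro sum_mono mult_left_mono order_trans[OF co_bound] bddW l a k rh_in norm_ge_zero)
  also have "\<dots> = ?K * cnorm p a" by (simp only: sum_distrib_right mult.assoc)
  finally show ?thesis .
 qed
 moreover have "?K >= 0" using k Cb by (intro sum_nonneg mult_nonneg_nonneg) auto
 ultimately show ?thesis by blast
qed

lemma Lset_inv:
 assumes "l : Lset" "h : SL2" shows "\<exists>l'\<in>Lset. \<forall>a\<in>W. l' a = l (rh h a)"
proof -
 obtain g F w where l: "g : SL2" "finite F" "\<forall>h\<in>SL2. cmod (\<Sum>m\<in>F. w m * co m (rh h (em (ee lam 0)))) <= 1"
  "l = (%a. \<Sum>m\<in>F. w m * co m (rh g a))" using assms(1) by (rule Lset_cases)
 let ?l = "%a. \<Sum>m\<in>F. w m * co m (rh (g ** h) a)"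
 have m1: "?l : Lset" by (rule LsetI[OF SL2_mult[OF l(1) assms(2)] l(2,3)])
 have m2: "\<forall>a\<in>W. ?l a = l (rh h a)"
 proof
  fix a assume a: "a : W"
  show "(\<Sum>m\<in>F. w m * co m (rh (g ** h) a)) = l (rh h a)" unfolding l(4) rh_mult[OF l(1) assms(2) a] ..
 qed
 show ?thesis by (rule bexI[where P="%l'. \<forall>a\<in>W. l' a = l (rh h a)" and x="?l", OF m2 m1])
qed

text \<open>For a weight vector e_k choose t with \<open>Mco lam k t\<close> nonzero;
  \<open>spherical_Bessel\<close> for the single frequency k bounds |l(e_k)| by 1/|Mco lam k t|, the
  same for all l.\<close>

lemma Lset_V:
 assumes lam: "Re lam = 0" and v: "v : V" shows "\<exists>B. \<forall>l\<in>Lset. cmod (l (em v)) <= B"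
 using v
proof (induction rule: Vs_induct)
 case zero
 have "cmod (l (em 0)) <= 0" if "l : Lset" for l
  using Lset_sc[OF that emb_in[OF V_zero], of 0] em0[OF emb_in[OF V_zero]] by simp
 then show ?case by blast
next
 case (ee k)
 obtain t where t: "t > 0" "Mco lam k t ~= 0" using Mco_nonvanishing[OF lam] by blast
 have "cmod (l (em (ee lam k))) <= 1 / cmod (Mco lam k t)" if l: "l : Lset" for l
 proof -
  obtain K where K: "K >= 0" "!!a. a : W ==> cmod (l a) <= K * cnorm p a" using Lset_bd[OF l] by blast
  interpret F: lb_family lam "%g v. l (rh g (em v))"
   by (rule functional_family[OF Lset_add[OF l] Lset_sc[OF l] K(2) K(1)])
  have b: "cmod (l (rh g (em (ee lam 0)))) <= 1" if g: "g : SL2" for g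
  proof -
   obtain g0 F w where l: "g0 : SL2" "finite F" "\<forall>h\<in>SL2. cmod (\<Sum>m\<in>F. w m * co m (rh h (em (ee lam 0)))) <= 1"
    "l = (%a. \<Sum>m\<in>F. w m * co m (rh g0 a))" using l by (rule Lset_cases)
   show ?thesis unfolding l(4) rh_mult[OF l(1) g emb_in[OF ee_in_Vs], symmetric] by (rule bspec[OF l(3) SL2_mult[OF l(1) g]])
  qed
  have "(\<Sum>m\<in>{k}. (cmod (l (rh (mat 1) (em (ee lam m)))))\<^sup>2 * (cmod (Mco lam m t))\<^sup>2) <= 1\<^sup>2"
   by (rule F.spherical_Bessel[OF lam SL2_one less_imp_le[OF t(1)]]) (use b in auto)
  then have "(cmod (l (em (ee lam k))) * cmod (Mco lam k t))\<^sup>2 <= 1\<^sup>2" by (simp add: power_mult_distrib rh_one emb_in)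
  then have "cmod (l (em (ee lam k))) * cmod (Mco lam k t) <= 1" by (rule power2_le_imp_le) simp
  then show ?thesis using t(2) by (simp add: field_simps)
 qed
 then show ?case by blast
next
 case (add u w)
 obtain B1 where B1: "!!l. l : Lset ==> cmod (l (em u)) <= B1" using add.IH(1) by blast
 obtain B2 where B2: "!!l. l : Lset ==> cmod (l (em w)) <= B2" using add.IH(2) by blast
 have H: "cmod (l (em (u + w))) <= B1 + B2" if "l : Lset" for l
  unfolding emb_add[OF add.hyps, symmetric] Lset_add[OF that emb_in[OF add.hyps(1)] emb_in[OF add.hyps(2)]]
  by (rule norm_triangle_mono[OF B1[OF that] B2[OF that]])
 show ?case by (rule exI[of _ "B1 + B2"], rule ballI, rule H)
next
 case (scale u c)
 obtain B1 where B1: "!!l. l : Lset ==> cmod (l (em u)) <= B1" using scale.IH by blast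
 have H: "cmod (l (em (scaleF c u))) <= cmod c * B1" if "l : Lset" for l
  unfolding emb_scale[OF scale.hyps, symmetric] Lset_sc[OF that emb_in[OF scale.hyps]] norm_mult
  by (intro mult_left_mono B1 that norm_ge_zero)
 show ?case by (rule exI[of _ "cmod c * B1"], rule ballI, rule H)
qed

lemma Lset_newnorm:
 assumes lam: "Re lam = 0" shows "newnorm lam p rh Cb Lset"
proof
 have "(%a. \<Sum>m\<in>{}. 0 * co m (rh (mat 1) a)) : Lset" by (rule LsetI[OF SL2_one]) simp_all
 then show "Lset ~= {}" by blast
qed (fact Lset_add Lset_sc Lset_bd Lset_inv Lset_V[OF lam])+

text \<open>The right rotation fixes e_0 and the left one multiplies by a character. For the middle
  factor \<open>avg_spherical\<close> applies at x = 1, where the averaged integrand is constant in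
  the angle.\<close>

lemma co_spherical:
 assumes lam: "Re lam = 0" and t: "t >= 0"
 shows "co m (rh (rot tta ** diagm t ** rot phh) (em (ee lam 0))) = cis (- 2 * of_int m * tta) * Mco lam m t"
proof -
 interpret F: lb_family lam "%g v. co m (rh g (em v))" by (rule co_family)
 have R: "rot tta : SL2" for tta by (intro SO2_SL2 rot_SO2)
 let ?e = "em (ee lam 0)"
 have e: "?e : W" by (intro emb_in ee_in_Vs)
 have dW: "rh (diagm t) ?e : W" by (intro rh_in diagm_SL2 e)
 have "act (rot phh) (ee lam 0) = ee lam 0" unfolding act_rot_ee by (simp add: fun_eq_iff)
 then have f: "rh (rot phh) ?e = ?e" by (simp only: rh_K[OF rot_SO2 ee_in_Vs])
 have "co m (rh (rot tta ** diagm t ** rot phh) ?e) = co m (rh (rot tta) (rh (diagm t) ?e))"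
  unfolding rh_mult[OF SL2_mult[OF R diagm_SL2] R e] f rh_mult[OF R diagm_SL2 e] ..
 also have "\<dots> = cis (- 2 * of_int m * tta) * co m (rh (diagm t) ?e)" by (rule co_rot[OF dW])
 also have "co m (rh (diagm t) ?e) = Mco lam m t"
 proof -
  have "avg (%g v. co m (rh g (em v))) (mat 1) m (diagm t) (ee lam 0) = co m (rh (mat 1) (em (ee lam m))) * Mco lam m t"
   by (rule F.avg_spherical[OF lam SL2_one t])
  moreover have "co m (rh (mat 1) (em (ee lam m))) = 1"
   unfolding rh_one[OF emb_in[OF ee_in_Vs]] co_em[OF ee_in_Vs] cf_ee by simp
  moreover have "avg (%g v. co m (rh g (em v))) (mat 1) m (diagm t) (ee lam 0) = co m (rh (diagm t) ?e)"
  proof -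
   have i: "co m (rh (mat 1 ** rot tta ** diagm t) ?e) * cis (2 * of_int m * tta) = co m (rh (diagm t) ?e)" for tta
   proof -
    have "co m (rh (mat 1 ** rot tta ** diagm t) ?e) = cis (- 2 * of_int m * tta) * co m (rh (diagm t) ?e)"
     unfolding matrix_mul_lid rh_mult[OF R diagm_SL2 e] by (rule co_rot[OF dW])
    then have "co m (rh (mat 1 ** rot tta ** diagm t) ?e) * cis (2 * of_int m * tta)
     = (cis (- 2 * of_int m * tta) * cis (2 * of_int m * tta)) * co m (rh (diagm t) ?e)" by (simp only: mult_ac)
    then show ?thesis by (simp add: cis_mult)
   qed
   show ?thesis unfolding avg_def fhat_def i integral_const_I0 by (simp add: scaleR_conv_of_real)
  qed
  ultimately show ?thesis by simp
 qed
 finally show ?thesis .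
qed

end

text \<open>By \<open>KAK\<close> and \<open>co_spherical\<close> the hypothesis says that P^-1
  times the signed sum of coefficient functionals belongs to \<open>Lset\<close>. On the vector with
  the same signs it takes the value card S/P. Maximality bounds the norm enlarged by
  \<open>Lset\<close> by D times \<open>pmax\<close>, with D depending on neither the signs nor
  S.\<close>

lemma max_lower:
 assumes lam: "Re lam = 0" and max: "is_max_norm (Vs lam) pmax"
 shows "\<exists>D>0. \<forall>S ep P. finite S --> (\<forall>m. ep m = 1 \<or> ep m = - 1) --> P > 0 -->
  (\<forall>tta t. t >= 0 --> cmod (\<Sum>m\<in>S. cor (ep m) * (cis (- 2 * of_int m * tta) * Mco lam m t)) <= P) -->
  real (card S) <= D * P * pmax (\<Sum>m\<in>S. scaleF (cor (ep m)) (ee lam m))"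
proof -
 have b: "pmax : bounded_norms (Vs lam)" using max by (simp add: is_max_norm_def)
 obtain rh C where rh: "globalization (Vs lam) pmax rh" and C: "C > 0"
  "!!g v. g : SL2 ==> v : Vs lam ==> cnorm pmax (rh g (emb (Vs lam) pmax v)) <= C * pmax v"
  using b unfolding bounded_norms_def by blast
 interpret bglob lam pmax rh C by unfold_locales (fact rh C)+
 interpret N: newnorm lam pmax rh C Lset by (rule Lset_newnorm[OF lam])
 have "norm_le V pmax N.q"
  unfolding norm_le_def by (rule exI[of _ 1]) (simp add: N.p_le_q)
 then have "norm_le V N.q pmax" using max N.q_bounded by (simp add: is_max_norm_def)
 then obtain D where D: "D > 0" "!!v. v : V ==> N.q v <= D * pmax v" unfolding norm_le_def by blast
 show ?thesis
 proof (intro exI[of _ D] conjI D(1) allI impI)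
  fix S :: "int set" and ep :: "int => real" and P :: real
  assume S: "finite S" and ep: "\<forall>m. ep m = 1 \<or> ep m = - 1" and P: "P > 0"
   and H: "\<forall>tta t. t >= 0 --> cmod (\<Sum>m\<in>S. cor (ep m) * (cis (- 2 * of_int m * tta) * Mco lam m t)) <= P"
  let ?v = "\<Sum>m\<in>S. scaleF (cor (ep m)) (ee lam m)"
  let ?w = "%m. cor (ep m) / cor P"
  have vV: "?v : V" by (intro Vs_sum Vs_scale ee_in_Vs)
  have l: "(%a. \<Sum>m\<in>S. ?w m * co m (rh (mat 1) a)) : Lset"
  proof (rule LsetI[OF SL2_one S], rule ballI)
   fix h assume "h : SL2"
   then obtain tta t phh where h: "t >= 0" "h = rot tta ** diagm t ** rot phh" by (rule KAK)
   have "(\<Sum>m\<in>S. ?w m * co m (rh h (em (ee lam 0)))) = (\<Sum>m\<in>S. cor (ep m) * (cis (- 2 * of_int m * tta) * Mco lam m t)) / cor P"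
    unfolding h(2) co_spherical[OF lam h(1)] by (simp add: sum_divide_distrib)
   then have "cmod (\<Sum>m\<in>S. ?w m * co m (rh h (em (ee lam 0)))) = cmod (\<Sum>m\<in>S. cor (ep m) * (cis (- 2 * of_int m * tta) * Mco lam m t)) / P"
    using P by (simp only: norm_divide norm_of_real)
   also have "\<dots> <= 1" using H h(1) P by simp
   finally show "cmod (\<Sum>m\<in>S. ?w m * co m (rh h (em (ee lam 0)))) <= 1" .
  qed
  have "(\<Sum>m\<in>S. ?w m * co m (rh (mat 1) (em ?v))) = (\<Sum>m\<in>S. cor (1 / P))"
  proof (rule sum.cong[OF refl])
   fix m assume m: "m : S"
   have "co m (rh (mat 1) (em ?v)) = cor (ep m)"
    unfolding rh_one[OF emb_in[OF vV]] co_em[OF vV] cf_sum[OF S] using m by simp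
   moreover have "cor (ep m) * cor (ep m) = 1" using ep[rule_format, of m] by auto
   ultimately show "?w m * co m (rh (mat 1) (em ?v)) = cor (1 / P)" by simp
  qed
  also have "\<dots> = cor (real (card S) / P)" by simp
  finally have e: "(\<Sum>m\<in>S. ?w m * co m (rh (mat 1) (em ?v))) = cor (real (card S) / P)" .
  have "cmod (\<Sum>m\<in>S. ?w m * co m (rh (mat 1) (em ?v))) <= N.NN (em ?v)" by (rule N.NN_em[OF vV l])
  then have "real (card S) / P <= N.NN (em ?v)" unfolding e norm_of_real using P by simp
  also have "\<dots> <= N.q ?v" by (rule N.NN_le_q[OF vV])
  also have "\<dots> <= D * pmax ?v" by (rule D(2)[OF vV])
  finally show "real (card S) <= D * P * pmax ?v" using P by (simp add: field_simps)
 qed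
qed

section \<open>Random signs\<close>

text \<open>Sub-Gaussian bound for one random sign, with the convenient exponent x^2. For 0 <= x <=
  1 compare both exponentials with quadratics; for x > 1 use x <= x^2.\<close>

lemma cosh_le_exp_square: "exp x + exp (- x) <= 2 * exp (x\<^sup>2)" for x :: real
proof -
 have pos: "exp x + exp (- x) <= 2 * exp (x\<^sup>2)" if "x >= 0" for x :: real
 proof (cases "x <= 1")
  case True
  have 1: "exp x <= 1 + x + x\<^sup>2" using exp_bound[OF that True] .
  have "exp (- x) <= 1 / (1 + x)"
   using exp_ge_add_one_self[of x] that by (simp add: exp_minus field_simps)
  also have "\<dots> <= 1 - x + x\<^sup>2"
  proof -
   have "1 <= (1 - x + x\<^sup>2) * (1 + x)" using that by (simp add: algebra_simps power2_eq_square)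
   then show ?thesis using that by (simp add: pos_divide_le_eq)
  qed
  finally have "exp x + exp (- x) <= 2 * (1 + x\<^sup>2)" using 1 by simp
  also have "\<dots> <= 2 * exp (x\<^sup>2)" by (intro mult_left_mono exp_ge_add_one_self) simp
  finally show ?thesis .
 next
  case False
  have "exp (- x) <= exp x" "exp x <= exp (x\<^sup>2)" using False by (auto simp: power2_eq_square)
  then show ?thesis by linarith
 qed
 show ?thesis using pos[of x] pos[of "- x"] by (cases "x >= 0") simp_all
qed

text \<open>A choice of signs is coded by the set of its plus signs, so an average over all choices
  is a sum over \<open>Pow S\<close>.\<close>

definition sg :: "int set => int => real" where "sg A m = (if m : A then 1 else - 1)"

text \<open>Independence of the signs: expanding the product of e^b + e^(-b) over S enumerates the
  subsets of S.\<close>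

lemma exp_moment:
 assumes S: "finite S"
 shows "(\<Sum>A\<in>Pow S. exp (\<Sum>m\<in>S. sg A m * b m)) <= 2 ^ card S * exp (\<Sum>m\<in>S. (b m)\<^sup>2)"
proof -
 have "(\<Sum>A\<in>Pow S. exp (\<Sum>m\<in>S. sg A m * b m)) = (\<Sum>A\<in>Pow S. (\<Prod>m\<in>A. exp (b m)) * (\<Prod>m\<in>S - A. exp (- b m)))"
 proof (rule sum.cong[OF refl])
  fix A assume "A : Pow S"
  then have A: "A \<subseteq> S" by simp
  have fA: "finite A" using A S by (rule finite_subset)
  have "(\<Sum>m\<in>S. sg A m * b m) = (\<Sum>m\<in>S - A. sg A m * b m) + (\<Sum>m\<in>A. sg A m * b m)"
   by (rule sum.subset_diff[OF A S])
  also have "(\<Sum>m\<in>S - A. sg A m * b m) = (\<Sum>m\<in>S - A. - b m)" by (intro sum.cong refl) (simp add: sg_def)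
  also have "(\<Sum>m\<in>A. sg A m * b m) = (\<Sum>m\<in>A. b m)" by (intro sum.cong refl) (simp add: sg_def)
  finally show "exp (\<Sum>m\<in>S. sg A m * b m) = (\<Prod>m\<in>A. exp (b m)) * (\<Prod>m\<in>S - A. exp (- b m))"
   using fA S by (simp only: exp_add exp_sum finite_Diff mult.commute)
 qed
 also have "\<dots> = (\<Prod>m\<in>S. exp (b m) + exp (- b m))" by (rule prod_add[OF S, symmetric])
 also have "\<dots> <= (\<Prod>m\<in>S. 2 * exp ((b m)\<^sup>2))"
  by (intro prod_mono conjI cosh_le_exp_square add_nonneg_nonneg exp_ge_zero)
 also have "\<dots> = 2 ^ card S * exp (\<Sum>m\<in>S. (b m)\<^sup>2)" using S by (simp add: prod.distrib exp_sum)
 finally show ?thesis .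
qed

text \<open>Exponential Markov inequality and union bound by counting: if every choice failed at
  some t, the sum of all moments would be at least 2^card S exp(u x), whereas it is at most 2^card S
  times 2 card T exp(u^2).\<close>

lemma random_signs_real:
 fixes a :: "'t => int => real"
 assumes S: "finite S" and T: "finite T" and a: "!!t. t : T ==> (\<Sum>m\<in>S. (a t m)\<^sup>2) <= 1"
  and c: "2 * real (card T) < exp (x\<^sup>2 / 4)"  and x: "x >= 0"
 shows "\<exists>A. \<forall>t\<in>T. \<bar>\<Sum>m\<in>S. sg A m * a t m\<bar> <= x"
proof (rule ccontr)
 assume n: "\<not> ?thesis"
 \<comment> \<open>Maximizes u x - u^2, with value x^2/4.\<close>
 let ?u = "x / 2"
 let ?X = "%A t. \<Sum>m\<in>S. sg A m * a t m"
 let ?f = "%A t. exp (?u * ?X A t) + exp (- ?u * ?X A t)"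
 have lower: "exp (?u * x) <= (\<Sum>t\<in>T. ?f A t)" for A
 proof -
  obtain t where t: "t : T" "\<bar>?X A t\<bar> > x" using n by (auto simp: not_le)
  have "exp (?u * x) <= exp (?u * \<bar>?X A t\<bar>)" using t(2) x by (simp add: mult_left_mono)
  also have "\<dots> <= ?f A t" by (cases "?X A t >= 0") simp_all
  also have "\<dots> <= (\<Sum>t\<in>T. ?f A t)" using t(1) T by (intro member_le_sum add_nonneg_nonneg) auto
  finally show ?thesis .
 qed
 have one: "(\<Sum>A\<in>Pow S. exp (k * ?X A t)) <= 2 ^ card S * exp (k\<^sup>2)" if t: "t : T" for t k
 proof -
  have "(\<Sum>A\<in>Pow S. exp (k * ?X A t)) = (\<Sum>A\<in>Pow S. exp (\<Sum>m\<in>S. sg A m * (k * a t m)))"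
   by (simp add: sum_distrib_left mult_ac)
  also have "\<dots> <= 2 ^ card S * exp (\<Sum>m\<in>S. (k * a t m)\<^sup>2)" by (rule exp_moment[OF S])
  also have "(\<Sum>m\<in>S. (k * a t m)\<^sup>2) = k\<^sup>2 * (\<Sum>m\<in>S. (a t m)\<^sup>2)" by (simp add: power_mult_distrib sum_distrib_left)
  also have "2 ^ card S * exp (k\<^sup>2 * (\<Sum>m\<in>S. (a t m)\<^sup>2)) <= 2 ^ card S * exp (k\<^sup>2)"
   using mult_left_mono[OF a[OF t], of "k\<^sup>2"] by simp
  finally show ?thesis .
 qed
 have "2 ^ card S * exp (?u * x) = (\<Sum>A\<in>Pow S. exp (?u * x))" using S by (simp add: card_Pow)
 also have "\<dots> <= (\<Sum>A\<in>Pow S. \<Sum>t\<in>T. ?f A t)" by (intro sum_mono lower)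
 also have "\<dots> = (\<Sum>t\<in>T. (\<Sum>A\<in>Pow S. exp (?u * ?X A t)) + (\<Sum>A\<in>Pow S. exp (- ?u * ?X A t)))"
  unfolding sum.distrib[symmetric] by (rule sum.swap)
 also have "\<dots> <= (\<Sum>t\<in>T. 2 ^ card S * exp (?u\<^sup>2) + 2 ^ card S * exp (?u\<^sup>2))"
 proof (intro sum_mono add_mono)
  fix t assume t: "t : T"
  show "(\<Sum>A\<in>Pow S. exp (?u * ?X A t)) <= 2 ^ card S * exp (?u\<^sup>2)" by (rule one[OF t])
  show "(\<Sum>A\<in>Pow S. exp (- ?u * ?X A t)) <= 2 ^ card S * exp (?u\<^sup>2)" using one[OF t, of "- ?u"] by (simp only: power2_minus)
 qed
 also have "\<dots> = 2 ^ card S * (2 * real (card T) * exp (?u\<^sup>2))" by simp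
 finally have "2 ^ card S * exp (?u * x) <= 2 ^ card S * (2 * real (card T) * exp (?u\<^sup>2))" .
 then have "exp (?u * x) <= 2 * real (card T) * exp (?u\<^sup>2)" by simp
 moreover have "exp (?u * x) = exp (x\<^sup>2 / 4) * exp (?u\<^sup>2)" by (simp add: power2_eq_square flip: exp_add)
 ultimately have "exp (x\<^sup>2 / 4) * exp (?u\<^sup>2) <= 2 * real (card T) * exp (?u\<^sup>2)" by simp
 then have "exp (x\<^sup>2 / 4) <= 2 * real (card T)" by (simp only: mult_le_cancel_right_pos[OF exp_gt_zero])
 then show False using c by simp
qed

text \<open>Real and imaginary parts are treated as separate test points, which doubles the number
  of conditions and the final bound.\<close>

lemma random_signs:
 fixes c :: "'t => int => complex"
 assumes S: "finite S" and T: "finite T" and c: "!!t. t : T ==> (\<Sum>m\<in>S. (cmod (c t m))\<^sup>2) <= 1"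
  and card: "4 * real (card T) < exp (x\<^sup>2 / 4)"  and x: "x >= 0"
 shows "\<exists>A. \<forall>t\<in>T. cmod (\<Sum>m\<in>S. cor (sg A m) * c t m) <= 2 * x"
proof -
 let ?a = "%(t, b) m. if b then Re (c t m) else Im (c t m)"
 have "\<exists>A. \<forall>t\<in>T \<times> UNIV. \<bar>\<Sum>m\<in>S. sg A m * ?a t m\<bar> <= x"
 proof (rule random_signs_real[OF S _ _ _ x])
  show "finite (T \<times> (UNIV :: bool set))" using T by simp
  show "2 * real (card (T \<times> (UNIV :: bool set))) < exp (x\<^sup>2 / 4)" using card by (simp add: card_cartesian_product)
  fix t assume "t : T \<times> (UNIV :: bool set)"
  then obtain s b where t: "t = (s, b)" "s : T" by (cases t) auto
  have "(\<Sum>m\<in>S. (?a t m)\<^sup>2) <= (\<Sum>m\<in>S. (cmod (c s m))\<^sup>2)"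
   by (intro sum_mono) (simp add: t cmod_power2)
  then show "(\<Sum>m\<in>S. (?a t m)\<^sup>2) <= 1" using c[OF t(2)] by linarith
 qed
 then obtain A where A0: "\<forall>t\<in>T \<times> UNIV. \<bar>\<Sum>m\<in>S. sg A m * ?a t m\<bar> <= x" by (elim exE)
 have A: "\<bar>\<Sum>m\<in>S. sg A m * ?a (t, b) m\<bar> <= x" if "t : T" for t b
  by (rule bspec[OF A0]) (use that in simp)
 have "cmod (\<Sum>m\<in>S. cor (sg A m) * c t m) <= 2 * x" if t: "t : T" for t
 proof -
  let ?z = "\<Sum>m\<in>S. cor (sg A m) * c t m"
  have "\<bar>Re ?z\<bar> <= x" using A[OF t, of True] by (simp add: Re_sum)
  moreover have "\<bar>Im ?z\<bar> <= x" using A[OF t, of False] by (simp add: Im_sum)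
  ultimately show ?thesis using cmod_le[of ?z] by linarith
 qed
 then show ?thesis by blast
qed

section \<open>Finite nets by rounding\<close>

lemma finite_net:
 assumes "finite K" "k ` \<Omega> \<subseteq> K"
 shows "\<exists>T. T \<subseteq> \<Omega> & finite T & card T <= card K & (\<forall>x\<in>\<Omega>. \<exists>y\<in>T. k x = k y)"
proof -
 have f: "finite (k ` \<Omega>)" using assms finite_subset by blast
 let ?T = "inv_into \<Omega> k ` (k ` \<Omega>)"
 have "?T \<subseteq> \<Omega>" by (auto intro: inv_into_into)
 moreover have "card ?T <= card K" using card_image_le[OF f] card_mono[OF assms] by (rule order_trans)
 moreover have "\<exists>y\<in>?T. k x = k y" if "x : \<Omega>" for x
  using that by (intro bexI[of _ "inv_into \<Omega> k (k x)"]) (simp_all add: f_inv_into_f)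
 ultimately show ?thesis using f by blast
qed

lemma floor_close:
 fixes a b h :: real
 assumes "\<lfloor>a / h\<rfloor> = \<lfloor>b / h\<rfloor>" "h > 0" shows "\<bar>a - b\<bar> <= h"
proof -
 have "\<bar>u - w\<bar> <= 1" if e: "\<lfloor>u\<rfloor> = \<lfloor>w\<rfloor>" for u w :: real
  using conjunct1[OF floor_correct[of u]] conjunct2[OF floor_correct[of u]]
   conjunct1[OF floor_correct[of w]] conjunct2[OF floor_correct[of w]] unfolding e by linarith
 from this[OF assms(1)] have "\<bar>a / h - b / h\<bar> <= 1" .
 then have "\<bar>(a - b) / h\<bar> <= 1" by (simp only: diff_divide_distrib)
 then show ?thesis using assms(2) by (simp add: abs_divide)
qed

lemma floor_range:
 fixes a h R :: real
 assumes "\<bar>a\<bar> <= R" "h > 0" shows "\<lfloor>a / h\<rfloor> : {- \<lceil>R / h\<rceil> - 1..\<lceil>R / h\<rceil>}"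
proof -
 have "\<bar>a / h\<bar> <= R / h" using assms by (simp add: abs_divide divide_right_mono)
 moreover have "- \<lceil>v\<rceil> - 1 <= \<lfloor>u\<rfloor> & \<lfloor>u\<rfloor> <= \<lceil>v\<rceil>" if "\<bar>u\<bar> <= v" for u v :: real
  using that by linarith
 ultimately show ?thesis unfolding atLeastAtMost_iff by blast
qed

lemma card_range:
 fixes h R :: real
 assumes "R >= 0" "h > 0" shows "real (card {- \<lceil>R / h\<rceil> - 1..\<lceil>R / h\<rceil>}) <= 2 * R / h + 4"
proof -
 have p: "R / h >= 0" using assms by simp
 then have c: "\<lceil>R / h\<rceil> >= 0" by linarith
 have "real (card {- \<lceil>R / h\<rceil> - 1..\<lceil>R / h\<rceil>}) = 2 * of_int \<lceil>R / h\<rceil> + 2" using c by simp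
 also have "\<dots> <= 2 * (R / h + 1) + 2"
 proof -
  have "2 * a + 2 <= 2 * (b + 1) + 2" if "a - 1 < b" for a b :: real using that by simp
  from this[OF conjunct1[OF ceiling_correct]] show ?thesis .
 qed
 finally show ?thesis by simp
qed

lemma cis_diff: "cmod (cis a - cis b) <= \<bar>a - b\<bar>"
proof -
 have "((%t. cis t) has_vector_derivative \<i> * cis t) (at t)" for t
  unfolding has_vector_derivative_def by (auto intro!: derivative_eq_intros simp: scaleR_conv_of_real)
 then have d: "((%t. cis (b + t)) has_vector_derivative \<i> * cis (b + t)) (at t)" for t
  using vector_diff_chain_at[OF has_vector_derivative_add[OF has_vector_derivative_const has_vector_derivative_id], of cis _ b t]
  by (simp add: o_def)
 have "cmod (cis (b + (a - b)) - cis (b + 0)) <= 1 * \<bar>a - b\<bar>"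
  by (rule vector_deriv_bound[OF d]) (simp add: norm_mult)
 then show ?thesis by simp
qed

section \<open>The Sobolev operator\<close>

lemma so2_eq:
 assumes "Y : so2" obtains y where "Y = y *\<^sub>R Jm"
proof -
 have T: "transpose Y = - Y" using assms by (simp add: so2_def)
 have e: "Y $ j $ i = - (Y $ i $ j)" for i j
 proof -
  have "Y $ j $ i = transpose Y $ i $ j" by (simp add: transpose_def)
  also have "\<dots> = - (Y $ i $ j)" unfolding T by simp
  finally show ?thesis .
 qed
 have "Y$1$1 = 0" "Y$2$2 = 0" using e[of 1 1] e[of 2 2] by linarith+
 then have "Y = Y$2$1 *\<^sub>R Jm" using e[of 1 2] unfolding mat2_eq_iff Jm_def by simp
 then show thesis by (rule that)
qed

lemma lie_Jm_ee: "lie_act Jm (ee lam k) = scaleF (- 2 * \<i> * of_int k) (ee lam k)"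
proof -
 have "alX Jm = 0" "beX Jm = 1" by (simp_all add: alX_def beX_def Jm_def complex_eq_iff)
 then show ?thesis by (simp add: lie_act_ee lie_ee_def fun_eq_iff)
qed

lemma cf_lie_J:
 assumes "v : Vs lam" shows "cf m (lie_act (y *\<^sub>R Jm) v) = - 2 * \<i> * of_int m * of_real y * cf m v"
proof -
 have J: "Jm : sl2" by simp
 have 0: "lie_act (y *\<^sub>R Jm) v = scaleF (cor y) (lie_act Jm v)" if "v : Vs lam" for v
  using lie_act_linear_left[OF that J J, of y 0] by (simp add: fun_eq_iff)
 show ?thesis unfolding 0[OF assms] cf_scale using assms
 proof (induction rule: Vs_induct)
  case zero
  show ?case by (simp only: lie_act_0[OF J] cf_0 mult_zero_right)
 next
  case (ee k)
  show ?case unfolding lie_Jm_ee cf_scale cf_ee by simp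
 next
  case (add v w)
  show ?case unfolding lie_act_add[OF add.hyps J] cf_add[OF lie_act_Vs[OF add.hyps(1) J] lie_act_Vs[OF add.hyps(2) J]] cf_add[OF add.hyps] distrib_left add.IH ..
 next
  case (scale v c)
  have "cor y * cf m (lie_act Jm (scaleF c v)) = c * (cor y * cf m (lie_act Jm v))"
   unfolding lie_act_scale[OF scale.hyps J] cf_scale by (simp only: mult.left_commute)
  then show ?case unfolding scale.IH cf_scale by (simp only: mult_ac)
 qed
qed

lemma cf_laplace:
 assumes "v : Vs lam" shows "cf m (laplace_K (y *\<^sub>R Jm) v) = of_real (4 * y\<^sup>2 * (of_int m)\<^sup>2) * cf m v"
proof -
 have J: "y *\<^sub>R Jm : sl2" by (intro sl2_closed) simp
 have "cf m (laplace_K (y *\<^sub>R Jm) v) = - cf m (lie_act (y *\<^sub>R Jm) (lie_act (y *\<^sub>R Jm) v))"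
  unfolding laplace_K_def scaleF_minus_one cf_scale by simp
 then show ?thesis
  unfolding cf_lie_J[OF lie_act_Vs[OF assms J]] cf_lie_J[OF assms] by (simp add: power2_eq_square)
qed

lemma laplace_Vs: "v : Vs lam ==> laplace_K (y *\<^sub>R Jm) v : Vs lam"
 unfolding laplace_K_def by (intro Vs_uminus lie_act_Vs sl2_closed) simp_all

text \<open>The weights m and -m share an eigenvalue, so an eigenvector decomposition must group S
  by 4 y^2 m^2. For uniqueness, an eigenvector with eigenvalue x has nonzero coefficient at m only
  if x = 4 y^2 m^2, so every decomposition multiplies the coefficient at m by the same
  factor.\<close>

lemma sobolev_op_eq:
 fixes y s :: real
 assumes S: "finite S"
 shows "sobolev_op (Vs lam) (y *\<^sub>R Jm) s (\<Sum>m\<in>S. scaleF (c m) (ee lam m))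
  = (\<Sum>m\<in>S. scaleF (cor ((1 + 4 * y\<^sup>2 * (of_int m)\<^sup>2) powr (s / 2)) * c m) (ee lam m))"
 unfolding sobolev_op_def
proof (rule the_equality)
 let ?muu = "%m. 4 * y\<^sup>2 * (real_of_int m)\<^sup>2"
 let ?v = "\<Sum>m\<in>S. scaleF (c m) (ee lam m)"
 let ?w = "\<Sum>m\<in>S. scaleF (cor ((1 + ?muu m) powr (s / 2)) * c m) (ee lam m)"
 have vV: "?v : Vs lam" by (intro Vs_sum Vs_scale ee_in_Vs)
 have wV: "?w : Vs lam" by (intro Vs_sum Vs_scale ee_in_Vs)
 let ?u = "%x. \<Sum>m | m : S & ?muu m = x. scaleF (c m) (ee lam m)"
 have uV: "?u x : Vs lam" for x by (intro Vs_sum Vs_scale ee_in_Vs)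
 have cu: "cf m (?u x) = (if m : S & ?muu m = x then c m else 0)" for m x
  using cf_sum[of "{m : S. ?muu m = x}" m c lam] S by simp
 have cs: "cf m (\<Sum>x\<in>X. f x) = (\<Sum>x\<in>X. cf m (f x))" if "!!x. x : X ==> f x : Vs lam" for m and X :: "real set" and f
  using that
 proof (induction X rule: infinite_finite_induct)
  case (insert x X)
  have "cf m (f x + (\<Sum>x\<in>X. f x)) = cf m (f x) + cf m (\<Sum>x\<in>X. f x)"
   by (rule cf_add) (use insert.prems in \<open>auto intro!: Vs_sum\<close>)
  then show ?case using insert by (simp only: sum.insert insert_iff simp_thms)
 qed (simp_all only: sum.empty sum.infinite cf_0 not_False_eq_True)
 show "\<exists>S' u. finite S' & (\<forall>x\<in>S'. u x : Vs lam & laplace_K (y *\<^sub>R Jm) (u x) = scaleF (cor x) (u x)) &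
  ?v = (\<Sum>x\<in>S'. u x) & ?w = (\<Sum>x\<in>S'. scaleF (cor ((1 + x) powr (s / 2))) (u x))"
 proof (intro exI[of _ "?muu ` S"] exI[of _ ?u] conjI ballI uV)
  show "finite (?muu ` S)" using S by simp
  show "laplace_K (y *\<^sub>R Jm) (?u x) = scaleF (cor x) (?u x)" for x
  proof (rule Vs_eqI[OF laplace_Vs[OF uV] Vs_scale[OF uV]])
   fix m
   show "cf m (laplace_K (y *\<^sub>R Jm) (?u x)) = cf m (scaleF (cor x) (?u x))"
    unfolding cf_laplace[OF uV] cf_scale cu
    by (cases "m : S & ?muu m = x") (simp_all only: simp_thms if_True if_False mult_zero_right)
  qed
  show "?v = (\<Sum>x\<in>?muu ` S. ?u x)"
  proof (rule Vs_eqI[OF vV Vs_sum[OF uV]])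
   fix m
   show "cf m ?v = cf m (\<Sum>x\<in>?muu ` S. ?u x)"
    unfolding cs[OF uV] cu cf_sum[OF S] using S by (cases "m : S") (auto simp: sum.delta)
  qed
  show "?w = (\<Sum>x\<in>?muu ` S. scaleF (cor ((1 + x) powr (s / 2))) (?u x))"
  proof (rule Vs_eqI[OF wV Vs_sum[OF Vs_scale[OF uV]]])
   fix m
   have "(\<Sum>x\<in>?muu ` S. cor ((1 + x) powr (s / 2)) * (if m : S & ?muu m = x then c m else 0))
    = (\<Sum>x\<in>?muu ` S. if ?muu m = x then (if m : S then cor ((1 + x) powr (s / 2)) * c m else 0) else 0)"
    by (intro sum.cong refl) simp
   also have "\<dots> = (if m : S then cor ((1 + ?muu m) powr (s / 2)) * c m else 0)"
    using S by (cases "m : S") (auto simp: sum.delta)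
   finally show "cf m ?w = cf m (\<Sum>x\<in>?muu ` S. scaleF (cor ((1 + x) powr (s / 2))) (?u x))"
    unfolding cs[OF Vs_scale[OF uV]] cf_scale cu cf_sum[OF S] by (simp only:)
  qed
 qed
 fix w assume "\<exists>S' u. finite S' & (\<forall>x\<in>S'. u x : Vs lam & laplace_K (y *\<^sub>R Jm) (u x) = scaleF (cor x) (u x)) &
  ?v = (\<Sum>x\<in>S'. u x) & w = (\<Sum>x\<in>S'. scaleF (cor ((1 + x) powr (s / 2))) (u x))"
 then obtain S' u where S': "finite S'" "!!x. x : S' ==> u x : Vs lam"
  "!!x. x : S' ==> laplace_K (y *\<^sub>R Jm) (u x) = scaleF (cor x) (u x)"
  "?v = (\<Sum>x\<in>S'. u x)" "w = (\<Sum>x\<in>S'. scaleF (cor ((1 + x) powr (s / 2))) (u x))" by blast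
 have wV': "w : Vs lam" unfolding S'(5) by (intro Vs_sum Vs_scale S'(2))
 show "w = ?w"
 proof (rule Vs_eqI[OF wV' wV])
  fix m
  have e: "cor ((1 + x) powr (s / 2)) * cf m (u x) = cor ((1 + ?muu m) powr (s / 2)) * cf m (u x)" if x: "x : S'" for x
  proof (cases "cf m (u x) = 0")
   case False
   have "cor (?muu m) * cf m (u x) = cor x * cf m (u x)"
    using cf_laplace[OF S'(2)[OF x], of m y] unfolding S'(3)[OF x] cf_scale by (rule sym)
   then have "cor (?muu m) = cor x" using False mult_right_cancel by blast
   then have "?muu m = x" by (simp only: of_real_eq_iff)
   then show ?thesis by (simp only:)
  qed simp
  have "cf m w = (\<Sum>x\<in>S'. cor ((1 + x) powr (s / 2)) * cf m (u x))"
   unfolding S'(5) by (subst cs) (simp_all add: Vs_scale S'(2) cf_scale)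
  also have "\<dots> = (\<Sum>x\<in>S'. cor ((1 + ?muu m) powr (s / 2)) * cf m (u x))" by (intro sum.cong refl e)
  also have "\<dots> = cor ((1 + ?muu m) powr (s / 2)) * cf m ?v"
   unfolding S'(4) sum_distrib_left[symmetric] by (subst cs) (simp_all add: S'(2))
  also have "\<dots> = cf m ?w" unfolding cf_sum[OF S] by simp
  finally show "cf m w = cf m ?w" .
 qed
qed

section \<open>The final estimate\<close>

lemma mult_entry_bound:
 fixes A B :: mat2
 assumes "!!i j. \<bar>A$i$j\<bar> <= a" "!!i j. \<bar>B$i$j\<bar> <= b"
 shows "\<bar>(A ** B)$i$j\<bar> <= 2 * (a * b)"
proof -
 have a0: "a >= 0" using order_trans[OF abs_ge_zero assms(1)] .
 have "\<bar>A$i$k * B$k$j\<bar> <= a * b" for k unfolding abs_mult by (intro mult_mono assms a0 abs_ge_zero)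
 from this[of 1] this[of 2] show ?thesis unfolding mat2_mult_entry by (simp only: mult_2)
qed

lemma adj2_entry_bound: "(!!i j. \<bar>A$i$j\<bar> <= a) ==> \<bar>adj2 A $ i $ j\<bar> <= a"
 using exhaust_2[of i] exhaust_2[of j] by (elim disjE) (simp_all add: adj2_def)

lemma rot_diagm_entry: "t >= 0 ==> \<bar>(rot tta ** diagm t) $ i $ j\<bar> <= exp t"
proof -
 assume t: "t >= 0"
 have 1: "exp (- t) <= exp t" using t by simp
 have "\<bar>x * exp t\<bar> <= exp t" "\<bar>x * exp (- t)\<bar> <= exp t" if x: "\<bar>x\<bar> <= 1" for x
 proof -
  have "\<bar>x\<bar> * exp t <= 1 * exp t" by (rule mult_right_mono[OF x]) simp
  then show "\<bar>x * exp t\<bar> <= exp t" by (simp add: abs_mult)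
  have "\<bar>x\<bar> * exp (- t) <= 1 * exp (- t)" by (rule mult_right_mono[OF x]) simp
  then have "\<bar>x\<bar> * exp (- t) <= exp t" using 1 by linarith
  then show "\<bar>x * exp (- t)\<bar> <= exp t" by (simp add: abs_mult)
 qed
 from this[OF abs_cos_le_one] this[OF abs_sin_le_one] show ?thesis
  using exhaust_2[of i] exhaust_2[of j] by (elim disjE) (simp_all add: rot_def diagm_def abs_mult)
qed

text \<open>Derivative bounds are given for e_0 only, so the variation at e_m is read off from
  Fourier coefficients of e_0 over K at the price of the factor \<open>Mco\<close>. Writing g = x w,
  the entries of w - 1 are at most 2Rh; conjugation by rot tta a_t enlarges this to 8 R e^(2t) h,
  and \<open>LDU_lipschitz\<close> contributes the factor 6.\<close>

lemma (in lb_family) sphere_lipschitz: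
 assumes lam: "Re lam = 0"
  and B: "!!g X. g : SL2 ==> X : {Fm, Hm, Em} ==> cmod (Ph g (lie_act X (ee lam 0))) <= B"
  and x: "x : SL2" "norm x <= R" and g: "g : SL2" "!!i j. \<bar>g$i$j - x$i$j\<bar> <= h"
  and t: "t >= 0" and small: "16 * (R * exp (2 * t) * h) <= 1"
 shows "cmod (Ph g (ee lam m) - Ph x (ee lam m)) * cmod (Mco lam m t) <= 48 * (R * exp (2 * t) * h) * B"
proof -
 let ?e = "ee lam 0" and ?dlt = "8 * (R * exp (2 * t) * h)"
 have B0: "B >= 0" using order_trans[OF norm_ge_zero B[OF SL2_one, of Fm]] by simp
 define w where "w = adj2 x ** g"
 have gw: "g = x ** w" unfolding w_def using x(1) by (simp add: matrix_mul_assoc adj2_mult)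
 have wS: "w : SL2" unfolding w_def by (intro SL2_mult adj2_SL2 x g)
 have w1: "\<bar>(w - mat 1)$i$j\<bar> <= 2 * (R * h)" for i j
 proof -
  have "w - mat 1 = adj2 x ** (g - x)"
   unfolding w_def using adj2_mult[OF x(1)] by (simp add: mat2_eq_iff adj2_def algebra_simps)
  moreover have "\<bar>(adj2 x ** (g - x))$i$j\<bar> <= 2 * (R * h)"
  proof (rule mult_entry_bound[OF adj2_entry_bound])
   show "\<bar>x$i$j\<bar> <= R" for i j using mat2_norm_entry[of x i j] x(2) by linarith
   show "\<bar>(g - x)$i$j\<bar> <= h" for i j using g(2)[of i j] by simp
  qed
  ultimately show ?thesis by simp
 qed
 let ?h1 = "%tta. Ph (g ** rot tta ** diagm t) ?e" and ?h2 = "%tta. Ph (x ** rot tta ** diagm t) ?e"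
 have d: "cmod (?h1 tta - ?h2 tta) <= 6 * ?dlt * B" for tta
 proof -
  define u where "u = rot tta ** diagm t"
  have uS: "u : SL2" unfolding u_def by (intro SL2_mult SO2_SL2 rot_SO2 diagm_SL2)
  have ue: "\<bar>u$i$j\<bar> <= exp t" for i j unfolding u_def by (rule rot_diagm_entry[OF t])
  let ?w = "adj2 u ** w ** u"
  have w'S: "?w : SL2" by (intro SL2_mult adj2_SL2 uS wS)
  have uu: "adj2 u ** u = mat 1" "u ** adj2 u = mat 1" using adj2_mult[OF uS] by simp_all
  have "\<bar>?w$i$j - (mat 1 :: mat2)$i$j\<bar> <= ?dlt" for i j
  proof -
   have "?w - mat 1 = adj2 u ** (w - mat 1) ** u"
   proof -
    have "adj2 u ** (w - mat 1) ** u = ?w - adj2 u ** u"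
     by (simp add: mat2_eq_iff algebra_simps)
    then show ?thesis by (simp only: uu)
   qed
   moreover have "\<bar>(adj2 u ** (w - mat 1) ** u)$i$j\<bar> <= 2 * ((2 * (exp t * (2 * (R * h)))) * exp t)"
    by (intro mult_entry_bound adj2_entry_bound ue w1)
   moreover have "2 * ((2 * (exp t * (2 * (R * h)))) * exp t) = ?dlt"
    by (simp add: exp_double power2_eq_square)
   ultimately show ?thesis by (metis vector_minus_component)
  qed
  then have "cmod (Ph ((x ** u) ** ?w) ?e - Ph (x ** u) ?e) <= 6 * ?dlt * B"
   using small by (intro LDU_lipschitz B ee_in_Vs SL2_mult x uS w'S) auto
  moreover have "(x ** u) ** ?w = g ** u"
  proof -
   have "(x ** u) ** ?w = x ** (u ** adj2 u) ** w ** u" by (simp only: matrix_mul_assoc)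
   then show ?thesis unfolding uu gw by (simp only: matrix_mul_rid)
  qed
  ultimately show ?thesis unfolding u_def by (simp only: matrix_mul_assoc)
 qed
 have c: "continuous_on I0 ?h1" "continuous_on I0 ?h2"
  by (rule avg_integrand_cont[OF g(1) diagm_SL2 ee_in_Vs], rule avg_integrand_cont[OF x(1) diagm_SL2 ee_in_Vs])
 have "(Ph g (ee lam m) - Ph x (ee lam m)) * Mco lam m t = fhat m (%tta. ?h1 tta - ?h2 tta)"
  unfolding fhat_diff[OF c] left_diff_distrib avg_spherical[OF lam x(1) t, symmetric] avg_spherical[OF lam g(1) t, symmetric]
  by (simp only: avg_def)
 then have "cmod (Ph g (ee lam m) - Ph x (ee lam m)) * cmod (Mco lam m t) = cmod (fhat m (%tta. ?h1 tta - ?h2 tta))"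
  by (simp only: norm_mult[symmetric])
 also have "\<dots> <= 6 * ?dlt * B" by (rule fhat_bound[OF continuous_on_diff[OF c] d])
 finally show ?thesis by simp
qed

text \<open>Every condition on \<open>L\<close> in one place. The third compares the polynomial size
  of the nets with exp(L^(1/25)/4); in the last one the left side has exponent 1/6 + 1/2 + 2/50 < 1
  up to logarithms.\<close>

lemma asymptotics:
 fixes ka R D Cs B Y :: real
 assumes p: "ka > 0" "R > 0" "D > 0" "Cs > 0" "B > 0" "Y > 0"
 shows "\<forall>\<^sub>F L in sequentially. ka <= real L & 1 <= real L &
  4 * ((14 * real L ^ 4 + 4) * (2 * real L ^ 5 + 4) + (2 * R * real L ^ 4 + 4) ^ 4) < exp ((real L powr (1/50))\<^sup>2 / 4) &
  (2 * real L + 1) * (16 * exp (- (real L / 2))) <= 1 &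
  (2 * real L + 1) * ((16 * real L + 8 * ka) / real L ^ 4) <= 1 &
  16 * R <= real L ^ 3 & 720 * R <= real L &
  512 * (1 + ln (real L / ka) / 2)\<^sup>2 * (D * (8 * real L powr (1/50) + 2) * (Cs * ((Y * (real L)\<^sup>2) powr (1/12) * B * (10 * sqrt (real L) * real L powr (1/50) + 1))))
   < real L / ka"
proof -
 have 1: "\<forall>\<^sub>F L in sequentially. ka <= real L" by real_asymp
 have 2: "\<forall>\<^sub>F L in sequentially. 1 <= real L" by real_asymp
 have 3: "\<forall>\<^sub>F L in sequentially. 4 * ((14 * real L ^ 4 + 4) * (2 * real L ^ 5 + 4) + (2 * R * real L ^ 4 + 4) ^ 4) < exp ((real L powr (1/50))\<^sup>2 / 4)"
  using p(2) by real_asymp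
 have 4: "\<forall>\<^sub>F L in sequentially. (2 * real L + 1) * (16 * exp (- (real L / 2))) <= 1" by real_asymp
 have 5: "\<forall>\<^sub>F L in sequentially. (2 * real L + 1) * ((16 * real L + 8 * ka) / real L ^ 4) <= 1" using p(1) by real_asymp
 have 6: "\<forall>\<^sub>F L in sequentially. 16 * R <= real L ^ 3" by real_asymp
 have 7: "\<forall>\<^sub>F L in sequentially. 720 * R <= real L" by real_asymp
 have 8: "\<forall>\<^sub>F L in sequentially. 512 * (1 + ln (real L / ka) / 2)\<^sup>2 * (D * (8 * real L powr (1/50) + 2) * (Cs * ((Y * (real L)\<^sup>2) powr (1/12) * B * (10 * sqrt (real L) * real L powr (1/50) + 1))))
   < real L / ka" using p by real_asymp
 show ?thesis using 1 2 3 4 5 6 7 8 by eventually_elim blast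
qed

text \<open>The radius R is independent of g and v, so one compact set carries the supremum defining
  the automorphic norm and one net can be fixed before v is chosen.\<close>

lemma (in glob) automorphic_reduce:
 assumes L: "cocompact_lattice \<Gamma>" and inv: "invariant_under \<Gamma> V p rh \<eta>"
 obtains R where "R > 0" "!!g v. g : SL2 ==> v : V ==> \<exists>w\<in>SL2. norm w <= R & \<eta> (rh g (em v)) = \<eta> (rh w (em v))"
proof -
 have sub: "\<Gamma> \<subseteq> SL2" using L subgroup.subset unfolding cocompact_lattice_def SL2_group_def by fastforce
 obtain R where R: "!!g. g : SL2 ==> \<exists>ga\<in>\<Gamma>. \<exists>w\<in>SL2. norm w <= R & g = ga ** w"
  using cocompact_bounded_representatives[OF L] by blast
 have "\<exists>w\<in>SL2. norm w <= \<bar>R\<bar> + 1 & \<eta> (rh g (em v)) = \<eta> (rh w (em v))" if g: "g : SL2" and v: "v : V" for g v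
 proof -
  obtain ga w where w: "ga : \<Gamma>" "w : SL2" "norm w <= R" "g = ga ** w" using R[OF g] by blast
  have ga: "ga : SL2" using w(1) sub by blast
  have "\<eta> (rh g (em v)) = \<eta> (rh ga (rh w (em v)))" unfolding w(4) rh_mult[OF ga w(2) emb_in[OF v]] ..
  also have "\<dots> = \<eta> (rh w (em v))"
   by (rule inv[unfolded invariant_under_def, rule_format, OF w(1) S_orbit[OF w(2) v]])
  finally have e: "\<eta> (rh g (em v)) = \<eta> (rh w (em v))" .
  have "norm w <= \<bar>R\<bar> + 1" using w(3) by linarith
  then show ?thesis using w(2) e by (intro bexI[of _ w] conjI)
 qed
 moreover have "\<bar>R\<bar> + 1 > 0" by simp
 ultimately show thesis by (intro that[of "\<bar>R\<bar> + 1"])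
qed

text \<open>The enlarged base is at least 1, so the exponent s/2 may be raised to 1/12.\<close>

lemma powr_weight_le:
 fixes y s :: real and m :: int
 assumes s: "0 <= s" "s <= 1 / 6" and m: "\<bar>m\<bar> <= int L" and L: "1 <= real L"
 shows "(1 + 4 * y\<^sup>2 * (of_int m)\<^sup>2) powr (s / 2) <= ((1 + 4 * y\<^sup>2) * (real L)\<^sup>2) powr (1 / 12)"
proof -
 have "\<bar>real_of_int m\<bar> <= real L" using m by linarith
 then have m2: "(real_of_int m)\<^sup>2 <= (real L)\<^sup>2" using abs_le_square_iff[of "real_of_int m" "real L"] by simp
 have L2: "1 <= (real L)\<^sup>2" using L by (simp add: one_le_power)
 have "1 + 4 * y\<^sup>2 * (real_of_int m)\<^sup>2 <= (real L)\<^sup>2 + 4 * y\<^sup>2 * (real L)\<^sup>2" by (intro add_mono L2 mult_left_mono m2) simp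
 also have "\<dots> = (1 + 4 * y\<^sup>2) * (real L)\<^sup>2" by (simp add: algebra_simps)
 finally have b: "1 + 4 * y\<^sup>2 * (real_of_int m)\<^sup>2 <= (1 + 4 * y\<^sup>2) * (real L)\<^sup>2" .
 have p: "0 <= 4 * y\<^sup>2 * (real_of_int m)\<^sup>2" by simp
 have "(1 + 4 * y\<^sup>2 * (of_int m)\<^sup>2) powr (s / 2) <= ((1 + 4 * y\<^sup>2) * (real L)\<^sup>2) powr (s / 2)"
  using b p s by (intro powr_mono2) auto
 also have "\<dots> <= ((1 + 4 * y\<^sup>2) * (real L)\<^sup>2) powr (1 / 12)"
 proof (rule powr_mono)
  show "1 <= (1 + 4 * y\<^sup>2) * (real L)\<^sup>2" using b p by linarith
 qed (use s in simp)
 finally show ?thesis .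
qed

text \<open>Frequencies outside S contribute at most (2L + 1)/(8(2L + 1)) = 1/8 to a mass of at
  least 1/4. Each one in S contributes at most 64 (1 + t)^2 e^(-2t), so S must be large; 512 = 8 *
  64.\<close>

lemma good_frequencies:
 fixes L :: nat
 assumes lam: "Re lam = 0" and t: "t >= 0" and L: "6 * (cmod (1 + lam) + 1) * exp (2 * t) <= real L"
 defines "S \<equiv> {m : {- int L..int L}. 1 <= 8 * (2 * real L + 1) * (cmod (Mco lam m t))\<^sup>2}"
 shows "exp (2 * t) <= 512 * (1 + t)\<^sup>2 * real (card S)"
proof -
 let ?I = "{- int L..int L}" and ?M = "%m. (cmod (Mco lam m t))\<^sup>2" and ?N = "8 * (2 * real L + 1)"
 have N: "?N > 0" by simp
 have SI: "S \<subseteq> ?I" unfolding S_def by blast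
 have "1 / 4 <= (\<Sum>m\<in>?I. ?M m)" by (rule Mco_mass[OF lam t L])
 also have "\<dots> = (\<Sum>m\<in>?I - S. ?M m) + (\<Sum>m\<in>S. ?M m)" by (rule sum.subset_diff[OF SI]) simp
 also have "(\<Sum>m\<in>?I - S. ?M m) <= (\<Sum>m\<in>?I - S. 1 / ?N)"
 proof (rule sum_mono)
  fix m assume "m : ?I - S"
  then have "?N * ?M m < 1" unfolding S_def by auto
  then show "?M m <= 1 / ?N" using N by (simp only: pos_le_divide_eq mult.commute less_imp_le)
 qed
 also have "(\<Sum>m\<in>?I - S. 1 / ?N) <= (\<Sum>m\<in>?I. 1 / ?N)" using N by (intro sum_mono2) auto
 also have "(\<Sum>m\<in>?I. 1 / ?N) = (2 * real L + 1) / ?N" by simp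
 also have "\<dots> = 1 / 8"
 proof -
  have "k / (8 * k) = 1 / 8" if "k > 0" for k :: real using that by simp
  from this[of "2 * real L + 1"] show ?thesis by simp
 qed
 finally have low: "1 / 8 <= (\<Sum>m\<in>S. ?M m)" by simp
 have "?M m <= 64 * (1 + t)\<^sup>2 * exp (- (2 * t))" for m
 proof -
  have "?M m <= (8 * (1 + t) * exp (- t))\<^sup>2" by (rule power_mono[OF Mco_bound[OF lam t] norm_ge_zero])
  also have "\<dots> = 8\<^sup>2 * (1 + t)\<^sup>2 * (exp (- t))\<^sup>2" by (simp only: power_mult_distrib)
  also have "\<dots> = 64 * (1 + t)\<^sup>2 * exp (- (2 * t))" by (simp flip: exp_double)
  finally show ?thesis .
 qed
 then have "(\<Sum>m\<in>S. ?M m) <= real (card S) * (64 * (1 + t)\<^sup>2 * exp (- (2 * t)))" by (rule sum_bounded_above)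
 then have "1 / 8 <= real (card S) * (64 * (1 + t)\<^sup>2 * exp (- (2 * t)))" using low by linarith
 then have "1 / 8 * exp (2 * t) <= real (card S) * (64 * (1 + t)\<^sup>2 * exp (- (2 * t))) * exp (2 * t)"
  by (rule mult_right_mono) simp
 also have "\<dots> = real (card S) * (64 * (1 + t)\<^sup>2) * (exp (- (2 * t)) * exp (2 * t))" by (simp only: mult_ac)
 also have "exp (- (2 * t)) * exp (2 * t) = 1" by (simp flip: exp_add)
 finally show ?thesis by (simp add: mult_ac)
qed

text \<open>One half of the exponential decay absorbs the factor 1 + t. This settles times beyond L
  without a net.\<close>

lemma Mco_large:
 assumes lam: "Re lam = 0" and t: "t >= L" "L >= 0"
 shows "cmod (Mco lam m t) <= 16 * exp (- (L / 2))"
proof -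
 have e: "exp (- t) = exp (- (t / 2)) * exp (- (t / 2))" by (simp flip: exp_add)
 have "1 + t / 2 <= exp (t / 2)" by (rule exp_ge_add_one_self)
 then have "1 + t <= 2 * exp (t / 2)" by linarith
 then have "8 * (1 + t) * exp (- t) <= 8 * (2 * exp (t / 2)) * exp (- t)" by (intro mult_right_mono mult_left_mono) auto
 also have "\<dots> = 16 * (exp (t / 2) * exp (- (t / 2))) * exp (- (t / 2))" unfolding e by simp
 also have "exp (t / 2) * exp (- (t / 2)) = 1" by (simp flip: exp_add)
 finally have "8 * (1 + t) * exp (- t) <= 16 * exp (- (t / 2))" by simp
 moreover have "exp (- (t / 2)) <= exp (- (L / 2))" using t by simp
 moreover have "cmod (Mco lam m t) <= 8 * (1 + t) * exp (- t)" using t by (intro Mco_bound lam) simp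
 ultimately show ?thesis by linarith
qed

lemma Mco_le_8: "Re lam = 0 ==> t >= 0 ==> cmod (Mco lam m t) <= 8"
proof -
 assume a: "Re lam = 0" "t >= 0"
 have "(1 + t) * exp (- t) <= exp t * exp (- t)" by (intro mult_right_mono exp_ge_add_one_self) simp
 then have "(1 + t) * exp (- t) <= 1" by (simp flip: exp_add)
 then show ?thesis using Mco_bound[OF a, of m] by linarith
qed

lemma cis_reduce:
 obtains tta0 where "0 <= tta0" "tta0 <= 2 * pi" "!!m::int. cis (- 2 * of_int m * tta) = cis (- 2 * of_int m * tta0)"
proof
 define k where "k = \<lfloor>tta / (2 * pi)\<rfloor>"
 let ?t = "tta - 2 * pi * of_int k"
 have k: "of_int k <= tta / (2 * pi)" "tta / (2 * pi) <= of_int k + 1" unfolding k_def by linarith+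
 show "0 <= ?t" using k(1) pi_gt_zero by (simp add: field_simps)
 show "?t <= 2 * pi" using k(2) pi_gt_zero by (simp add: field_simps)
 fix m :: int
 have "- 2 * of_int m * tta = - 2 * of_int m * ?t + 2 * pi * of_int (- 2 * m * k)" by (simp add: algebra_simps)
 then have "cis (- 2 * of_int m * tta) = cis (- 2 * of_int m * ?t) * cis (2 * pi * of_int (- 2 * m * k))" by (simp only: cis_mult)
 also have "cis (2 * pi * of_int (- 2 * m * k)) = 1"
  using cos_int_2pin[of "- 2 * m * k"] sin_int_2pin[of "- 2 * m * k"] by (simp add: complex_eq_iff)
 finally show "cis (- 2 * of_int m * tta) = cis (- 2 * of_int m * ?t)" by simp
qed

text \<open>One choice of signs has to serve two purposes: small pairing with the orbit of e_0 at
  all angles and times, and small values of the weighted family on the compact set of norm at most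
  R. Both are imposed on finite nets by a single application of \<open>random_signs\<close> to a
  disjoint union, and extended by Lipschitz bounds.\<close>

lemma random_vector:
 fixes L :: nat and Ph :: "mat2 => fn => complex" and W :: "int => real"
 assumes lam: "Re lam = 0" and fam: "lb_family lam Ph"
  and B: "B > 0" "!!g. g : SL2 ==> cmod (Ph g (ee lam 0)) <= B"
   "!!g X. g : SL2 ==> X : {Fm, Hm, Em} ==> cmod (Ph g (lie_act X (ee lam 0))) <= B"
  and R: "R > 0"
  and W: "!!m. \<bar>m\<bar> <= int L ==> 0 <= W m & W m <= WL" "WL > 0"
  and ka: "ka = 6 * (cmod (1 + lam) + 1)" and x: "x >= 0"
  and L: "ka <= real L" "1 <= real L"
   "4 * ((14 * real L ^ 4 + 4) * (2 * real L ^ 5 + 4) + (2 * R * real L ^ 4 + 4) ^ 4) < exp (x\<^sup>2 / 4)"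
   "(2 * real L + 1) * (16 * exp (- (real L / 2))) <= 1"
   "(2 * real L + 1) * ((16 * real L + 8 * ka) / real L ^ 4) <= 1"
   "16 * R <= real L ^ 3" "720 * R <= real L"
 shows "\<exists>S A. finite S & real L / ka <= 512 * (1 + ln (real L / ka) / 2)\<^sup>2 * real (card S) &
  (\<forall>tta t. t >= 0 --> cmod (\<Sum>m\<in>S. cor (sg A m) * (cis (- 2 * of_int m * tta) * Mco lam m t)) <= 8 * x + 2) &
  (\<forall>g\<in>SL2. norm g <= R --> cmod (\<Sum>m\<in>S. cor (sg A m) * (cor (W m) * Ph g (ee lam m)))
   <= WL * B * (10 * sqrt (real L) * x + 1))"
proof -
 interpret lb_family lam Ph by (rule fam)
 have ka6: "ka >= 6" unfolding ka by simp
 have ka0: "ka > 0" using ka6 by linarith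
 have Lp: "real L > 0" using L(2) by linarith
 define t where "t = ln (real L / ka) / 2"
 have "real L / ka >= 1" using L(1) ka0 by simp
 then have t: "t >= 0" and et: "exp (2 * t) = real L / ka" unfolding t_def by auto
 have etL: "exp (2 * t) <= real L" unfolding et using ka6 Lp by (simp add: field_simps)
 have mass: "6 * (cmod (1 + lam) + 1) * exp (2 * t) <= real L" unfolding et ka[symmetric] using ka0 by simp
 define N where "N = 8 * (2 * real L + 1)"
 have N0: "N > 0" unfolding N_def by simp
 have "N <= 25 * real L" unfolding N_def using L(2) by simp
 then have "sqrt N <= sqrt (25 * real L)" by simp
 also have "\<dots> = 5 * sqrt (real L)" using real_sqrt_unique[of 5 25] by (simp add: real_sqrt_mult)
 finally have sN: "sqrt N <= 5 * sqrt (real L)" .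
 have "real L <= (real L)\<^sup>2" by (rule self_le_power[OF L(2)]) simp
 then have "sqrt (real L) <= sqrt ((real L)\<^sup>2)" by (rule real_sqrt_le_mono)
 then have sL: "sqrt (real L) <= real L" by simp
 define S where "S = {m : {- int L..int L}. 1 <= 8 * (2 * real L + 1) * (cmod (Mco lam m t))\<^sup>2}"
 have S: "finite S" unfolding S_def by (rule finite_subset[of _ "{- int L..int L}"]) auto
 have Sm: "\<bar>m\<bar> <= int L" if "m : S" for m using that unfolding S_def by auto
 have SM: "1 <= N * (cmod (Mco lam m t))\<^sup>2" if "m : S" for m using that unfolding S_def N_def by blast
 have "card S <= card {- int L..int L}" unfolding S_def by (intro card_mono) auto
 then have cS: "real (card S) <= 2 * real L + 1" by simp
 have cS3: "real (card S) <= 3 * real L" using cS L(2) by linarith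
 \<comment> \<open>Fine enough that the rounding errors of up to 2L + 1 frequencies add up to at
   most 1 for the first net and \<open>WL * B\<close> for the second, while both nets stay
   polynomial in L.\<close>
 define h where "h = 1 / real L ^ 4"
 have h: "h > 0" unfolding h_def using Lp by simp
 define rng where "rng r = {- \<lceil>r / h\<rceil> - 1..\<lceil>r / h\<rceil>}" for r
 have rcard: "real (card (rng r)) <= 2 * r * real L ^ 4 + 4" if "r >= 0" for r
  using card_range[OF that h] unfolding rng_def by (simp add: h_def)
 have rfin: "finite (rng r)" for r unfolding rng_def by simp
 have rmem: "\<lfloor>a / h\<rfloor> : rng r" if "\<bar>a\<bar> <= r" for a r using floor_range[OF that h] unfolding rng_def .
 let ?kA = "%z::real \<times> real. (\<lfloor>fst z / h\<rfloor>, \<lfloor>snd z / h\<rfloor>)"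
 let ?kB = "%g::mat2. (\<lfloor>g$1$1 / h\<rfloor>, \<lfloor>g$1$2 / h\<rfloor>, \<lfloor>g$2$1 / h\<rfloor>, \<lfloor>g$2$2 / h\<rfloor>)"
 \<comment> \<open>Angles matter only modulo 2 pi < 7, and times beyond L are left to decay, so a
   bounded rectangle is enough.\<close>
 obtain TA where TA: "TA \<subseteq> {0..2 * pi} \<times> {0..real L}" "finite TA" "card TA <= card (rng 7 \<times> rng (real L))"
  "\<forall>z\<in>{0..2 * pi} \<times> {0..real L}. \<exists>y\<in>TA. ?kA z = ?kA y"
 proof -
  have "?kA ` ({0..2 * pi} \<times> {0..real L}) \<subseteq> rng 7 \<times> rng (real L)"
   using pi_less_4 by (auto intro!: rmem simp: abs_le_iff) (use pi_approx in simp)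
  from finite_net[OF finite_cartesian_product[OF rfin rfin] this] show thesis using that by blast
 qed
 obtain TB where TB: "TB \<subseteq> {g : SL2. norm g <= R}" "finite TB" "card TB <= card (rng R \<times> rng R \<times> rng R \<times> rng R)"
  "\<forall>z\<in>{g : SL2. norm g <= R}. \<exists>y\<in>TB. ?kB z = ?kB y"
 proof -
  have "?kB ` {g : SL2. norm g <= R} \<subseteq> rng R \<times> rng R \<times> rng R \<times> rng R"
   by (auto intro!: rmem order_trans[OF mat2_norm_entry])
  from finite_net[OF finite_cartesian_product[OF rfin finite_cartesian_product[OF rfin finite_cartesian_product[OF rfin rfin]]] this]
  show thesis using that by blast
 qed
 have cA: "real (card TA) <= (14 * real L ^ 4 + 4) * (2 * real L ^ 5 + 4)"
 proof -
  have "real (card TA) <= real (card (rng 7)) * real (card (rng (real L)))"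
   using TA(3) unfolding card_cartesian_product by (simp only: of_nat_mult[symmetric] of_nat_le_iff)
  also have "\<dots> <= (14 * real L ^ 4 + 4) * (2 * real L ^ 5 + 4)"
  proof (intro mult_mono)
   show "real (card (rng 7)) <= 14 * real L ^ 4 + 4" using rcard[of 7] by simp
   have "2 * real L * real L ^ 4 = 2 * real L ^ 5" by (simp add: power_Suc[symmetric] numeral_eq_Suc)
   then show "real (card (rng (real L))) <= 2 * real L ^ 5 + 4" using rcard[of "real L"] by simp
  qed simp_all
  finally show ?thesis .
 qed
 have cB: "real (card TB) <= (2 * R * real L ^ 4 + 4) ^ 4"
 proof -
  have "real (card TB) <= real (card (rng R)) ^ 4"
   using TB(3) unfolding card_cartesian_product by (simp add: power4_eq_xxxx of_nat_mult[symmetric] mult.assoc del: of_nat_mult)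
  also have "\<dots> <= (2 * R * real L ^ 4 + 4) ^ 4" using rcard[of R] R by (intro power_mono) simp_all
  finally show ?thesis .
 qed
 \<comment> \<open>On S the inequality 1 <= N |Mco|^2 and \<open>spherical_Bessel\<close> bound the
   sum of |Ph g e_m|^2 by N B^2; dividing by \<open>NL\<close> also removes the weights W <=
   WL.\<close>
 define NL where "NL = WL * B * sqrt N"
 have NL: "NL > 0" unfolding NL_def using W(2) B(1) N0 by simp
 \<comment> \<open>Both kinds of coefficients are scaled to have square sum at most 1; the divisor 4
   suits the bound 12 of \<open>Mco_Bessel\<close>.\<close>
 define c where "c u m = (case u of Inl z => cis (- 2 * of_int m * fst z) * Mco lam m (snd z) / 4
  | Inr g => cor (W m / NL) * Ph g (ee lam m))" for u and m :: int
 have "\<exists>A. \<forall>u\<in>TA <+> TB. cmod (\<Sum>m\<in>S. cor (sg A m) * c u m) <= 2 * x"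
 proof (rule random_signs[OF S _ _ _ x])
  show "finite (TA <+> TB)" using TA(2) TB(2) by simp
  have "real (card (TA <+> TB)) = real (card TA) + real (card TB)" using TA(2) TB(2) by (simp add: card_Plus)
  moreover have "4 * u < e" if "u = a + b" "a <= a'" "b <= b'" "4 * (a' + b') < e" for u a b a' b' e :: real
   using that unfolding distrib_left by linarith
  ultimately show "4 * real (card (TA <+> TB)) < exp (x\<^sup>2 / 4)" using cA cB L(3) by blast
  fix u assume "u : TA <+> TB"
  then show "(\<Sum>m\<in>S. (cmod (c u m))\<^sup>2) <= 1"
  proof (rule PlusE)
   fix z assume z: "u = Inl z" "z : TA"
   have z0: "snd z >= 0" using z(2) TA(1) by auto
   have "(\<Sum>m\<in>S. (cmod (c u m))\<^sup>2) = (\<Sum>m\<in>S. (cmod (Mco lam m (snd z)))\<^sup>2) / 16"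
    unfolding z(1) c_def by (simp add: norm_mult norm_divide power_divide sum_divide_distrib)
   also have "\<dots> <= 12 / 16" using Mco_Bessel[OF lam z0 S] by simp
   finally show ?thesis by simp
  next
   fix g assume g: "u = Inr g" "g : TB"
   have gS: "g : SL2" using g(2) TB(1) by blast
   have "(cmod (c u m))\<^sup>2 <= 1 / B\<^sup>2 * ((cmod (Ph g (ee lam m)))\<^sup>2 * (cmod (Mco lam m t))\<^sup>2)" if m: "m : S" for m
   proof -
    have w: "0 <= W m" "W m <= WL" using W(1)[OF Sm[OF m]] by auto
    have "(cmod (c u m))\<^sup>2 = (W m)\<^sup>2 / NL\<^sup>2 * (cmod (Ph g (ee lam m)))\<^sup>2"
     unfolding g(1) c_def by (simp add: norm_mult power_mult_distrib power_divide norm_divide)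
    also have "\<dots> <= WL\<^sup>2 / NL\<^sup>2 * (cmod (Ph g (ee lam m)))\<^sup>2"
     using w by (intro mult_right_mono divide_right_mono power_mono) auto
    also have "WL\<^sup>2 / NL\<^sup>2 = 1 / (B\<^sup>2 * N)" unfolding NL_def using W(2) N0 by (simp add: power_mult_distrib)
    also have "1 / (B\<^sup>2 * N) * (cmod (Ph g (ee lam m)))\<^sup>2 <= 1 / (B\<^sup>2 * N) * (cmod (Ph g (ee lam m)))\<^sup>2 * (N * (cmod (Mco lam m t))\<^sup>2)"
     using mult_left_mono[OF SM[OF m], of "1 / (B\<^sup>2 * N) * (cmod (Ph g (ee lam m)))\<^sup>2"] N0 by simp
    also have "\<dots> = 1 / B\<^sup>2 * ((cmod (Ph g (ee lam m)))\<^sup>2 * (cmod (Mco lam m t))\<^sup>2)" using N0 by simp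
    finally show ?thesis .
   qed
   then have "(\<Sum>m\<in>S. (cmod (c u m))\<^sup>2) <= (\<Sum>m\<in>S. 1 / B\<^sup>2 * ((cmod (Ph g (ee lam m)))\<^sup>2 * (cmod (Mco lam m t))\<^sup>2))" by (rule sum_mono)
   also have "\<dots> <= 1 / B\<^sup>2 * B\<^sup>2"
    unfolding sum_distrib_left[symmetric] by (intro mult_left_mono spherical_Bessel lam gS t S B) simp_all
   finally show ?thesis using B(1) by simp
  qed
 qed
 then obtain A where A: "!!u. u : TA <+> TB ==> cmod (\<Sum>m\<in>S. cor (sg A m) * c u m) <= 2 * x" by blast
 have sg1: "cmod (cor (sg A m) * z) = cmod z" for m z by (simp add: sg_def norm_mult)
 have close: "cmod (\<Sum>m\<in>S. cor (sg A m) * f m) <= cmod (\<Sum>m\<in>S. cor (sg A m) * f' m) + real (card S) * d"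
  if "!!m. m : S ==> cmod (f m - f' m) <= d" for f f' d
 proof -
  have e: "(\<Sum>m\<in>S. cor (sg A m) * f m) = (\<Sum>m\<in>S. cor (sg A m) * f' m) + (\<Sum>m\<in>S. cor (sg A m) * (f m - f' m))"
   by (simp add: algebra_simps sum_subtractf)
  have b: "cmod (\<Sum>m\<in>S. cor (sg A m) * (f m - f' m)) <= real (card S) * d"
   by (rule order_trans[OF norm_sum sum_bounded_above]) (simp only: sg1 that)
  show ?thesis unfolding e by (rule order_trans[OF norm_triangle_ineq add_left_mono[OF b]])
 qed
 have I: "cmod (\<Sum>m\<in>S. cor (sg A m) * (cis (- 2 * of_int m * tta) * Mco lam m s)) <= 8 * x + 2" if s: "s >= 0" for tta s
 proof (cases "s >= real L")
  \<comment> \<open>Beyond time L every coefficient is exponentially small, so the trivial bound on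
    the sum suffices.\<close>
  case True
  have "cmod (\<Sum>m\<in>S. cor (sg A m) * (cis (- 2 * of_int m * tta) * Mco lam m s)) <= real (card S) * (16 * exp (- (real L / 2)))"
   by (rule order_trans[OF norm_sum sum_bounded_above]) (simp only: sg1, simp add: norm_mult Mco_large[OF lam True])
  also have "\<dots> <= (2 * real L + 1) * (16 * exp (- (real L / 2)))" by (intro mult_right_mono cS) simp
  also note L(4)
  finally show ?thesis using x by linarith
 next
  case False
  obtain tta0 where tta0: "0 <= tta0" "tta0 <= 2 * pi" "!!m::int. cis (- 2 * of_int m * tta) = cis (- 2 * of_int m * tta0)"
   using cis_reduce by blast
  have "(tta0, s) : {0..2 * pi} \<times> {0..real L}" using tta0 s False by simp
  then obtain z where z: "z : TA" "?kA (tta0, s) = ?kA z" using TA(4) by blast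
  have c1: "\<bar>tta0 - fst z\<bar> <= h" by (rule floor_close[OF _ h]) (use z(2) in simp)
  have c2: "\<bar>s - snd z\<bar> <= h" by (rule floor_close[OF _ h]) (use z(2) in simp)
  have z0: "snd z >= 0" using z(1) TA(1) by auto
  have "cmod (cis (- 2 * of_int m * tta0) * Mco lam m s - cis (- 2 * of_int m * fst z) * Mco lam m (snd z)) <= (16 * real L + 8 * ka) / real L ^ 4"
   if m: "m : S" for m
  proof -
   have mL: "\<bar>real_of_int m\<bar> <= real L" using Sm[OF m] by linarith
   have "cmod (cis (- 2 * of_int m * tta0) - cis (- 2 * of_int m * fst z)) <= \<bar>- 2 * of_int m * tta0 - - 2 * of_int m * fst z\<bar>"
    by (rule cis_diff)
   also have "\<dots> = 2 * \<bar>of_int m\<bar> * \<bar>tta0 - fst z\<bar>"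
   proof -
    have "- 2 * of_int m * tta0 - - 2 * of_int m * fst z = - 2 * of_int m * (tta0 - fst z)" by (simp add: algebra_simps)
    then show ?thesis by (simp only: abs_mult)
   qed
   also have "\<dots> <= 2 * real L * h" by (intro mult_mono mult_left_mono mL c1) simp_all
   finally have d1: "cmod (cis (- 2 * of_int m * tta0) - cis (- 2 * of_int m * fst z)) <= 2 * real L * h" .
   have "cmod (Mco lam m s - Mco lam m (snd z)) <= 8 * cmod (1 + lam) * \<bar>s - snd z\<bar>" by (rule Mco_lipschitz[OF lam z0 s])
   also have "\<dots> <= 8 * ka * h" using c2 h by (intro mult_mono) (simp_all add: ka)
   finally have d2: "cmod (Mco lam m s - Mco lam m (snd z)) <= 8 * ka * h" .
   have e: "cis (- 2 * of_int m * tta0) * Mco lam m s - cis (- 2 * of_int m * fst z) * Mco lam m (snd z)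
    = (cis (- 2 * of_int m * tta0) - cis (- 2 * of_int m * fst z)) * Mco lam m s + cis (- 2 * of_int m * fst z) * (Mco lam m s - Mco lam m (snd z))"
    by (simp add: algebra_simps)
   have "cmod (cis (- 2 * of_int m * tta0) * Mco lam m s - cis (- 2 * of_int m * fst z) * Mco lam m (snd z))
    <= cmod (cis (- 2 * of_int m * tta0) - cis (- 2 * of_int m * fst z)) * cmod (Mco lam m s) + 1 * cmod (Mco lam m s - Mco lam m (snd z))"
    unfolding e by (rule order_trans[OF norm_triangle_ineq]) (simp only: norm_mult norm_cis order_refl)
   also have "\<dots> <= (2 * real L * h) * 8 + 1 * (8 * ka * h)"
    using h by (intro add_mono mult_mono d1 d2 Mco_le_8 lam s) simp_all
   also have "\<dots> = (16 * real L + 8 * ka) / real L ^ 4" by (simp add: h_def add_divide_distrib)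
   finally show ?thesis .
  qed
  from close[OF this]
  have "cmod (\<Sum>m\<in>S. cor (sg A m) * (cis (- 2 * of_int m * tta0) * Mco lam m s))
   <= cmod (\<Sum>m\<in>S. cor (sg A m) * (cis (- 2 * of_int m * fst z) * Mco lam m (snd z))) + real (card S) * ((16 * real L + 8 * ka) / real L ^ 4)" .
  moreover have "real (card S) * ((16 * real L + 8 * ka) / real L ^ 4) <= 1"
   by (rule order_trans[OF mult_right_mono[OF cS] L(5)]) (use ka0 in simp)
  moreover have "cmod (\<Sum>m\<in>S. cor (sg A m) * (cis (- 2 * of_int m * fst z) * Mco lam m (snd z))) <= 8 * x"
  proof -
   have "(\<Sum>m\<in>S. cor (sg A m) * (cis (- 2 * of_int m * fst z) * Mco lam m (snd z))) = 4 * (\<Sum>m\<in>S. cor (sg A m) * c (Inl z) m)"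
    unfolding c_def sum_distrib_left by (intro sum.cong refl) simp
   then have "cmod (\<Sum>m\<in>S. cor (sg A m) * (cis (- 2 * of_int m * fst z) * Mco lam m (snd z))) = 4 * cmod (\<Sum>m\<in>S. cor (sg A m) * c (Inl z) m)"
    by (simp only: norm_mult norm_numeral)
   then show ?thesis using A[OF InlI[OF z(1)]] by linarith
  qed
  moreover have "a <= 8 * x + 2" if "a <= b + e" "e <= 1" "b <= 8 * x" for a b e :: real using that by linarith
  ultimately show ?thesis unfolding tta0(3) by blast
 qed
 have II: "cmod (\<Sum>m\<in>S. cor (sg A m) * (cor (W m) * Ph g (ee lam m))) <= WL * B * (10 * sqrt (real L) * x + 1)"
  if g: "g : SL2" "norm g <= R" for g
 proof -
  have "g : {g : SL2. norm g <= R}" using g by simp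
  then obtain y where y: "y : TB" "?kB g = ?kB y" using TB(4) by blast
  have yS: "y : SL2" "norm y <= R" using y(1) TB(1) by auto
  have ent: "\<bar>g$i$j - y$i$j\<bar> <= h" for i j
   by (rule floor_close[OF _ h]) (use y(2) exhaust_2[of i] exhaust_2[of j] in auto)
  have L3: "R * real L * h = R / real L ^ 3" unfolding h_def using Lp by (simp add: power_Suc[symmetric] numeral_eq_Suc)
  have rle: "R * exp (2 * t) * h <= R / real L ^ 3"
   unfolding L3[symmetric] using R h etL by (intro mult_right_mono mult_left_mono) auto
  have "16 * (R / real L ^ 3) <= 1" using L(6) Lp by simp
  then have small: "16 * (R * exp (2 * t) * h) <= 1" using rle by linarith
  have "cmod (cor (W m) * Ph g (ee lam m) - cor (W m) * Ph y (ee lam m)) <= WL * B / (3 * real L)" if m: "m : S" for m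
  proof -
   \<comment> \<open>Membership in S means |Mco| >= N^(-1/2), which strips the factor
     \<open>Mco\<close> from \<open>sphere_lipschitz\<close> at the cost of sqrt N.\<close>
   let ?D = "cmod (Ph g (ee lam m) - Ph y (ee lam m))" and ?M = "cmod (Mco lam m t)"
   have "1\<^sup>2 <= (sqrt N * ?M)\<^sup>2" using SM[OF m] N0 by (simp add: power_mult_distrib)
   then have "1 <= sqrt N * ?M" by (rule power2_le_imp_le) (use N0 in simp)
   then have "?D * 1 <= ?D * (sqrt N * ?M)" by (intro mult_left_mono) simp_all
   also have "\<dots> = sqrt N * (?D * ?M)" by (simp only: mult_ac)
   also have "?D * ?M <= 48 * (R * exp (2 * t) * h) * B" by (rule sphere_lipschitz[OF lam B(3) yS g(1) ent t small])
   also have "48 * (R * exp (2 * t) * h) * B <= 48 * (R / real L ^ 3) * B" using rle B(1) by (intro mult_right_mono mult_left_mono) auto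
   also have "sqrt N * (48 * (R / real L ^ 3) * B) <= (5 * real L) * (48 * (R / real L ^ 3) * B)"
    using sN sL R B(1) Lp by (intro mult_right_mono) auto
   also have "\<dots> = 240 * R * B / (real L)\<^sup>2" using Lp by (simp add: power2_eq_square power3_eq_cube)
   also have "\<dots> <= B / (3 * real L)"
   proof -
    have "240 * R * B / (real L)\<^sup>2 = (720 * R) * (B / (3 * (real L)\<^sup>2))" by simp
    also have "\<dots> <= real L * (B / (3 * (real L)\<^sup>2))" using L(7) B(1) by (intro mult_right_mono) auto
    also have "\<dots> = B / (3 * real L)" using Lp by (simp add: power2_eq_square)
    finally show ?thesis .
   qed
   finally have D: "?D <= B / (3 * real L)" using N0 by simp
   have "cmod (cor (W m) * Ph g (ee lam m) - cor (W m) * Ph y (ee lam m)) = W m * ?D"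
    using W(1)[OF Sm[OF m]] by (simp only: right_diff_distrib[symmetric] norm_mult norm_of_real) simp
   also have "\<dots> <= WL * (B / (3 * real L))" using W(1)[OF Sm[OF m]] W(2) D by (intro mult_mono) auto
   finally show ?thesis by simp
  qed
  from close[OF this]
  have 1: "cmod (\<Sum>m\<in>S. cor (sg A m) * (cor (W m) * Ph g (ee lam m)))
   <= cmod (\<Sum>m\<in>S. cor (sg A m) * (cor (W m) * Ph y (ee lam m))) + real (card S) * (WL * B / (3 * real L))" .
  have "real (card S) * (WL * B / (3 * real L)) <= 3 * real L * (WL * B / (3 * real L))"
   using cS3 W(2) B(1) Lp by (intro mult_right_mono) auto
  also have "\<dots> = WL * B" using Lp by simp
  finally have 2: "real (card S) * (WL * B / (3 * real L)) <= WL * B" .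
  have "(\<Sum>m\<in>S. cor (sg A m) * (cor (W m) * Ph y (ee lam m))) = cor NL * (\<Sum>m\<in>S. cor (sg A m) * c (Inr y) m)"
   unfolding c_def sum_distrib_left using NL by (intro sum.cong refl) simp
  then have "cmod (\<Sum>m\<in>S. cor (sg A m) * (cor (W m) * Ph y (ee lam m))) = NL * cmod (\<Sum>m\<in>S. cor (sg A m) * c (Inr y) m)"
   using NL by (simp add: norm_mult)
  also have "\<dots> <= NL * (2 * x)" using NL A[OF InrI[OF y(1)]] by (intro mult_left_mono) auto
  also have "\<dots> <= WL * B * (5 * sqrt (real L)) * (2 * x)"
   unfolding NL_def using sN W(2) B(1) x by (intro mult_right_mono mult_left_mono) auto
  finally have 3: "cmod (\<Sum>m\<in>S. cor (sg A m) * (cor (W m) * Ph y (ee lam m))) <= WL * B * (5 * sqrt (real L)) * (2 * x)" .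
  have "WL * B * (5 * sqrt (real L)) * (2 * x) + WL * B = WL * B * (10 * sqrt (real L) * x + 1)" by (simp add: algebra_simps)
  moreover have "a <= d" if "a <= b + e" "e <= f" "b <= k" "k + f = d" for a b d e f k :: real using that by linarith
  ultimately show ?thesis using 1 2 3 by blast
 qed
 have "real L / ka <= 512 * (1 + t)\<^sup>2 * real (card S)"
  using good_frequencies[OF lam t mass] unfolding et S_def .
 then show ?thesis using S I II unfolding t_def by blast
qed

theorem proposition8p2:
  fixes \<Gamma> :: "mat2 set" and lam :: complex and V :: "fn set"
    and Y :: mat2 and c :: real
    and q pmax :: "fn \<Rightarrow> real" and \<rho> :: "mat2 \<Rightarrow> cvec \<Rightarrow> cvec" and \<eta> :: "cvec \<Rightarrow> complex"
  assumes "cocompact_lattice \<Gamma>"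
    and "Re lam = 0" and "V = principal_series lam"
    and "Y \<in> so2" and "c > 0" and "- c * killing_form Y Y = 1"
    and "globalization V q \<rho>"
    and "\<eta> \<in> distribution_vectors V q \<rho>"
    and "invariant_under \<Gamma> V q \<rho> \<eta>"
    and "\<exists>a\<in>smooth_vectors V q \<rho>. \<eta> a \<noteq> 0"
    and "is_max_norm V pmax"
  shows "sobolev_dist V Y (automorphic_norm V q \<rho> \<eta>) pmax \<ge> 1 / 6"
proof -
 note lam = \<open>Re lam = 0\<close>
 have VV: "V = Vs lam" using assms(3) by (simp only: principal_series_eq_Vs)
 note G = assms(7)[unfolded VV] and eta = assms(8)[unfolded VV] and inv = assms(9)[unfolded VV] and mx = assms(11)[unfolded VV]
 interpret Gl: glob lam q \<rho> by unfold_locales (rule G)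
 interpret E: lb_family lam "%g v. \<eta> (\<rho> g (emb (Vs lam) q v))" by (rule Gl.distribution_family[OF eta])
 let ?paut = "automorphic_norm (Vs lam) q \<rho> \<eta>"
 obtain y where y: "Y = y *\<^sub>R Jm" using so2_eq[OF assms(4)] .
 obtain R where R: "R > 0" "!!g v. g : SL2 ==> v : Vs lam ==> \<exists>w\<in>SL2. norm w <= R & \<eta> (\<rho> g (emb (Vs lam) q v)) = \<eta> (\<rho> w (emb (Vs lam) q v))"
  using Gl.automorphic_reduce[OF assms(1) inv] by blast
 have bd: "\<exists>B. \<forall>g\<in>SL2. cmod (\<eta> (\<rho> g (emb (Vs lam) q v))) <= B" if "v : Vs lam" for v
  by (rule Gl.automorphic_bounded[OF assms(1) eta inv that])
 have e0: "ee lam 0 : Vs lam" by (rule ee_in_Vs)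
 obtain B0 where B0: "!!g. g : SL2 ==> cmod (\<eta> (\<rho> g (emb (Vs lam) q (ee lam 0)))) <= B0" using bd[OF e0] by blast
 obtain B1 where B1: "!!g. g : SL2 ==> cmod (\<eta> (\<rho> g (emb (Vs lam) q (lie_act Hm (ee lam 0))))) <= B1" using bd[OF lie_act_Vs[OF e0 basis_sl2(1)]] by blast
 obtain B2 where B2: "!!g. g : SL2 ==> cmod (\<eta> (\<rho> g (emb (Vs lam) q (lie_act Em (ee lam 0))))) <= B2" using bd[OF lie_act_Vs[OF e0 basis_sl2(2)]] by blast
 obtain B3 where B3: "!!g. g : SL2 ==> cmod (\<eta> (\<rho> g (emb (Vs lam) q (lie_act Fm (ee lam 0))))) <= B3" using bd[OF lie_act_Vs[OF e0 basis_sl2(3)]] by blast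
 \<comment> \<open>One constant for e_0 and its derivatives in the three directions of
   \<open>LDU\<close>; the summand 1 makes it positive.\<close>
 define B where "B = 1 + \<bar>B0\<bar> + \<bar>B1\<bar> + \<bar>B2\<bar> + \<bar>B3\<bar>"
 have B: "B > 0" "B0 <= B" "B1 <= B" "B2 <= B" "B3 <= B" unfolding B_def by linarith+
 have BX: "cmod (\<eta> (\<rho> g (emb (Vs lam) q (lie_act X (ee lam 0))))) <= B" if g: "g : SL2" and X: "X : {Fm, Hm, Em}" for g X
  using X B1[OF g] B2[OF g] B3[OF g] B by (elim insertE emptyE; simp only:; linarith)
 obtain D where D: "D > 0" "\<forall>S ep P. finite S --> (\<forall>m. ep m = 1 \<or> ep m = - 1) --> P > 0 -->
  (\<forall>tta t. t >= 0 --> cmod (\<Sum>m\<in>S. cor (ep m) * (cis (- 2 * of_int m * tta) * Mco lam m t)) <= P) -->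
  real (card S) <= D * P * pmax (\<Sum>m\<in>S. scaleF (cor (ep m)) (ee lam m))"
  using max_lower[OF lam mx] by (elim exE conjE)
 \<comment> \<open>Of the two directions of the distance, the one that dominates \<open>pmax\<close>
   by twisted automorphic norms is bounded: every admissible s is at least 1/6.\<close>
 have main: "1 / 6 <= s" if s0: "0 <= s" and le: "norm_le (Vs lam) pmax (sobolev_norm (Vs lam) Y s ?paut)" for s :: real
 proof (rule ccontr)
  assume "\<not> 1 / 6 <= s"
  then have s6: "s <= 1 / 6" by simp
  obtain Cs where Cs: "Cs > 0" "!!v. v : Vs lam ==> pmax v <= Cs * ?paut (sobolev_op (Vs lam) Y s v)"
   using le unfolding norm_le_def sobolev_norm_def by blast
  define ka where "ka = 6 * (cmod (1 + lam) + 1)"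
  have ka: "ka > 0" unfolding ka_def by (intro mult_pos_pos add_nonneg_pos) auto
  have Y0: "1 + 4 * y\<^sup>2 > 0" by (intro add_pos_nonneg) auto
  obtain L :: nat where L: "ka <= real L" "1 <= real L"
   "4 * ((14 * real L ^ 4 + 4) * (2 * real L ^ 5 + 4) + (2 * R * real L ^ 4 + 4) ^ 4) < exp ((real L powr (1/50))\<^sup>2 / 4)"
   "(2 * real L + 1) * (16 * exp (- (real L / 2))) <= 1"
   "(2 * real L + 1) * ((16 * real L + 8 * ka) / real L ^ 4) <= 1"
   "16 * R <= real L ^ 3" "720 * R <= real L"
   "512 * (1 + ln (real L / ka) / 2)\<^sup>2 * (D * (8 * real L powr (1/50) + 2) * (Cs * (((1 + 4 * y\<^sup>2) * (real L)\<^sup>2) powr (1/12) * B * (10 * sqrt (real L) * real L powr (1/50) + 1))))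
   < real L / ka"
   using eventually_happens[OF asymptotics[OF ka R(1) D(1) Cs(1) B(1) Y0]] by auto
  let ?x = "real L powr (1/50)" and ?WL = "((1 + 4 * y\<^sup>2) * (real L)\<^sup>2) powr (1/12)"
  let ?W = "%m::int. (1 + 4 * y\<^sup>2 * (of_int m)\<^sup>2) powr (s / 2)"
  have W: "0 <= ?W m & ?W m <= ?WL" if "\<bar>m\<bar> <= int L" for m using powr_weight_le[OF s0 s6 that L(2), of y] by simp
  have WL: "?WL > 0"
  proof -
   have ne: "(1 + 4 * y\<^sup>2) * (real L)\<^sup>2 ~= 0" using Y0 L(2) by (intro no_zero_divisors) auto
   show ?thesis by (simp only: powr_gt_zero ne not_False_eq_True)
  qed
  have "\<exists>S A. finite S & real L / ka <= 512 * (1 + ln (real L / ka) / 2)\<^sup>2 * real (card S) &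
   (\<forall>tta t. t >= 0 --> cmod (\<Sum>m\<in>S. cor (sg A m) * (cis (- 2 * of_int m * tta) * Mco lam m t)) <= 8 * ?x + 2) &
   (\<forall>g\<in>SL2. norm g <= R --> cmod (\<Sum>m\<in>S. cor (sg A m) * (cor (?W m) * \<eta> (\<rho> g (emb (Vs lam) q (ee lam m)))))
    <= ?WL * B * (10 * sqrt (real L) * ?x + 1))"
   by (rule random_vector[OF lam E.lb_family_axioms B(1) order_trans[OF B0 B(2)] BX R(1) W WL ka_def powr_ge_zero L(1-7)])
  then obtain S A where S: "finite S" "real L / ka <= 512 * (1 + ln (real L / ka) / 2)\<^sup>2 * real (card S)"
   "\<forall>tta t. t >= 0 --> cmod (\<Sum>m\<in>S. cor (sg A m) * (cis (- 2 * of_int m * tta) * Mco lam m t)) <= 8 * ?x + 2"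
   "\<forall>g\<in>SL2. norm g <= R --> cmod (\<Sum>m\<in>S. cor (sg A m) * (cor (?W m) * \<eta> (\<rho> g (emb (Vs lam) q (ee lam m)))))
    <= ?WL * B * (10 * sqrt (real L) * ?x + 1)"
   by (elim exE conjE)
  let ?U = "?WL * B * (10 * sqrt (real L) * ?x + 1)"
  let ?v = "\<Sum>m\<in>S. scaleF (cor (sg A m)) (ee lam m)"
  let ?v' = "\<Sum>m\<in>S. scaleF (cor (?W m) * cor (sg A m)) (ee lam m)"
  have vV: "?v : Vs lam" "?v' : Vs lam" by (intro Vs_sum Vs_scale ee_in_Vs)+
  have "?paut ?v' <= ?U"
   unfolding automorphic_norm_def
  proof (rule cSUP_least)
   show "SL2 ~= {}" using SL2_one by blast
   fix g assume g: "g : SL2"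
   obtain w where w: "w : SL2" "norm w <= R" "\<eta> (\<rho> g (emb (Vs lam) q ?v')) = \<eta> (\<rho> w (emb (Vs lam) q ?v'))"
    using R(2)[OF g vV(2)] by blast
   have "\<eta> (\<rho> w (emb (Vs lam) q ?v')) = (\<Sum>m\<in>S. \<eta> (\<rho> w (emb (Vs lam) q (scaleF (cor (?W m) * cor (sg A m)) (ee lam m)))))"
    by (rule E.Ph_sum[OF w(1) S(1)]) (intro Vs_scale ee_in_Vs)
   also have "\<dots> = (\<Sum>m\<in>S. cor (sg A m) * (cor (?W m) * \<eta> (\<rho> w (emb (Vs lam) q (ee lam m)))))"
    by (intro sum.cong refl) (simp only: E.Ph_scale[OF w(1) ee_in_Vs] mult_ac)
   finally show "cmod (\<eta> (\<rho> g (emb (Vs lam) q ?v'))) <= ?U" unfolding w(3) using S(4) w(1,2) by (simp only:)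
  qed
  moreover have "sobolev_op (Vs lam) Y s ?v = ?v'" unfolding y by (rule sobolev_op_eq[OF S(1)])
  ultimately have "Cs * ?paut (sobolev_op (Vs lam) Y s ?v) <= Cs * ?U" using Cs(1) by (intro mult_left_mono) auto
  then have pv: "pmax ?v <= Cs * ?U" using Cs(2)[OF vV(1)] by linarith
  have x2: "8 * ?x + 2 > 0" by (intro add_nonneg_pos) auto
  have "\<forall>m. sg A m = 1 \<or> sg A m = - 1" by (simp add: sg_def)
  then have "real (card S) <= D * (8 * ?x + 2) * pmax ?v"
   using D(2)[rule_format, OF S(1), of "sg A" "8 * ?x + 2"] x2 S(3) by blast
  also have "\<dots> <= D * (8 * ?x + 2) * (Cs * ?U)" using D(1) x2 pv by (intro mult_left_mono) auto
  finally have fin: "512 * (1 + ln (real L / ka) / 2)\<^sup>2 * real (card S) <= 512 * (1 + ln (real L / ka) / 2)\<^sup>2 * (D * (8 * ?x + 2) * (Cs * ?U))"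
   by (intro mult_left_mono) simp_all
  show False by (rule notE[OF leD[OF order_trans[OF S(2) fin]] L(8)])
 qed
 have six: "(1 / 6 :: ereal) = ereal (1 / 6)" by (simp add: one_ereal_def numeral_eq_ereal)
 have "(1 / 6 :: ereal) <= dist_to (Vs lam) Y pmax ?paut"
  unfolding dist_to_def six by (rule Inf_greatest) (use main in auto)
 then show ?thesis unfolding VV sobolev_dist_def by (rule max.coboundedI2)
qed

end
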